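(* Let $(a,-b_1,-b_2,-b_3)$ be a partition of $-2$ with $a,b_1,b_2,b_3\geq 1$ integers. Up to relabeling the poles, the monodromy group of the isoresidual cover of the genus zero stratum $\mathcal{H}(a,-b_1,-b_2,-b_3)$ is isomorphic to: (i) the cyclic group $\mathbb{Z}_a$ of order $a$ if $b_2=b_3=1$; (ii) the exotic embedding of $\mathfrak{S}_5$ into $\mathfrak{S}_6$ if $b_1=2$ and $b_2=b_3=3$; (iii) the alternating group $\mathfrak{A}_a$ if $b_1,b_2\geq 2$ and $b_1,b_2,b_3$ have the same parity; (iv) the symmetric group $\mathfrak{S}_a$ otherwise, that is, if none of (i)–(iii) holds for any labeling of the poles.
   Context: The stratum $\mathcal{H}(a,-b_1,\dots,-b_p)$ is the space of meromorphic $1$-forms $\omega$ on $\mathbb{CP}^1$ having exactly one zero, of order $a$, and exactly $p$ poles, labeled by $1,\dots,p$, the $j$-th one of order $b_j$, considered up to biholomorphisms (pulling back forms and preserving the labels of the poles). The residue of $\omega$ at a pole is the period of $\omega$ over a positively oriented simple loop around it (so it is $2i\pi$ times the usual residue). The residual space is $\mathcal{R}_p=\{(\lambda_1,\dots,\lambda_p)\in\mathbb{C}^p : \sum_{j=1}^p\lambda_j=0\}$. The residual map $\operatorname{res}\colon\mathcal{H}(a,-b_1,\dots,-b_p)\to\mathcal{R}_p$ sends $\omega$ to the tuple of its residues. The resonance arrangement $\mathcal{A}_p$ is the union of the hyperplanes $A_I=\{\lambda\in\mathcal{R}_p:\sum_{j\in I}\lambda_j=0\}$ over nonempty proper subsets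 $I\subset\{1,\dots,p\}$. Over $\mathcal{R}_p\setminus\mathcal{A}_p$ the residual map is an unramified cover of degree $\frac{a!}{(a+2-p)!}$ (the isoresidual cover); for $p=3$ this degree is $a$. A generic fiber is a fiber $\mathcal{F}$ over a point of $\mathcal{R}_p\setminus\mathcal{A}_p$. The monodromy group of the isoresidual cover is the image of the fundamental group $\pi_1(\mathcal{R}_p\setminus\mathcal{A}_p)$ in the group of permutations of a generic fiber, given by lifting loops. The exotic embedding of $\mathfrak{S}_5$ into $\mathfrak{S}_6$ is the embedding given by the action of $\mathfrak{S}_5$ by conjugation on its six $5$-Sylow subgroups; case (ii) means that the monodromy group, as a permutation group of the six-element generic fiber, is isomorphic to the image of this embedding. *)

theory Defs
  imports
    "HOL-Complex_Analysis.Complex_Analysis"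
    "HOL-Algebra.Bij"
    "HOL-Algebra.Elementary_Groups"
    "HOL-Algebra.Sym_Groups"
begin

section \<open>The Riemann sphere\<close>

text \<open>Points of the sphere: \<^term>\<open>None\<close> is the point at infinity.\<close>

type_synonym sphere = "complex option"

definition sphere_topology :: "sphere topology" where
  "sphere_topology = Alexandroff_compactification euclidean"

definition infinity_chart :: "complex \<Rightarrow> sphere" where
  "infinity_chart w = (if w = 0 then None else Some (inverse w))"

definition sphere_charts :: "(complex \<Rightarrow> sphere) set" where
  "sphere_charts = {Some, infinity_chart}"

definition sphere_holomorphic :: "(sphere \<Rightarrow> sphere) \<Rightarrow> bool" where
  "sphere_holomorphic \<phi> \<longleftrightarrow>
     continuous_map sphere_topology sphere_topology \<phi> \<and>
     (\<forall>\<alpha>\<in>sphere_charts. \<forall>\<beta>\<in>sphere_charts.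
        (\<lambda>u. inv_into UNIV \<alpha> (\<phi> (\<beta> u))) holomorphic_on {u. \<phi> (\<beta> u) \<in> range \<alpha>})"

definition sphere_biholomorphism :: "(sphere \<Rightarrow> sphere) \<Rightarrow> bool" where
  "sphere_biholomorphism \<phi> \<longleftrightarrow>
     bij \<phi> \<and> sphere_holomorphic \<phi> \<and> sphere_holomorphic (inv_into UNIV \<phi>)"

section \<open>Meromorphic one-forms on the sphere\<close>

text \<open>
  A meromorphic one-form is represented by its coefficient \<open>f\<close> in the affine chart, where it reads
  \<open>f(z) dz\<close>. Requiring \<open>f\<close> to be nicely meromorphic (removable singularities removed, value 0 at
  the poles) makes this representation unique. In the coordinate \<open>w = 1/z\<close> the form reads
  \<open>- f(1/w) / w^2 dw\<close>.
\<close>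

definition coeff_at_infinity :: "(complex \<Rightarrow> complex) \<Rightarrow> complex \<Rightarrow> complex" where
  "coeff_at_infinity f w = - f (inverse w) / w\<^sup>2"

definition meromorphic_form :: "(complex \<Rightarrow> complex) \<Rightarrow> bool" where
  "meromorphic_form f \<longleftrightarrow>
     f nicely_meromorphic_on UNIV \<and> coeff_at_infinity f meromorphic_on {0}"

fun form_order :: "(complex \<Rightarrow> complex) \<Rightarrow> sphere \<Rightarrow> int" where
  "form_order f (Some z) = zorder f z"
| "form_order f None = zorder (coeff_at_infinity f) 0"

text \<open>The residue is normalised as a period, hence the factor \<open>2 \<pi> \<i>\<close>.\<close>

fun form_residue :: "(complex \<Rightarrow> complex) \<Rightarrow> sphere \<Rightarrow> complex" where
  "form_residue f (Some z) = 2 * of_real pi * \<i> * residue f z"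
| "form_residue f None = 2 * of_real pi * \<i> * residue (coeff_at_infinity f) 0"

text \<open>
  \<open>is_pullback \<phi> g f\<close>: \<open>f dz\<close> is the pullback of \<open>g dz\<close> under \<open>\<phi>\<close>. At most one affine point is
  sent to infinity, so the condition determines the (nicely meromorphic) function \<open>f\<close>.
\<close>

definition is_pullback ::
    "(sphere \<Rightarrow> sphere) \<Rightarrow> (complex \<Rightarrow> complex) \<Rightarrow> (complex \<Rightarrow> complex) \<Rightarrow> bool" where
  "is_pullback \<phi> g f \<longleftrightarrow>
     (\<forall>z. \<phi> (Some z) \<noteq> None \<longrightarrow>
        f z = g (the (\<phi> (Some z))) * deriv (\<lambda>u. the (\<phi> (Some u))) z)"

section \<open>Strata with one zero\<close>

text \<open>
  The poles are labelled by the finite type \<^typ>\<open>'p\<close>: a marked form is a form together with the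
  enumeration of its poles by labels.
\<close>

type_synonym 'p marked_form = "(complex \<Rightarrow> complex) \<times> ('p \<Rightarrow> sphere)"

definition marked_forms :: "nat \<Rightarrow> ('p::finite \<Rightarrow> nat) \<Rightarrow> 'p marked_form set" where
  "marked_forms a b = {(f, z).
     meromorphic_form f \<and> (\<exists>x. f x \<noteq> 0) \<and>
     (\<exists>q. {x. form_order f x > 0} = {q} \<and> form_order f q = int a) \<and>
     bij_betw z UNIV {x. form_order f x < 0} \<and>
     (\<forall>j. form_order f (z j) = - int (b j))}"

definition form_iso :: "nat \<Rightarrow> ('p::finite \<Rightarrow> nat) \<Rightarrow> 'p marked_form rel" where
  "form_iso a b = {((f, z), (g, w)).
     (f, z) \<in> marked_forms a b \<and> (g, w) \<in> marked_forms a b \<and>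
     (\<exists>\<phi>. sphere_biholomorphism \<phi> \<and> is_pullback \<phi> g f \<and> w = \<phi> \<circ> z)}"

definition stratum :: "nat \<Rightarrow> ('p::finite \<Rightarrow> nat) \<Rightarrow> 'p marked_form set set" where
  "stratum a b = marked_forms a b // form_iso a b"

text \<open>
  The usual topology on forms with prescribed singularities: the zero and the poles vary
  continuously on the sphere, and the coefficient varies continuously in the compact-open topology
  away from the poles. The divisor determines the form up to a scalar, so the affine coefficient
  suffices and nothing has to be added in the chart at infinity. The stratum carries the quotient
  topology.
\<close>

definition marked_forms_topology ::
    "nat \<Rightarrow> ('p::finite \<Rightarrow> nat) \<Rightarrow> 'p marked_form topology" where
  "marked_forms_topology a b = subtopology
     (topology_generated_by
        ({{(f, z). z j \<in> U} | j U. openin sphere_topology U} \<union>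
         {{(f, z). \<exists>q\<in>U. form_order f q > 0} | U. openin sphere_topology U} \<union>
         {{(f, z). Some ` K \<inter> range z = {} \<and> f ` K \<subseteq> V} | K V. compact K \<and> open V}))
     (marked_forms a b)"

definition stratum_topology ::
    "nat \<Rightarrow> ('p::finite \<Rightarrow> nat) \<Rightarrow> 'p marked_form set topology" where
  "stratum_topology a b = topology (\<lambda>U. U \<subseteq> stratum a b \<and>
     openin (marked_forms_topology a b) {m \<in> marked_forms a b. form_iso a b `` {m} \<in> U})"

section \<open>The isoresidual cover and its monodromy\<close>

definition residual_space :: "(complex ^ 'p::finite) set" where
  "residual_space = {lam. (\<Sum>j\<in>UNIV. lam $ j) = 0}"

definition resonance_arrangement :: "(complex ^ 'p::finite) set" where
  "resonance_arrangement =
     (\<Union>I\<in>{I. I \<noteq> {} \<and> I \<noteq> UNIV}. {lam \<in> residual_space. (\<Sum>j\<in>I. lam $ j) = 0})"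

definition marked_residues :: "'p::finite marked_form \<Rightarrow> complex ^ 'p" where
  "marked_residues m = (\<chi> j. form_residue (fst m) (snd m j))"

text \<open>The common value of \<^const>\<open>marked_residues\<close> on an isomorphism class.\<close>

definition residual_map :: "'p::finite marked_form set \<Rightarrow> complex ^ 'p" where
  "residual_map X = the_elem (marked_residues ` X)"

definition residual_fiber ::
    "nat \<Rightarrow> ('p::finite \<Rightarrow> nat) \<Rightarrow> complex ^ 'p \<Rightarrow> 'p marked_form set set" where
  "residual_fiber a b lam = {X \<in> stratum a b. residual_map X = lam}"

definition lifts_loop ::
    "nat \<Rightarrow> ('p::finite \<Rightarrow> nat) \<Rightarrow> (real \<Rightarrow> complex ^ 'p) \<Rightarrow> (real \<Rightarrow> 'p marked_form set) \<Rightarrow> bool"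
  where
  "lifts_loop a b \<gamma> \<delta> \<longleftrightarrow>
     pathin (stratum_topology a b) \<delta> \<and> (\<forall>t\<in>{0..1}. residual_map (\<delta> t) = \<gamma> t)"

definition monodromy_perms ::
    "nat \<Rightarrow> ('p::finite \<Rightarrow> nat) \<Rightarrow> complex ^ 'p \<Rightarrow> ('p marked_form set \<Rightarrow> 'p marked_form set) set"
  where
  "monodromy_perms a b lam = {\<pi> \<in> Bij (residual_fiber a b lam).
     \<exists>\<gamma>. path \<gamma> \<and> path_image \<gamma> \<subseteq> residual_space - resonance_arrangement \<and>
         pathstart \<gamma> = lam \<and> pathfinish \<gamma> = lam \<and>
         (\<forall>X\<in>residual_fiber a b lam. \<exists>\<delta>. lifts_loop a b \<gamma> \<delta> \<and> \<delta> 0 = X \<and> \<delta> 1 = \<pi> X)}"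

text \<open>
  The monodromy depends only on the homotopy class of the loop, so the image of the fundamental
  group at \<open>lam\<close> is the set of permutations induced by all loops at \<open>lam\<close>.
\<close>

definition monodromy_group ::
    "nat \<Rightarrow> ('p::finite \<Rightarrow> nat) \<Rightarrow> complex ^ 'p \<Rightarrow> ('p marked_form set \<Rightarrow> 'p marked_form set) monoid"
  where
  "monodromy_group a b lam =
     (BijGroup (residual_fiber a b lam)) \<lparr>carrier := monodromy_perms a b lam\<rparr>"

section \<open>Permutation groups and the exotic embedding\<close>

text \<open>Isomorphism of permutation groups: a bijection of the sets conjugates one into the other.\<close>

definition perm_group_isomorphic ::
    "'a set \<Rightarrow> ('a \<Rightarrow> 'a) set \<Rightarrow> 'b set \<Rightarrow> ('b \<Rightarrow> 'b) set \<Rightarrow> bool" where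
  "perm_group_isomorphic A M B N \<longleftrightarrow>
     (\<exists>h. bij_betw h A B \<and> N = (\<lambda>\<pi>. \<lambda>y\<in>B. h (\<pi> (inv_into A h y))) ` M)"

definition sylow_subgroups :: "nat \<Rightarrow> ('a, 'm) monoid_scheme \<Rightarrow> 'a set set" where
  "sylow_subgroups p G = {P. subgroup P G \<and> card P = p ^ multiplicity p (Coset.order G)}"

definition sylow_conjugation ::
    "nat \<Rightarrow> ('a, 'm) monoid_scheme \<Rightarrow> 'a \<Rightarrow> 'a set \<Rightarrow> 'a set" where
  "sylow_conjugation p G g = (\<lambda>P\<in>sylow_subgroups p G. g <#\<^bsub>G\<^esub> P #>\<^bsub>G\<^esub> inv\<^bsub>G\<^esub> g)"

definition exotic_S5 :: "((nat \<Rightarrow> nat) set \<Rightarrow> (nat \<Rightarrow> nat) set) set" where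
  "exotic_S5 = sylow_conjugation 5 (sym_group 5) ` carrier (sym_group 5)"

end

theory Submission
 imports "HOL-Algebra.Multiplicative_Group" "HOL-Computational_Algebra.Fundamental_Theorem_Algebra" Defs
begin

text \<open>
 Sending the three poles to \<open>0\<close>, \<open>1\<close>, \<open>\<infinity>\<close> puts every form in the shape
 \<open>c (x - t)^a / (x^b1 (x - 1)^b2) dx\<close>, whose residues are \<open>c p1(t)\<close>, \<open>c p2(t)\<close>, \<open>c p3(t)\<close> for polynomials
 with \<open>p1 + p2 + p3 = 0\<close>. Up to scaling, the isoresidual cover is therefore the restriction of the
 rational function \<open>- p1 / p3\<close> of degree \<open>a\<close> to the complement of the fibers over \<open>0\<close>, \<open>1\<close>, \<open>\<infinity>\<close>. The
 Wronskian of \<open>p1\<close> and \<open>p3\<close> has no zeros outside \<open>0\<close> and \<open>1\<close>, so each of these three fibers contains a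
 single multiple point, and the monodromy group is a transitive group generated by three cycles
 of lengths \<open>a + 1 - b_i\<close> with product 1. Two cycles whose product is again a cycle can be brought to an explicit
 normal form, and a product of few generators is a 3-cycle unless the pole orders are
 \<open>2, 3, 3\<close>; Jordan's argument then gives the alternating or symmetric group.
\<close>

text \<open>Once the third residue is prescribed, the scale \<open>c\<close> is determined; hence a
  generic fiber is a fiber of the ratio. The Wronskian is divisible by \<open>t^(m1-1)\<close> and,
  written with \<open>p2\<close> and \<open>p3\<close>, by \<open>(1-t)^(m2-1)\<close>, and these
  exponents exhaust its degree. Riemann-Hurwitz becomes \<open>m1 + m2 + m3 = 2a + 1\<close>. This
  equation drives the combinatorics: exactly one point is moved by all three cycles, and the points
  common to the first two form a string of \<open>b3\<close> points. A commutator of the two cycles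
  disturbs only the ends of the string; it is a 3-cycle for \<open>b3 = 1\<close> and otherwise a
  double transposition, and two such sharing one point yield a 3-cycle by squaring their product.
  Primitivity is not proved beforehand: a maximal set carrying all its 3-cycles is a block, and the
  genus equation forces it to be everything. Fundamental groups are avoided by numbering sheets over
  three cut planes; the numberings agree on the upper half plane, and their discrepancies on the
  lower one are the generators. For \<open>2, 3, 3\<close> the six Sylow 5-subgroups are numbered so
  that two 4-cycles of S5 act on them exactly as the model cycles.\<close>

abbreviation transposition :: "'a => 'a => 'a => 'a" where
 "transposition \<equiv> Transposition.transpose"

definition three_cycle :: "'a => 'a => 'a => 'a => 'a" where
 "three_cycle x y z = transposition x y \<circ> transposition y z"

lemma three_cycle_apply:
 assumes "distinct [x, y, z]"
 shows "three_cycle x y z x = y" "three_cycle x y z y = z" "three_cycle x y z z = x"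
  "\<And>u. u \<notin> {x, y, z} ==> three_cycle x y z u = u"
 using assms by (auto simp: three_cycle_def Transposition.transpose_def)

lemma three_cycle_rotate: "distinct [x, y, z] ==> three_cycle x y z = three_cycle y z x"
 by (rule ext) (auto simp: three_cycle_def Transposition.transpose_def)

lemma three_cycle_inv: "distinct [x, y, z] ==> inv' (three_cycle x y z) = three_cycle y x z"
 by (rule inv_unique_comp) (auto simp: fun_eq_iff three_cycle_def Transposition.transpose_def)

lemma three_cycle_conj:
 assumes "bij p" shows "p \<circ> three_cycle x y z \<circ> inv' p = three_cycle (p x) (p y) (p z)"
proof -
 have t: "p \<circ> transposition x y \<circ> inv' p = transposition (p x) (p y)" for x y
 proof
  fix u
  obtain v where "u = p v" using assms by (metis bij_pointE)
  then show "(p \<circ> transposition x y \<circ> inv' p) u = transposition (p x) (p y) u"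
   using assms by (auto simp: Transposition.transpose_def bij_is_inj inj_eq)
 qed
 have "p \<circ> three_cycle x y z \<circ> inv' p = (p \<circ> transposition x y \<circ> inv' p) \<circ> (p \<circ> transposition y z \<circ> inv' p)"
  using assms by (auto simp: three_cycle_def fun_eq_iff bij_is_inj)
 then show ?thesis by (simp add: t three_cycle_def)
qed

section \<open>Permutation groups containing a three-cycle\<close>

locale perm_group =
 fixes n :: nat and G :: "(nat => nat) set"
 assumes subgr: "subgroup G (sym_group n)"
begin

lemma perm: "p \<in> G ==> p permutes {1..n}"
 using subgroup.subset[OF subgr] sym_group_carrier by blast

lemma id_mem: "id \<in> G"
 using subgroup.one_closed[OF subgr] by (simp add: sym_group_one)

lemma comp_mem: "p \<in> G ==> q \<in> G ==> p \<circ> q \<in> G"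
 using subgroup.m_closed[OF subgr] by (simp add: sym_group_mult)

lemma inv_mem: "p \<in> G ==> inv' p \<in> G"
 using subgroup.m_inv_closed[OF subgr, of p] subgroup.subset[OF subgr]
 by (metis subsetD sym_group_inv_equality)

lemma pow_mem: "p \<in> G ==> p ^^ k \<in> G"
 by (induct k) (auto simp: id_mem comp_mem funpow_0 simp del: funpow.simps(1) simp: funpow.simps(1))

lemma bij: "p \<in> G ==> bij p"
 using perm permutes_bij by blast

lemma conj_mem: "p \<in> G ==> q \<in> G ==> p \<circ> q \<circ> inv' p \<in> G"
 by (simp add: comp_mem inv_mem)

text \<open>Vacuous for sets of fewer than three points, which is why \<open>card B >= 3\<close>
  accompanies it below.\<close>

definition alt_closed :: "nat set => bool" where
 "alt_closed B \<longleftrightarrow> B <= {1..n} \<and>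
  (\<forall>x\<in>B. \<forall>y\<in>B. \<forall>z\<in>B. distinct [x, y, z] --> three_cycle x y z \<in> G)"

lemma three_cycle_swap: "distinct [x, y, z] ==> three_cycle x y z \<in> G ==> three_cycle y x z \<in> G"
 using inv_mem three_cycle_inv by metis

text \<open>Conjugation by \<open>(x y v)\<close> carries \<open>x, y, w\<close> to
  \<open>y, v, w\<close>.\<close>

lemma three_cycle_trans:
 assumes "distinct [x, y, v, w]" "three_cycle x y w \<in> G" "three_cycle x y v \<in> G"
 shows "three_cycle y v w \<in> G"
proof -
 have "three_cycle x y v \<circ> three_cycle x y w \<circ> inv' (three_cycle x y v) \<in> G"
  using assms conj_mem by blast
 then show ?thesis
  using three_cycle_conj[OF bij[OF assms(3)]] assms(1) by (simp add: three_cycle_apply)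
qed

text \<open>One 3-cycle through \<open>w\<close> and two points of \<open>B\<close> is enough:
  inversion exchanges the two points and conjugation by 3-cycles inside \<open>B\<close> moves the
  pair, so every ordered pair of points of \<open>B\<close> is reached.\<close>

lemma alt_closed_insert:
 assumes B: "alt_closed B" and xy: "x \<in> B" "y \<in> B" "w \<notin> B" "w \<in> {1..n}" "x ~= y"
  and t: "three_cycle x y w \<in> G"
 shows "alt_closed (insert w B)"
proof -
 let ?P = "%u v. three_cycle u v w \<in> G"
 have sym: "?P v u" if "?P u v" "u \<in> B" "v \<in> B" "u ~= v" for u v
  using three_cycle_swap[of u v w] that xy by auto
 have step: "?P v v'" if "?P u v" "u \<in> B" "v \<in> B" "u ~= v" "v' \<in> B" "v' ~= u" "v' ~= v" for u v v'
 proof (rule three_cycle_trans[of u v v' w])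
  show "three_cycle u v v' \<in> G" using B that by (auto simp: alt_closed_def)
 qed (use that xy in auto)
 have all: "?P u v" if uv: "u \<in> B" "v \<in> B" "u ~= v" for u v
 proof -
  have yx: "?P y x" using sym t xy by auto
  consider "u = x" "v = y" | "u = x" "v ~= y" | "u = y" "v = x" | "u = y" "v ~= x"
   | "u ~= x" "u ~= y" by blast
  then show ?thesis
  proof cases
   case 5
   then have yu: "?P y u" using step[OF t] xy uv by auto
   then have uy: "?P u y" using sym xy uv 5 by auto
   show ?thesis
   proof (cases "v = y")
    case False then show ?thesis using step[OF yu] xy uv 5 by auto
   qed (use uy in simp)
  qed (use t yx step[OF t] step[OF yx] uv xy in auto)
 qed
 show ?thesis
  unfolding alt_closed_def
 proof (intro conjI ballI impI)
  show "insert w B <= {1..n}" using B xy by (auto simp: alt_closed_def)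
  fix u v z assume uvz: "u \<in> insert w B" "v \<in> insert w B" "z \<in> insert w B" "distinct [u, v, z]"
  consider "u = w" "v \<in> B" "z \<in> B" | "v = w" "u \<in> B" "z \<in> B" | "z = w" "u \<in> B" "v \<in> B"
   | "u \<in> B" "v \<in> B" "z \<in> B" using uvz by auto
  then show "three_cycle u v z \<in> G"
  proof cases
   case 1 then show ?thesis using all[of v z] uvz three_cycle_rotate[of u v z] by auto
  next
   case 2 then show ?thesis
    using all[of z u] uvz three_cycle_rotate[of u v z] three_cycle_rotate[of v z u] by auto
  next
   case 3 then show ?thesis using all uvz by auto
  next
   case 4 then show ?thesis using B uvz by (auto simp: alt_closed_def)
  qed
 qed
qed

text \<open>Here only one point of the 3-cycle is known to lie in \<open>B\<close>. If
  \<open>w\<close> lies outside as well, conjugating a 3-cycle \<open>(x p q)\<close> of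
  \<open>B\<close> by it replaces \<open>x\<close> by \<open>y\<close> and keeps \<open>p\<close>
  and \<open>q\<close>, which reduces to the previous situation.\<close>

lemma alt_closed_insert2:
 assumes B: "alt_closed B" "card B >= 3" and x: "x \<in> B" and yw: "y \<notin> B" "w \<in> {1..n}" "y \<in> {1..n}"
  and d: "distinct [x, y, w]" and t: "three_cycle x y w \<in> G"
 shows "\<exists>B'. alt_closed B' & B \<subset> B'"
proof (cases "w \<in> B")
 case True
 have "three_cycle w x y \<in> G"
  using t d three_cycle_rotate[of w x y] by auto
 then have "alt_closed (insert y B)"
  using alt_closed_insert[of B w x y] B x yw d True by auto
 then show ?thesis using yw by blast
next
 case False
 have finB: "finite B" using B card.infinite by fastforce
 then have "card (B - {x}) >= 2" using B x by simp
 then obtain p where p: "p \<in> B - {x}" by (metis card.empty ex_in_conv not_numeral_le_zero)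
 have "card (B - {x} - {p}) >= 1" using finB B x p by (simp add: card_Diff_singleton)
 then obtain q where q: "q \<in> B - {x} - {p}" by (metis card.empty ex_in_conv not_one_le_zero)
 have "three_cycle x p q \<in> G" using B x p q by (auto simp: alt_closed_def)
 then have "three_cycle x y w \<circ> three_cycle x p q \<circ> inv' (three_cycle x y w) \<in> G"
  using conj_mem t by blast
 then have "three_cycle y p q \<in> G"
  using three_cycle_conj[OF bij[OF t]] d p q yw False x
  by (metis (no_types, lifting) DiffE insertCI insertE singletonD three_cycle_apply(1,4))
 moreover have "distinct [y, p, q]" using p q yw by auto
 ultimately have "three_cycle p q y \<in> G" using three_cycle_rotate[of y p q] by simp
 then have "alt_closed (insert y B)"
  using alt_closed_insert[of B p q y] B yw p q by auto
 then show ?thesis using yw by blast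
qed

lemma alt_closed_image:
 assumes "alt_closed B" "g \<in> G" shows "alt_closed (g ` B)"
 unfolding alt_closed_def
proof (intro conjI ballI impI)
 show "g ` B <= {1..n}"
  using assms perm[OF assms(2)] permutes_image by (fastforce simp: alt_closed_def permutes_in_image)
 fix x y z assume "x \<in> g ` B" "y \<in> g ` B" "z \<in> g ` B" "distinct [x, y, z]"
 then obtain u v w where "u \<in> B" "v \<in> B" "w \<in> B" "distinct [u,v,w]" "x = g u" "y = g v" "z = g w"
  by auto
 moreover from this have "three_cycle u v w \<in> G" using assms(1) by (auto simp: alt_closed_def)
 ultimately show "three_cycle x y z \<in> G"
  using three_cycle_conj[OF bij[OF assms(2)], of u v w] conj_mem[OF assms(2)] by metis
qed

text \<open>A maximal set on which \<open>G\<close> induces all three-cycles is a block of \<open>G\<close>.\<close>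

lemma exists_alt_block:
 assumes t: "three_cycle x y z \<in> G" "distinct [x, y, z]" "{x, y, z} <= {1..n}"
 obtains B where "alt_closed B" "card B >= 3" "\<And>g. g \<in> G ==> g ` B \<inter> B ~= {} ==> g ` B = B"
proof -
 define \<B> where "\<B> = {B. alt_closed B & card B >= 3}"
 have "alt_closed {x, y, z}"
  unfolding alt_closed_def
  using t three_cycle_rotate[of x y z] three_cycle_rotate[of y z x] three_cycle_swap[of x y z]
   three_cycle_swap[of y z x] three_cycle_swap[of z x y] by auto
 then have ne: "{x, y, z} \<in> \<B>" using t by (auto simp: \<B>_def)
 have "\<B> <= Pow {1..n}" by (auto simp: \<B>_def alt_closed_def)
 then have fin: "finite \<B>" by (meson finite_Pow_iff finite_atLeastAtMost finite_subset)
 obtain B where B: "B \<in> \<B>" "\<And>C. C \<in> \<B> ==> B <= C ==> B = C"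
  using finite_has_maximal[OF fin] ne by blast
 have finB: "finite B" using B card.infinite by (fastforce simp: \<B>_def)
 show ?thesis
 proof (rule that)
  show "alt_closed B" "3 <= card B" using B by (auto simp: \<B>_def)
  fix g assume g: "g \<in> G" "g ` B \<inter> B ~= {}"
  have cg: "card (g ` B) = card B" using bij[OF g(1)] by (meson bij_is_inj card_image inj_on_subset subset_UNIV)
  show "g ` B = B"
  proof (rule ccontr)
   assume "g ` B ~= B"
   then have "\<not> g ` B <= B" using cg finB card_subset_eq by blast
   \<comment> \<open>The image of \<open>B\<close> has a point \<open>u\<close> in \<open>B\<close>,
     a point \<open>v\<close> outside and, as it has at least three points, a further point
     \<open>w\<close>. The 3-cycle on these lies in \<open>G\<close> and enlarges \<open>B\<close>,
     against maximality.\<close>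
   then obtain v where v: "v \<in> g ` B" "v \<notin> B" by blast
   obtain u where u: "u \<in> g ` B" "u \<in> B" using g by blast
   have "card (g ` B - {u}) = card B - 1" using cg finB u by (simp add: card_Diff_singleton)
   moreover have "v \<in> g ` B - {u}" using u v by auto
   ultimately have "card (g ` B - {u} - {v}) = card B - 2"
    using finB by (simp add: card_Diff_singleton)
   moreover have "card B >= 3" using B(1) by (simp add: \<B>_def)
   ultimately have "card (g ` B - {u} - {v}) >= 1" by linarith
   then obtain w where w: "w \<in> g ` B - {u} - {v}" by (metis card.empty ex_in_conv not_one_le_zero)
   have ac: "alt_closed (g ` B)" using alt_closed_image g B by (auto simp: \<B>_def)
   moreover have "distinct [u, v, w]" using u v w by auto
   ultimately have "three_cycle u v w \<in> G" using u v w unfolding alt_closed_def by blast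
   then obtain B' where "alt_closed B'" "B \<subset> B'"
   proof -
    have "alt_closed B" "card B >= 3" using B(1) by (auto simp: \<B>_def)
    moreover have "g ` B <= {1..n}" using ac by (simp add: alt_closed_def)
    then have "w \<in> {1..n}" "v \<in> {1..n}" using v w by blast+
    ultimately show thesis
     using alt_closed_insert2[of B u v w] u(2) v(2) \<open>distinct [u, v, w]\<close>
      \<open>three_cycle u v w \<in> G\<close> that by blast
   qed
   then have "B' \<in> \<B>"
   proof -
    assume B': "alt_closed B'" "B \<subset> B'"
    then have "finite B'" by (meson alt_closed_def finite_atLeastAtMost finite_subset)
    then have "card B <= card B'" using B' by (simp add: card_mono)
    then show ?thesis using B(1) B' by (auto simp: \<B>_def)
   qed
   then show False using B(2) \<open>B \<subset> B'\<close> by blast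
  qed
 qed
qed

section \<open>From 3-cycles to the alternating and the symmetric group\<close>

lemma three_cycle_eq_cycle_of_list: "three_cycle x y z = cycle_of_list [x, y, z]"
 by (simp add: three_cycle_def comp_assoc)

lemma alt_subset:
 assumes "alt_closed {1..n}" shows "carrier (alt_group n) <= G"
proof -
 interpret A: group "alt_group n" by (rule alt_group_is_group)
 interpret S: group "sym_group n" by (rule sym_group_is_group)
 have "three_cycles n <= G"
 proof
  fix p assume "p \<in> three_cycles n"
  then obtain cs where cs: "p = cycle_of_list cs" "distinct cs" "length cs = 3" "set cs <= {1..n}"
   by auto
  obtain a b c where "cs = [a, b, c]" using stupid_lemma[OF cs(3)] by auto
  then show "p \<in> G" using cs assms by (auto simp: alt_closed_def three_cycle_eq_cycle_of_list simp del: cycle_of_list.simps)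
 qed
 have "p \<in> G" if "p \<in> generate (alt_group n) (three_cycles n)" for p
  using that
 proof induct
  case (inv h)
  then have "h \<in> carrier (alt_group n)" using three_cycles_incl by blast
  then have "inv\<^bsub>alt_group n\<^esub> h = inv' h" by (rule alt_group_inv_equality)
  then show ?case using inv_mem \<open>three_cycles n <= G\<close> inv by auto
 next
  case one then show ?case using id_mem by (simp only: alt_group_one)
 next
  case (incl h) then show ?case using \<open>three_cycles n <= G\<close> by blast
 next
  case (eng h1 h2) then show ?case using comp_mem by (simp only: alt_group_mult)
 qed
 then show ?thesis using alt_group_carrier_as_three_cycles by blast
qed

text \<open>The alternating group has index two: an odd \<open>q\<close> times the inverse of one
  odd element of \<open>G\<close> is even.\<close>

lemma eq_sym_if_odd:
 assumes A: "carrier (alt_group n) <= G" and p: "p \<in> G" "\<not> evenperm p"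
 shows "G = carrier (sym_group n)"
proof
 show "G <= carrier (sym_group n)" using subgr subgroup.subset by blast
 show "carrier (sym_group n) <= G"
 proof
  fix q assume q: "q \<in> carrier (sym_group n)"
  show "q \<in> G"
  proof (cases "evenperm q")
   case True then show ?thesis using A q by (auto simp: alt_group_carrier sym_group_carrier)
  next
   case False
   have perms: "permutation p" "permutation q"
    using p q perm sym_group_carrier' permutes_imp_permutation by blast+
   have "evenperm (q \<circ> inv' p)"
    using False p perms by (simp add: evenperm_comp evenperm_inv permutation_inverse)
   moreover have "q \<circ> inv' p permutes {1..n}"
    using q p perm by (simp add: permutes_compose permutes_inv sym_group_carrier)
   ultimately have "q \<circ> inv' p \<in> G" using A by (auto simp: alt_group_carrier)
   then have "q \<circ> inv' p \<circ> p \<in> G" using comp_mem p by blast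
   moreover have "q \<circ> inv' p \<circ> p = q" using bij[OF p(1)] by (simp add: fun_eq_iff bij_is_inj)
   ultimately show ?thesis by simp
  qed
 qed
qed

end

section \<open>Triples of cycles of genus zero\<close>

text \<open>A one-point \<open>A\<close> is allowed and, among permutations, describes the identity;
  \<open>A\<close> is the support only from two points on. Cycles of length 1 occur when two of the
  poles are simple.\<close>

definition is_cycle_on :: "('a => 'a) => 'a set => bool" where
 "is_cycle_on s A \<longleftrightarrow> (\<forall>x. x \<notin> A --> s x = x) & (\<forall>x\<in>A. \<forall>y\<in>A. \<exists>k. (s ^^ k) x = y)"

lemma is_cycle_on_support:
 assumes "is_cycle_on s A" "card A >= 2" shows "A = {x. s x ~= x}"
proof -
 have "s x ~= x" if "x \<in> A" for x
 proof
  assume "s x = x"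
  then have fixed: "(s ^^ k) x = x" for k by (induct k) auto
  have "A <= {x}" using assms(1) that fixed by (fastforce simp: is_cycle_on_def)
  then have "card A <= 1" using card_mono[of "{x}" A] by simp
  then show False using assms(2) by simp
 qed
 then show ?thesis using assms(1) by (auto simp: is_cycle_on_def)
qed

lemma is_cycle_on_image_subset:
 assumes "is_cycle_on s A" "s ` B <= B" "x \<in> A" "x \<in> B" shows "A <= B"
proof
 fix y assume "y \<in> A"
 then obtain k where "(s ^^ k) x = y" using assms unfolding is_cycle_on_def by blast
 moreover have "(s ^^ k) x \<in> B" using assms(2,4) by (induct k) auto
 ultimately show "y \<in> B" by simp
qed

lemma is_cycle_on_inv:
 assumes "is_cycle_on s A" "bij s" shows "is_cycle_on (inv' s) A"
 unfolding is_cycle_on_def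
proof (intro conjI allI ballI impI)
 fix x assume "x \<notin> A"
 then have "s x = x" using assms by (auto simp: is_cycle_on_def)
 then show "inv' s x = x" using assms(2) by (metis bij_inv_eq_iff)
next
 fix x y assume "x \<in> A" "y \<in> A"
 then obtain k where k: "(s ^^ k) y = x" using assms unfolding is_cycle_on_def by blast
 have "(inv' s ^^ k) ((s ^^ k) y) = y" for y
  by (induct k arbitrary: y) (auto simp: funpow_swap1 assms(2) bij_is_inj)
 then show "\<exists>k. (inv' s ^^ k) x = y" using k by auto
qed

lemma is_cycle_on_orbit:
 assumes c: "is_cycle_on s A" and x: "x \<in> A" and fin: "finite A" and p: "s permutes S" "finite S"
 shows "inj_on (%i. (s ^^ i) x) {..<card A}" "(%i. (s ^^ i) x) ` {..<card A} = A"
  "(s ^^ card A) x = x" "\<And>y. y \<in> A ==> s y = cycle_of_list (map (%i. (s ^^ i) x) [0..<card A]) y"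
proof -
 have perm: "permutation s" using p by (simp add: permutation_permutes) blast
 have stab: "s y \<in> A" if "y \<in> A" for y
 proof (rule ccontr)
  assume "s y \<notin> A"
  then have "s (s y) = s y" using c by (auto simp: is_cycle_on_def)
  then have "s y = y" using p(1) by (metis permutes_inverses(2))
  then show False using \<open>s y \<notin> A\<close> that by simp
 qed
 have "(s ^^ i) x \<in> A" for i by (induct i) (auto simp: x stab)
 moreover have "A <= range (%i. (s ^^ i) x)" using c x by (fastforce simp: is_cycle_on_def)
 ultimately have A: "set (support s x) = A" unfolding support_set[OF perm] by auto
 have d: "distinct (support s x)" by (rule cycle_of_permutation[OF perm])
 have lp: "least_power s x = card A" using distinct_card[OF d] A by simp
 show "inj_on (%i. (s ^^ i) x) {..<card A}"
  using d lp by (simp add: distinct_map atLeast_upt)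
 show "(%i. (s ^^ i) x) ` {..<card A} = A"
  using A lp by (simp add: atLeast_upt)
 show "(s ^^ card A) x = x" using least_power_of_permutation(1)[OF perm, of x] lp by simp
 show "\<And>y. y \<in> A ==> s y = cycle_of_list (map (%i. (s ^^ i) x) [0..<card A]) y"
  using cycle_restrict[OF perm, of _ x] A lp by simp
qed

lemma evenperm_cycle_of_list: "distinct cs ==> cs ~= [] ==> evenperm (cycle_of_list cs) \<longleftrightarrow> odd (length cs)"
proof (induct cs rule: cycle_of_list.induct)
 case (1 i j cs)
 then have "evenperm (cycle_of_list (j # cs)) \<longleftrightarrow> odd (length (j # cs))" by simp
 moreover have "evenperm (cycle_of_list (i # j # cs)) \<longleftrightarrow>
   (evenperm (transposition i j) \<longleftrightarrow> evenperm (cycle_of_list (j # cs)))"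
  by (simp only: cycle_of_list.simps) (rule evenperm_comp[OF permutation_swap_id permutation_of_cycle])
 ultimately show ?case using 1(2,3) by (simp add: evenperm_swap del: cycle_of_list.simps)
qed auto

lemma evenperm_cycle:
 assumes c: "is_cycle_on s A" "card A >= 1" and p: "s permutes S" "finite S"
 shows "evenperm s \<longleftrightarrow> odd (card A)"
proof -
 have fin: "finite A" "A ~= {}" using assms(2) card.infinite by fastforce+
 then obtain x where x: "x \<in> A" by blast
 define cs where "cs = map (%i. (s ^^ i) x) [0..<card A]"
 note o = is_cycle_on_orbit[OF c(1) x fin(1) p]
 have set: "set cs = A" unfolding cs_def using o(2) by (simp add: atLeast_upt)
 have "s = cycle_of_list cs"
 proof
  fix y
  show "s y = cycle_of_list cs y"
  proof (cases "y \<in> A")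
   case True then show ?thesis using o(4) cs_def by simp
  next
   case False then show ?thesis using c(1) set id_outside_supp[of y cs] by (simp add: is_cycle_on_def)
  qed
 qed
 moreover have "distinct cs" unfolding cs_def using o(1) by (simp add: distinct_map atLeast_upt)
 moreover have "length cs = card A" by (simp add: cs_def)
 moreover have "cs ~= []" using assms(2) by (auto simp: cs_def)
 ultimately show ?thesis using evenperm_cycle_of_list[of cs] by metis
qed

section \<open>Transitive triples of cycles with product 1\<close>

lemma perm_group_generate:
 assumes "\<And>p. p \<in> H ==> p permutes {1..n}"
 shows "perm_group n (generate (sym_group n) H)"
proof (rule perm_group.intro)
 interpret S: group "sym_group n" by (rule sym_group_is_group)
 show "subgroup (generate (sym_group n) H) (sym_group n)"
  by (rule S.generate_is_subgroup) (use assms sym_group_carrier in blast)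
qed

lemma (in perm_group) generate_subset:
 assumes "H <= G" shows "generate (sym_group n) H <= G"
 using group.generate_subgroup_incl[OF sym_group_is_group assms subgr] .

text \<open>\<open>genus\<close> is the Riemann-Hurwitz equation for a sphere covering a sphere with
  three branch points: \<open>2 n - 2\<close> is the sum of the \<open>m_i - 1\<close>. Lengths of
  at least 2 make each cycle determine its support; length 1 leads to the cyclic case, treated
  separately.\<close>

locale cycle_triple =
 fixes n :: nat and s1 s2 s3 :: "nat => nat" and m1 m2 m3 :: nat
 assumes perm_s: "s1 permutes {1..n}" "s2 permutes {1..n}" "s3 permutes {1..n}"
  and prod_id: "\<And>x. s3 (s2 (s1 x)) = x"
  and cyc: "\<exists>A\<subseteq>{1..n}. card A = m1 & is_cycle_on s1 A"
   "\<exists>A\<subseteq>{1..n}. card A = m2 & is_cycle_on s2 A"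
   "\<exists>A\<subseteq>{1..n}. card A = m3 & is_cycle_on s3 A"
  and genus: "m1 + m2 + m3 = 2 * n + 1"
  and m_ge: "m1 >= 2" "m2 >= 2" "m3 >= 2"
  and transitive: "\<And>x y. x \<in> {1..n} ==> y \<in> {1..n} ==>
    \<exists>g\<in>generate (sym_group n) {s1, s2, s3}. g x = y"
begin

lemma rotate: "cycle_triple n s2 s3 s1 m2 m3 m1"
proof
 show "s1 (s3 (s2 x)) = x" for x
  using prod_id[of "inv' s1 x"] perm_s(1) by (metis permutes_inverses(1))
 show "\<And>x y. x \<in> {1..n} ==> y \<in> {1..n} ==>
    \<exists>g\<in>generate (sym_group n) {s2, s3, s1}. g x = y"
  using transitive by (simp add: insert_commute)
qed (use perm_s cyc genus m_ge in auto)

abbreviation "G \<equiv> generate (sym_group n) {s1, s2, s3}"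

sublocale perm_group n G
 by (rule perm_group_generate) (use perm_s in auto)

lemma s_mem: "s1 \<in> G" "s2 \<in> G" "s3 \<in> G"
 by (auto intro: generate.incl)

lemma reflect_generate: "generate (sym_group n) {inv' s3, inv' s2, inv' s1} = G"
proof
 interpret R: perm_group n "generate (sym_group n) {inv' s3, inv' s2, inv' s1}"
  by (rule perm_group_generate) (use perm_s in \<open>auto intro: permutes_inv\<close>)
 show "generate (sym_group n) {inv' s3, inv' s2, inv' s1} <= G"
  by (rule generate_subset) (auto intro: inv_mem s_mem)
 show "G <= generate (sym_group n) {inv' s3, inv' s2, inv' s1}"
 proof (rule R.generate_subset)
  have "inv' (inv' s) \<in> generate (sym_group n) {inv' s3, inv' s2, inv' s1}"
   if "s \<in> {s1, s2, s3}" for s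
   using that by (intro R.inv_mem generate.incl) auto
  moreover have "inv' (inv' s) = s" if "s \<in> {s1, s2, s3}" for s
   using that perm_s permutes_inv_inv by blast
  ultimately show "{s1, s2, s3} <= generate (sym_group n) {inv' s3, inv' s2, inv' s1}"
   by (metis subsetI)
 qed
qed

text \<open>Inversion reverses the order of the factors. With \<open>rotate\<close> this gives all
  six orders of the lengths for one and the same group, so it can be chosen freely which two cycles
  are compared.\<close>

lemma reflect: "cycle_triple n (inv' s3) (inv' s2) (inv' s1) m3 m2 m1"
proof
 show "inv' s1 (inv' s2 (inv' s3 x)) = x" for x
  using prod_id perm_s by (metis permutes_inverses)
 show "\<And>x y. x \<in> {1..n} ==> y \<in> {1..n} ==>
    \<exists>g\<in>generate (sym_group n) {inv' s3, inv' s2, inv' s1}. g x = y"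
  using transitive reflect_generate by simp
next
 show "\<exists>A\<subseteq>{1..n}. card A = m3 & is_cycle_on (inv' s3) A"
  "\<exists>A\<subseteq>{1..n}. card A = m2 & is_cycle_on (inv' s2) A"
  "\<exists>A\<subseteq>{1..n}. card A = m1 & is_cycle_on (inv' s1) A"
  using cyc perm_s by (meson is_cycle_on_inv permutes_bij)+
qed (use perm_s genus m_ge in \<open>auto simp del: One_nat_def intro: permutes_inv\<close>)

abbreviation "A1 \<equiv> {x. s1 x ~= x}"
abbreviation "A2 \<equiv> {x. s2 x ~= x}"
abbreviation "A3 \<equiv> {x. s3 x ~= x}"

lemma supports:
 "A1 <= {1..n}" "A2 <= {1..n}" "A3 <= {1..n}" "card A1 = m1" "card A2 = m2" "card A3 = m3"
 "is_cycle_on s1 A1" "is_cycle_on s2 A2" "is_cycle_on s3 A3"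
 using cyc m_ge is_cycle_on_support by metis+

lemma n_ge: "n >= 2"
 using supports m_ge card_mono[of "{1..n}" A1] by simp

text \<open>Since the product is 1, a point fixed by two of the permutations is fixed by the third;
  a common fixed point contradicts transitivity because \<open>n >= 2\<close>.\<close>

lemma support_cover:
 assumes "x \<in> {1..n}" shows "x \<in> A1 \<or> x \<in> A2" "x \<in> A1 \<or> x \<in> A3" "x \<in> A2 \<or> x \<in> A3"
proof -
 have *: "\<not> (s1 x = x & s2 x = x & s3 x = x)"
 proof
  assume fixed: "s1 x = x & s2 x = x & s3 x = x"
  interpret S: group "sym_group n" by (rule sym_group_is_group)
  have "g x = x" if "g \<in> G" for g
   using that
  proof induct
   case (inv h)
   have "inv\<^bsub>sym_group n\<^esub> h = inv' h"
    by (rule sym_group_inv_equality) (use inv perm_s sym_group_carrier in blast)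
   then show ?case using inv fixed perm_s by (auto simp: permutes_inv_eq)
  qed (use fixed in \<open>auto simp: sym_group_one sym_group_mult\<close>)
  then have "\<forall>y\<in>{1..n}. y = x" using transitive assms by metis
  then have "1 = x" "2 = x" using n_ge by auto
  then show False by simp
 qed
 have "s3 (s2 (s1 x)) = x" by (rule prod_id)
 moreover have "s1 (s3 (s2 x)) = x" by (rule cycle_triple.prod_id[OF rotate])
 ultimately show "x \<in> A1 \<or> x \<in> A2" "x \<in> A1 \<or> x \<in> A3" "x \<in> A2 \<or> x \<in> A3"
  using * cycle_triple.prod_id[OF cycle_triple.rotate[OF rotate], of x] by auto
qed

lemma A3_iff: "x \<in> A3 \<longleftrightarrow> s2 (s1 x) ~= x"
 using prod_id[of x] perm_s by (metis (mono_tags, lifting) mem_Collect_eq permutes_inverses(2))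

lemma card_A12: "card (A1 \<inter> A2) + n = m1 + m2"
proof -
 have "A1 \<union> A2 = {1..n}" using supports(1,2) support_cover(1) by blast
 moreover have "finite A1" "finite A2" using supports finite_subset by blast+
 ultimately show ?thesis using card_Un_Int[of A1 A2] supports by simp
qed

text \<open>By \<open>support_cover\<close> the fixed points of \<open>s3\<close> lie in both other
  supports, so the number of points in question is \<open>(m1 + m2 - n) - (n - m3)\<close>, which is
  1 by the genus equation.\<close>

lemma center: obtains p where "A1 \<inter> A2 \<inter> A3 = {p}"
proof -
 have fin: "finite A1" "finite A2" "finite A3" using supports finite_subset by blast+
 have sub: "{1..n} - A3 <= A1 \<inter> A2" using support_cover by blast
 have "A1 \<inter> A2 \<inter> A3 = (A1 \<inter> A2) - ({1..n} - A3)" using supports by blast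
 then have "card (A1 \<inter> A2 \<inter> A3) = card (A1 \<inter> A2) - card ({1..n} - A3)"
  using card_Diff_subset[OF _ sub] by simp
 also have "card ({1..n} - A3) = n - m3" using supports(3,6) fin by (simp add: card_Diff_subset)
 also have "card (A1 \<inter> A2) - (n - m3) = 1"
  using card_A12 genus card_mono[OF _ supports(3)] supports(6) by simp
 finally show ?thesis using that card_1_singletonE by blast
qed

text \<open>The form of Jordan's argument used here: by transitivity the block of
  \<open>exists_alt_block\<close> is moved so that it contains the central point \<open>p\<close>,
  and then it is compared with the three supports, which all contain \<open>p\<close>.\<close>

lemma alt_subset_if_three_cycle:
 assumes t: "three_cycle x y z \<in> G" "distinct [x, y, z]" "{x, y, z} <= {1..n}"
 shows "carrier (alt_group n) <= G"
proof -
 obtain B0 where B0: "alt_closed B0" "card B0 >= 3"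
  "\<And>g. g \<in> G ==> g ` B0 \<inter> B0 ~= {} ==> g ` B0 = B0"
  using exists_alt_block[OF t] by metis
 obtain p where p: "A1 \<inter> A2 \<inter> A3 = {p}" by (rule center)
 then have "p \<in> {1..n}" using supports by blast
 obtain b where b: "b \<in> B0" using B0(2) by fastforce
 then have "b \<in> {1..n}" using B0(1) by (auto simp: alt_closed_def)
 then obtain g where g: "g \<in> G" "g b = p" using transitive \<open>p \<in> {1..n}\<close> by metis
 define B where "B = g ` B0"
 have B: "alt_closed B" "p \<in> B" using alt_closed_image[OF B0(1) g(1)] b g by (auto simp: B_def)
 have cB: "card B >= 3"
  using B0(2) bij[OF g(1)] by (metis B_def bij_is_inj card_image inj_on_subset subset_UNIV)
 have Bsub: "B <= {1..n}" using B by (auto simp: alt_closed_def)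
 have block: "h ` B = B" if h: "h \<in> G" "h ` B \<inter> B ~= {}" for h
 proof -
  let ?k = "inv' g \<circ> h \<circ> g"
  have kG: "?k \<in> G" by (intro comp_mem inv_mem g(1) h(1))
  have gk: "g ` ?k ` C = h ` g ` C" for C
   using bij[OF g(1)] by (simp add: image_image bij_is_surj surj_f_inv_f)
  have "g ` (?k ` B0 \<inter> B0) = h ` B \<inter> B"
   using gk[of B0] bij[OF g(1)] by (simp add: B_def image_Int bij_is_inj)
  then have "?k ` B0 \<inter> B0 ~= {}" using h by auto
  then have "?k ` B0 = B0" using B0(3) kG by blast
  then show ?thesis using gk[of B0] by (simp add: B_def)
 qed
 \<comment> \<open>A point of \<open>B\<close> outside \<open>A\<close> is fixed by
   \<open>s\<close>, so \<open>s\<close> preserves the block, which then contains the whole cycle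
   through \<open>p\<close>.\<close>
 have dich: "B <= A \<or> A <= B" if "s \<in> G" "is_cycle_on s A" "p \<in> A" for s A
 proof (cases "B <= A")
  case False
  then obtain x where "x \<in> B" "x \<notin> A" by blast
  then have "s x = x" using that unfolding is_cycle_on_def by blast
  then have "x \<in> s ` B \<inter> B" using \<open>x \<in> B\<close> by (metis IntI imageI)
  then have "s ` B = B" using block that by blast
  then show ?thesis using is_cycle_on_image_subset[OF that(2) _ that(3) B(2)] by blast
 qed simp
 have pA: "p \<in> A1" "p \<in> A2" "p \<in> A3" using p by blast+
 have d: "B <= A1 \<or> A1 <= B" "B <= A2 \<or> A2 <= B" "B <= A3 \<or> A3 <= B"
  using dich[OF s_mem(1) supports(7) pA(1)] dich[OF s_mem(2) supports(8) pA(2)]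
   dich[OF s_mem(3) supports(9) pA(3)] by blast+
 have not_single: "\<not> A <= {p}" if "card A >= 2" for A :: "nat set"
  using that card_mono[of "{p}" A] by auto
 have "{1..n} <= B"
 proof -
  have n: "\<not> B <= {p}" "\<not> A1 <= {p}" "\<not> A2 <= {p}" "\<not> A3 <= {p}"
   using not_single cB supports(4-6) m_ge by auto
  \<comment> \<open>If two supports were not inside \<open>B\<close>, then \<open>B\<close> would
    lie in both of them, and the comparison with the third would put either \<open>B\<close> or that
    third support inside \<open>{p}\<close>. So two supports lie in \<open>B\<close>, and any two
    supports cover all points.\<close>
  then have "(A1 <= B & A2 <= B) \<or> (A1 <= B & A3 <= B) \<or> (A2 <= B & A3 <= B)"
   using d p by blast
  then show ?thesis using support_cover by blast
 qed
 then have "alt_closed {1..n}" using B Bsub by (metis subset_antisym)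
 then show ?thesis by (rule alt_subset)
qed

lemma parity: "evenperm s1 \<longleftrightarrow> odd m1" "evenperm s2 \<longleftrightarrow> odd m2" "evenperm s3 \<longleftrightarrow> odd m3"
 using evenperm_cycle[OF supports(7) _ perm_s(1)] evenperm_cycle[OF supports(8) _ perm_s(2)]
  evenperm_cycle[OF supports(9) _ perm_s(3)] supports m_ge by auto

lemma subset_alt:
 assumes "odd m1" "odd m2" "odd m3" shows "G <= carrier (alt_group n)"
proof -
 interpret A: perm_group n "carrier (alt_group n)"
  by (rule perm_group.intro) (rule alt_group_is_subgroup)
 show ?thesis by (rule A.generate_subset) (use assms parity perm_s in \<open>auto simp: alt_group_carrier\<close>)
qed


text \<open>The points of \<open>A1 \<inter> A2\<close> form a common string of \<open>s1\<close> and \<open>inv s2\<close>, because the fixed points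
 of \<open>s3\<close> are exactly the points where these two permutations agree inside it.\<close>

lemma common_string:
 assumes c: "c + n = m1 + m2"
 obtains p where "p \<in> A1 \<inter> A2" "(%i. (s1 ^^ i) p) ` {..<c} = A1 \<inter> A2"
  "\<And>i. i < c ==> (inv' s2 ^^ i) p = (s1 ^^ i) p"
proof -
 define K where "K = A1 \<inter> A2"
 define J where "J = {1..n} - A3"
 have fin: "finite A1" "finite A2" "finite A3" using supports finite_subset by blast+
 then have finK: "finite K" by (simp add: K_def)
 have cK: "card K = c" using card_A12 c by (simp add: K_def)
 have JK: "J <= K" using support_cover by (auto simp: J_def K_def)
 obtain z where z: "K - J = {z}"
 proof -
  obtain z where "A1 \<inter> A2 \<inter> A3 = {z}" by (rule center)
  moreover have "K - J = A1 \<inter> A2 \<inter> A3" using supports by (auto simp: K_def J_def)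
  ultimately show ?thesis using that by simp
 qed
 have bij1: "bij s1" and bij2: "bij s2" using perm_s permutes_bij by blast+
 have J_agree: "inv' s2 x = s1 x" if "x \<in> J" for x
 proof -
  have "s2 (s1 x) = x" using that A3_iff by (auto simp: J_def)
  then show ?thesis using bij2 by (metis bij_inv_eq_iff)
 qed
 have s1J: "s1 x \<in> K" if "x \<in> J" for x
 proof -
  have xK: "x \<in> A1" using that JK by (auto simp: K_def)
  have e: "s2 (s1 x) = x" using that A3_iff by (auto simp: J_def)
  have "s1 (s1 x) ~= s1 x" using xK bij1 by (simp add: bij_is_inj inj_eq)
  moreover have "s2 (s1 x) ~= s1 x" using e xK by simp
  ultimately show ?thesis by (simp add: K_def)
 qed
 have finJ: "finite J" by (simp add: J_def)
 have cJ: "Suc (card J) = card K"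
 proof -
  have "card (K - J) = card K - card J" using JK finJ card_Diff_subset by blast
  moreover have "card J <= card K" using JK finK card_mono by blast
  ultimately show ?thesis using z by simp
 qed
 have "card (K - s1 ` J) = card K - card (s1 ` J)"
  by (rule card_Diff_subset) (use finJ s1J in auto)
 also have "card (s1 ` J) = card J" using bij1 by (meson bij_is_inj card_image inj_on_subset subset_UNIV)
 finally have "card (K - s1 ` J) = 1" using cJ by simp
 \<comment> \<open>\<open>p\<close> is where the string begins: \<open>J\<close> has one element
   less than \<open>K\<close>, so exactly one point of \<open>K\<close> is not reached from
   \<open>J\<close> by \<open>s1\<close>.\<close>
 then obtain p where p: "K - s1 ` J = {p}" by (rule card_1_singletonE)
 let ?C = "%i. (s1 ^^ i) p"
 have pK: "p \<in> K" using p by blast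
 have "\<exists>i. ?C i \<notin> J"
 proof (rule ccontr)
  assume "\<not> ?thesis"
  then have all: "?C i \<in> J" for i by blast
  have "\<exists>k. (s1 ^^ k) (s1 p) = p"
   using supports(7) pK s1J all[of 0] unfolding is_cycle_on_def K_def by auto
  then obtain k where "(s1 ^^ k) (s1 p) = p" by blast
  then have "s1 (?C k) = p" by (simp add: funpow_swap1)
  then show False using p all[of k] by blast
 qed
 define r where "r = (LEAST i. ?C i \<notin> J)"
 have r: "?C r \<notin> J" using \<open>\<exists>i. ?C i \<notin> J\<close> unfolding r_def by (rule LeastI_ex)
 have lt: "?C i \<in> J" if "i < r" for i using that not_less_Least unfolding r_def by blast
 have CK: "?C i \<in> K" if "i <= r" for i
 proof (cases i)
  case 0 then show ?thesis using pK by simp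
 next
  case (Suc j) then show ?thesis using s1J lt[of j] that by simp
 qed
 have Cr: "?C r = z" using CK[of r] r z by blast
 \<comment> \<open>The points of \<open>J\<close> off the string that starts at \<open>p\<close>.
   They are stable under \<open>s1\<close>, so a nonempty \<open>J'\<close> would contain the whole
   cycle \<open>A1\<close>, and with it \<open>p\<close>.\<close>
 define J' where "J' = J - ?C ` {..<r}"
 have s1J': "s1 x \<in> J'" if "x \<in> J'" for x
 proof -
  have x: "x \<in> J" "x \<notin> ?C ` {..<r}" using that by (auto simp: J'_def)
  have 1: "s1 x ~= p" using p x by blast
  have 2: "s1 x ~= ?C (Suc i)" if "i < r" for i
   using x that bij1 by (auto simp: bij_is_inj inj_eq)
  have 3: "s1 x ~= ?C i" if "i <= r" for i
   using 1 2 that by (cases i) auto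
  have "s1 x ~= z" using 3[of r] Cr by simp
  then have "s1 x \<in> J" using s1J[OF x(1)] z by blast
  moreover have "s1 x \<notin> ?C ` {..<r}"
  proof
   assume "s1 x \<in> ?C ` {..<r}"
   then obtain i where "i < r" "s1 x = ?C i" by (elim imageE) simp
   then show False using 3[of i] by simp
  qed
  ultimately show ?thesis by (simp add: J'_def)
 qed
 have "J' = {}"
 proof (rule ccontr)
  assume "J' ~= {}"
  then obtain x where x: "x \<in> J'" by blast
  then have xA: "x \<in> A1" using JK by (auto simp: J'_def K_def)
  have "A1 <= J'"
   by (rule is_cycle_on_image_subset[OF supports(7) _ xA x]) (use s1J' in blast)
  then have "p \<in> J'" using pK by (auto simp: K_def)
  then have pJ: "p \<in> J" "p \<notin> ?C ` {..<r}" unfolding J'_def by simp_all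
  have "r = 0"
  proof (rule ccontr)
   assume "r ~= 0"
   then have "?C 0 \<in> ?C ` {..<r}" by (intro imageI) simp
   then show False using pJ by simp
  qed
  then show False using r pJ by simp
 qed
 then have JC: "J <= ?C ` {..<r}" unfolding J'_def by (simp only: Diff_eq_empty_iff)
 have Keq: "?C ` {..<Suc r} = K"
 proof
  show "?C ` {..<Suc r} <= K" by (rule image_subsetI) (use CK in simp)
  have "K <= insert z J" using z by blast
  then have "K <= insert (?C r) (?C ` {..<r})" using JC unfolding Cr by (rule order_trans[OF _ insert_mono])
  then show "K <= ?C ` {..<Suc r}" by (simp add: lessThan_Suc)
 qed
 have inj: "inj_on ?C {..<m1}"
  using is_cycle_on_orbit(1)[OF supports(7) _ fin(1) perm_s(1)] pK supports(4) by (auto simp: K_def)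
 have "card K <= m1" using card_mono[OF fin(1)] supports(4) by (metis K_def inf_le1)
 \<comment> \<open>The string cannot wrap around the cycle of \<open>s1\<close>: otherwise the
   predecessor of \<open>p\<close> would lie in \<open>J\<close>, against the choice of
   \<open>p\<close>.\<close>
 have "Suc r = c"
 proof (cases "Suc r <= m1")
  case True
  then have "inj_on ?C {..<Suc r}" using inj by (meson inj_on_subset lessThan_subset_iff)
  then show ?thesis using card_image Keq cK by fastforce
 next
  case False
  have "(s1 ^^ m1) p = p"
   using is_cycle_on_orbit(3)[OF supports(7) _ fin(1) perm_s(1)] pK supports(4) by (auto simp: K_def)
  moreover have "m1 = Suc (m1 - 1)" using m_ge by simp
  ultimately have "s1 (?C (m1 - 1)) = p" by (metis comp_apply funpow.simps(2))
  moreover have "?C (m1 - 1) \<in> J" using lt False m_ge by simp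
  ultimately show ?thesis using p by blast
 qed
 moreover have "(inv' s2 ^^ i) p = ?C i" if "i <= r" for i
  using that by (induct i) (use J_agree lt in auto)
 ultimately show ?thesis using that[of p] pK Keq by (auto simp: K_def)
qed

end

text \<open>In the model the first cycle is \<open>(1 \<dots> c+k)\<close> and the inverse of the second one is
 \<open>(1 \<dots> c c+k+1 \<dots> c+k+l)\<close>.\<close>

definition model1 :: "nat => nat => nat => nat" where
 "model1 c k i = (if 1 <= i & i < c + k then i + 1 else if i = c + k then 1 else i)"

definition model2 :: "nat => nat => nat => nat => nat" where
 "model2 c k l i = (if 1 <= i & i < c then i + 1 else if i = c then c + k + 1
  else if c + k < i & i < c + k + l then i + 1 else if i = c + k + l then 1 else i)"

definition model1_inv :: "nat => nat => nat => nat" where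
 "model1_inv c k i = (if 2 <= i & i <= c + k then i - 1 else if i = 1 then c + k else i)"

definition model2_inv :: "nat => nat => nat => nat => nat" where
 "model2_inv c k l i = (if 2 <= i & i <= c then i - 1 else if i = 1 then c + k + l
  else if i = c + k + 1 then c else if c + k + 2 <= i & i <= c + k + l then i - 1 else i)"

lemma model1_inverse:
 assumes "c >= 1"
 shows "model1 c k (model1_inv c k i) = i" "model1_inv c k (model1 c k i) = i"
 using assms by (auto simp: model1_def model1_inv_def)

lemma model2_inverse:
 assumes "c >= 1" "l >= 1"
 shows "model2 c k l (model2_inv c k l i) = i" "model2_inv c k l (model2 c k l i) = i"
proof -
 show "model2 c k l (model2_inv c k l i) = i"
 proof (cases i)
  case (Suc j)
  consider "j = 0" | "1 <= j" "j < c" | "c <= j" "j < c + k" "j ~= 0" | "j = c + k" "j ~= 0"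
   | "c + k + 1 <= j" "j < c + k + l" | "c + k + l <= j" "j ~= 0" "j ~= c + k" by linarith
  then show ?thesis
   by cases (use Suc assms in \<open>simp_all add: model2_def model2_inv_def\<close>)
 qed (use assms in \<open>simp add: model2_def model2_inv_def\<close>)
 consider "i = 0" | "1 <= i" "i < c" | "i = c" | "c < i" "i <= c + k" | "c + k < i" "i < c + k + l"
  | "i = c + k + l" "i ~= c" | "c + k + l < i" by linarith
 then show "model2_inv c k l (model2 c k l i) = i"
  by cases (use assms in \<open>simp_all add: model2_def model2_inv_def\<close>)
qed

lemma inv_model:
 assumes "c >= 1" shows "inv' (model1 c k) = model1_inv c k"
  "l >= 1 ==> inv' (model2 c k l) = model2_inv c k l"
 by (rule inv_unique_comp; use assms in \<open>simp add: fun_eq_iff model1_inverse model2_inverse\<close>)+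

lemma model1_permutes:
 assumes "c >= 1" shows "model1 c k permutes {1..c + k + l}"
proof (rule bij_imp_permutes)
 show "bij_betw (model1 c k) {1..c + k + l} {1..c + k + l}"
 proof (rule bij_betw_byWitness[where f' = "model1_inv c k"])
  show "model1 c k ` {1..c + k + l} <= {1..c + k + l}" "model1_inv c k ` {1..c + k + l} <= {1..c + k + l}"
   using assms by (auto simp: model1_def model1_inv_def)
 qed (use assms model1_inverse in blast)+
qed (use assms in \<open>auto simp: model1_def\<close>)

lemma model2_permutes:
 assumes "c >= 1" "l >= 1" shows "model2 c k l permutes {1..c + k + l}"
proof (rule bij_imp_permutes)
 show "bij_betw (model2 c k l) {1..c + k + l} {1..c + k + l}"
 proof (rule bij_betw_byWitness[where f' = "model2_inv c k l"])
  show "model2 c k l ` {1..c + k + l} <= {1..c + k + l}" "model2_inv c k l ` {1..c + k + l} <= {1..c + k + l}"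
   using assms by (auto simp: model2_def model2_inv_def)
 qed (use assms model2_inverse in blast)+
qed (use assms in \<open>auto simp: model2_def\<close>)

text \<open>The points are numbered along the cycle of \<open>s1\<close>, beginning at the entry of
  the common string, and then along the rest of the cycle of \<open>inv' s2\<close>.\<close>

lemma (in cycle_triple) normal_form:
 assumes n: "n = c + k + l" and m: "m1 = c + k" "m2 = c + l" and kl: "c >= 1" "k >= 1" "l >= 1"
 obtains h where "h permutes {1..n}" "\<And>i. i \<in> {1..n} ==> s1 (h i) = h (model1 c k i)"
  "\<And>i. i \<in> {1..n} ==> inv' s2 (h i) = h (model2 c k l i)"
proof -
 have "c + n = m1 + m2" using n m by simp
 then obtain p where p: "p \<in> A1 \<inter> A2" and K: "(%i. (s1 ^^ i) p) ` {..<c} = A1 \<inter> A2"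
  and agree: "\<forall>i<c. (inv' s2 ^^ i) p = (s1 ^^ i) p"
  by (rule common_string) simp
 have fin: "finite A1" "finite A2" using supports finite_subset by blast+
 have pA: "p \<in> A1" "p \<in> A2" using p by blast+
 have bij: "bij s2" using perm_s permutes_bij by blast
 define t where "t = inv' s2"
 have A2': "is_cycle_on t A2" "t permutes {1..n}"
  using is_cycle_on_inv[OF supports(8) bij] perm_s(2) by (simp_all add: t_def permutes_inv)
 note o1 = is_cycle_on_orbit[OF supports(7) pA(1) fin(1) perm_s(1) finite_atLeastAtMost, unfolded supports(4) m]
 note o2 = is_cycle_on_orbit[OF A2'(1) pA(2) fin(2) A2'(2) finite_atLeastAtMost, unfolded supports(5) m]
 have agree: "(t ^^ i) p = (s1 ^^ i) p" if "i < c" for i using agree that by (simp add: t_def)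
 have fix1: "s1 x = x" if "x \<notin> A1" for x using that by simp
 have fix2: "t x = x" if "x \<notin> A2" for x using that A2'(1) unfolding is_cycle_on_def by blast
 \<comment> \<open>The shift by \<open>k\<close> lets the index \<open>c + k + 1\<close> stand for
   the \<open>c\<close>-th iterate of \<open>t\<close>, the first point after the common
   string.\<close>
 define h where "h i = (if i \<in> {1..c + k} then (s1 ^^ (i - 1)) p
  else if i \<in> {c + k + 1..n} then (t ^^ (i - k - 1)) p else i)" for i
 have h1: "h i \<in> A1" if "i \<in> {1..c + k}" for i
 proof -
  have "(s1 ^^ (i - 1)) p \<in> A1" by (subst o1(2)[symmetric]) (use that in auto)
  then show ?thesis using that by (simp add: h_def)
 qed
 have h2: "h i \<in> A2 - A1" if "i \<in> {c + k + 1..n}" for i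
 proof -
  have i: "i - k - 1 < c + l" using that n kl by auto
  have "h i \<in> A2" by (subst o2(2)[symmetric]) (use that i in \<open>auto simp: h_def\<close>)
  moreover have "h i \<notin> A1 \<inter> A2"
  proof
   assume "h i \<in> A1 \<inter> A2"
   then obtain j where j: "j < c" "h i = (s1 ^^ j) p" unfolding K[symmetric] by (elim imageE) simp
   have "h i = (t ^^ (i - k - 1)) p" using that by (auto simp: h_def)
   then have "(t ^^ (i - k - 1)) p = (t ^^ j) p" using agree[OF j(1)] j(2) by simp
   then have "i - k - 1 = j" using o2(1) i j(1) unfolding inj_on_def by auto
   then show False using that j(1) by auto
  qed
  ultimately show ?thesis by blast
 qed
 have inj: "inj_on h {1..n}"
 proof (rule inj_onI)
  fix i j assume ij: "i \<in> {1..n}" "j \<in> {1..n}" "h i = h j"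
  consider "i \<in> {1..c + k}" "j \<in> {1..c + k}" | "i \<in> {c + k + 1..n}" "j \<in> {c + k + 1..n}"
   | "i \<in> {1..c + k}" "j \<in> {c + k + 1..n}" | "j \<in> {1..c + k}" "i \<in> {c + k + 1..n}"
   using ij by fastforce
  then show "i = j"
  proof cases
   case 1
   then have "(s1 ^^ (i - 1)) p = (s1 ^^ (j - 1)) p" using ij by (simp add: h_def)
   then have "i - 1 = j - 1" using inj_onD[OF o1(1), of "i - 1" "j - 1"] 1 by auto
   then show ?thesis using 1 by auto
  next
   case 2
   then have "(t ^^ (i - k - 1)) p = (t ^^ (j - k - 1)) p" using ij by (auto simp: h_def)
   then have "i - k - 1 = j - k - 1"
    using inj_onD[OF o2(1), of "i - k - 1" "j - k - 1"] 2 n kl by auto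
   then show ?thesis using 2 kl by auto
  next
   case 3
   then show ?thesis using h1 h2 ij(3) by (metis DiffD2)
  next
   case 4
   then show ?thesis using h1 h2 ij(3) by (metis DiffD2)
  qed
 qed
 have sub: "h ` {1..n} <= {1..n}"
 proof
  fix y assume "y \<in> h ` {1..n}"
  then obtain i where i: "i \<in> {1..n}" "y = h i" by blast
  then have "i \<in> {1..c + k} \<or> i \<in> {c + k + 1..n}" by auto
  then have "y \<in> A1 \<union> A2" using h1 h2 i by blast
  then show "y \<in> {1..n}" using supports(1,2) by blast
 qed
 have "bij_betw h {1..n} {1..n}"
  using inj sub endo_inj_surj[of "{1..n}" h] by (auto simp: bij_betw_def)
 then have "h permutes {1..n}"
  by (rule bij_imp_permutes) (use n kl in \<open>auto simp: h_def\<close>)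
 moreover have "s1 (h i) = h (model1 c k i)" if i: "i \<in> {1..n}" for i
 proof -
  consider "i \<in> {1..<c + k}" | "i = c + k" | "i \<in> {c + k + 1..n}" using i by fastforce
  then show ?thesis
  proof cases
   case 1
   then obtain j where "i = Suc j" by (cases i) auto
   then show ?thesis using 1 by (simp add: h_def model1_def)
  next
   case 2
   then have "s1 (h i) = (s1 ^^ Suc (c + k - 1)) p"
    by (simp only: funpow.simps(2) comp_apply) (use kl in \<open>simp add: h_def\<close>)
   also have "Suc (c + k - 1) = c + k" using kl by simp
   finally show ?thesis using 2 o1(3) kl by (simp add: h_def model1_def)
  next
   case 3 then show ?thesis using fix1 h2[OF 3] by (auto simp: model1_def)
  qed
 qed
 moreover have "t (h i) = h (model2 c k l i)" if i: "i \<in> {1..n}" for i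
 proof -
  consider "i \<in> {1..<c}" | "i = c" | "i \<in> {c + 1..c + k}" | "i \<in> {c + k + 1..<n}" | "i = n"
   using i by fastforce
  then show ?thesis
  proof cases
   case 1
   then obtain j where j: "i = Suc j" by (cases i) auto
   then have "h i = (t ^^ j) p" "h (Suc i) = (t ^^ Suc j) p"
    using agree[of j] agree[of "Suc j"] 1 by (simp_all add: h_def)
   then show ?thesis using 1 by (simp add: model2_def)
  next
   case 2
   then have "h i = (t ^^ (c - 1)) p" using agree[of "c - 1"] kl by (simp add: h_def)
   moreover have "h (c + k + 1) = (t ^^ Suc (c - 1)) p" using kl n by (simp add: h_def)
   ultimately show ?thesis using 2 by (simp add: model2_def)
  next
   case 3
   have "h i \<notin> A2"
   proof
    assume "h i \<in> A2"
    then have "h i \<in> A1 \<inter> A2" using h1[of i] 3 by simp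
    then obtain j where j: "j < c" "h i = (s1 ^^ j) p" unfolding K[symmetric] by (elim imageE) simp
    then have "h i = h (Suc j)" by (simp add: h_def)
    then have "i = Suc j" using inj_onD[OF inj, of i "Suc j"] 3 j(1) n by auto
    then show False using j 3 by simp
   qed
   then show ?thesis using fix2[of "h i"] 3 kl by (auto simp: model2_def)
  next
   case 4
   then have "h i = (t ^^ (i - k - 1)) p" "h (Suc i) = (t ^^ (Suc i - k - 1)) p"
    using n by (auto simp: h_def)
   moreover have "Suc i - k - 1 = Suc (i - k - 1)" using 4 kl by auto
   ultimately show ?thesis using 4 n by (simp add: model2_def)
  next
   case 5
   have "h n = (t ^^ (n - k - 1)) p" using n kl by (auto simp: h_def)
   then have "t (h i) = (t ^^ Suc (n - k - 1)) p"
    by (simp only: funpow.simps(2) comp_apply 5)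
   also have "Suc (n - k - 1) = c + l" using n kl by simp
   finally have "t (h i) = p" using o2(3) by simp
   moreover have "h 1 = p" using kl by (simp add: h_def)
   ultimately show ?thesis using 5 kl n by (simp add: model2_def)
  qed
 qed
 ultimately show ?thesis using that[of h] by (simp add: t_def)
qed

section \<open>Three-cycles in the model group\<close>

definition has_three_cycle :: "nat => (nat => nat) set => bool" where
 "has_three_cycle n G \<longleftrightarrow> (\<exists>x y z. distinct [x, y, z] & {x, y, z} <= {1..n} & three_cycle x y z \<in> G)"

lemma has_three_cycleI:
 "three_cycle x y z \<in> G ==> distinct [x, y, z] ==> {x, y, z} <= {1..n} ==> has_three_cycle n G"
 unfolding has_three_cycle_def by blast

text \<open>\<open>u\<close> and \<open>v\<close> share only the point \<open>x\<close>, so their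
  product is a 3-cycle times two transpositions disjoint from it; squaring removes the
  transpositions.\<close>

lemma double_transposition_product:
 assumes "distinct [p, q, p', q', x, y, z]"
 defines "u \<equiv> transposition p q \<circ> transposition y x"
  and "v \<equiv> transposition p' q' \<circ> transposition z x"
 shows "(u \<circ> v) \<circ> (u \<circ> v) = three_cycle x y z"
proof
 have ne: "p ~= q" "p ~= p'" "p ~= q'" "p ~= x" "p ~= y" "p ~= z"
  "q ~= p" "q ~= p'" "q ~= q'" "q ~= x" "q ~= y" "q ~= z"
  "p' ~= p" "p' ~= q" "p' ~= q'" "p' ~= x" "p' ~= y" "p' ~= z"
  "q' ~= p" "q' ~= q" "q' ~= p'" "q' ~= x" "q' ~= y" "q' ~= z"
  "x ~= p" "x ~= q" "x ~= p'" "x ~= q'" "x ~= y" "x ~= z"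
  "y ~= p" "y ~= q" "y ~= p'" "y ~= q'" "y ~= x" "y ~= z"
  "z ~= p" "z ~= q" "z ~= p'" "z ~= q'" "z ~= x" "z ~= y"
  using assms(1) by auto
 fix w
 consider "w \<in> {p, q, p', q', x, y, z}" | "w \<notin> {p, q, p', q', x, y, z}" by blast
 then show "((u \<circ> v) \<circ> (u \<circ> v)) w = three_cycle x y z w"
 proof cases
  case 1 then show ?thesis
   unfolding u_def v_def three_cycle_def
   by (elim insertE emptyE; simp add: Transposition.transpose_def ne)
 next
  case 2 then show ?thesis unfolding u_def v_def three_cycle_def by (simp add: Transposition.transpose_def)
 qed
qed

locale model_group = perm_group n G for n G +
 fixes c k l :: nat
 assumes n: "n = c + k + l" and pos: "c >= 1" "k >= 1" "l >= 1"
  and mem: "model1 c k \<in> G" "model2 c k l \<in> G"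
begin

lemma inv_model_mem: "model1_inv c k \<in> G" "model2_inv c k l \<in> G"
 using mem inv_mem inv_model pos by metis+

text \<open>Two cycles that meet in a single point have a 3-cycle as commutator.\<close>

lemma three_cycle_1:
 assumes "c = 1" shows "has_three_cycle n G"
proof (rule has_three_cycleI)
 have *: "model1 c k (model2 c k l i) = three_cycle 1 2 (k + 2) (model2 c k l (model1 c k i))" for i
 proof -
  consider "i = 0" | "i = 1" | "1 < i" "i < k + 1" | "i = k + 1" "i ~= 1" | "k + 2 <= i" "i < c + k + l"
   | "i = c + k + l" "i ~= 1" "k + 1 < i" | "c + k + l < i" using assms pos by linarith
  then show ?thesis
   by cases (use assms pos in \<open>simp_all add: model1_def model2_def three_cycle_def Transposition.transpose_def\<close>)
 qed
 have "model1 c k \<circ> model2 c k l \<circ> model1_inv c k \<circ> model2_inv c k l = three_cycle 1 2 (k + 2)"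
  using pos by (simp add: fun_eq_iff * model1_inverse model2_inverse)
 then show "three_cycle 1 2 (k + 2) \<in> G" using mem inv_model_mem comp_mem by metis
qed (use pos n assms in auto)

text \<open>The two model cycles agree along the common string, so \<open>model1\<close> and the
  inverse of \<open>model2\<close> fail to commute only near its ends; the commutator moves four
  points.\<close>

lemma double_transposition:
 assumes "c >= 2" shows "transposition c (c + 1) \<circ> transposition 1 n \<in> G"
proof -
 have *: "model1 c k (model2_inv c k l i) =
   (transposition c (c + 1) \<circ> transposition 1 n) (model2_inv c k l (model1 c k i))" for i
 proof -
  show ?thesis
  proof (cases i)
   case (Suc j)
   consider "j = 0" | "1 <= j" "Suc j < c" | "c = Suc j" "j ~= 0" | "c <= j" "Suc j < c + k" "j ~= 0"
    | "Suc j = c + k" "c <= j" "j ~= 0" | "j = c + k" "j ~= 0"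
    | "c + k + 1 <= j" "j < c + k + l" | "c + k + l <= j" "j ~= 0" "j ~= c + k" using pos by linarith
   then show ?thesis
    by cases (use Suc assms pos n in \<open>simp_all add: model1_def model2_inv_def Transposition.transpose_def\<close>)
  qed (use assms pos n in \<open>simp add: model1_def model2_inv_def Transposition.transpose_def\<close>)
 qed
 have "model1 c k \<circ> model2_inv c k l \<circ> model1_inv c k \<circ> model2 c k l = transposition c (c + 1) \<circ> transposition 1 n"
  using pos by (simp add: fun_eq_iff * model1_inverse model2_inverse del: comp_apply)
   (simp add: * model1_inverse model2_inverse)
 then show ?thesis using mem inv_model_mem comp_mem by metis
qed

text \<open>The \<open>m\<close>-th power of \<open>model1\<close> shifts the double transposition
  along the first cycle while fixing \<open>n\<close>. The bounds on \<open>m\<close> are exactly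
  what makes the old and the new double transposition share \<open>n\<close> only.\<close>

lemma three_cycle_2:
 assumes c: "c >= 2" and m: "2 <= m" "m < k" "m ~= c" "m + 1 ~= c" shows "has_three_cycle n G"
proof (rule has_three_cycleI)
 have pw: "(model1 c k ^^ j) i = i + j" if "1 <= i" "i + j <= c + k" for i j
  using that by (induct j) (auto simp: model1_def)
 have pn: "(model1 c k ^^ j) n = n" for j
  using n pos by (induct j) (auto simp: model1_def)
 let ?s = "model1 c k ^^ m" and ?u = "transposition c (c + 1) \<circ> transposition 1 n"
 have sG: "?s \<in> G" using mem pow_mem by blast
 have b: "bij ?s" using bij sG by blast
 have t: "?s \<circ> transposition x y \<circ> inv' ?s = transposition (?s x) (?s y)" for x y
 proof
  fix u
  obtain v where "u = ?s v" using b by (metis bij_pointE)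
  then show "(?s \<circ> transposition x y \<circ> inv' ?s) u = transposition (?s x) (?s y) u"
   using b by (auto simp: Transposition.transpose_def bij_is_inj inj_eq)
 qed
 have "?s \<circ> ?u \<circ> inv' ?s = (?s \<circ> transposition c (c + 1) \<circ> inv' ?s) \<circ> (?s \<circ> transposition 1 n \<circ> inv' ?s)"
  using b by (auto simp: fun_eq_iff bij_is_inj)
 also have "\<dots> = transposition (c + m) (c + m + 1) \<circ> transposition (m + 1) n"
  unfolding t using pw[of c m] pw[of "c + 1" m] pw[of 1 m] pn m c by simp
 finally have v: "transposition (c + m) (c + m + 1) \<circ> transposition (m + 1) n \<in> G"
  using conj_mem[OF sG double_transposition[OF c]] by simp
 have d: "distinct [c, c + 1, c + m, c + m + 1, n, 1, m + 1]" using m c n pos by auto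
 show "three_cycle n 1 (m + 1) \<in> G"
  using double_transposition_product[OF d] double_transposition[OF c] v comp_mem by metis
qed (use assms n in auto)

lemma three_cycle_3:
 assumes "c = 2" "k = 1" shows "has_three_cycle n G"
proof (rule has_three_cycleI)
 have "model1 c k = three_cycle 1 2 3"
  using assms by (auto simp: fun_eq_iff model1_def three_cycle_def Transposition.transpose_def)
 then show "three_cycle 1 2 3 \<in> G" using mem by simp
qed (use assms n in auto)

lemma fun_eq_bounded:
 assumes "\<And>i. i \<in> {1..N} ==> f i = g i" "\<And>i. i \<notin> {1..N} ==> f i = i" "\<And>i. i \<notin> {1..N} ==> g i = i"
 shows "f = (g :: nat => nat)"
 using assms by (metis ext)

lemma atLeastAtMost_1_numerals:
 "{1..7} = {1, 2, 3, 4, 5, 6, 7 :: nat}" "{1..8} = {1, 2, 3, 4, 5, 6, 7, 8 :: nat}"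
 "{1..9} = {1, 2, 3, 4, 5, 6, 7, 8, 9 :: nat}"
 by auto

text \<open>Small parameters leave no room for the shift by \<open>m\<close>, and explicit words
  take over. Here the word is \<open>(1 3 4)(2 5 6 7)\<close>, whose fourth power is its
  3-cycle.\<close>

lemma three_cycle_223:
 assumes "c = 2" "k = 2" "l = 3" shows "has_three_cycle n G"
proof (rule has_three_cycleI)
 let ?w = "model1 2 2 \<circ> model2 2 2 3"
 have "(?w \<circ> ?w) \<circ> (?w \<circ> ?w) = three_cycle 1 3 4"
 proof (rule fun_eq_bounded[where N = 7])
  fix i :: nat assume "i \<in> {1..7}"
  then show "((?w \<circ> ?w) \<circ> (?w \<circ> ?w)) i = three_cycle 1 3 4 i"
   unfolding atLeastAtMost_1_numerals
   by (elim insertE emptyE) (simp_all add: model1_def model2_def three_cycle_def Transposition.transpose_def)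
 next
  fix i :: nat assume "i \<notin> {1..7}"
  then have "model1 2 2 i = i" "model2 2 2 3 i = i" by (auto simp: model1_def model2_def)
  then show "((?w \<circ> ?w) \<circ> (?w \<circ> ?w)) i = i" by simp
 qed (auto simp: three_cycle_def Transposition.transpose_def)
 then show "three_cycle 1 3 4 \<in> G" using mem comp_mem assms by metis
qed (use assms n in auto)

lemma three_cycle_322:
 assumes "c = 3" "k = 2" "l = 2" shows "has_three_cycle n G"
proof (rule has_three_cycleI)
 \<comment> \<open>This word is \<open>(1 4)(2 5)(3 6 7)\<close>, so its square is the inverse of
   the last cycle.\<close>
 let ?w = "model1 3 2 \<circ> model1 3 2 \<circ> model2 3 2 2"
 have "?w \<circ> ?w = three_cycle 3 7 6"
 proof (rule fun_eq_bounded[where N = 7])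
  fix i :: nat assume "i \<in> {1..7}"
  then show "(?w \<circ> ?w) i = three_cycle 3 7 6 i"
   unfolding atLeastAtMost_1_numerals
   by (elim insertE emptyE) (simp_all add: model1_def model2_def three_cycle_def Transposition.transpose_def)
 next
  fix i :: nat assume "i \<notin> {1..7}"
  then have "model1 3 2 i = i" "model2 3 2 2 i = i" by (auto simp: model1_def model2_def)
  then show "(?w \<circ> ?w) i = i" by simp
 qed (auto simp: three_cycle_def Transposition.transpose_def)
 then show "three_cycle 3 7 6 \<in> G" using mem comp_mem assms by metis
qed (use assms n in auto)

lemma three_cycle_323:
 assumes "c = 3" "k = 2" "l = 3" shows "has_three_cycle n G"
proof (rule has_three_cycleI)
 \<comment> \<open>This word is \<open>(1 4 5)(2 6 8 3 7)\<close>; the fifth power removes the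
   5-cycle and inverts the 3-cycle.\<close>
 let ?w = "model1 3 2 \<circ> model2 3 2 3 \<circ> model2 3 2 3"
 have "?w \<circ> (?w \<circ> ?w) \<circ> (?w \<circ> ?w) = three_cycle 1 5 4"
 proof (rule fun_eq_bounded[where N = 8])
  fix i :: nat assume "i \<in> {1..8}"
  then show "(?w \<circ> (?w \<circ> ?w) \<circ> (?w \<circ> ?w)) i = three_cycle 1 5 4 i"
   unfolding atLeastAtMost_1_numerals
   by (elim insertE emptyE) (simp_all add: model1_def model2_def three_cycle_def Transposition.transpose_def)
 next
  fix i :: nat assume "i \<notin> {1..8}"
  then have "model1 3 2 i = i" "model2 3 2 3 i = i" by (auto simp: model1_def model2_def)
  then show "(?w \<circ> (?w \<circ> ?w) \<circ> (?w \<circ> ?w)) i = i" by simp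
 qed (auto simp: three_cycle_def Transposition.transpose_def)
 then show "three_cycle 1 5 4 \<in> G" using mem comp_mem assms by metis
qed (use assms n in auto)

lemma three_cycle_522:
 assumes "c = 5" "k = 2" "l = 2" shows "has_three_cycle n G"
proof (rule has_three_cycleI)
 let ?s = "model1 5 2" and ?t = "model2 5 2 2"
 have "?s \<circ> ?s \<circ> ?s \<circ> ?t \<circ> ?t \<circ> ?s \<circ> ?s \<circ> ?t \<circ> ?t = three_cycle 1 9 8"
 proof (rule fun_eq_bounded[where N = 9])
  fix i :: nat assume "i \<in> {1..9}"
  then show "(?s \<circ> ?s \<circ> ?s \<circ> ?t \<circ> ?t \<circ> ?s \<circ> ?s \<circ> ?t \<circ> ?t) i = three_cycle 1 9 8 i"
   unfolding atLeastAtMost_1_numerals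
   by (elim insertE emptyE) (simp_all add: model1_def model2_def three_cycle_def Transposition.transpose_def)
 next
  fix i :: nat assume "i \<notin> {1..9}"
  then have "model1 5 2 i = i" "model2 5 2 2 i = i" by (auto simp: model1_def model2_def)
  then show "(?s \<circ> ?s \<circ> ?s \<circ> ?t \<circ> ?t \<circ> ?s \<circ> ?s \<circ> ?t \<circ> ?t) i = i" by simp
 qed (auto simp: three_cycle_def Transposition.transpose_def)
 then show "three_cycle 1 9 8 \<in> G" using mem comp_mem assms by metis
qed (use assms n in auto)

end

text \<open>The arguments stand for \<open>c\<close>, \<open>k + 1\<close> and \<open>l + 1\<close>
  of the model, that is, for the pole orders \<open>b3\<close>, \<open>b2\<close>,
  \<open>b1\<close>; the disjuncts are the cases settled above.\<close>

definition three_cycle_params :: "nat => nat => nat => bool" where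
 "three_cycle_params x y z \<longleftrightarrow> x >= 1 & y >= 2 & z >= 2 \<and>
  (x = 1 \<or> (x >= 2 & (\<exists>m. 2 <= m & m + 1 < y & m ~= x & m + 1 ~= x)) \<or> (x = 2 & y = 2) \<or>
   (x, y, z) \<in> {(2, 3, 4), (3, 3, 3), (3, 3, 4), (5, 3, 3)})"

lemma (in perm_group) perm_group_conj:
 assumes h: "h permutes {1..n}" shows "perm_group n ((%g. inv' h \<circ> g \<circ> h) ` G)"
proof (rule perm_group.intro, rule group.subgroupI[OF sym_group_is_group])
 have b: "bij h" using h permutes_bij by blast
 have c: "inv' h \<circ> g \<circ> h permutes {1..n}" if "g \<in> G" for g
  using perm[OF that] h by (intro permutes_compose permutes_inv)
 show "(%g. inv' h \<circ> g \<circ> h) ` G <= carrier (sym_group n)"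
  using c by (auto simp: sym_group_carrier)
 show "(%g. inv' h \<circ> g \<circ> h) ` G ~= {}" using id_mem by blast
 fix x assume "x \<in> (%g. inv' h \<circ> g \<circ> h) ` G"
 then obtain g where g: "g \<in> G" "x = inv' h \<circ> g \<circ> h" by blast
 have "inv\<^bsub>sym_group n\<^esub> x = inv' x"
  by (rule sym_group_inv_equality) (use c g in \<open>simp add: sym_group_carrier\<close>)
 also have "\<dots> = inv' h \<circ> inv' g \<circ> h"
  using b bij[OF g(1)]
  by (simp add: g(2) o_inv_distrib bij_imp_bij_inv bij_comp inv_inv_eq o_assoc)
 finally show "inv\<^bsub>sym_group n\<^esub> x \<in> (%g. inv' h \<circ> g \<circ> h) ` G" using inv_mem[OF g(1)] by blast
 fix y assume "y \<in> (%g. inv' h \<circ> g \<circ> h) ` G"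
 then obtain g' where g': "g' \<in> G" "y = inv' h \<circ> g' \<circ> h" by blast
 have "x \<otimes>\<^bsub>sym_group n\<^esub> y = inv' h \<circ> (g \<circ> g') \<circ> h"
  using b by (simp add: g g' sym_group_mult fun_eq_iff bij_is_surj surj_f_inv_f)
 then show "x \<otimes>\<^bsub>sym_group n\<^esub> y \<in> (%g. inv' h \<circ> g \<circ> h) ` G" using comp_mem[OF g(1) g'(1)] by blast
qed

lemma conj_eqI:
 assumes "h permutes {1..n}" "s permutes {1..n}" "m permutes {1..n}"
  "\<And>i. i \<in> {1..n} ==> s (h i) = h (m i)"
 shows "m = inv' h \<circ> s \<circ> h"
proof
 fix i
 show "m i = (inv' h \<circ> s \<circ> h) i"
 proof (cases "i \<in> {1..n}")
  case True then show ?thesis using assms by (simp add: permutes_inverses(2))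
 next
  case False
  have "m i = i" "h i = i" "s i = i"
   using permutes_not_in[OF assms(1) False] permutes_not_in[OF assms(2) False]
    permutes_not_in[OF assms(3) False] by simp_all
  moreover have "inv' h i = i" by (rule permutes_not_in[OF permutes_inv[OF assms(1)] False])
  ultimately show ?thesis by simp
 qed
qed

context cycle_triple
begin

lemma model_conj:
 assumes n: "n = c + k + l" and m: "m1 = c + k" "m2 = c + l" and kl: "c >= 1" "k >= 1" "l >= 1"
 obtains h where "h permutes {1..n}" "model1 c k = inv' h \<circ> s1 \<circ> h"
  "model2 c k l = inv' h \<circ> inv' s2 \<circ> h"
proof -
 obtain h where h: "h permutes {1..n}" "\<forall>i\<in>{1..n}. s1 (h i) = h (model1 c k i)"
  "\<forall>i\<in>{1..n}. inv' s2 (h i) = h (model2 c k l i)"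
  by (rule normal_form[OF assms]) simp
 have "model1 c k permutes {1..n}" "model2 c k l permutes {1..n}"
  using model1_permutes[of c k l] model2_permutes[of c l k] kl n by simp_all
 then show ?thesis
  using that[OF h(1)] conj_eqI[OF h(1)] perm_s(1) permutes_inv[OF perm_s(2)] h(2,3) by blast
qed

lemma has_three_cycle_oriented:
 assumes b: "b1 + m1 = n + 1" "b2 + m2 = n + 1" "b3 + m3 = n + 1"
  and params: "three_cycle_params b3 b2 b1"
 shows "has_three_cycle n G"
proof -
 \<comment> \<open>The supports of \<open>s1\<close> and \<open>s2\<close> share
   \<open>m1 + m2 - n\<close> points, and by the genus equation this is
   \<open>n + 1 - m3 = b3\<close>.\<close>
 define c k l where "c = b3" and "k = b2 - 1" and "l = b1 - 1"
 have kl: "c >= 1" "k >= 1" "l >= 1"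
  using params by (auto simp: three_cycle_params_def c_def k_def l_def)
 have n: "n = c + k + l" and m: "m1 = c + k" "m2 = c + l"
  using b genus kl by (auto simp: c_def k_def l_def)
 obtain h where h: "h permutes {1..n}" "model1 c k = inv' h \<circ> s1 \<circ> h"
  "model2 c k l = inv' h \<circ> inv' s2 \<circ> h"
  using model_conj[OF n m kl] by blast
 let ?H = "(%g. inv' h \<circ> g \<circ> h) ` G"
 interpret H: perm_group n ?H by (rule perm_group_conj[OF h(1)])
 interpret H: model_group n ?H c k l
 proof
  show "model1 c k \<in> ?H" using h(2) s_mem(1) by blast
  show "model2 c k l \<in> ?H" using h(3) inv_mem[OF s_mem(2)] by blast
 qed (use n kl in auto)
 have "has_three_cycle n ?H"
 proof -
  have "b1 = l + 1" "b2 = k + 1" "b3 = c" using kl by (simp_all add: c_def k_def l_def)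
  from params[unfolded three_cycle_params_def this]
  have "c = 1 \<or> (\<exists>m. c >= 2 & 2 <= m & m < k & m ~= c & m + 1 ~= c) \<or> (c = 2 & k = 1) \<or>
   (c = 2 & k = 2 & l = 3) \<or> (c = 3 & k = 2 & l = 2) \<or> (c = 3 & k = 2 & l = 3) \<or>
   (c = 5 & k = 2 & l = 2)" by simp
  then show ?thesis
   by (elim disjE exE conjE) (rule H.three_cycle_1 H.three_cycle_2 H.three_cycle_3 H.three_cycle_223
    H.three_cycle_322 H.three_cycle_323 H.three_cycle_522, assumption+)+
 qed
 then obtain x y z where t: "distinct [x, y, z]" "{x, y, z} <= {1..n}" "three_cycle x y z \<in> ?H"
  unfolding has_three_cycle_def by blast
 then obtain g where g: "g \<in> G" "three_cycle x y z = inv' h \<circ> g \<circ> h" by blast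
 have bh: "bij h" using h(1) permutes_bij by blast
 have "three_cycle (h x) (h y) (h z) = h \<circ> three_cycle x y z \<circ> inv' h"
  using three_cycle_conj[OF bh] by simp
 also have "\<dots> = g" using bh by (simp add: g(2) fun_eq_iff bij_is_surj surj_f_inv_f)
 finally have "three_cycle (h x) (h y) (h z) \<in> G" using g(1) by simp
 moreover have "distinct [h x, h y, h z]" using t(1) bh by (auto simp: bij_is_inj inj_eq)
 moreover have "{h x, h y, h z} <= {1..n}" using t(2) permutes_in_image[OF h(1)] by blast
 ultimately show ?thesis by (rule has_three_cycleI)
qed

end

text \<open>A large entry \<open>z\<close> is used as \<open>k + 1\<close> and leaves room for a
  shift \<open>m\<close>. Apart from an entry 1 or two entries 2, which have their own cases, only a
  few small triples remain, and all of them but 2, 3, 3 are among the explicit ones.\<close>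

lemma three_cycle_params_sorted:
 assumes "1 <= x" "x <= y" "y <= z" "2 <= y" "\<not> (x = 2 & y = 3 & z = 3)"
 shows "three_cycle_params x y z \<or> three_cycle_params x z y \<or> three_cycle_params y z x \<or>
  three_cycle_params z x y"
proof -
 have big: "three_cycle_params p q r" if "2 <= m" "m + 1 < q" "m ~= p" "m + 1 ~= p" "p >= 2" "q >= 2" "r >= 2"
  for m p q r unfolding three_cycle_params_def using that
  by (intro conjI disjI2[OF disjI1] exI[of _ m]) auto
 consider "x = 1" | "x = 2" "y = 2" | "x = 2" "y = 3" | "x = 3" "y = 3" | "x >= 2" "y >= 4"
  using assms(1-4) by linarith
 then show ?thesis
 proof cases
  case 3
  then consider "z = 4" | "z >= 5" using assms(3,5) by linarith
  then show ?thesis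
  proof cases
   case 2 then show ?thesis using 3 big[of 3 z x y] by simp
  qed (use 3 in \<open>simp add: three_cycle_params_def\<close>)
 next
  case 4
  then consider "z = 3" | "z = 4" | "z = 5" | "z >= 6" using assms(3) by linarith
  then show ?thesis
  proof cases
   case 4 then show ?thesis using \<open>x = 3\<close> \<open>y = 3\<close> big[of 4 z x y] by simp
  qed (use 4 in \<open>simp_all add: three_cycle_params_def\<close>)
 next
  case 5 then show ?thesis using big[of 2 z y x] assms by simp
 qed (use assms in \<open>simp_all add: three_cycle_params_def\<close>)
qed

lemma three_cycle_params_perm:
 assumes "1 <= x" "1 <= y" "1 <= z" "x + y >= 3" "x + z >= 3" "y + z >= 3"
  "\<not> (x = 2 & y = 3 & z = 3)" "\<not> (x = 3 & y = 2 & z = 3)" "\<not> (x = 3 & y = 3 & z = 2)"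
 shows "three_cycle_params x y z \<or> three_cycle_params x z y \<or> three_cycle_params y x z \<or>
  three_cycle_params y z x \<or> three_cycle_params z x y \<or> three_cycle_params z y x"
proof -
 consider "x <= y" "y <= z" | "x <= z" "z <= y" | "y <= x" "x <= z" | "y <= z" "z <= x"
  | "z <= x" "x <= y" | "z <= y" "y <= x" by linarith
 then show ?thesis
 proof cases
  case 1 then show ?thesis using three_cycle_params_sorted[of x y z] assms by auto
 next
  case 2 then show ?thesis using three_cycle_params_sorted[of x z y] assms by auto
 next
  case 3 then show ?thesis using three_cycle_params_sorted[of y x z] assms by auto
 next
  case 4 then show ?thesis using three_cycle_params_sorted[of y z x] assms by auto
 next
  case 5 then show ?thesis using three_cycle_params_sorted[of z x y] assms by auto
 next
  case 6 then show ?thesis using three_cycle_params_sorted[of z y x] assms by auto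
 qed
qed

context cycle_triple
begin

text \<open>The criterion depends on the order of its arguments. Each of the six orders belongs to a
  triple obtained by rotation and reflection, and all six triples generate the same group.\<close>

lemma has_three_cycle:
 assumes b: "b1 + m1 = n + 1" "b2 + m2 = n + 1" "b3 + m3 = n + 1"
  and ge: "b1 >= 1" "b2 >= 1" "b3 >= 1"
  and not_exotic: "{#b1, b2, b3#} ~= {#2, 3, 3#}"
 shows "has_three_cycle n G"
proof -
 have G2: "generate (sym_group n) {s2, s3, s1} = G" "generate (sym_group n) {s3, s1, s2} = G"
  by (simp_all add: insert_commute)
 have R2: "generate (sym_group n) {inv' s2, inv' s1, inv' s3} = G"
  "generate (sym_group n) {inv' s1, inv' s3, inv' s2} = G"
  using reflect_generate by (simp_all add: insert_commute)
 note r1 = rotate and r2 = cycle_triple.rotate[OF rotate]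
 note q1 = cycle_triple.rotate[OF reflect] and q2 = cycle_triple.rotate[OF cycle_triple.rotate[OF reflect]]
 have "three_cycle_params b1 b2 b3 \<or> three_cycle_params b1 b3 b2 \<or> three_cycle_params b2 b1 b3 \<or>
  three_cycle_params b2 b3 b1 \<or> three_cycle_params b3 b1 b2 \<or> three_cycle_params b3 b2 b1"
  by (rule three_cycle_params_perm) (use b ge genus m_ge not_exotic in auto)
 then show ?thesis
  using has_three_cycle_oriented[OF b]
   cycle_triple.has_three_cycle_oriented[OF r1 b(2,3,1)]
   cycle_triple.has_three_cycle_oriented[OF r2 b(3,1,2)]
   cycle_triple.has_three_cycle_oriented[OF reflect b(3,2,1)]
   cycle_triple.has_three_cycle_oriented[OF q1 b(2,1,3)]
   cycle_triple.has_three_cycle_oriented[OF q2 b(1,3,2)]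
  unfolding G2 R2 reflect_generate by blast
qed

theorem generate_alt_or_sym:
 assumes b: "b1 + m1 = n + 1" "b2 + m2 = n + 1" "b3 + m3 = n + 1"
  and ge: "b1 >= 1" "b2 >= 1" "b3 >= 1"
  and not_exotic: "{#b1, b2, b3#} ~= {#2, 3, 3#}"
 shows "G = (if even b1 = even b2 & even b2 = even b3 then carrier (alt_group n) else carrier (sym_group n))"
proof -
 obtain x y z where t: "three_cycle x y z \<in> G" "distinct [x, y, z]" "{x, y, z} <= {1..n}"
  using has_three_cycle[OF assms] unfolding has_three_cycle_def by blast
 have alt: "carrier (alt_group n) <= G" by (rule alt_subset_if_three_cycle[OF t])
 have par: "odd m1 & odd m2 & odd m3 \<longleftrightarrow> even b1 = even b2 & even b2 = even b3"
 proof -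
  have "m1 + 1 = b2 + b3" "m2 + 1 = b1 + b3" "m3 + 1 = b1 + b2" using b genus by auto
  then show ?thesis by (metis even_add even_plus_one_iff)
 qed
 show ?thesis
 proof (cases "odd m1 & odd m2 & odd m3")
  case True then show ?thesis using alt subset_alt par by auto
 next
  case False
  then have "\<not> evenperm s1 \<or> \<not> evenperm s2 \<or> \<not> evenperm s3" using parity by blast
  then have "G = carrier (sym_group n)" using eq_sym_if_odd[OF alt] s_mem by blast
  then show ?thesis by (simp only: if_not_P[OF False[unfolded par]])
 qed
qed

end

section \<open>The exotic action of the symmetric group of degree five\<close>

text \<open>One generator for each of the 24 / 4 = 6 Sylow 5-subgroups, normalized to send 1 to 2.
  The numbering is chosen so that conjugation by \<open>exotic_s\<close> and \<open>exotic_t\<close>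
  permutes the indices as \<open>model1 2 2\<close> and \<open>model2 2 2 2\<close>.\<close>

definition five_cycle_list :: "nat => nat list" where
 "five_cycle_list i = (if i = 1 then [1, 2, 4, 5, 3] else if i = 2 then [1, 2, 3, 4, 5]
  else if i = 3 then [1, 2, 5, 4, 3] else if i = 4 then [1, 2, 4, 3, 5]
  else if i = 5 then [1, 2, 3, 5, 4] else [1, 2, 5, 3, 4])"

definition five_cycle :: "nat => nat => nat" where
 "five_cycle i = cycle_of_list (five_cycle_list i)"

definition sylow5 :: "nat => (nat => nat) set" where
 "sylow5 i = range (%k. five_cycle i ^^ k)"

lemma set_1_5: "{1..5} = {1, 2, 3, 4, 5 :: nat}" "{1..6} = {1, 2, 3, 4, 5, 6 :: nat}" by auto

lemma five_cycle_list:
 "distinct (five_cycle_list i)" "length (five_cycle_list i) = 5" "set (five_cycle_list i) = {1..5}"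
 unfolding set_1_5 by (auto simp: five_cycle_list_def)

lemma five_cycle_permutes: "five_cycle i permutes {1..5}"
 using cycle_permutes[of "five_cycle_list i"] five_cycle_list by (simp add: five_cycle_def)

lemma permutes_fun_eqI:
 assumes "p permutes S" "q permutes S" "\<And>x. x \<in> S ==> p x = q x" shows "p = q"
proof
 fix x show "p x = q x"
  using assms(3)[of x] permutes_not_in[OF assms(1), of x] permutes_not_in[OF assms(2), of x]
  by (cases "x \<in> S") simp_all
qed

lemma five_cycle_rotate: "map (five_cycle i ^^ k) (five_cycle_list i) = rotate k (five_cycle_list i)"
 unfolding five_cycle_def by (rule cyclic_rotation) (rule five_cycle_list)

lemma five_cycle_pow5: "five_cycle i ^^ 5 = id"
proof (rule permutes_fun_eqI[OF permutes_funpow[OF five_cycle_permutes] permutes_id])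
 fix x :: nat assume "x \<in> {1..5}"
 then have "x \<in> set (five_cycle_list i)" using five_cycle_list by simp
 moreover have "map (five_cycle i ^^ 5) (five_cycle_list i) = five_cycle_list i"
  using five_cycle_rotate[where i = i and k = 5] five_cycle_list(2)[of i]
   rotate_id[of 5 "five_cycle_list i"] by simp
 ultimately show "(five_cycle i ^^ 5) x = id x" by (metis id_apply map_idI map_eq_conv list.map_id)
qed

lemma pow5_mod: "c ^^ 5 = id ==> c ^^ m = c ^^ (m mod 5)"
 by (rule ext) (simp add: funpow_mod_eq)

lemma sylow5_eq: "sylow5 i = (%k. five_cycle i ^^ k) ` {..<5}"
proof
 show "sylow5 i <= (%k. five_cycle i ^^ k) ` {..<5}"
 proof
  fix p assume "p \<in> sylow5 i"
  then obtain k where "p = five_cycle i ^^ k" by (auto simp: sylow5_def)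
  then have "p = five_cycle i ^^ (k mod 5)" using pow5_mod[OF five_cycle_pow5] by simp
  then show "p \<in> (%k. five_cycle i ^^ k) ` {..<5}" by simp
 qed
qed (auto simp: sylow5_def)

lemma five_cycle_pow_1: "k < 5 ==> (five_cycle i ^^ k) 1 = five_cycle_list i ! k"
proof -
 assume k: "k < 5"
 have "hd (map (five_cycle i ^^ k) (five_cycle_list i)) = five_cycle_list i ! k"
  unfolding five_cycle_rotate using k five_cycle_list(2)[of i]
  by (subst hd_rotate_conv_nth) auto
 moreover have "five_cycle_list i ~= []" "hd (five_cycle_list i) = 1" by (auto simp: five_cycle_list_def)
 ultimately show ?thesis by (simp add: hd_map)
qed

lemma five_cycle_pow_inj: "inj_on (%k. five_cycle i ^^ k) {..<5}"
proof (rule inj_onI)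
 fix j k assume jk: "j \<in> {..<5}" "k \<in> {..<5}" "five_cycle i ^^ j = five_cycle i ^^ k"
 then have "five_cycle_list i ! j = five_cycle_list i ! k"
  using five_cycle_pow_1[of j i] five_cycle_pow_1[of k i] by simp
 then show "j = k" using jk five_cycle_list[of i] by (simp add: nth_eq_iff_index_eq)
qed

lemma card_sylow5: "card (sylow5 i) = 5"
 unfolding sylow5_eq using card_image[OF five_cycle_pow_inj, of i] by simp

lemma sylow5_subgroup: "subgroup (sylow5 i) (sym_group 5)"
proof (rule group.subgroupI[OF sym_group_is_group])
 have perm: "five_cycle i ^^ k permutes {1..5}" for k by (rule permutes_funpow[OF five_cycle_permutes])
 show "sylow5 i <= carrier (sym_group 5)" using perm by (auto simp: sylow5_def sym_group_carrier)
 show "sylow5 i ~= {}" by (auto simp: sylow5_def)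
 fix p assume "p \<in> sylow5 i"
 then obtain k where k: "k < 5" "p = five_cycle i ^^ k" by (auto simp: sylow5_eq)
 have "inv\<^bsub>sym_group 5\<^esub> p = inv' p"
  by (rule sym_group_inv_equality) (use perm k in \<open>simp add: sym_group_carrier\<close>)
 also have "\<dots> = five_cycle i ^^ (5 - k)"
  by (rule inv_unique_comp) (use k five_cycle_pow5[of i] in \<open>simp_all add: funpow_add[symmetric]\<close>)
 finally show "inv\<^bsub>sym_group 5\<^esub> p \<in> sylow5 i" by (simp add: sylow5_def)
 fix q assume "q \<in> sylow5 i"
 then obtain j where "q = five_cycle i ^^ j" by (auto simp: sylow5_def)
 then show "p \<otimes>\<^bsub>sym_group 5\<^esub> q \<in> sylow5 i"
  by (auto simp: sylow5_def k sym_group_mult funpow_add[symmetric])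
qed

lemma sym_group_pow: "p [^]\<^bsub>sym_group n\<^esub> (k::nat) = p ^^ k"
proof (induct k)
 case 0 then show ?case by (simp add: sym_group_one)
next
 case (Suc k)
 interpret group "sym_group n" by (rule sym_group_is_group)
 show ?case using Suc by (simp add: sym_group_mult funpow_Suc_right del: funpow.simps)
qed

text \<open>The orbit length of \<open>x\<close> divides 5 and is not 1.\<close>

lemma order5_full_cycle:
 fixes g :: "nat => nat"
 assumes g: "g permutes {1..5}" "g ^^ 5 = id" and x: "x \<in> {1..5}" "g x ~= x"
 shows "least_power g x = 5" "set (support g x) = {1..5}"
proof -
 have perm: "permutation g" using g(1) by (meson finite_atLeastAtMost permutation_permutes)
 have "least_power g x dvd 5" by (rule least_power_minimal) (simp add: g)
 moreover have "prime (5::nat)" by simp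
 ultimately have "least_power g x = 1 \<or> least_power g x = 5" by (meson prime_nat_iff)
 moreover have "least_power g x ~= 1" using least_power_gt_one[OF perm x(2)] by simp
 ultimately show lp: "least_power g x = 5" by blast
 have "card (set (support g x)) = 5" using distinct_card[OF cycle_of_permutation[OF perm, of x]] lp by simp
 moreover have "set (support g x) <= {1..5}"
 proof
  fix y assume "y \<in> set (support g x)"
  then obtain i where "y = (g ^^ i) x" by auto
  then show "y \<in> {1..5}" using x(1) permutes_in_image[OF permutes_funpow[OF g(1)]] by simp
 qed
 ultimately show "set (support g x) = {1..5}" by (intro card_subset_eq) auto
qed

text \<open>A nontrivial element is a full 5-cycle, and some power of it sends 1 to 2. Such a
  5-cycle is fixed by the order of 3, 4, 5 in it, so it is one of the six listed ones and generates
  the subgroup.\<close>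

lemma sylow5_complete:
 assumes P: "subgroup P (sym_group 5)" "card P = 5"
 shows "\<exists>i\<in>{1..6}. P = sylow5 i"
proof -
 interpret P: perm_group 5 P by (rule perm_group.intro[OF P(1)])
 have finP: "finite P" using P(2) card.infinite by fastforce
 have "P ~= {id}" using P(2) by auto
 then obtain g where g: "g \<in> P" "g ~= id" using P.id_mem by blast
 have pow5: "p ^^ 5 = id" if "p \<in> P" for p
 proof -
  interpret H: group "sym_group 5\<lparr>carrier := P\<rparr>"
   by (rule subgroup.subgroup_is_group[OF P(1) sym_group_is_group])
  have "p [^]\<^bsub>sym_group 5\<lparr>carrier := P\<rparr>\<^esub> Coset.order (sym_group 5\<lparr>carrier := P\<rparr>) = \<one>\<^bsub>sym_group 5\<lparr>carrier := P\<rparr>\<^esub>"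
   by (rule H.pow_order_eq_1) (use that in simp)
  moreover have "Coset.order (sym_group 5\<lparr>carrier := P\<rparr>) = 5" by (simp add: Coset.order_def P(2))
  moreover have "p [^]\<^bsub>sym_group 5\<lparr>carrier := P\<rparr>\<^esub> (5::nat) = p [^]\<^bsub>sym_group 5\<^esub> (5::nat)"
   by (simp add: nat_pow_def)
  ultimately show ?thesis by (simp add: sym_group_pow sym_group_one)
 qed
 obtain x where x: "g x ~= x" using g(2) by (metis ext id_apply)
 have x5: "x \<in> {1..5}"
 proof (rule ccontr)
  assume "x \<notin> {1..5}"
  then show False using permutes_not_in[OF P.perm[OF g(1)]] x by simp
 qed
 note full = order5_full_cycle[OF P.perm[OF g(1)] pow5[OF g(1)] x5 x]
 have "1 \<in> set (support g x)" "2 \<in> set (support g x)" unfolding full(2) by auto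
 then obtain i j where ij: "i < 5" "j < 5" "1 = (g ^^ i) x" "2 = (g ^^ j) x" using full(1) by auto
 \<comment> \<open>The exponent meant is \<open>j - i\<close>; adding 5 keeps it a natural number
   and does not change the power.\<close>
 define c where "c = g ^^ (j + (5 - i))"
 have cP: "c \<in> P" unfolding c_def by (rule P.pow_mem[OF g(1)])
 have "c 1 = (g ^^ (j + (5 - i) + i)) x" unfolding c_def ij(3) by (simp add: funpow_add)
 also have "j + (5 - i) + i = j + 5" using ij by simp
 finally have c1: "c 1 = 2" using pow5[OF g(1)] ij(4) by (simp add: funpow_add)
 have cperm: "c permutes {1..5}" by (rule P.perm[OF cP])
 have "c 1 ~= 1" using c1 by simp
 note cfull = order5_full_cycle[OF cperm pow5[OF cP] _ this]
 define y z w where "y = c 2" and "z = c (c 2)" and "w = c (c (c 2))"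
 have "[0..<5] = [0, 1, 2, 3, 4]" by (simp add: upt_rec)
 then have sup: "support c 1 = [1, 2, y, z, w]"
  using cfull(1) c1 by (simp add: y_def z_def w_def eval_nat_numeral)
 have perm: "permutation c" using cperm by (meson finite_atLeastAtMost permutation_permutes)
 have d: "distinct [1, 2, y, z, w]" using cycle_of_permutation[OF perm, of 1] unfolding sup .
 have s: "{1, 2, y, z, w} = {1..5}" using cfull(2) unfolding sup by simp
 have "c = cycle_of_list [1, 2, y, z, w]"
 proof (rule permutes_fun_eqI[OF cperm])
  show "cycle_of_list [1, 2, y, z, w] permutes {1..5}"
   using cycle_permutes[of "[1, 2, y, z, w]"] s by simp
  fix v :: nat assume "v \<in> {1..5}"
  then have "v \<in> set (support c 1)" using cfull(2) by simp
  then show "c v = cycle_of_list [1, 2, y, z, w] v" using cycle_restrict[OF perm] sup by metis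
 qed
 moreover have "\<exists>i\<in>{1..6}. five_cycle_list i = [1, 2, y, z, w]"
 proof -
  have "y \<in> {1, 2, 3, 4, 5}" "z \<in> {1, 2, 3, 4, 5}" "w \<in> {1, 2, 3, 4, 5}"
   using s unfolding set_1_5 by blast+
  then have "y \<in> {3, 4, 5}" "z \<in> {3, 4, 5}" "w \<in> {3, 4, 5}" using d by auto
  then have "[1, 2, y, z, w] \<in> {five_cycle_list 1, five_cycle_list 2, five_cycle_list 3,
    five_cycle_list 4, five_cycle_list 5, five_cycle_list 6}"
   using d by (elim insertE emptyE) (simp_all add: five_cycle_list_def)
  then show ?thesis unfolding set_1_5 by auto
 qed
 ultimately obtain i where i: "i \<in> {1..6}" "c = five_cycle i" by (auto simp: five_cycle_def)
 have "sylow5 i <= P" using P.pow_mem[OF cP] by (auto simp: sylow5_def i)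
 then have "sylow5 i = P" by (rule card_subset_eq[OF finP]) (simp add: card_sylow5 P(2))
 then show ?thesis using i by blast
qed

lemma sylow_subgroups_5: "sylow_subgroups 5 (sym_group 5) = sylow5 ` {1..6}"
proof -
 have "Coset.order (sym_group 5) = 120"
  by (simp add: Coset.order_def sym_group_card_carrier fact_numeral)
 moreover have "multiplicity 5 (120::nat) = 1" by (rule multiplicity_eqI) auto
 ultimately have "sylow_subgroups 5 (sym_group 5) = {P. subgroup P (sym_group 5) & card P = 5}"
  by (simp add: sylow_subgroups_def)
 then show ?thesis using sylow5_complete sylow5_subgroup card_sylow5 by auto
qed

lemma sylow5_inj: "inj_on sylow5 {1..6}"
proof (rule inj_onI)
 fix i j :: nat assume ij: "i \<in> {1..6}" "j \<in> {1..6}" "sylow5 i = sylow5 j"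
 have "five_cycle i \<in> sylow5 i" unfolding sylow5_def by (rule range_eqI[of _ _ 1]) simp
 then obtain k where k: "k < 5" "five_cycle i = five_cycle j ^^ k" using ij(3) by (auto simp: sylow5_eq)
 have l2: "five_cycle_list m ! 1 = 2" for m by (simp add: five_cycle_list_def)
 have "five_cycle i 1 = 2" using five_cycle_pow_1[of 1 i] l2[of i] by simp
 then have "five_cycle_list j ! k = five_cycle_list j ! 1" using k five_cycle_pow_1[of k j] l2 by simp
 then have "k = 1" using k five_cycle_list[of j] by (simp add: nth_eq_iff_index_eq)
 then have e: "five_cycle i = five_cycle j" using k by simp
 have "five_cycle_list i ! m = five_cycle_list j ! m" if "m < 5" for m
  using five_cycle_pow_1[OF that, of i] five_cycle_pow_1[OF that, of j] e by simp
 then have "five_cycle_list i ! 2 = five_cycle_list j ! 2" "five_cycle_list i ! 3 = five_cycle_list j ! 3"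
  by simp_all
 then show "i = j" using ij(1,2) unfolding set_1_5
  by (elim insertE emptyE) (simp_all add: five_cycle_list_def)
qed

lemma sylow_conjugation_image:
 assumes g: "g \<in> carrier (sym_group 5)" and i: "i \<in> {1..6}"
 shows "sylow_conjugation 5 (sym_group 5) g (sylow5 i) = (%p. g \<circ> p \<circ> inv' g) ` sylow5 i"
proof -
 have "inv\<^bsub>sym_group 5\<^esub> g = inv' g" by (rule sym_group_inv_equality[OF g])
 then show ?thesis
  using i by (auto simp: sylow_conjugation_def sylow_subgroups_5 l_coset_def r_coset_def sym_group_mult)
qed

text \<open>The graph of the exotic embedding in the numbering \<open>sylow5\<close>. As a relation
  it is closed under the group operations, so checking it on generators suffices.\<close>

definition exotic_related :: "(nat => nat) => (nat => nat) => bool" where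
 "exotic_related g p \<longleftrightarrow> g \<in> carrier (sym_group 5) & p permutes {1..6} \<and>
  (\<forall>i\<in>{1..6}. (%q. g \<circ> q \<circ> inv' g) ` sylow5 i = sylow5 (p i))"

lemma exotic_related_id: "exotic_related id id"
 by (auto simp: exotic_related_def sym_group_carrier)

lemma exotic_related_comp:
 assumes "exotic_related g p" "exotic_related g' p'" shows "exotic_related (g \<circ> g') (p \<circ> p')"
 unfolding exotic_related_def
proof (intro conjI ballI)
 have g: "g permutes {1..5}" "g' permutes {1..5}" "p permutes {1..6}" "p' permutes {1..6}"
  using assms by (auto simp: exotic_related_def sym_group_carrier)
 show "g \<circ> g' \<in> carrier (sym_group 5)" "p \<circ> p' permutes {1..6}"
  using g by (simp_all add: sym_group_carrier permutes_compose)
 fix i :: nat assume i: "i \<in> {1..6}"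
 have "inv' (g \<circ> g') = inv' g' \<circ> inv' g" using g permutes_bij o_inv_distrib by metis
 then have "(%q. (g \<circ> g') \<circ> q \<circ> inv' (g \<circ> g')) ` sylow5 i =
   (%q. g \<circ> q \<circ> inv' g) ` (%q. g' \<circ> q \<circ> inv' g') ` sylow5 i"
  by (simp add: image_image o_assoc)
 also have "\<dots> = sylow5 (p (p' i))"
  using assms i permutes_in_image[OF g(4), of i] by (simp add: exotic_related_def)
 finally show "(%q. (g \<circ> g') \<circ> q \<circ> inv' (g \<circ> g')) ` sylow5 i = sylow5 ((p \<circ> p') i)" by simp
qed

lemma exotic_related_inv:
 assumes "exotic_related g p" shows "exotic_related (inv' g) (inv' p)"
 unfolding exotic_related_def
proof (intro conjI ballI)
 have g: "g permutes {1..5}" "p permutes {1..6}"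
  using assms by (auto simp: exotic_related_def sym_group_carrier)
 show "inv' g \<in> carrier (sym_group 5)" "inv' p permutes {1..6}"
  using g by (simp_all add: sym_group_carrier permutes_inv)
 fix i :: nat assume i: "i \<in> {1..6}"
 have "inv' p i \<in> {1..6}" using i permutes_in_image[OF permutes_inv[OF g(2)], of i] by simp
 moreover have "p (inv' p i) = i" using permutes_inverses(1)[OF g(2)] .
 ultimately have "sylow5 i = (%q. g \<circ> q \<circ> inv' g) ` sylow5 (inv' p i)"
  using assms by (simp add: exotic_related_def)
 then have "(%q. inv' g \<circ> q \<circ> inv' (inv' g)) ` sylow5 i =
   (%q. inv' g \<circ> (g \<circ> q \<circ> inv' g) \<circ> inv' (inv' g)) ` sylow5 (inv' p i)"
  by (simp add: image_image)
 also have "(%q. inv' g \<circ> (g \<circ> q \<circ> inv' g) \<circ> inv' (inv' g)) = (%q. q)"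
  using permutes_inverses[OF g(1)] permutes_inv_inv[OF g(1)] by (simp add: fun_eq_iff)
 finally show "(%q. inv' g \<circ> q \<circ> inv' (inv' g)) ` sylow5 i = sylow5 (inv' p i)"
  by (simp only: image_ident)
qed

text \<open>It is enough that one generator of each subgroup is conjugated into the target, since
  source and target both have five elements.\<close>

lemma exotic_related_generator:
 assumes g: "g permutes {1..5}" and p: "p permutes {1..6}"
  and e: "\<And>i. i \<in> {1..6} ==> \<exists>k. \<forall>x\<in>{1..5}. g (five_cycle i x) = (five_cycle (p i) ^^ k) (g x)"
 shows "exotic_related g p"
 unfolding exotic_related_def
proof (intro conjI ballI)
 show "g \<in> carrier (sym_group 5)" "p permutes {1..6}" using g p by (simp_all add: sym_group_carrier)
 fix i :: nat assume i: "i \<in> {1..6}"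
 obtain k where k: "\<forall>x\<in>{1..5}. g (five_cycle i x) = (five_cycle (p i) ^^ k) (g x)" using e[OF i] by blast
 have eq: "g \<circ> five_cycle i = (five_cycle (p i) ^^ k) \<circ> g"
  by (rule permutes_fun_eqI[where S = "{1..5}"])
   (use g five_cycle_permutes k in \<open>auto intro!: permutes_compose permutes_funpow simp del: One_nat_def\<close>)
 have pw: "g \<circ> (five_cycle i ^^ m) = (five_cycle (p i) ^^ (k * m)) \<circ> g" for m
 proof (induct m)
  case (Suc m)
  have "g \<circ> (five_cycle i ^^ Suc m) = (g \<circ> five_cycle i) \<circ> (five_cycle i ^^ m)" by (simp add: o_assoc)
  also have "\<dots> = (five_cycle (p i) ^^ k) \<circ> (g \<circ> (five_cycle i ^^ m))" unfolding eq by (simp add: o_assoc)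
  also have "\<dots> = (five_cycle (p i) ^^ (k * Suc m)) \<circ> g" unfolding Suc by (simp add: o_assoc funpow_add)
  finally show ?case .
 qed simp
 have inj: "inj (%q. g \<circ> q \<circ> inv' g)"
 proof (rule injI)
  fix q q' assume "g \<circ> q \<circ> inv' g = g \<circ> q' \<circ> inv' g"
  then have "inv' g \<circ> (g \<circ> q \<circ> inv' g) \<circ> g = inv' g \<circ> (g \<circ> q' \<circ> inv' g) \<circ> g" by simp
  then show "q = q'" using permutes_inverses[OF g] by (simp add: fun_eq_iff)
 qed
 show "(%q. g \<circ> q \<circ> inv' g) ` sylow5 i = sylow5 (p i)"
 proof (rule card_subset_eq)
  show "finite (sylow5 (p i))" using card_sylow5[of "p i"] card.infinite by fastforce
  show "card ((%q. g \<circ> q \<circ> inv' g) ` sylow5 i) = card (sylow5 (p i))"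
   using card_image[OF inj_on_subset[OF inj subset_UNIV], of "sylow5 i"] by (simp add: card_sylow5)
  show "(%q. g \<circ> q \<circ> inv' g) ` sylow5 i <= sylow5 (p i)"
  proof (rule image_subsetI)
   fix q assume "q \<in> sylow5 i"
   then obtain m where "q = five_cycle i ^^ m" by (auto simp: sylow5_def)
   then have "g \<circ> q \<circ> inv' g = (five_cycle (p i) ^^ (k * m)) \<circ> g \<circ> inv' g" using pw by simp
   also have "\<dots> = five_cycle (p i) ^^ (k * m)"
    using permutes_inverses[OF g] by (simp add: fun_eq_iff)
   finally show "g \<circ> q \<circ> inv' g \<in> sylow5 (p i)" by (auto simp: sylow5_def)
  qed
 qed
qed

definition exotic_s :: "nat => nat" where "exotic_s = cycle_of_list [2, 3, 4, 5]"
definition exotic_t :: "nat => nat" where "exotic_t = cycle_of_list [1, 4, 3, 2]"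

lemma exotic_permutes: "exotic_s permutes {1..5}" "exotic_t permutes {1..5}"
 using cycle_permutes[of "[2,3,4,5::nat]"] cycle_permutes[of "[1,4,3,2::nat]"]
 unfolding exotic_s_def exotic_t_def by (auto elim!: permutes_subset)

lemma exotic_s_apply: "exotic_s 1 = 1" "exotic_s 2 = 3" "exotic_s 3 = 4" "exotic_s 4 = 5" "exotic_s 5 = 2"
 and exotic_t_apply: "exotic_t 1 = 4" "exotic_t 2 = 1" "exotic_t 3 = 2" "exotic_t 4 = 3" "exotic_t 5 = 5"
 by (simp_all add: exotic_s_def exotic_t_def Transposition.transpose_def)

lemma five_cycle_apply:
 "five_cycle 1 1 = 2" "five_cycle 1 2 = 4" "five_cycle 1 4 = 5" "five_cycle 1 5 = 3" "five_cycle 1 3 = 1"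
 "five_cycle 2 1 = 2" "five_cycle 2 2 = 3" "five_cycle 2 3 = 4" "five_cycle 2 4 = 5" "five_cycle 2 5 = 1"
 "five_cycle 3 1 = 2" "five_cycle 3 2 = 5" "five_cycle 3 5 = 4" "five_cycle 3 4 = 3" "five_cycle 3 3 = 1"
 "five_cycle 4 1 = 2" "five_cycle 4 2 = 4" "five_cycle 4 4 = 3" "five_cycle 4 3 = 5" "five_cycle 4 5 = 1"
 "five_cycle 5 1 = 2" "five_cycle 5 2 = 3" "five_cycle 5 3 = 5" "five_cycle 5 5 = 4" "five_cycle 5 4 = 1"
 "five_cycle 6 1 = 2" "five_cycle 6 2 = 5" "five_cycle 6 5 = 3" "five_cycle 6 3 = 4" "five_cycle 6 4 = 1"
 by (simp_all add: five_cycle_def five_cycle_list_def Transposition.transpose_def)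

lemma funpow_1_4: "f ^^ 2 = f \<circ> f" "f ^^ 3 = f \<circ> f \<circ> f" "f ^^ 4 = f \<circ> f \<circ> f \<circ> f"
 by (simp_all add: eval_nat_numeral o_assoc)

lemma funpow_1: "(f :: 'a => 'a) ^^ 1 = f" by (simp only: One_nat_def funpow.simps o_id)

lemma exotic_related_generators:
 "exotic_related exotic_s (model1 2 2)" "exotic_related exotic_t (model2 2 2 2)"
proof -
 have m: "model1 2 2 permutes {1..6}" "model2 2 2 2 permutes {1..6}"
  using model1_permutes[of 2 2 2] model2_permutes[of 2 2 2] by simp_all
 have a1: "model1 2 2 1 = 2" "model1 2 2 2 = 3" "model1 2 2 3 = 4" "model1 2 2 4 = 1" "model1 2 2 5 = 5" "model1 2 2 6 = 6"
  by (simp_all add: model1_def)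
 have a2: "model2 2 2 2 1 = 2" "model2 2 2 2 2 = 5" "model2 2 2 2 3 = 3" "model2 2 2 2 4 = 4" "model2 2 2 2 5 = 6" "model2 2 2 2 6 = 1"
  by (simp_all add: model2_def)
 note simps = a1 a2 funpow_1 funpow_1_4 exotic_s_apply exotic_t_apply five_cycle_apply
 show "exotic_related exotic_s (model1 2 2)"
 proof (rule exotic_related_generator[OF exotic_permutes(1) m(1)])
  fix i :: nat assume "i \<in> {1..6}"
  then have i: "i \<in> {1, 2, 3, 4, 5, 6}" unfolding set_1_5 .
  \<comment> \<open>The list gives, for each index, the power of the target 5-cycle that the
    conjugate of \<open>five_cycle i\<close> turns out to be.\<close>
  have "\<forall>x\<in>{1, 2, 3, 4, 5}. exotic_s (five_cycle i x) =
    (five_cycle (model1 2 2 i) ^^ ([2, 4, 3, 4, 2, 3] ! (i - 1))) (exotic_s x)"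
   using i by (elim insertE emptyE) (simp_all add: simps del: One_nat_def funpow.simps)
  then show "\<exists>k. \<forall>x\<in>{1..5}. exotic_s (five_cycle i x) = (five_cycle (model1 2 2 i) ^^ k) (exotic_s x)"
   unfolding set_1_5 by blast
 qed
 show "exotic_related exotic_t (model2 2 2 2)"
 proof (rule exotic_related_generator[OF exotic_permutes(2) m(2)])
  fix i :: nat assume "i \<in> {1..6}"
  then have i: "i \<in> {1, 2, 3, 4, 5, 6}" unfolding set_1_5 .
  have "\<forall>x\<in>{1, 2, 3, 4, 5}. exotic_t (five_cycle i x) =
    (five_cycle (model2 2 2 2 i) ^^ ([2, 1, 2, 3, 1, 3] ! (i - 1))) (exotic_t x)"
   using i by (elim insertE emptyE) (simp_all add: simps del: One_nat_def funpow.simps)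
  then show "\<exists>k. \<forall>x\<in>{1..5}. exotic_t (five_cycle i x) = (five_cycle (model2 2 2 2 i) ^^ k) (exotic_t x)"
   unfolding set_1_5 by blast
 qed
qed

lemma exotic_generate: "generate (sym_group 5) {exotic_s, exotic_t} = carrier (sym_group 5)"
proof -
 let ?G = "generate (sym_group 5) {exotic_s, exotic_t}"
 interpret perm_group 5 ?G by (rule perm_group_generate) (use exotic_permutes in auto)
 have mem: "exotic_s \<in> ?G" "exotic_t \<in> ?G" by (auto intro: generate.incl)
 have "exotic_s \<circ> exotic_t = three_cycle 1 5 2"
 proof (rule permutes_fun_eqI)
  show "exotic_s \<circ> exotic_t permutes {1..5}" by (rule permutes_compose[OF exotic_permutes(2,1)])
  show "three_cycle 1 5 2 permutes {1..5::nat}"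
   unfolding three_cycle_def by (intro permutes_compose permutes_swap_id) auto
  fix x :: nat assume "x \<in> {1..5}"
  then show "(exotic_s \<circ> exotic_t) x = three_cycle 1 5 2 x" unfolding set_1_5
   by (elim insertE emptyE)
    (simp_all add: exotic_s_apply exotic_t_apply three_cycle_def Transposition.transpose_def del: One_nat_def)
 qed
 then have t: "three_cycle 1 5 2 \<in> ?G" using comp_mem[OF mem] by simp
 obtain B where B: "alt_closed B" "card B >= 3" "\<And>g. g \<in> ?G ==> g ` B \<inter> B ~= {} ==> g ` B = B"
  by (rule exists_alt_block[OF t]) simp_all
 have Bsub: "B <= {1..5}" using B(1) by (simp add: alt_closed_def)
 \<comment> \<open>A translate disjoint from \<open>B\<close> would require six points, so the block
   is invariant under the whole group; following the two generators then fills all of 1 to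
   5.\<close>
 have stable: "g ` B = B" if g: "g \<in> ?G" for g
 proof (rule B(3)[OF g], rule notI)
  assume e: "g ` B \<inter> B = {}"
  have sub: "g ` B <= {1..5}" using Bsub permutes_image[OF perm[OF g]] by blast
  have fin: "finite B" "finite (g ` B)" using Bsub finite_subset by auto
  have "card (g ` B \<union> B) = card (g ` B) + card B" using card_Un_disjoint[OF fin(2,1) e] .
  also have "card (g ` B) = card B"
   using bij[OF g] by (intro card_image) (meson bij_is_inj inj_on_subset subset_UNIV)
  finally have "card B + card B <= card {1..5::nat}" using card_mono[of "{1..5}" "g ` B \<union> B"] sub Bsub by simp
  then show False using B(2) by simp
 qed
 have s: "exotic_s x \<in> B" and t: "exotic_t x \<in> B" if "x \<in> B" for x
  using stable[OF mem(1)] stable[OF mem(2)] that by blast+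
 have "\<not> B <= {1, 5}" using B(2) card_mono[of "{1, 5}" B] by fastforce
 then have "2 \<in> B \<or> 3 \<in> B \<or> 4 \<in> B" using Bsub unfolding set_1_5 by blast
 then have "2 \<in> B" "3 \<in> B" "4 \<in> B" "5 \<in> B"
  using s[of 2] s[of 3] s[of 4] s[of 5] unfolding exotic_s_apply by blast+
 moreover have "1 \<in> B" using t[of 2] calculation unfolding exotic_t_apply by blast
 ultimately have "B = {1..5}" using Bsub unfolding set_1_5 by blast
 then have "carrier (alt_group 5) <= ?G" using alt_subset B(1) by simp
 moreover have "\<not> evenperm exotic_s" unfolding exotic_s_def by (subst evenperm_cycle_of_list) auto
 ultimately show ?thesis using eq_sym_if_odd mem(1) by blast
qed

text \<open>Applied in both directions: every monodromy permutation is matched with an element of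
  S5, and every element of S5 with a monodromy permutation.\<close>

lemma generate_transfer:
 assumes gens: "\<And>x. x \<in> H ==> \<exists>y\<in>K. R x y"
  and one: "R id id" and comp: "\<And>x y x' y'. R x y ==> R x' y' ==> R (x \<circ> x') (y \<circ> y')"
  and inv: "\<And>x y. R x y ==> R (inv' x) (inv' y)"
  and H: "\<And>x. x \<in> H ==> x permutes {1..n}" and K: "\<And>y. y \<in> K ==> y permutes {1..m}"
  and x: "x \<in> generate (sym_group n) H"
 shows "\<exists>y\<in>generate (sym_group m) K. R x y"
proof -
 interpret K: perm_group m "generate (sym_group m) K" by (rule perm_group_generate[OF K])
 show ?thesis using x
 proof induct
  case one show ?case unfolding sym_group_one using K.id_mem assms(2) by blast
 next
  case (incl h) then show ?case using gens generate.incl by metis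
 next
  case (inv h)
  then obtain y where "y \<in> K" "R h y" using gens by blast
  moreover have "inv\<^bsub>sym_group n\<^esub> h = inv' h"
   by (rule sym_group_inv_equality) (use H inv in \<open>simp add: sym_group_carrier\<close>)
  ultimately show ?case using assms(4) K.inv_mem[OF generate.incl] by metis
 next
  case (eng h1 h2) then show ?case using comp K.comp_mem by (metis sym_group_mult)
 qed
qed

text \<open>Two lengths 4 on six points mean \<open>c = k = l = 2\<close>, the parameters for which
  the Sylow subgroups have been numbered.\<close>

lemma (in cycle_triple) exotic_action:
 assumes n: "n = 6" and m: "m1 = 4" "m2 = 4"
 obtains kp where "bij_betw kp {1..6} (sylow_subgroups 5 (sym_group 5))"
  "\<forall>p\<in>G. \<exists>g\<in>carrier (sym_group 5). \<forall>i\<in>{1..6}. sylow_conjugation 5 (sym_group 5) g (kp i) = kp (p i)"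
  "\<forall>g\<in>carrier (sym_group 5). \<exists>p\<in>G. \<forall>i\<in>{1..6}. sylow_conjugation 5 (sym_group 5) g (kp i) = kp (p i)"
proof -
 obtain h where h: "h permutes {1..6}" "model1 2 2 = inv' h \<circ> s1 \<circ> h" "model2 2 2 2 = inv' h \<circ> inv' s2 \<circ> h"
  using model_conj[of 2 2 2] n m by auto
 define R where "R g p \<longleftrightarrow> exotic_related g (inv' h \<circ> p \<circ> h)" for g p
 have bh: "bij h" using h(1) permutes_bij by blast
 have hh: "h (inv' h x) = x" "inv' h (h x) = x" for x using permutes_inverses[OF h(1)] by auto
 have R_id: "R id id" unfolding R_def using exotic_related_id hh by (simp add: o_def id_def)
 have R_comp: "R (g \<circ> g') (p \<circ> p')" if "R g p" "R g' p'" for g g' p p'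
 proof -
  have "inv' h \<circ> (p \<circ> p') \<circ> h = (inv' h \<circ> p \<circ> h) \<circ> (inv' h \<circ> p' \<circ> h)" using hh by (simp add: fun_eq_iff)
  then show ?thesis using exotic_related_comp that unfolding R_def by metis
 qed
 have R_inv: "R (inv' g) (inv' p)" if "R g p" for g p
 proof -
  have "inv' h \<circ> p \<circ> h permutes {1..6}" using that by (simp add: R_def exotic_related_def)
  then have "h \<circ> (inv' h \<circ> p \<circ> h) \<circ> inv' h permutes {1..6}"
   by (rule permutes_compose[OF permutes_inv[OF h(1)] permutes_compose[OF _ h(1)]])
  moreover have "h \<circ> (inv' h \<circ> p \<circ> h) \<circ> inv' h = p" using hh by (simp add: fun_eq_iff)
  ultimately have "bij p" using permutes_bij by metis
  then have "inv' (inv' h \<circ> p \<circ> h) = inv' h \<circ> inv' p \<circ> h"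
   using bh by (simp add: o_inv_distrib bij_imp_bij_inv bij_comp inv_inv_eq o_assoc)
  then show ?thesis using exotic_related_inv that unfolding R_def by metis
 qed
 have R1: "R exotic_s s1" "R exotic_t (inv' s2)"
  unfolding R_def h(2,3)[symmetric] by (rule exotic_related_generators)+
 \<comment> \<open>The product relation recovers \<open>s3\<close> from \<open>s1\<close> and
   \<open>s2\<close>, so the two matched generators generate \<open>G\<close>.\<close>
 have Geq: "generate (sym_group 6) {s1, inv' s2} = G"
 proof
  interpret K: perm_group 6 "generate (sym_group 6) {s1, inv' s2}"
   by (rule perm_group_generate) (use perm_s n in \<open>auto intro: permutes_inv\<close>)
  show "generate (sym_group 6) {s1, inv' s2} <= G"
   using generate_subset[of "{s1, inv' s2}"] s_mem inv_mem n by simp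
  have k: "s1 \<in> generate (sym_group 6) {s1, inv' s2}" "inv' s2 \<in> generate (sym_group 6) {s1, inv' s2}"
   by (auto intro: generate.incl)
  then have k2: "s2 \<in> generate (sym_group 6) {s1, inv' s2}"
   using K.inv_mem permutes_inv_inv[OF perm_s(2)] by metis
  have "s3 = inv' (s2 \<circ> s1)"
  proof
   fix x
   have "bij (s2 \<circ> s1)" using perm_s permutes_bij bij_comp by blast
   then have "(s2 \<circ> s1) (inv' (s2 \<circ> s1) x) = x" by (simp only: bij_is_surj surj_f_inv_f)
   then show "s3 x = inv' (s2 \<circ> s1) x" using prod_id by (metis comp_apply)
  qed
  then have "s3 \<in> generate (sym_group 6) {s1, inv' s2}" using K.inv_mem[OF K.comp_mem[OF k2 k(1)]] by simp
  then show "G <= generate (sym_group 6) {s1, inv' s2}"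
   using K.generate_subset[of "{s1, s2, s3}"] k k2 n by simp
 qed
 define kp where "kp i = sylow5 (inv' h i)" for i
 have act: "\<forall>i\<in>{1..6}. sylow_conjugation 5 (sym_group 5) g (kp i) = kp (p i)" if "R g p" for g p
 proof
  fix i :: nat assume "i \<in> {1..6}"
  then have i: "inv' h i \<in> {1..6}" using permutes_in_image[OF permutes_inv[OF h(1)]] by simp
  have g: "g \<in> carrier (sym_group 5)" using that by (simp add: R_def exotic_related_def)
  have "sylow_conjugation 5 (sym_group 5) g (kp i) = sylow5 ((inv' h \<circ> p \<circ> h) (inv' h i))"
   unfolding kp_def sylow_conjugation_image[OF g i] using that i by (simp add: R_def exotic_related_def)
  then show "sylow_conjugation 5 (sym_group 5) g (kp i) = kp (p i)" by (simp add: kp_def hh)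
 qed
 show ?thesis
 proof (rule that)
  have "bij_betw (inv' h) {1..6} {1..6}" by (rule permutes_imp_bij[OF permutes_inv[OF h(1)]])
  moreover have "bij_betw sylow5 {1..6} (sylow_subgroups 5 (sym_group 5))"
   unfolding bij_betw_def sylow_subgroups_5 using sylow5_inj by simp
  ultimately have "bij_betw (sylow5 \<circ> inv' h) {1..6} (sylow_subgroups 5 (sym_group 5))" by (rule bij_betw_trans)
  then show "bij_betw kp {1..6} (sylow_subgroups 5 (sym_group 5))" unfolding kp_def by (simp add: o_def)
  show "\<forall>p\<in>G. \<exists>g\<in>carrier (sym_group 5). \<forall>i\<in>{1..6}. sylow_conjugation 5 (sym_group 5) g (kp i) = kp (p i)"
  proof
   fix p assume "p \<in> G"
   then have p: "p \<in> generate (sym_group 6) {s1, inv' s2}" using Geq by simp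
   have "\<exists>g\<in>generate (sym_group 5) {exotic_s, exotic_t}. R g p"
    by (rule generate_transfer[where R = "%p g. R g p", OF _ _ _ _ _ _ p])
     (use R1 R_id R_comp R_inv perm_s n exotic_permutes in \<open>auto intro: permutes_inv\<close>)
   then show "\<exists>g\<in>carrier (sym_group 5). \<forall>i\<in>{1..6}. sylow_conjugation 5 (sym_group 5) g (kp i) = kp (p i)"
    unfolding exotic_generate using act by blast
  qed
  show "\<forall>g\<in>carrier (sym_group 5). \<exists>p\<in>G. \<forall>i\<in>{1..6}. sylow_conjugation 5 (sym_group 5) g (kp i) = kp (p i)"
  proof
   fix g assume "g \<in> carrier (sym_group 5)"
   then have g: "g \<in> generate (sym_group 5) {exotic_s, exotic_t}" by (simp add: exotic_generate)
   have "\<exists>p\<in>generate (sym_group 6) {s1, inv' s2}. R g p"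
    by (rule generate_transfer[where R = R, OF _ _ _ _ _ _ g])
     (use R1 R_id R_comp R_inv perm_s n exotic_permutes in \<open>auto intro: permutes_inv\<close>)
   then show "\<exists>p\<in>G. \<forall>i\<in>{1..6}. sylow_conjugation 5 (sym_group 5) g (kp i) = kp (p i)"
    unfolding Geq using act by blast
  qed
 qed
qed

section \<open>Residues of the normal form\<close>

text \<open>The normal form has its poles at \<open>0\<close>, \<open>1\<close>, \<open>\<infinity>\<close> and its zero at \<open>t\<close>.\<close>

definition normal_coeff :: "nat => nat => nat => complex => complex => complex => complex" where
 "normal_coeff a b1 b2 c t x = c * (x - t) ^ a / (x ^ b1 * (x - 1) ^ b2)"

text \<open>The coefficient of \<open>x^j\<close> in \<open>(1 - c x)^(-b)\<close>.\<close>

definition neg_binom :: "complex => nat => nat => complex" where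
 "neg_binom c b j = of_nat ((b + j - 1) choose j) * c ^ j"

lemma neg_binom_nonzero: "c ~= 0 ==> b > 0 ==> neg_binom c b j ~= 0"
 by (simp add: neg_binom_def)

lemma neg_binom_0 [simp]: "neg_binom c b 0 = 1" by (simp add: neg_binom_def)

lemma neg_binom_fps:
 assumes "b > 0"
 shows "fps_nth (inverse ((1 - fps_const c * fps_X) ^ b)) j = neg_binom c b j"
proof -
 have "(b + j - 1) choose j = (b + j - 1) choose j" by simp
 then show ?thesis using one_minus_const_fps_X_neg_power'[OF assms, of c] by (simp add: neg_binom_def)
qed

lemma fps_nth_linear_power:
 "fps_nth ((fps_const u + fps_const v * fps_X) ^ a) k = of_nat (a choose k) * v ^ k * (u :: complex) ^ (a - k)"
proof -
 have "fps_const u + fps_const v * fps_X = fps_of_poly [:u, v:]" by simp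
 then have "fps_nth ((fps_const u + fps_const v * fps_X) ^ a) k = coeff ([:u, v:] ^ a) k"
  by (simp only: fps_of_poly_power[symmetric] fps_of_poly_nth)
 moreover have "coeff ([:u, v:] ^ a) k = of_nat (a choose k) * v ^ k * u ^ (a - k)"
 proof (cases "k <= a")
  case True then show ?thesis by (rule coeff_linear_poly_power)
 next
  case False
  have "degree ([:u, v:] ^ a) <= a" using degree_power_le[of "[:u, v:]" a] by (simp split: if_splits)
  then show ?thesis using False by (simp add: coeff_eq_0 binomial_eq_0)
 qed
 ultimately show ?thesis by simp
qed

lemma residue_linear_power_quotient:
 assumes b: "b > 0"
 shows "residue (%x. (u + v * x) ^ a / ((1 - c * x) ^ b * x ^ Suc m)) 0 =
  (\<Sum>k\<le>m. of_nat (a choose k) * v ^ k * u ^ (a - k) * neg_binom c b (m - k))"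
proof -
 let ?F = "(fps_const u + fps_const v * fps_X) ^ a * inverse ((1 - fps_const c * fps_X) ^ b)"
 have "(%x. (u + v * x) ^ a * inverse ((1 - c * x) ^ b)) has_fps_expansion ?F"
  by (intro fps_expansion_intros) simp
 then have "residue (%x. (u + v * x) ^ a * inverse ((1 - c * x) ^ b) / x ^ Suc m) 0 = fps_nth ?F m"
  by (rule residue_fps_expansion_over_power_at_0)
 also have "(%x. (u + v * x) ^ a * inverse ((1 - c * x) ^ b) / x ^ Suc m) =
   (%x. (u + v * x) ^ a / ((1 - c * x) ^ b * x ^ Suc m))"
  by (simp add: fun_eq_iff field_simps)
 finally show ?thesis
  by (simp add: fps_mult_nth neg_binom_fps[OF b] fps_nth_linear_power atLeast0AtMost)
qed

lemma poly_eqI_infinite: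
 fixes p q :: "complex poly"
 assumes "\<And>t. t \<notin> S ==> poly p t = poly q t" "finite S" shows "p = q"
proof (rule ccontr)
 assume "p ~= q"
 then have "finite {t. poly (p - q) t = 0}" by (intro poly_roots_finite) simp
 moreover have "UNIV - S <= {t. poly (p - q) t = 0}" using assms by auto
 ultimately have "finite (UNIV - S)" using finite_subset by blast
 then show False using assms(2) infinite_UNIV_char_0 by (metis Diff_infinite_finite)
qed

text \<open>The residue theorem on the sphere: \<open>w = 1/z\<close> turns the circle of radius 1/2
  in the chart at infinity into the circle of radius 2 run backwards.\<close>

lemma residue_sum_zero:
 assumes f: "f holomorphic_on - {0, 1}"
 shows "residue f 0 + residue f 1 + residue (coeff_at_infinity f) 0 = 0"
proof -
 let ?g = "circlepath 0 2" and ?h = "circlepath 0 (1/2)"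
 have "contour_integral ?g f = 2 * pi * \<i> * (\<Sum>p\<in>{0, 1}. winding_number ?g p * residue f p)"
  by (rule Residue_theorem[where S = UNIV]) (use f in \<open>auto simp: Compl_eq_Diff_UNIV\<close>)
 moreover have "winding_number ?g 0 = 1" "winding_number ?g 1 = 1"
  by (rule winding_number_circlepath; simp)+
 ultimately have I1: "contour_integral ?g f = 2 * pi * \<i> * (residue f 0 + residue f 1)" by simp
 have "coeff_at_infinity f holomorphic_on ball 0 1 - {0}"
 proof -
  have "(f \<circ> inverse) holomorphic_on ball 0 1 - {0}"
   by (rule holomorphic_on_compose_gen[OF _ f])
    (auto intro!: holomorphic_intros simp: norm_inverse, (metis inverse_1 inverse_inverse_eq norm_one order_less_irrefl)?)
  then have "(%w. f (inverse w)) holomorphic_on ball 0 1 - {0}" by (simp add: o_def)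
  then have "(%w. - f (inverse w) / w\<^sup>2) holomorphic_on ball 0 1 - {0}"
   by (intro holomorphic_intros) auto
  then show ?thesis by (simp add: coeff_at_infinity_def[abs_def])
 qed
 then have "(coeff_at_infinity f has_contour_integral 2 * pi * \<i> * residue (coeff_at_infinity f) 0) ?h"
  by (intro base_residue[of "ball 0 1"]) (auto simp: cball_subset_ball_iff)
 then have I2: "contour_integral ?h (coeff_at_infinity f) = 2 * pi * \<i> * residue (coeff_at_infinity f) 0"
  by (rule contour_integral_unique)
 have vd: "vector_derivative (reversepath ?g) (at x) = - (4 * pi * \<i> * exp (- (2 * of_real pi * \<i> * x)))" for x
 proof -
  have "(reversepath ?g has_vector_derivative - (4 * pi * \<i> * exp (- (2 * of_real pi * \<i> * x)))) (at x)"
  proof -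
   have e: "exp (2 * complex_of_real pi * \<i> * (1 - y)) = exp (- (2 * of_real pi * \<i> * y))" for y
    by (simp only: right_diff_distrib exp_diff exp_minus) (simp add: inverse_eq_divide)
   have "reversepath ?g = (%x. 2 * exp (- (2 * of_real pi * \<i> * of_real x)))"
    by (rule ext) (simp add: reversepath_def circlepath e)
   moreover have "((%x. 2 * exp (- (2 * of_real pi * \<i> * of_real x))) has_vector_derivative
     - (4 * pi * \<i> * exp (- (2 * of_real pi * \<i> * x)))) (at x)"
    by (rule has_vector_derivative_real_field[where f = "%z. 2 * exp (- (2 * of_real pi * \<i> * z))"])
     (auto intro!: derivative_eq_intros)
   ultimately show ?thesis by simp
  qed
  then show ?thesis by (rule vector_derivative_at)
 qed
 have "contour_integral ?h (coeff_at_infinity f) = contour_integral (reversepath ?g) f"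
  unfolding contour_integral_integral
 proof (rule integral_cong)
  fix x :: real assume "x \<in> {0..1}"
  define e where "e = (exp (2 * of_real pi * \<i> * of_real x) :: complex)"
  have e0: "e ~= 0" by (simp add: e_def)
  have "?h x = e / 2" by (simp add: e_def circlepath)
  then have 1: "coeff_at_infinity f (?h x) = - f (2 * inverse e) * 4 / e\<^sup>2"
  proof -
   assume h: "?h x = e / 2"
   have "inverse (e / 2) = 2 * inverse e" "X / (e / 2)\<^sup>2 = X * 4 / e\<^sup>2" for X
    by (simp_all add: inverse_eq_divide power_divide)
   then show ?thesis unfolding h coeff_at_infinity_def by simp
  qed
  have 2: "reversepath ?g x = 2 * inverse e"
  proof -
   have "2 * complex_of_real pi * \<i> * of_real (1 - x) = 2 * of_real pi * \<i> - 2 * of_real pi * \<i> * of_real x"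
    by (simp add: right_diff_distrib)
   then show ?thesis
    unfolding reversepath_def circlepath e_def by (simp only: exp_diff) (simp add: inverse_eq_divide)
  qed
  have 3: "vector_derivative (reversepath ?g) (at x) = - (4 * pi * \<i> * inverse e)"
   unfolding vd by (simp add: e_def exp_minus)
  have 4: "vector_derivative ?h (at x) = pi * \<i> * e"
   unfolding vector_derivative_circlepath by (simp add: e_def)
  have cancel: "- F * 4 / e\<^sup>2 * (of_real pi * \<i> * e) = F * - (of_real (4 * pi) * \<i> * inverse e)" for F
   using e0 by (simp add: power2_eq_square field_simps)
  show "coeff_at_infinity f (?h x) * vector_derivative ?h (at x) =
    f (reversepath ?g x) * vector_derivative (reversepath ?g) (at x)"
   unfolding 1 2 3 4 by (rule cancel)
 qed
 also have "\<dots> = - contour_integral ?g f" by (rule contour_integral_reversepath) simp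
 finally have "2 * pi * \<i> * (residue f 0 + residue f 1 + residue (coeff_at_infinity f) 0) = 0"
  using I1 I2 by (simp add: algebra_simps)
 then show ?thesis by simp
qed

lemma degree_sum_monom:
 fixes c :: "nat => complex"
 assumes "c n ~= 0" shows "degree (\<Sum>i\<le>n. monom (c i) i) = n"
  "coeff (\<Sum>i\<le>n. monom (c i) i) n = c n" "poly (\<Sum>i\<le>n. monom (c i) i) 0 = c 0"
proof -
 have co: "coeff (\<Sum>i\<le>n. monom (c i) i) k = (if k <= n then c k else 0)" for k
  by (simp add: coeff_sum)
 show "degree (\<Sum>i\<le>n. monom (c i) i) = n"
  by (rule antisym) (auto intro!: degree_le le_degree simp: co assms)
 show "coeff (\<Sum>i\<le>n. monom (c i) i) n = c n" by (simp add: co)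
 show "poly (\<Sum>i\<le>n. monom (c i) i) 0 = c 0" by (simp add: poly_0_coeff_0 co)
qed

lemma power_dvd_pderiv:
 fixes l q :: "complex poly"
 assumes "m >= 1" shows "l ^ (m - 1) dvd pderiv (l ^ m * q)"
proof -
 obtain j where m: "m = Suc j" using assms by (cases m) auto
 have "pderiv (l ^ m * q) = l ^ Suc j * pderiv q + q * (smult (of_nat (Suc j)) (l ^ j) * pderiv l)"
  by (simp only: m pderiv_mult pderiv_power_Suc)
 moreover have "l ^ j dvd l ^ Suc j * pderiv q" by (intro dvd_mult2 le_imp_power_dvd) simp
 moreover have "l ^ j dvd q * (smult (of_nat (Suc j)) (l ^ j) * pderiv l)"
  by (intro dvd_mult dvd_mult2 dvd_smult dvd_refl)
 ultimately show ?thesis by (simp add: m)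
qed

text \<open>\<open>p + q = 1\<close> is a Bezout identity, and it passes to the powers of
  \<open>p\<close> and \<open>q\<close>. The lemma is meant for \<open>t\<close> and
  \<open>1 - t\<close>.\<close>

lemma power_mult_dvd_if_sum_one:
 fixes p q w :: "complex poly"
 assumes pq: "p + q = 1" and d: "p ^ j dvd w" "q ^ k dvd w" shows "p ^ j * q ^ k dvd w"
proof -
 have bezout: "\<exists>A B. A * x ^ i + B * y = 1" if "\<exists>A B. A * x + B * y = 1" for x y :: "complex poly" and i
 proof (induct i)
  case 0 then show ?case by (intro exI[of _ 1] exI[of _ 0]) simp
 next
  case (Suc i)
  then obtain A B C D where e: "A * x ^ i + B * y = 1" "C * x + D * y = 1" using \<open>\<exists>A B. A * x + B * y = 1\<close> by blast
  have "1 = (A * x ^ i + B * y) * (C * x + D * y)" unfolding e by simp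
  also have "\<dots> = (A * C) * x ^ Suc i + (A * x ^ i * D + B * C * x + B * D * y) * y" by (simp add: algebra_simps)
  finally show ?case by metis
 qed
 have "\<exists>A B. A * p + B * q = 1" using pq by (intro exI[of _ 1]) simp
 then obtain A B where "A * p ^ j + B * q = 1" using bezout by blast
 then have "\<exists>A B. A * q + B * p ^ j = 1" by (metis add.commute)
 then obtain C D where e: "C * q ^ k + D * p ^ j = 1" using bezout by blast
 have "p ^ j * q ^ k dvd (C * q ^ k) * w" "p ^ j * q ^ k dvd (D * p ^ j) * w"
  using d by (metis dvd_mult mult.assoc mult.commute mult_dvd_mono dvd_refl)+
 then have "p ^ j * q ^ k dvd (C * q ^ k + D * p ^ j) * w" by (simp add: distrib_right)
 then show ?thesis by (simp add: e)
qed

section \<open>The residues of the normal form as polynomials in the position of the zero\<close>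

locale residue_data =
 fixes a b1 b2 b3 :: nat
 assumes b_pos: "b1 >= 1" "b2 >= 1" "b3 >= 1" and a_eq: "a + 2 = b1 + b2 + b3" and a_pos: "a >= 1"
begin

text \<open>\<open>m1\<close>, \<open>m2\<close>, \<open>m3\<close> will be the multiplicities of
  the ratio \<open>- p1 / p3\<close> at 0, 1 and infinity, hence the lengths of the three
  cycles.\<close>

definition m1 where "m1 = b2 + b3 - 1"
definition m2 where "m2 = b1 + b3 - 1"
definition m3 where "m3 = b1 + b2 - 1"

text \<open>The residue at the pole 0 involves only the powers of \<open>t\<close> from
  \<open>m1\<close> to \<open>a\<close>; \<open>q1\<close> is what remains after dividing by
  \<open>t^m1\<close>.\<close>

definition q1 :: "complex poly" where
 "q1 = (\<Sum>i\<le>b1 - 1. monom (of_nat (a choose (b1 - 1 - i)) * (-1) ^ (m1 + i) * (-1) ^ b2 * neg_binom 1 b2 i) i)"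

text \<open>The counterpart of \<open>q1\<close> at the pole 1, in the variable
  \<open>1 - t\<close>.\<close>

definition q2 :: "complex poly" where
 "q2 = (\<Sum>i\<le>b2 - 1. monom (of_nat (a choose (b2 - 1 - i)) * neg_binom (-1) b1 i) i)"

definition p1 :: "complex poly" where "p1 = [:0, 1:] ^ m1 * q1"
definition p2 :: "complex poly" where "p2 = pcompose ([:0, 1:] ^ m2 * q2) [:1, -1:]"
definition p3 :: "complex poly" where
 "p3 = (\<Sum>k\<le>b3 - 1. monom (- (of_nat (a choose k) * (-1) ^ k * neg_binom 1 b2 (b3 - 1 - k))) k)"

lemma m_eq: "m1 + b1 = a + 1" "m2 + b2 = a + 1" "m3 + b3 = a + 1" "m1 >= 1" "m2 >= 1" "m3 >= 1"
 using b_pos a_eq by (auto simp: m1_def m2_def m3_def)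

lemma poly_p1: "poly p1 t = residue (normal_coeff a b1 b2 1 t) 0"
proof -
 have eq: "normal_coeff a b1 b2 1 t = (%x. (-1) ^ b2 * ((- t + 1 * x) ^ a / ((1 - 1 * x) ^ b2 * x ^ Suc (b1 - 1))))"
 proof
  fix x :: complex
  have "x - 1 = (-1) * (1 - 1 * x)" by simp
  then have "(x - 1) ^ b2 = (-1) ^ b2 * (1 - 1 * x) ^ b2" by (simp only: power_mult_distrib)
  moreover have "Suc (b1 - 1) = b1" using b_pos by simp
  moreover have "inverse ((-1) ^ b2) = ((-1) ^ b2 :: complex)" by (simp add: power_inverse[symmetric])
  ultimately show "normal_coeff a b1 b2 1 t x = (-1) ^ b2 * ((- t + 1 * x) ^ a / ((1 - 1 * x) ^ b2 * x ^ Suc (b1 - 1)))"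
   by (simp add: normal_coeff_def divide_inverse mult_ac)
 qed
 have "residue (normal_coeff a b1 b2 1 t) 0 = (-1) ^ b2 *
   residue (%x. (- t + 1 * x) ^ a / ((1 - 1 * x) ^ b2 * x ^ Suc (b1 - 1))) 0"
  unfolding eq by (rule residue_lmul[of "ball 0 1"]) (auto intro!: holomorphic_intros)
 also have "\<dots> = (-1) ^ b2 * (\<Sum>k\<le>b1 - 1. of_nat (a choose k) * 1 ^ k * (- t) ^ (a - k) * neg_binom 1 b2 (b1 - 1 - k))"
  by (subst residue_linear_power_quotient) (use b_pos in auto)
 also have "\<dots> = (\<Sum>k\<le>b1 - 1. (-1) ^ b2 * of_nat (a choose k) * (- t) ^ (a - k) * neg_binom 1 b2 (b1 - 1 - k))"
  by (simp add: sum_distrib_left mult_ac)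
 also have "\<dots> = (\<Sum>i\<le>b1 - 1. (-1) ^ b2 * of_nat (a choose (b1 - 1 - i)) * (- t) ^ (m1 + i) * neg_binom 1 b2 i)"
 proof (rule sum.reindex_bij_witness[where i = "%i. b1 - 1 - i" and j = "%i. b1 - 1 - i"], goal_cases)
  case (5 k)
  then have "a - k = m1 + (b1 - 1 - k)" using m_eq b_pos by auto
  then show ?case using 5 b_pos by simp
 qed auto
 also have "\<dots> = poly p1 t"
  by (simp add: p1_def q1_def poly_sum poly_monom sum_distrib_left power_add power_minus[of t] mult_ac)
 finally show ?thesis by simp
qed

lemma poly_p2: "poly p2 t = residue (normal_coeff a b1 b2 1 t) 1"
proof -
 let ?s = "1 - t"
 have eq: "normal_coeff a b1 b2 1 t (1 + x) = (?s + 1 * x) ^ a / ((1 - (-1) * x) ^ b1 * x ^ Suc (b2 - 1))" for x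
  using b_pos by (simp add: normal_coeff_def algebra_simps)
 have "residue (normal_coeff a b1 b2 1 t) 1 = residue (%x. normal_coeff a b1 b2 1 t (1 + x)) 0"
  by (rule residue_shift_0)
 also have "\<dots> = (\<Sum>k\<le>b2 - 1. of_nat (a choose k) * 1 ^ k * ?s ^ (a - k) * neg_binom (-1) b1 (b2 - 1 - k))"
  unfolding eq by (subst residue_linear_power_quotient) (use b_pos in auto)
 also have "\<dots> = (\<Sum>i\<le>b2 - 1. of_nat (a choose (b2 - 1 - i)) * ?s ^ (m2 + i) * neg_binom (-1) b1 i)"
 proof (rule sum.reindex_bij_witness[where i = "%i. b2 - 1 - i" and j = "%i. b2 - 1 - i"], goal_cases)
  case (5 k)
  then have "a - k = m2 + (b2 - 1 - k)" using m_eq b_pos by auto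
  then show ?case using 5 b_pos by simp
 qed auto
 also have "\<dots> = poly p2 t"
  by (simp add: p2_def q2_def poly_pcompose poly_sum poly_monom sum_distrib_left power_add mult_ac)
 finally show ?thesis by simp
qed

lemma poly_p3: "poly p3 t = residue (coeff_at_infinity (normal_coeff a b1 b2 1 t)) 0"
proof -
 have eq: "coeff_at_infinity (normal_coeff a b1 b2 1 t) w =
   - ((1 + (- t) * w) ^ a / ((1 - 1 * w) ^ b2 * w ^ Suc (b3 - 1)))" if "w ~= 0" for w
 proof -
  have "inverse w - t = (1 - t * w) / w" "inverse w - 1 = (1 - w) / w"
   using that by (simp_all add: field_simps)
  then have 1: "(inverse w - t) ^ a = (1 - t * w) ^ a / w ^ a"
   and 2: "(inverse w - 1) ^ b2 = (1 - w) ^ b2 / w ^ b2"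
   by (simp_all only: power_divide)
  \<comment> \<open>The square from the change of chart joins \<open>w ^ a\<close>; since
    \<open>a + 2 = b1 + b2 + b3\<close>, only \<open>w ^ b3\<close> is left in the
    denominator.\<close>
  have 3: "w ^ a * w ^ 2 = w ^ b1 * w ^ b2 * w ^ b3"
   using a_eq by (simp add: power_add[symmetric])
  have "coeff_at_infinity (normal_coeff a b1 b2 1 t) w =
    - ((1 - t * w) ^ a * (w ^ b1 * w ^ b2)) / ((1 - w) ^ b2 * (w ^ a * w ^ 2))"
   by (simp add: coeff_at_infinity_def normal_coeff_def 1 2 power_inverse divide_inverse mult_ac)
  also have "\<dots> = - ((1 - t * w) ^ a / ((1 - w) ^ b2 * w ^ b3))"
  proof -
   have "- (A * W) / (B * (W * C)) = - (A / (B * C))" if "W ~= 0" for A B C W :: complex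
    using that by (cases "B = 0"; cases "C = 0"; simp add: field_simps)
   then show ?thesis unfolding 3 using \<open>w ~= 0\<close> by simp
  qed
  finally show ?thesis using b_pos by simp
 qed
 have "residue (coeff_at_infinity (normal_coeff a b1 b2 1 t)) 0 =
   residue (%w. - ((1 + (- t) * w) ^ a / ((1 - 1 * w) ^ b2 * w ^ Suc (b3 - 1)))) 0"
  by (rule residue_cong) (auto simp: eventually_at_filter eq intro!: always_eventually)
 also have "\<dots> = - residue (%w. (1 + (- t) * w) ^ a / ((1 - 1 * w) ^ b2 * w ^ Suc (b3 - 1))) 0"
  by (rule residue_neg[of "ball 0 1"]) (auto intro!: holomorphic_intros)
 also have "\<dots> = - (\<Sum>k\<le>b3 - 1. of_nat (a choose k) * (- t) ^ k * 1 ^ (a - k) * neg_binom 1 b2 (b3 - 1 - k))"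
  by (subst residue_linear_power_quotient) (use b_pos in auto)
 also have "\<dots> = poly p3 t"
  by (simp add: p3_def poly_sum poly_monom sum_negf[symmetric] power_minus[of t] mult_ac)
 finally show ?thesis by simp
qed

lemma b_le_a: "b1 - 1 <= a" "b2 - 1 <= a" "b3 - 1 < a"
 using a_eq b_pos by auto

lemma q1_props: "degree q1 = b1 - 1" "poly q1 0 ~= 0" "q1 ~= 0"
proof -
 note d = degree_sum_monom[where n = "b1 - 1" and
  c = "%i. of_nat (a choose (b1 - 1 - i)) * (-1) ^ (m1 + i) * (-1) ^ b2 * neg_binom 1 b2 i", folded q1_def]
 have nz: "of_nat (a choose (b1 - 1 - i)) * (-1) ^ (m1 + i) * (-1) ^ b2 * neg_binom 1 b2 i ~= 0" for i
 proof -
  have "b1 - 1 - i <= a" using b_le_a by simp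
  then show ?thesis using neg_binom_nonzero[of 1 b2 i] b_pos by simp
 qed
 show "degree q1 = b1 - 1" by (rule d(1)[OF nz])
 show "poly q1 0 ~= 0" using d(3)[OF nz] nz[of 0] by simp
 then show "q1 ~= 0" by auto
qed

lemma q2_props: "degree q2 = b2 - 1" "poly q2 0 ~= 0" "q2 ~= 0"
proof -
 note d = degree_sum_monom[where n = "b2 - 1" and
  c = "%i. of_nat (a choose (b2 - 1 - i)) * neg_binom (-1) b1 i", folded q2_def]
 have nz: "of_nat (a choose (b2 - 1 - i)) * neg_binom (-1) b1 i ~= 0" for i
 proof -
  have "b2 - 1 - i <= a" using b_le_a by simp
  then show ?thesis using neg_binom_nonzero[of "-1" b1 i] b_pos by simp
 qed
 show "degree q2 = b2 - 1" by (rule d(1)[OF nz])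
 show "poly q2 0 ~= 0" using d(3)[OF nz] nz[of 0] by simp
 then show "q2 ~= 0" by auto
qed

lemma degree_p3: "degree p3 = b3 - 1" "p3 ~= 0"
proof -
 note d = degree_sum_monom[where n = "b3 - 1" and
  c = "%k. - (of_nat (a choose k) * (-1) ^ k * neg_binom 1 b2 (b3 - 1 - k))", folded p3_def]
 have nz: "- (of_nat (a choose (b3 - 1)) * (-1) ^ (b3 - 1) * neg_binom 1 b2 (b3 - 1 - (b3 - 1))) ~= 0"
  using b_le_a by simp
 show "degree p3 = b3 - 1" by (rule d(1)[OF nz])
 show "p3 ~= 0" using d(2)[OF nz] nz by auto
qed

lemma degree_p1: "degree p1 = a" "p1 ~= 0"
proof -
 show "p1 ~= 0" using q1_props by (simp add: p1_def)
 have "degree p1 = m1 + (b1 - 1)" unfolding p1_def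
  by (subst degree_mult_eq) (use q1_props in \<open>simp_all add: degree_power_eq\<close>)
 then show "degree p1 = a" using m_eq b_pos by simp
qed

lemma p1_factor: "poly p1 t = t ^ m1 * poly q1 t"
 by (simp add: p1_def)

lemma p2_factor: "poly p2 t = (1 - t) ^ m2 * poly q2 (1 - t)"
 by (simp add: p2_def poly_pcompose)

lemma sum_zero: "p1 + p2 + p3 = 0"
proof (rule poly_eqI_infinite[where S = "{}"])
 fix t :: complex
 have "normal_coeff a b1 b2 1 t holomorphic_on - {0, 1}"
  unfolding normal_coeff_def[abs_def] by (intro holomorphic_intros) auto
 then show "poly (p1 + p2 + p3) t = poly 0 t"
  using residue_sum_zero[of "normal_coeff a b1 b2 1 t"] by (simp add: poly_p1 poly_p2 poly_p3)
qed simp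

lemma sum_zero_poly: "poly p1 t + poly p2 t + poly p3 t = 0"
 using arg_cong[OF sum_zero, of "%p. poly p t"] by simp

definition wronskian :: "complex poly" where "wronskian = p1 * pderiv p3 - pderiv p1 * p3"

lemma wronskian_eq: "wronskian = pderiv p2 * p3 - p2 * pderiv p3"
proof -
 have p1: "p1 = - p2 - p3" using sum_zero by (simp add: eq_neg_iff_add_eq_0 add_ac algebra_simps)
 show ?thesis unfolding wronskian_def p1 by (simp add: pderiv_diff pderiv_minus algebra_simps)
qed

lemma wronskian_nonzero: "t ~= 0 ==> t ~= 1 ==> poly wronskian t ~= 0"
proof -
 have d1: "[:0, 1:] ^ (m1 - 1) dvd wronskian"
 proof -
  have "[:0, 1:] ^ (m1 - 1) dvd p1" unfolding p1_def by (intro dvd_mult2 le_imp_power_dvd) simp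
  moreover have "[:0, 1:] ^ (m1 - 1) dvd pderiv p1" unfolding p1_def by (rule power_dvd_pderiv) (use m_eq in simp)
  ultimately show ?thesis unfolding wronskian_def by (intro dvd_diff dvd_mult2)
 qed
 have d2: "[:1, -1:] ^ (m2 - 1) dvd wronskian"
 proof -
  have e: "pcompose ([:0, 1:] ^ k) [:1, -1:] = [:1, -1 :: complex:] ^ k" for k
  proof (induct k)
   case (Suc k)
   show ?case by (simp only: power_Suc pcompose_mult Suc) (simp add: pcompose_pCons)
  qed (simp add: one_pCons pcompose_pCons)
  have p2: "p2 = [:1, -1:] ^ m2 * pcompose q2 [:1, -1:]" by (simp add: p2_def pcompose_mult e)
  have "[:1, -1:] ^ (m2 - 1) dvd p2" unfolding p2 by (intro dvd_mult2 le_imp_power_dvd) simp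
  moreover have "[:1, -1:] ^ (m2 - 1) dvd pderiv p2"
   unfolding p2 by (rule power_dvd_pderiv) (use m_eq in simp)
  ultimately show ?thesis unfolding wronskian_eq by (intro dvd_diff dvd_mult2)
 qed
 have "[:0, 1:] ^ (m1 - 1) * [:1, -1:] ^ (m2 - 1) dvd wronskian"
  by (rule power_mult_dvd_if_sum_one[OF _ d1 d2]) (simp add: one_pCons)
 then obtain K where K: "wronskian = [:0, 1:] ^ (m1 - 1) * [:1, -1:] ^ (m2 - 1) * K" by (elim dvdE)
 \<comment> \<open>The leading terms do not cancel because \<open>b3 - 1 < a\<close>, so the
   Wronskian is not 0. Its degree is at most \<open>a + b3 - 2\<close>, which equals
   \<open>(m1 - 1) + (m2 - 1)\<close>, so the cofactor \<open>K\<close> is a nonzero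
   constant.\<close>
 have top: "coeff wronskian (a + (b3 - 1) - 1) = (of_nat (b3 - 1) - of_nat a) * (lead_coeff p1 * lead_coeff p3)"
 proof (cases "b3 - 1")
  case 0
  then obtain u where u: "p3 = [:u:]" using degree_p3(1) by (metis degree_eq_zeroE)
  have "coeff (pderiv p1) (a - 1) = of_nat a * lead_coeff p1"
   using a_pos degree_p1 by (simp add: coeff_pderiv)
  then show ?thesis using 0 u by (simp add: wronskian_def pderiv_pCons)
 next
  case (Suc j)
  have dp: "degree (pderiv p1) = a - 1" "degree (pderiv p3) = j"
   using degree_p1 degree_p3 Suc by (simp_all add: degree_pderiv)
  have c1: "coeff (p1 * pderiv p3) (a + j) = lead_coeff p1 * coeff (pderiv p3) j"
   using coeff_mult_degree_sum[of p1 "pderiv p3"] degree_p1 dp by simp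
  have c2: "coeff (pderiv p1 * p3) (a - 1 + Suc j) = coeff (pderiv p1) (a - 1) * lead_coeff p3"
  proof -
   have "degree p3 = Suc j" using degree_p3 Suc by simp
   then show ?thesis using coeff_mult_degree_sum[of "pderiv p1" p3] by (simp only: dp)
  qed
  have c3: "coeff (pderiv p3) j = of_nat (b3 - 1) * lead_coeff p3"
   using degree_p3 Suc by (simp add: coeff_pderiv)
  have c4: "coeff (pderiv p1) (a - 1) = of_nat a * lead_coeff p1"
   using a_pos degree_p1 by (simp add: coeff_pderiv)
  have i: "a - 1 + Suc j = a + j" "a + (b3 - 1) - 1 = a + j" using a_pos Suc by auto
  have "coeff wronskian (a + j) = lead_coeff p1 * (of_nat (b3 - 1) * lead_coeff p3) - of_nat a * lead_coeff p1 * lead_coeff p3"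
   unfolding wronskian_def coeff_diff c1 c2[unfolded i(1)] c3 c4 ..
  then show ?thesis unfolding i(2) by (simp only: left_diff_distrib mult_ac)
 qed
 have "of_nat (b3 - 1) - of_nat a ~= (0 :: complex)" using b_le_a(3) by simp
 then have nz: "coeff wronskian (a + (b3 - 1) - 1) ~= 0" unfolding top
  using degree_p1(2) degree_p3(2) by (simp only: mult_eq_0_iff leading_coeff_0_iff) blast
 have deg: "degree wronskian <= a + (b3 - 1) - 1"
 proof -
  have "degree (p1 * pderiv p3) <= a + (b3 - 1) - 1"
  proof (cases "b3 - 1")
   case 0 then have "pderiv p3 = 0" using degree_p3 by (simp add: pderiv_eq_0_iff)
   then show ?thesis by simp
  next
   case (Suc j)
   then show ?thesis using degree_mult_le[of p1 "pderiv p3"] degree_p1 degree_p3 by (simp add: degree_pderiv)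
  qed
  moreover have "degree (pderiv p1 * p3) <= a + (b3 - 1) - 1"
   using degree_mult_le[of "pderiv p1" p3] degree_p1 degree_p3 a_pos by (simp add: degree_pderiv)
  ultimately show ?thesis unfolding wronskian_def by (rule degree_diff_le)
 qed
 have K0: "K ~= 0" using nz K by auto
 have "degree wronskian = (m1 - 1) + (m2 - 1) + degree K"
  unfolding K using K0 by (simp add: degree_mult_eq degree_power_eq)
 then have "degree K = 0" using deg m_eq b_pos a_eq by (simp add: m1_def m2_def)
 then obtain u where u: "K = [:u:]" "u ~= 0" using K0 by (metis degree_eq_zeroE pCons_0_0)
 show "t ~= 0 ==> t ~= 1 ==> poly wronskian t ~= 0" by (simp add: K u)
qed

lemma special_values: "poly p1 0 = 0" "poly p2 1 = 0" "poly p3 0 ~= 0" "poly p3 1 ~= 0"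
proof -
 show "poly p1 0 = 0" "poly p2 1 = 0" using m_eq by (simp_all add: p1_factor p2_factor)
 have "poly p3 0 = - neg_binom 1 b2 (b3 - 1)"
  using degree_sum_monom(3) by (simp add: p3_def poly_0_coeff_0 coeff_sum)
 then show "poly p3 0 ~= 0" using neg_binom_nonzero[of 1 b2] b_pos by simp
 \<comment> \<open>At \<open>t = 1\<close> the factor \<open>(x - 1)^b2\<close> cancels, and the
   residue at 0 is one binomial coefficient up to sign. \<open>neg_binom 0 1\<close> stands for the
   denominator that has disappeared, so that the general residue formula still applies.\<close>
 have nb: "neg_binom 0 1 j = (if j = 0 then 1 else 0)" for j by (simp add: neg_binom_def)
 have ab: "b2 + (a - b2) = a" "b1 - 1 <= a - b2" using a_eq b_pos by auto
 have eq: "normal_coeff a b1 b2 1 1 x = ((- 1) + 1 * x) ^ (a - b2) / ((1 - 0 * x) ^ 1 * x ^ Suc (b1 - 1))"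
  if "x ~= 1" for x
 proof -
  have "(x - 1) ^ a = (x - 1) ^ b2 * (x - 1) ^ (a - b2)" using ab by (simp add: power_add[symmetric])
  then show ?thesis using that b_pos by (simp add: normal_coeff_def)
 qed
 have "\<forall>\<^sub>F x in at 0. x ~= (1 :: complex)"
  by (rule eventually_at_in_open'[of "- {1}", THEN eventually_mono]) auto
 then have "poly p1 1 = residue (%x. ((- 1) + 1 * x) ^ (a - b2) / ((1 - 0 * x) ^ 1 * x ^ Suc (b1 - 1))) 0"
  unfolding poly_p1 by (intro residue_cong) (auto simp: eq elim!: eventually_mono)
 also have "\<dots> = (\<Sum>k\<le>b1 - 1. of_nat ((a - b2) choose k) * 1 ^ k * (- 1) ^ (a - b2 - k) * neg_binom 0 1 (b1 - 1 - k))"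
  by (rule residue_linear_power_quotient) simp
 also have "\<dots> = (\<Sum>k\<le>b1 - 1. if k = b1 - 1 then of_nat ((a - b2) choose k) * (- 1) ^ (a - b2 - k) else 0)"
  by (rule sum.cong) (auto simp: nb simp del: One_nat_def)
 also have "\<dots> = of_nat ((a - b2) choose (b1 - 1)) * (- 1) ^ (a - b2 - (b1 - 1))" by simp
 finally have "poly p1 1 ~= 0" using ab by simp
 then show "poly p3 1 ~= 0" using sum_zero_poly[of 1] \<open>poly p2 1 = 0\<close> by auto
qed

end

section \<open>Covers of the plane punctured at 0 and 1\<close>

text \<open>A local homeomorphism need not be a covering; the constant fiber size makes it one.
  Small disjoint neighbourhoods of the \<open>n\<close> preimages already supply \<open>n\<close>
  points over every nearby value, so no further sheet fits in.\<close>

lemma covering_space_finite_fibers: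
 assumes S: "open S" and f: "f holomorphic_on S" and f': "\<And>t. t \<in> S ==> deriv f t ~= 0"
  and B: "open B" "f ` S <= B" and n: "n >= 1" "\<And>y. y \<in> B ==> card {t \<in> S. f t = y} = n"
 shows "covering_space S f B"
proof
 have fin: "finite {t \<in> S. f t = y}" if "y \<in> B" for y
  by (rule card_ge_0_finite) (use n(1) n(2)[OF that] in simp)
 show contf: "continuous_on S f" using f holomorphic_on_imp_continuous_on by blast
 show "f ` S = B"
 proof
  show "B <= f ` S"
  proof
   fix y assume "y \<in> B"
   then have "card {t \<in> S. f t = y} ~= 0" using n by simp
   then have "{t \<in> S. f t = y} ~= {}" by (metis card.empty)
   then show "y \<in> f ` S" by blast
  qed
 qed (rule B(2))
 fix y assume y: "y \<in> B"
 define F where "F = {t \<in> S. f t = y}"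
 have F: "finite F" "card F = n" using fin[OF y] n(2)[OF y] by (auto simp: F_def)
 have "\<exists>r>0. ball t r <= S & inj_on f (ball t r)" if "t \<in> F" for t
  using has_complex_derivative_locally_injective[OF f, of t] that f' S unfolding F_def by blast
 then obtain r where r: "\<And>t. t \<in> F ==> r t > 0 & ball t (r t) <= S & inj_on f (ball t (r t))"
  by metis
 have "\<exists>d>0. \<forall>s\<in>F. s ~= t --> d <= dist t s" for t using finite_set_avoid[OF F(1)] by blast
 then obtain d0 where d0: "\<And>t. d0 t > 0" "\<And>s t. s \<in> F ==> s ~= t ==> d0 t <= dist t s" by metis
 define d where "d = Min (d0 ` F)"
 have Fne: "F ~= {}" using F n(1) by auto
 have d: "d > 0" "\<And>s t. s \<in> F ==> t \<in> F ==> s ~= t ==> dist s t >= d"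
 proof -
  show "d > 0" unfolding d_def using d0(1) F(1) Fne by (subst Min_gr_iff) auto
  fix s t assume "s \<in> F" "t \<in> F" "s ~= t"
  then have "d <= d0 s" "d0 s <= dist s t" unfolding d_def using F(1) d0(2)[of t s] by auto
  then show "dist s t >= d" by simp
 qed
 define U where "U t = ball t (min (r t) (d / 2))" for t
 have Usub: "U t <= S" "inj_on f (U t)" "t \<in> U t" "open (U t)" if "t \<in> F" for t
 proof -
  have s: "U t <= ball t (r t)" by (auto simp: U_def)
  then show "U t <= S" "inj_on f (U t)" using r[OF that] inj_on_subset by blast+
  show "t \<in> U t" "open (U t)" using r[OF that] d(1) by (auto simp: U_def)
 qed
 have Udisj: "U s \<inter> U t = {}" if "s \<in> F" "t \<in> F" "s ~= t" for s t
 proof (rule equals0I)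
  fix x assume "x \<in> U s \<inter> U t"
  then have "dist s x < d / 2" "dist t x < d / 2" by (auto simp: U_def)
  then have "dist s t < d" using dist_triangle_half_r[of x s d t] by (simp add: dist_commute)
  then show False using d(2)[OF that] by simp
 qed
 have fU: "open (f ` V)" if "t \<in> F" "V <= U t" "open V" for t V
  using open_mapping_thm3[of f V] that Usub[OF that(1)] f
  by (meson holomorphic_on_subset inj_on_subset order_trans)
 define T where "T = B \<inter> (\<Inter>t\<in>F. f ` U t)"
 have oT: "open T" unfolding T_def
 proof (intro open_Int B(1) open_INT F(1) ballI)
  fix t assume t: "t \<in> F"
  show "open (f ` U t)" by (rule fU[OF t order_refl Usub(4)[OF t]])
 qed
 have yT: "y \<in> T" unfolding T_def using y Usub(3) by (auto simp: F_def)
 have "\<exists>v. \<Union>v = S \<inter> f -` T & (\<forall>u\<in>v. openin (top_of_set S) u) & pairwise disjnt v \<and>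
   (\<forall>u\<in>v. \<exists>q. homeomorphism u T f q)"
 proof (intro exI[of _ "(%t. U t \<inter> f -` T) ` F"] conjI ballI)
  show "\<Union> ((%t. U t \<inter> f -` T) ` F) = S \<inter> f -` T"
  proof
   show "\<Union> ((%t. U t \<inter> f -` T) ` F) <= S \<inter> f -` T" using Usub(1) by blast
   show "S \<inter> f -` T <= \<Union> ((%t. U t \<inter> f -` T) ` F)"
   proof
    fix s assume s: "s \<in> S \<inter> f -` T"
    \<comment> \<open>A point over \<open>f s\<close> is chosen in each neighbourhood. These are
      \<open>n\<close> different points, hence the whole fiber, and \<open>s\<close> is one of
      them.\<close>
    then have "\<forall>t\<in>F. \<exists>u\<in>U t. f u = f s" unfolding T_def by force
    then obtain g where g: "\<And>t. t \<in> F ==> g t \<in> U t & f (g t) = f s" by metis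
    have "inj_on g F"
    proof (rule inj_onI)
     fix t t' assume "t \<in> F" "t' \<in> F" "g t = g t'"
     then show "t = t'" using g[of t] g[of t'] Udisj[of t t'] by auto
    qed
    then have "card (g ` F) = n" using F by (simp add: card_image)
    moreover have "g ` F <= {t \<in> S. f t = f s}" using g Usub(1) by blast
    moreover have "f s \<in> B" using s by (simp add: T_def)
    ultimately have "g ` F = {t \<in> S. f t = f s}" using card_subset_eq[OF fin] n(2) by simp
    moreover have "s \<in> {t \<in> S. f t = f s}" using s by simp
    ultimately have "s \<in> g ` F" by simp
    then obtain t where t: "t \<in> F" "s = g t" by (elim imageE) simp
    then have "s \<in> U t \<inter> f -` T" using g[OF t(1)] s by simp
    then show "s \<in> \<Union> ((%t. U t \<inter> f -` T) ` F)" by (rule UN_I[OF t(1)])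
   qed
  qed
  show "pairwise disjnt ((%t. U t \<inter> f -` T) ` F)"
   unfolding pairwise_def disjnt_def using Udisj by blast
  fix u assume "u \<in> (%t. U t \<inter> f -` T) ` F"
  then obtain t where t: "t \<in> F" "u = U t \<inter> f -` T" by blast
  have ou: "open u" unfolding t(2)
   by (rule continuous_open_preimage[OF continuous_on_subset[OF contf Usub(1)[OF t(1)]] Usub(4)[OF t(1)] oT])
  moreover have uS: "u <= S" using t Usub(1) by blast
  ultimately show "openin (top_of_set S) u" by (rule open_subset[rotated])
  have inj: "inj_on f u" using Usub(2)[OF t(1)] t(2) by (auto intro: inj_on_subset)
  have "f ` u = T" using t T_def by blast
  moreover have "openin (top_of_set T) (f ` V)" if V: "openin (top_of_set u) V" for V
  proof -
   have "open V" "V <= u" using V ou by (auto simp: openin_open_eq)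
   then have "open (f ` V)" using fU[OF t(1)] t(2) by blast
   moreover have "f ` V <= T" using \<open>V <= u\<close> t(2) by blast
   ultimately show ?thesis by (rule open_subset[rotated])
  qed
  ultimately show "\<exists>q. homeomorphism u T f q"
   using homeomorphism_injective_open_map[OF continuous_on_subset[OF contf uS], of T] inj by metis
 qed
 then show "\<exists>T. y \<in> T & openin (top_of_set B) T & (\<exists>v. \<Union>v = S \<inter> f -` T \<and>
   (\<forall>u\<in>v. openin (top_of_set S) u) & pairwise disjnt v & (\<forall>u\<in>v. \<exists>q. homeomorphism u T f q))"
  using yT open_subset[OF _ oT, of B] T_def by (intro exI[of _ T]) auto
qed

section \<open>Cut planes and labels of the sheets\<close>

definition cut_plane :: "real set => complex set" where
 "cut_plane I = {z. Im z ~= 0 \<or> Re z \<in> I}"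

lemma open_cut_plane: "open I ==> open (cut_plane I)"
proof -
 assume I: "open I"
 have "cut_plane I = Im -` (- {0}) \<union> Re -` I" by (auto simp: cut_plane_def)
 moreover have "open (Im -` (- {0}))" "open (Re -` I)"
  using I by (auto intro!: open_vimage continuous_intros simp del: vimage_Compl)
 ultimately show ?thesis by (simp only: open_Un)
qed

lemma starlike_cut_plane:
 assumes "convex I" "x \<in> I" shows "starlike (cut_plane I)"
 unfolding starlike_def
proof (intro bexI ballI subsetI)
 show "of_real x \<in> cut_plane I" using assms by (simp add: cut_plane_def)
 fix z w assume z: "z \<in> cut_plane I" and "w \<in> closed_segment (of_real x) z"
 then obtain u where u: "0 <= u" "u <= 1" "w = (1 - u) *\<^sub>R of_real x + u *\<^sub>R z"
  by (auto simp: closed_segment_def)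
 show "w \<in> cut_plane I"
 proof (cases "u = 0 \<or> Im z = 0")
  case False then show ?thesis using u by (simp add: cut_plane_def)
 next
  case True
  have "Re w = (1 - u) *\<^sub>R x + u *\<^sub>R Re z" using u by simp
  moreover have "u ~= 0 ==> Re z \<in> I" using True z by (auto simp: cut_plane_def)
  ultimately have "Re w \<in> I"
   using convexD[OF assms(1,2), of "Re z" "1 - u" u] assms(2) u by (cases "u = 0") auto
  then show ?thesis by (simp add: cut_plane_def)
 qed
qed

text \<open>0 and 1 divide the real line into three open intervals, and \<open>sector k\<close>
  joins the two open half planes through the \<open>k\<close>-th of them. These three simply
  connected sets cover the punctured plane.\<close>

definition side :: "nat => real set" where
 "side k = (if k = 0 then {..<0} else if k = 1 then {0<..<1} else {1<..})"

abbreviation sector :: "nat => complex set" where "sector k \<equiv> cut_plane (side k)"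

lemma side: "open (side k)" "convex (side k)" "side k ~= {}"
 by (auto simp: side_def convex_real_interval)
  (metis empty_iff greaterThanLessThan_empty_iff greaterThanLessThan_iff not_one_le_zero)?

lemma sector: "open (sector k)" "simply_connected (sector k)" "path_connected (sector k)"
 "locally path_connected (sector k)" "\<i> \<in> sector k" "- \<i> \<in> sector k" "sector k <= - {0, 1}"
proof -
 obtain x where "x \<in> side k" using side(3) by blast
 then have st: "starlike (sector k)" using starlike_cut_plane side(2) by blast
 show o: "open (sector k)" by (rule open_cut_plane[OF side(1)])
 show sc: "simply_connected (sector k)" by (rule starlike_imp_simply_connected[OF st])
 show "path_connected (sector k)" by (rule simply_connected_imp_path_connected[OF sc])
 show "locally path_connected (sector k)" by (rule open_imp_locally_path_connected[OF o])
 show "\<i> \<in> sector k" "- \<i> \<in> sector k" "sector k <= - {0, 1}"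
  by (auto simp: cut_plane_def side_def split: if_splits)
qed

lemma sector_cover: "z \<notin> {0, 1} ==> \<exists>k\<in>{0, 1, 2}. z \<in> sector k"
proof -
 assume z: "z \<notin> {0, 1}"
 consider "Im z ~= 0" | "Im z = 0" "Re z < 0" | "Im z = 0" "0 < Re z" "Re z < 1" | "Im z = 0" "Re z > 1"
  using z by (metis complex_eqI insertI1 insertI2 linorder_neqE_linordered_idom one_complex.sel zero_complex.sel)
 then show ?thesis by cases (auto simp: cut_plane_def side_def)
qed

text \<open>Different sectors meet only off the real line, so their labels need to be compared over
  the two half planes only.\<close>

lemma sector_overlap: "z \<in> sector j ==> z \<in> sector k ==> Im z = 0 ==> j \<in> {0, 1, 2} ==> k \<in> {0, 1, 2} ==> j = k"
 by (auto simp: cut_plane_def side_def split: if_splits)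

locale punctured_cover =
 fixes S :: "complex set" and f :: "complex => complex" and n :: nat
 assumes S: "open S" "path_connected S" and holo: "f holomorphic_on S"
  and deriv_nz: "\<And>t. t \<in> S ==> deriv f t ~= 0" and range: "f ` S <= - {0, 1}" and n: "n >= 1"
  and card_fiber: "\<And>y. y \<notin> {0, 1} ==> card {t \<in> S. f t = y} = n"
begin

lemma cover: "covering_space S f (- {0, 1})"
 by (rule covering_space_finite_fibers[OF S(1) holo deriv_nz _ range n]) (auto simp: card_fiber open_Compl)

lemma contf: "continuous_on S f" using holo holomorphic_on_imp_continuous_on by blast

abbreviation "fiber y \<equiv> {t \<in> S. f t = y}"

lemma finite_fiber: "y \<notin> {0, 1} ==> finite (fiber y)"
 by (rule card_ge_0_finite) (use n card_fiber[of y] in simp)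

lemma lift_path:
 assumes "path g" "path_image g <= - {0, 1}" "t \<in> S" "f t = g 0"
 obtains h where "path h" "path_image h <= S" "h 0 = t" "\<And>x. x \<in> {0..1} ==> f (h x) = g x"
 using covering_space_lift_path_strong[OF cover assms(3,1,2)] assms(4) by (metis pathstart_def)

lemma connect_halfplane:
 assumes t: "t \<in> S" "f t \<in> H" and H: "convex H" "H <= - {0, 1}" "z \<in> H"
 obtains T t' where "connected T" "T <= S" "f ` T <= H" "t \<in> T" "t' \<in> T" "f t' = z"
proof -
 have im: "path_image (linepath (f t) z) <= H"
  using H t by (simp add: closed_segment_subset)
 have im01: "path_image (linepath (f t) z) <= - {0, 1}" using im H(2) by (rule order_trans)
 obtain h where h: "path h" "path_image h <= S" "h 0 = t" "\<forall>x\<in>{0..1}. f (h x) = linepath (f t) z x"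
  by (rule lift_path[OF path_linepath im01 t(1)]) (auto simp: linepath_0')
 show ?thesis
 proof (rule that)
  show "connected (path_image h)" by (rule connected_path_image[OF h(1)])
  show "f ` path_image h <= H" using h(4) im by (auto simp: path_image_def)
  show "t \<in> path_image h" using h(3) by (metis pathstart_def pathstart_in_path_image)
  show "h 1 \<in> path_image h" by (metis pathfinish_def pathfinish_in_path_image)
  show "f (h 1) = z" using bspec[OF h(4), of 1] by (simp add: linepath_def)
 qed (rule h(2))
qed

text \<open>Over a simply connected sector there is a section through each point above
  \<open>\<i>\<close>, and a sheet is labelled by the point where its section passes over
  \<open>\<i>\<close>. Every sector contains \<open>\<i>\<close>, which makes the labels of
  different sectors comparable.\<close>

lemma sector_label:
 obtains L :: "complex => complex" where
  "\<And>y. y \<in> sector k ==> bij_betw L (fiber y) (fiber \<i>)"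
  "\<And>T t t'. connected T ==> T <= S ==> f ` T <= sector k ==> t \<in> T ==> t' \<in> T ==> L t = L t'"
  "\<And>e. e \<in> fiber \<i> ==> L e = e"
proof -
 let ?U = "sector k" and ?F = "fiber \<i>"
 have "\<exists>s::complex => complex. continuous_on ?U s & s \<in> ?U \<rightarrow> S & s \<i> = e & (\<forall>y\<in>?U. f (s y) = y)" if "e \<in> ?F" for e
 proof -
  have e: "e \<in> S" "\<i> = f e" using that by auto
  have fim: "(%x. x) \<in> ?U \<rightarrow> - {0, 1}" using sector(7) by blast
  show ?thesis
   using covering_space_lift_strong[OF cover e(1) sector(5,2,4) continuous_on_id fim e(2)] by metis
 qed
 then obtain s where s: "\<And>e. e \<in> ?F ==> continuous_on ?U (s e) & s e \<in> ?U \<rightarrow> S & s e \<i> = e & (\<forall>y\<in>?U. f (s e y) = y)"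
  by metis
 have s_inj: "e = e'" if "e \<in> ?F" "e' \<in> ?F" "y \<in> ?U" "s e y = s e' y" for e e' y
 proof -
  have conn: "connected ?U" by (rule path_connected_imp_connected[OF sector(3)])
  have id: "(%x. x) \<in> ?U \<rightarrow> - {0, 1}" using sector(7) by blast
  note s1 = s[OF that(1)] and s2 = s[OF that(2)]
  have "s e \<i> = s e' \<i>"
   by (rule covering_space_lift_unique[OF cover, of "s e" y "s e'" ?U "%x. x" \<i>, OF that(4)])
    (use s1 s2 conn id that(3) sector(5) in simp_all)
  then show ?thesis using s that by simp
 qed
 have onto: "(%e. s e y) ` ?F = fiber y" if y: "y \<in> ?U" for y
 proof (rule card_subset_eq)
  have y01: "y \<notin> {0, 1}" using y sector(7) by blast
  show "finite (fiber y)" by (rule finite_fiber[OF y01])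
  show "(%e. s e y) ` ?F <= fiber y" using s y by (auto simp: Pi_iff)
  have "card ((%e. s e y) ` ?F) = card ?F" using s_inj y by (intro card_image inj_onI) blast
  moreover have "card ?F = n" using card_fiber[of \<i>] by simp
  ultimately show "card ((%e. s e y) ` ?F) = card (fiber y)" using card_fiber[OF y01] by simp
 qed
 define L where "L t = (THE e. e \<in> ?F & s e (f t) = t)" for t
 have L: "L t \<in> ?F" "s (L t) (f t) = t" "\<And>e. e \<in> ?F ==> s e (f t) = t ==> L t = e"
  if t: "t \<in> S" "f t \<in> ?U" for t
 proof -
  have "t \<in> (%e. s e (f t)) ` ?F" using onto[OF t(2)] t(1) by simp
  then obtain e where e: "e \<in> ?F" "s e (f t) = t" by (elim imageE) auto
  have "e' = e" if "e' \<in> ?F & s e' (f t) = t" for e' using s_inj[of e' e "f t"] that e t by simp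
  then have "L t = e" unfolding L_def using e by (intro the_equality) auto
  then show "L t \<in> ?F" "s (L t) (f t) = t" using e by auto
  show "\<And>e. e \<in> ?F ==> s e (f t) = t ==> L t = e"
   using s_inj[of _ "L t" "f t"] \<open>L t \<in> ?F\<close> \<open>s (L t) (f t) = t\<close> t by metis
 qed
 show ?thesis
 proof (rule that[of L])
  fix y assume y: "y \<in> ?U"
  show "bij_betw L (fiber y) (fiber \<i>)"
  proof (rule bij_betw_byWitness[where f' = "%e. s e y"])
   show "\<forall>t\<in>fiber y. s (L t) y = t" using L(2) y by auto
   show "\<forall>e\<in>fiber \<i>. L (s e y) = e" using L(3) s y by (auto simp: Pi_iff)
   show "L ` fiber y <= fiber \<i>" using L(1) y by blast
   show "(%e. s e y) ` fiber \<i> <= fiber y" using onto[OF y] by blast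
  qed
 next
  fix e assume "e \<in> fiber \<i>" then show "L e = e" using L(3) s sector(5) by auto
 next
  fix T t t' assume T: "connected T" "T <= S" "f ` T <= ?U" "t \<in> T" "t' \<in> T"
  define A where "A e = {x \<in> T. s e (f x) = x}" for e
  have cl: "closedin (top_of_set T) (A e)" if "e \<in> ?F" for e
  proof -
   have "continuous_on (f ` T) (s e)" using s[OF that] T(3) continuous_on_subset by blast
   then have "continuous_on T (%x. s e (f x))"
    using continuous_on_compose[of T f "s e"] continuous_on_subset[OF contf T(2)] by (simp add: o_def)
   then have "continuous_on T (%x. s e (f x) - x)" by (intro continuous_intros)
   from continuous_closedin_preimage_constant[OF this, of 0] show ?thesis by (simp add: A_def)
  qed
  have TS: "x \<in> S" "f x \<in> ?U" if "x \<in> T" for x using T that by auto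
  have Aiff: "x \<in> A e \<longleftrightarrow> x \<in> T & L x = e" if "e \<in> ?F" for x e
  proof (cases "x \<in> T")
   case True
   show ?thesis using L(2)[OF TS[OF True]] L(3)[OF TS[OF True] that] True by (auto simp: A_def)
  qed (simp add: A_def)
  have LF: "L x \<in> ?F" if "x \<in> T" for x by (rule L(1)[OF TS(1)[OF that] TS(2)[OF that]])
  \<comment> \<open>The sets on which the label is constant are finitely many, closed and disjoint,
    so each is also open in the connected set \<open>T\<close>.\<close>
  have "T - A (L t) = \<Union> (A ` (?F - {L t}))"
  proof
   show "T - A (L t) <= \<Union> (A ` (?F - {L t}))"
   proof
    fix x assume x: "x \<in> T - A (L t)"
    then have "x \<in> A (L x)" "L x \<in> ?F - {L t}" using Aiff[OF LF[OF T(4)]] Aiff[OF LF[of x]] LF[of x] by auto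
    then show "x \<in> \<Union> (A ` (?F - {L t}))" by (rule UN_I[rotated])
   qed
   show "\<Union> (A ` (?F - {L t})) <= T - A (L t)"
   proof
    fix x assume "x \<in> \<Union> (A ` (?F - {L t}))"
    then obtain e where e: "e \<in> ?F - {L t}" "x \<in> A e" by (elim UN_E)
    then have "x \<in> T" "L x = e" using Aiff[of e x] by simp_all
    then show "x \<in> T - A (L t)" using e Aiff[OF LF[OF T(4)]] by simp
   qed
  qed
  moreover have "closedin (top_of_set T) (\<Union> (A ` (?F - {L t})))"
   by (rule closedin_Union) (use cl finite_fiber[of \<i>] in auto)
  ultimately have "closedin (top_of_set T) (T - A (L t))" by simp
  moreover have AT: "A (L t) <= T" by (auto simp: A_def)
  ultimately have "openin (top_of_set T) (A (L t))"
   by (simp add: openin_closedin_eq)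
  moreover have "closedin (top_of_set T) (A (L t))" by (rule cl[OF LF[OF T(4)]])
  ultimately have "A (L t) = {} \<or> A (L t) = T" using T(1) by (simp add: connected_clopen)
  moreover have "t \<in> A (L t)" using Aiff[OF LF[OF T(4)]] T(4) by simp
  ultimately have "t' \<in> A (L t)" using T(5) by auto
  then show "L t = L t'" using Aiff[OF LF[OF T(4)]] by simp
 qed
qed

end

text \<open>The labels of the sectors coincide over the upper half plane, and \<open>c k\<close>
  measures their discrepancy over the lower one on passing to the next sector. The two sectors
  concerned are separated on the real line by 0, 1 and infinity for \<open>k = 0, 1, 2\<close>, so
  \<open>c k\<close> is the local monodromy at that point.\<close>

locale labelled_cover = punctured_cover S f n for S f n +
 fixes lab :: "nat => complex => nat" and c :: "nat => nat => nat"
 assumes label_bij: "\<And>k y. y \<in> sector k ==> bij_betw (lab k) (fiber y) {1..n}"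
  and label_const: "\<And>k T t t'. connected T ==> T <= S ==> f ` T <= sector k ==> t \<in> T ==> t' \<in> T ==> lab k t = lab k t'"
  and label_up: "\<And>j k t. t \<in> S ==> Im (f t) > 0 ==> lab j t = lab k t"
  and c_permutes: "\<And>k. c k permutes {1..n}"
  and label_down: "\<And>t. t \<in> S ==> Im (f t) < 0 ==> lab 1 t = c 0 (lab 0 t)"
   "\<And>t. t \<in> S ==> Im (f t) < 0 ==> lab 2 t = c 1 (lab 1 t)"
   "\<And>t. t \<in> S ==> Im (f t) < 0 ==> lab 0 t = c 2 (lab 2 t)"

lemma (in punctured_cover) exists_labelled_cover: "\<exists>lab c. labelled_cover S f n lab c"
proof -
 have "\<exists>L :: complex => complex. (\<forall>y\<in>sector k. bij_betw L (fiber y) (fiber \<i>)) \<and>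
   (\<forall>T t t'. connected T --> T <= S --> f ` T <= sector k --> t \<in> T --> t' \<in> T --> L t = L t') \<and>
   (\<forall>e\<in>fiber \<i>. L e = e)" for k
 proof -
  obtain L :: "complex => complex" where L: "\<And>y. y \<in> sector k ==> bij_betw L (fiber y) (fiber \<i>)"
   "\<And>T t t'. connected T ==> T <= S ==> f ` T <= sector k ==> t \<in> T ==> t' \<in> T ==> L t = L t'"
   "\<And>e. e \<in> fiber \<i> ==> L e = e"
   using sector_label[of k] by blast
  show ?thesis by (intro exI[of _ L] conjI allI impI ballI) (rule L; assumption)+
 qed
 then have "\<exists>L :: nat => complex => complex. \<forall>k. (\<forall>y\<in>sector k. bij_betw (L k) (fiber y) (fiber \<i>)) \<and>
   (\<forall>T t t'. connected T --> T <= S --> f ` T <= sector k --> t \<in> T --> t' \<in> T --> L k t = L k t') \<and>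
   (\<forall>e\<in>fiber \<i>. L k e = e)"
  by (intro choice allI)
 then obtain L :: "nat => complex => complex" where
  L0: "\<forall>k. (\<forall>y\<in>sector k. bij_betw (L k) (fiber y) (fiber \<i>)) \<and>
   (\<forall>T t t'. connected T --> T <= S --> f ` T <= sector k --> t \<in> T --> t' \<in> T --> L k t = L k t') \<and>
   (\<forall>e\<in>fiber \<i>. L k e = e)"
  by (elim exE)
 have L: "\<And>k y. y \<in> sector k ==> bij_betw (L k) (fiber y) (fiber \<i>)"
  "\<And>k T t t'. connected T ==> T <= S ==> f ` T <= sector k ==> t \<in> T ==> t' \<in> T ==> L k t = L k t'"
  "\<And>k e. e \<in> fiber \<i> ==> L k e = e"
  subgoal for k y by (rule bspec[OF conjunct1[OF spec[OF L0]]])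
  subgoal for k T t t' by (rule conjunct1[OF conjunct2[OF spec[OF L0, of k]], rule_format])
  subgoal for k e by (rule bspec[OF conjunct2[OF conjunct2[OF spec[OF L0]]]])
  done
 have fin: "finite (fiber \<i>)" by (rule finite_fiber) simp
 have "card (fiber \<i>) = card {1..n}" using card_fiber[of \<i>] by simp
 from finite_same_card_bij[OF fin finite_atLeastAtMost this]
 obtain h where h: "bij_betw h (fiber \<i>) {1..n}" by (elim exE)
 define lab where "lab k t = h (L k t)" for k t
 have bij: "bij_betw (lab k) (fiber y) {1..n}" if "y \<in> sector k" for k y
  using bij_betw_trans[OF L(1)[OF that] h] unfolding lab_def by (simp add: o_def)
 \<comment> \<open>The change of labels is read off at the single point \<open>- \<i>\<close>;
   connecting inside the half plane shows that it is the same over all of the lower half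
   plane.\<close>
 define c' where "c' j k e = (if e \<in> {1..n} then lab k (inv_into (fiber (- \<i>)) (lab j) e) else e)" for j k e
 have c'_perm: "c' j k permutes {1..n}" for j k
 proof (rule bij_imp_permutes)
  have "bij_betw (lab k \<circ> inv_into (fiber (- \<i>)) (lab j)) {1..n} {1..n}"
   by (rule bij_betw_trans[OF bij_betw_inv_into[OF bij[OF sector(6)]] bij[OF sector(6)]])
  then show "bij_betw (c' j k) {1..n} {1..n}"
   by (rule bij_betw_cong[THEN iffD1, rotated]) (simp add: c'_def)
  fix x assume "x \<notin> {1..n}"
  then show "c' j k x = x" unfolding c'_def by (rule if_not_P)
 qed
 have down: "lab k t = c' j k (lab j t)" if t: "t \<in> S" "Im (f t) < 0" for j k t
 proof -
  have H: "convex {z. Im z < 0}" "{z. Im z < 0} <= - {0, 1}" "- \<i> \<in> {z. Im z < 0}"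
   by (auto simp: convex_halfspace_Im_lt)
  obtain T t' where T: "connected T" "T <= S" "f ` T <= {z. Im z < 0}" "t \<in> T" "t' \<in> T" "f t' = - \<i>"
   using connect_halfplane[OF t(1) _ H] t(2) by blast
  have sub: "f ` T <= sector m" for m using T(3) by (force simp: cut_plane_def)
  have e: "lab m t = lab m t'" for m unfolding lab_def using L(2)[OF T(1,2) sub T(4,5)] by simp
  have t': "t' \<in> fiber (- \<i>)" using T by auto
  then have "inv_into (fiber (- \<i>)) (lab j) (lab j t') = t'"
   using bij[OF sector(6)] by (meson bij_betw_inv_into_left)
  moreover have "lab j t' \<in> {1..n}" using bij_betwE[OF bij[OF sector(6)]] t' by blast
  ultimately show ?thesis unfolding e by (simp add: c'_def)
 qed
 have up: "lab j t = lab k t" if t: "t \<in> S" "Im (f t) > 0" for j k t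
 proof -
  have H: "convex {z. Im z > 0}" "{z. Im z > 0} <= - {0, 1}" "\<i> \<in> {z. Im z > 0}"
   by (auto simp: convex_halfspace_Im_gt)
  obtain T t' where T: "connected T" "T <= S" "f ` T <= {z. Im z > 0}" "t \<in> T" "t' \<in> T" "f t' = \<i>"
   using connect_halfplane[OF t(1) _ H] t(2) by blast
  have sub: "f ` T <= sector m" for m using T(3) by (force simp: cut_plane_def)
  have t': "t' \<in> fiber \<i>" using T by auto
  have "L m t = t'" for m using L(2)[OF T(1,2) sub T(4,5)] L(3)[OF t'] by simp
  then show ?thesis by (simp add: lab_def)
 qed
 have "labelled_cover S f n lab (%k. c' k (if k = 2 then 0 else k + 1))"
 proof (unfold_locales, goal_cases)
  case (1 k y) then show ?case by (rule bij)
 next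
  case (2 k T t t') then show ?case unfolding lab_def using L(2) by metis
 next
  case (3 j k t) then show ?case using up by blast
 next
  case (4 k) show ?case by (rule c'_perm)
 next
  case (5 t) then show ?case using down[of t 1 0] by simp
 next
  case (6 t) then show ?case using down[of t 2 1] by (simp add: numeral_2_eq_2)
 next
  case (7 t) then show ?case using down[of t 0 2] by simp
 qed
 then show ?thesis by blast
qed

context labelled_cover
begin

abbreviation "G \<equiv> generate (sym_group n) {c 0, c 1, c 2}"

sublocale perm_group n G
 by (rule perm_group_generate) (use c_permutes in auto)

lemma c_mem: "c 0 \<in> G" "c 1 \<in> G" "c 2 \<in> G" by (auto intro: generate.incl)

text \<open>Passing through the three sectors in turn leads back to the first labelling.\<close>

lemma c_prod: "c 2 (c 1 (c 0 x)) = x"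
proof (cases "x \<in> {1..n}")
 case True
 then obtain t where t: "t \<in> fiber (- \<i>)" "lab 0 t = x"
  using bij_betw_imp_surj_on[OF label_bij[OF sector(6), of 0]] True by (metis (no_types, lifting) imageE)
 then have d: "t \<in> S" "Im (f t) < 0" by auto
 show ?thesis using label_down[OF d] t(2) by simp
next
 case False
 then show ?thesis using permutes_not_in[OF c_permutes False] by simp
qed

lemma label_change:
 assumes y: "y \<in> sector j" "y \<in> sector k" and jk: "j \<in> {0, 1, 2}" "k \<in> {0, 1, 2}"
 shows "\<exists>g\<in>G. \<forall>t\<in>fiber y. lab k t = g (lab j t)"
proof -
 consider "Im y > 0" | "Im y = 0" | "Im y < 0" by linarith
 then show ?thesis
 proof cases
  case 1
  then have "\<forall>t\<in>fiber y. lab k t = id (lab j t)" using label_up by auto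
  then show ?thesis using id_mem by blast
 next
  case 2
  then have "j = k" using sector_overlap[OF y 2 jk] by simp
  then have "\<forall>t\<in>fiber y. lab k t = id (lab j t)" by simp
  then show ?thesis using id_mem by blast
 next
  case 3
  have d: "lab 1 t = c 0 (lab 0 t)" "lab 2 t = c 1 (lab 1 t)" "lab 0 t = c 2 (lab 2 t)" if "t \<in> fiber y" for t
   using label_down[of t] that 3 by auto
  have ex: "\<exists>g\<in>G. \<forall>t\<in>fiber y. lab k t = g (lab 0 t)" "\<exists>g\<in>G. \<forall>t\<in>fiber y. lab 0 t = g (lab k t)"
   if k: "k \<in> {0, 1, 2}" for k
  proof -
   consider "k = 0" | "k = 1" | "k = 2" using k by auto
   then have "(\<exists>g\<in>G. \<forall>t\<in>fiber y. lab k t = g (lab 0 t)) & (\<exists>g\<in>G. \<forall>t\<in>fiber y. lab 0 t = g (lab k t))"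
   proof cases
    case 1
    show ?thesis unfolding 1 by (intro conjI bexI[OF _ id_mem]) auto
   next
    case 2
    have "\<forall>t\<in>fiber y. lab 1 t = c 0 (lab 0 t)" using d(1) by simp
    moreover have "\<forall>t\<in>fiber y. lab 0 t = (c 2 \<circ> c 1) (lab 1 t)" using d(2,3) by simp
    ultimately show ?thesis unfolding 2
     by (intro conjI[OF bexI[OF _ c_mem(1)] bexI[OF _ comp_mem[OF c_mem(3,2)]]])
   next
    case 3
    have "\<forall>t\<in>fiber y. lab 0 t = c 2 (lab 2 t)" using d(3) by simp
    moreover have "\<forall>t\<in>fiber y. lab 2 t = (c 1 \<circ> c 0) (lab 0 t)" using d(1,2) by simp
    ultimately show ?thesis unfolding 3
     by (intro conjI[OF bexI[OF _ comp_mem[OF c_mem(2,1)]] bexI[OF _ c_mem(3)]])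
   qed
   then show "\<exists>g\<in>G. \<forall>t\<in>fiber y. lab k t = g (lab 0 t)" "\<exists>g\<in>G. \<forall>t\<in>fiber y. lab 0 t = g (lab k t)" by blast+
  qed
  obtain g where g: "g \<in> G" "\<forall>t\<in>fiber y. lab k t = g (lab 0 t)" using ex(1)[OF jk(2)] by blast
  obtain h where h: "h \<in> G" "\<forall>t\<in>fiber y. lab 0 t = h (lab j t)" using ex(2)[OF jk(1)] by blast
  show ?thesis
  proof (rule bexI[OF _ comp_mem[OF g(1) h(1)]], rule ballI)
   fix t assume t: "t \<in> fiber y"
   show "lab k t = (g \<circ> h) (lab j t)" using bspec[OF g(2) t] bspec[OF h(2) t] by simp
  qed
 qed
qed

section \<open>Lifted paths and the monodromy of the labels\<close>

definition lift_of :: "(real => complex) => (real => complex) => bool" where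
 "lift_of gm dl \<longleftrightarrow> continuous_on {0..1} dl & (\<forall>x\<in>{0..1}. dl x \<in> S & f (dl x) = gm x)"

lemma exists_lift:
 assumes "path gm" "path_image gm <= - {0, 1}" "t \<in> S" "f t = gm 0"
 obtains dl where "lift_of gm dl" "dl 0 = t"
proof -
 obtain h where h: "path h" "path_image h <= S" "h 0 = t" "\<forall>x\<in>{0..1}. f (h x) = gm x"
  by (rule lift_path[OF assms]) blast
 have "lift_of gm h" using h unfolding lift_of_def path_def path_image_def by blast
 then show ?thesis using that h(3) by blast
qed

text \<open>\<open>R\<close> relates two parameters if labels are transported from one to the other
  by an element of \<open>G\<close>, the same for all lifts. It is an equivalence relation on [0, 1]
  with open classes; connectedness takes the place of a subdivision of the path.\<close>

theorem monodromy_in_group: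
 assumes gm: "path gm" "path_image gm <= - {0, 1}"
  and ends: "gm 0 \<in> sector j" "gm 1 \<in> sector k" "j \<in> {0, 1, 2}" "k \<in> {0, 1, 2}"
 shows "\<exists>g\<in>G. \<forall>dl. lift_of gm dl --> lab k (dl 1) = g (lab j (dl 0))"
proof -
 define R where "R s s' \<longleftrightarrow> (\<forall>j\<in>{0, 1, 2}. \<forall>k\<in>{0, 1, 2}. gm s \<in> sector j --> gm s' \<in> sector k -->
   (\<exists>g\<in>G. \<forall>dl. lift_of gm dl --> lab k (dl s') = g (lab j (dl s))))" for s s'
 have cov: "\<exists>k\<in>{0, 1, 2}. gm s \<in> sector k" if "s \<in> {0..1}" for s
  using sector_cover gm(2) that unfolding path_image_def by blast
 have "R 0 1"
 proof (rule connected_equivalence_relation[of "{0..1::real}"])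
  fix s s' assume R: "R s s'" and s: "s \<in> {0..1}" "s' \<in> {0..1}"
  show "R s' s"
   unfolding R_def
  proof (intro ballI impI)
   fix j k assume jk: "j \<in> {0, 1, 2}" "k \<in> {0, 1, 2 :: nat}" "gm s' \<in> sector j" "gm s \<in> sector k"
   then obtain g where g: "g \<in> G" "\<forall>dl. lift_of gm dl --> lab j (dl s') = g (lab k (dl s))"
    using R unfolding R_def by meson
   show "\<exists>g\<in>G. \<forall>dl. lift_of gm dl --> lab k (dl s) = g (lab j (dl s'))"
    by (rule bexI[OF _ inv_mem[OF g(1)]]) (use g(2) permutes_inverses(2)[OF perm[OF g(1)]] in simp)
  qed
 next
  fix x y z assume R: "R x y" "R y z" and s: "x \<in> {0..1}" "y \<in> {0..1}" "z \<in> {0..1}"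
  show "R x z"
   unfolding R_def
  proof (intro ballI impI)
   fix j k assume jk: "j \<in> {0, 1, 2}" "k \<in> {0, 1, 2 :: nat}" "gm x \<in> sector j" "gm z \<in> sector k"
   obtain i where i: "i \<in> {0, 1, 2}" "gm y \<in> sector i" using cov[OF s(2)] by blast
   obtain g where g: "g \<in> G" "\<forall>dl. lift_of gm dl --> lab i (dl y) = g (lab j (dl x))"
    using R(1) jk i unfolding R_def by meson
   obtain h where h: "h \<in> G" "\<forall>dl. lift_of gm dl --> lab k (dl z) = h (lab i (dl y))"
    using R(2) jk i unfolding R_def by meson
   show "\<exists>g\<in>G. \<forall>dl. lift_of gm dl --> lab k (dl z) = g (lab j (dl x))"
    by (rule bexI[OF _ comp_mem[OF h(1) g(1)]]) (use g(2) h(2) in simp)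
  qed
 next
  fix s :: real assume s: "s \<in> {0..1}"
  obtain i where i: "i \<in> {0, 1, 2}" "gm s \<in> sector i" using cov[OF s] by blast
  have cont: "continuous_on {0..1} gm" using gm(1) by (simp add: path_def)
  have "openin (top_of_set {0..1}) ({0..1} \<inter> gm -` sector i)"
   by (rule continuous_openin_preimage_gen[OF cont sector(1)])
  then have "\<forall>x\<in>{0..1} \<inter> gm -` sector i. \<exists>e>0. ball x e \<inter> {0..1} <= {0..1} \<inter> gm -` sector i"
   unfolding openin_contains_ball by (rule conjunct2)
  moreover have "s \<in> {0..1} \<inter> gm -` sector i" using s i(2) by simp
  ultimately obtain e where e: "e > 0" "ball s e \<inter> {0..1} <= {0..1} \<inter> gm -` sector i"
   by (elim ballE exE conjE) auto
  define T where "T = ball s e \<inter> {0..1}"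
  have T: "s \<in> T" "openin (top_of_set {0..1}) T" "connected T"
  proof -
   show "s \<in> T" using e s by (simp add: T_def)
   have "openin (top_of_set {0..1}) ({0..1} \<inter> ball s e)" by (rule openin_open_Int[OF open_ball])
   then show "openin (top_of_set {0..1}) T" by (simp add: T_def Int_commute)
   show "connected T" unfolding T_def by (intro convex_connected convex_Int convex_ball convex_real_interval)
  qed
  show "\<exists>T. openin (top_of_set {0..1}) T & s \<in> T & (\<forall>x\<in>T. R s x)"
  proof (intro exI[of _ T] conjI T ballI)
   fix x assume x: "x \<in> T"
   have step: "lab i (dl x) = lab i (dl s)" if "lift_of gm dl" for dl
   proof (rule label_const)
    have sub: "T <= {0..1}" by (simp add: T_def)
    show "connected (dl ` T)"
     using that sub T(3) by (intro connected_continuous_image) (auto simp: lift_of_def intro: continuous_on_subset)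
    show "dl ` T <= S" using that sub by (auto simp: lift_of_def)
    show "f ` dl ` T <= sector i" using that e(2) by (auto simp: lift_of_def T_def)
    show "dl x \<in> dl ` T" "dl s \<in> dl ` T" using x T(1) by blast+
   qed
   have x01: "x \<in> {0..1}" "gm x \<in> sector i" using x e(2) unfolding T_def by blast+
   show "R s x"
    unfolding R_def
   proof (intro ballI impI)
    fix j k assume jk: "j \<in> {0, 1, 2}" "k \<in> {0, 1, 2 :: nat}" "gm s \<in> sector j" "gm x \<in> sector k"
    obtain g where g: "g \<in> G" "\<forall>t\<in>fiber (gm s). lab i t = g (lab j t)"
     using label_change[OF jk(3) i(2) jk(1) i(1)] by blast
    obtain h where h: "h \<in> G" "\<forall>t\<in>fiber (gm x). lab k t = h (lab i t)"
     using label_change[OF x01(2) jk(4) i(1) jk(2)] by blast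
    show "\<exists>g\<in>G. \<forall>dl. lift_of gm dl --> lab k (dl x) = g (lab j (dl s))"
    proof (rule bexI[OF _ comp_mem[OF h(1) g(1)]], intro allI impI)
     fix dl assume l: "lift_of gm dl"
     then have "dl x \<in> fiber (gm x)" "dl s \<in> fiber (gm s)" using x01(1) s by (auto simp: lift_of_def)
     then show "lab k (dl x) = (h \<circ> g) (lab j (dl s))" using g(2) h(2) step[OF l] by simp
    qed
   qed
  qed
 qed auto
 then show ?thesis using ends unfolding R_def by meson
qed

text \<open>The labels at the two ends may belong to different sectors, so that half turns can be
  described separately and then composed.\<close>

definition realized :: "complex => nat => complex => nat => (nat => nat) => bool" where
 "realized x j y k g \<longleftrightarrow> (\<exists>gm. path gm & path_image gm <= - {0, 1} & gm 0 = x & gm 1 = y \<and>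
  (\<forall>dl. lift_of gm dl --> lab k (dl 1) = g (lab j (dl 0))))"

lemma realized_sector:
 assumes "x \<in> sector k" "y \<in> sector k" shows "realized x k y k id"
proof -
 obtain gm where gm: "path gm" "path_image gm <= sector k" "pathstart gm = x" "pathfinish gm = y"
  using sector(3)[of k] assms unfolding path_connected_def by blast
 have "lab k (dl 1) = id (lab k (dl 0))" if l: "lift_of gm dl" for dl
 proof -
  have "lab k (dl 1) = lab k (dl 0)"
  proof (rule label_const)
   show "connected (dl ` {0..1})" using l by (intro connected_continuous_image) (auto simp: lift_of_def)
   show "dl ` {0..1} <= S" using l by (auto simp: lift_of_def)
   show "f ` dl ` {0..1} <= sector k" using l gm(2) unfolding path_image_def by (auto simp: lift_of_def)
  qed auto
  then show ?thesis by simp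
 qed
 then show ?thesis unfolding realized_def
  using gm sector(7)[of k] by (intro exI[of _ gm]) (auto simp: pathstart_def pathfinish_def)
qed

lemma realized_comp:
 assumes "realized x i y j g" "realized y j z k h" shows "realized x i z k (h \<circ> g)"
proof -
 obtain gm1 where 1: "path gm1" "path_image gm1 <= - {0, 1}" "gm1 0 = x" "gm1 1 = y"
  "\<And>dl. lift_of gm1 dl ==> lab j (dl 1) = g (lab i (dl 0))" using assms(1) unfolding realized_def by blast
 obtain gm2 where 2: "path gm2" "path_image gm2 <= - {0, 1}" "gm2 0 = y" "gm2 1 = z"
  "\<And>dl. lift_of gm2 dl ==> lab k (dl 1) = h (lab j (dl 0))" using assms(2) unfolding realized_def by blast
 let ?gm = "gm1 +++ gm2"
 have m: "pathfinish gm1 = pathstart gm2" using 1(4) 2(3) by (simp add: pathfinish_def pathstart_def)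
 show ?thesis unfolding realized_def
 proof (intro exI[of _ ?gm] conjI allI impI)
  show "path ?gm" using 1(1) 2(1) m by simp
  show "path_image ?gm <= - {0, 1}" using 1(2) 2(2) m by (simp add: path_image_join)
  show "?gm 0 = x" "?gm 1 = z" using 1(3) 2(4) by (simp_all add: joinpaths_def)
  fix dl assume l: "lift_of ?gm dl"
  have "lift_of gm1 (%s. dl (s / 2))"
   unfolding lift_of_def
  proof (intro conjI ballI)
   show "continuous_on {0..1} (%s. dl (s / 2))"
    by (rule continuous_on_compose2[of "{0..1}" dl]) (use l in \<open>auto simp: lift_of_def intro!: continuous_intros\<close>)
   fix s :: real assume "s \<in> {0..1}"
   then have s: "s / 2 \<in> {0..1}" "s / 2 <= 1 / 2" by auto
   show "dl (s / 2) \<in> S" "f (dl (s / 2)) = gm1 s" using l s by (auto simp: lift_of_def joinpaths_def)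
  qed
  note e1 = 1(5)[OF this]
  have "lift_of gm2 (%s. dl ((s + 1) / 2))"
   unfolding lift_of_def
  proof (intro conjI ballI)
   show "continuous_on {0..1} (%s. dl ((s + 1) / 2))"
    by (rule continuous_on_compose2[of "{0..1}" dl]) (use l in \<open>auto simp: lift_of_def intro!: continuous_intros\<close>)
   fix s :: real assume s01: "s \<in> {0..1}"
   then have s: "(s + 1) / 2 \<in> {0..1}" by auto
   have "?gm ((s + 1) / 2) = gm2 s"
   proof (cases "s = 0")
    case True then show ?thesis using 1(4) 2(3) by (simp add: joinpaths_def)
   next
    case False
    then have "\<not> (s + 1) / 2 <= 1 / 2" "2 * ((s + 1) / 2) - 1 = s" using s01 by (auto simp: field_simps)
    then show ?thesis unfolding joinpaths_def by simp
   qed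
   then show "dl ((s + 1) / 2) \<in> S" "f (dl ((s + 1) / 2)) = gm2 s" using l s by (auto simp: lift_of_def)
  qed
  note e2 = 2(5)[OF this]
  show "lab k (dl 1) = (h \<circ> g) (lab i (dl 0))" using e1 e2 by simp
 qed
qed

lemma realized_inv:
 assumes "realized x j y k g" "g permutes {1..n}" shows "realized y k x j (inv' g)"
proof -
 obtain gm where 1: "path gm" "path_image gm <= - {0, 1}" "gm 0 = x" "gm 1 = y"
  "\<And>dl. lift_of gm dl ==> lab k (dl 1) = g (lab j (dl 0))" using assms(1) unfolding realized_def by blast
 show ?thesis unfolding realized_def
 proof (intro exI[of _ "reversepath gm"] conjI allI impI)
  show "path (reversepath gm)" "path_image (reversepath gm) <= - {0, 1}" using 1 by simp_all
  show "reversepath gm 0 = y" "reversepath gm 1 = x" using 1 by (simp_all add: reversepath_def)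
  fix dl assume l: "lift_of (reversepath gm) dl"
  have "lift_of gm (%s. dl (1 - s))"
   unfolding lift_of_def
  proof (intro conjI ballI)
   show "continuous_on {0..1} (%s. dl (1 - s))"
    by (rule continuous_on_compose2[of "{0..1}" dl]) (use l in \<open>auto simp: lift_of_def intro!: continuous_intros\<close>)
   fix s :: real assume s: "s \<in> {0..1}"
   then have "1 - s \<in> {0..1}" by auto
   then show "dl (1 - s) \<in> S" "f (dl (1 - s)) = gm s" using l by (auto simp: lift_of_def reversepath_def)
  qed
  then have "lab k (dl 0) = g (lab j (dl 1))" using 1(5) by fastforce
  then show "lab j (dl 1) = inv' g (lab k (dl 0))" using permutes_inverses(2)[OF assms(2)] by simp
 qed
qed

lemma realized_change:
 assumes "realized x i y j g" and h: "\<And>t. t \<in> fiber y ==> lab k t = h (lab j t)"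
 shows "realized x i y k (h \<circ> g)"
proof -
 obtain gm where 1: "path gm" "path_image gm <= - {0, 1}" "gm 0 = x" "gm 1 = y"
  "\<And>dl. lift_of gm dl ==> lab j (dl 1) = g (lab i (dl 0))" using assms(1) unfolding realized_def by blast
 have "lab k (dl 1) = (h \<circ> g) (lab i (dl 0))" if "lift_of gm dl" for dl
  using 1(5)[OF that] h[of "dl 1"] that 1(4) by (simp add: lift_of_def)
 then show ?thesis unfolding realized_def using 1 by (intro exI[of _ gm]) simp
qed

text \<open>A generator arises from the loop that goes from \<open>x\<close> to \<open>\<i>\<close>,
  through one sector to \<open>- \<i>\<close>, back through the next sector to \<open>\<i>\<close>,
  and home again; the change of sector at \<open>- \<i>\<close> produces the permutation.\<close>

theorem group_realized:
 assumes g: "g \<in> G" and x: "x \<in> sector k" shows "realized x k x k g"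
proof -
 have xi: "realized x k \<i> k id" "realized \<i> k x k id"
  by (rule realized_sector[OF x sector(5)], rule realized_sector[OF sector(5) x])
 have up: "realized x k \<i> j id" for j
  using realized_change[OF xi(1), of j id] label_up by auto
 have up': "realized \<i> j x k id" for j
 proof -
  have "realized \<i> j \<i> k (id \<circ> id)"
   by (rule realized_change[OF realized_sector[OF sector(5) sector(5)]]) (use label_up in auto)
  from realized_comp[OF this xi(2)] show ?thesis by simp
 qed
 have gen: "realized x k x k s" if "\<And>t. t \<in> fiber (- \<i>) ==> lab j' t = s (lab j t)" for s j j'
 proof -
  have "realized \<i> j (- \<i>) j' (s \<circ> id)"
   by (rule realized_change[OF realized_sector[OF sector(5,6)] that])
  from realized_comp[OF up this] have "realized x k (- \<i>) j' s" by simp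
  from realized_comp[OF this realized_sector[OF sector(6,5)]] have "realized x k \<i> j' s" by simp
  from realized_comp[OF this up'] show ?thesis by simp
 qed
 have c: "realized x k x k (c 0)" "realized x k x k (c 1)" "realized x k x k (c 2)"
  by (rule gen[of 1 _ 0] gen[of 2 _ 1] gen[of 0 _ 2]; rule label_down; simp)+
 show ?thesis using g
 proof induct
  case one show ?case unfolding sym_group_one by (rule realized_sector[OF x x])
 next
  case (incl h) then show ?case using c by auto
 next
  case (inv h)
  then have "h permutes {1..n}" using c_permutes by auto
  moreover from this have "inv\<^bsub>sym_group n\<^esub> h = inv' h"
   by (intro sym_group_inv_equality) (simp add: sym_group_carrier)
  moreover have "realized x k x k h" using inv c by auto
  ultimately show ?case using realized_inv by simp
 next
  case (eng h1 h2) then show ?case unfolding sym_group_mult by (intro realized_comp)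
 qed
qed

text \<open>A path between two points of a fiber, inside the connected set \<open>S\<close>,
  projects to a loop whose monodromy joins their labels.\<close>

lemma G_transitive:
 assumes "x \<in> {1..n}" "y \<in> {1..n}" shows "\<exists>g\<in>G. g x = y"
proof -
 obtain t where t: "t \<in> fiber \<i>" "lab 0 t = x"
  using bij_betw_imp_surj_on[OF label_bij[OF sector(5), of 0]] assms(1) by (metis (no_types, lifting) imageE)
 obtain t' where t': "t' \<in> fiber \<i>" "lab 0 t' = y"
  using bij_betw_imp_surj_on[OF label_bij[OF sector(5), of 0]] assms(2) by (metis (no_types, lifting) imageE)
 obtain p where p: "path p" "path_image p <= S" "pathstart p = t" "pathfinish p = t'"
  using S(2) t t' unfolding path_connected_def by blast
 have l: "lift_of (f \<circ> p) p" using p(1,2) unfolding lift_of_def path_def path_image_def by auto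
 have path: "path (f \<circ> p)"
  by (rule path_continuous_image[OF p(1) continuous_on_subset[OF contf p(2)]])
 have im: "path_image (f \<circ> p) <= - {0, 1}" using p(2) range unfolding path_image_compose by blast
 have e: "(f \<circ> p) 0 = \<i>" "(f \<circ> p) 1 = \<i>" using p t t' by (simp_all add: pathstart_def pathfinish_def)
 have e': "(f \<circ> p) 0 \<in> sector 0" "(f \<circ> p) 1 \<in> sector 0" unfolding e by (rule sector(5))+
 obtain g where g: "g \<in> G" "\<forall>dl. lift_of (f \<circ> p) dl --> lab 0 (dl 1) = g (lab 0 (dl 0))"
  using monodromy_in_group[OF path im e' insertI1 insertI1] by (elim bexE)
 then have "lab 0 (p 1) = g (lab 0 (p 0))" using l by blast
 then have "g x = y" using p(3,4) t t' by (simp add: pathstart_def pathfinish_def)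
 then show ?thesis using g(1) by blast
qed

end

subsection \<open>Ramification\<close>

text \<open>Near \<open>z\<close> the function \<open>h\<close> is an exponential and has an
  \<open>m\<close>-th root \<open>k\<close>. So \<open>F\<close> is the \<open>m\<close>-th power of
  \<open>P w = (w - z) * k w\<close>, which is injective near \<open>z\<close> because its
  derivative there is \<open>k z\<close>; \<open>kp\<close> is the inverse of
  \<open>P\<close>.\<close>

lemma local_root_chart:
 assumes h: "h holomorphic_on ball z r" "r > 0" "h z ~= 0" and m: "m >= 1"
  and F: "\<And>w. w \<in> ball z r ==> F w = (w - z) ^ m * h w" and e: "e > 0"
 obtains et kp where "et > 0" "continuous_on (ball 0 et) kp" "inj_on kp (ball 0 et)"
  "kp ` ball 0 et <= ball z e" "\<And>w. w \<in> ball 0 et ==> F (kp w) = w ^ m"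
  "\<And>w. w \<in> ball 0 et ==> w ~= 0 ==> kp w ~= z"
proof -
 have "continuous_on (ball z r) h" using h(1) by (rule holomorphic_on_imp_continuous_on)
 then obtain d where d: "d > 0" "\<And>w. w \<in> ball z r ==> dist w z < d ==> dist (h w) (h z) < norm (h z)"
  using h(2,3) unfolding continuous_on_iff by (metis centre_in_ball zero_less_norm_iff)
 define r' where "r' = min r (min d e)"
 have r': "r' > 0" "ball z r' <= ball z r" "ball z r' <= ball z e" using d(1) h(2) e by (auto simp: r'_def)
 have nz: "h w ~= 0" if "w \<in> ball z r'" for w
 proof
  assume "h w = 0"
  moreover have "dist (h w) (h z) < norm (h z)" using that by (intro d(2)) (auto simp: r'_def dist_commute)
  ultimately show False by simp
 qed
 have hr': "h holomorphic_on ball z r'" using h(1) r'(2) holomorphic_on_subset by blast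
 obtain g where g: "g holomorphic_on ball z r'" "\<And>w. w \<in> ball z r' ==> h w = exp (g w)"
  using contractible_imp_holomorphic_log[OF hr' convex_imp_contractible[OF convex_ball] nz] by metis
 define k where "k w = exp (g w / of_nat m)" for w
 have km: "k w ^ m = h w" if "w \<in> ball z r'" for w
  using m g(2)[OF that] by (simp add: k_def exp_of_nat_mult[symmetric])
 define P where "P w = (w - z) * k w" for w
 have kh: "k holomorphic_on ball z r'" unfolding k_def using m by (intro holomorphic_intros g(1)) auto
 have Ph: "P holomorphic_on ball z r'" unfolding P_def by (intro holomorphic_intros kh)
 have zb: "z \<in> ball z r'" using r' by simp
 have "(P has_field_derivative k z) (at z)"
 proof -
  have "(k has_field_derivative deriv k z) (at z)"
   using kh zb by (simp add: holomorphic_derivI)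
  then have "(P has_field_derivative (1 * k z + deriv k z * (z - z))) (at z)"
   unfolding P_def by (intro derivative_eq_intros) auto
  then show ?thesis by simp
 qed
 then have "deriv P z ~= 0" by (simp add: DERIV_imp_deriv k_def)
 then obtain s where s: "s > 0" "ball z s <= ball z r'" "open (P ` ball z s)" "inj_on P (ball z s)"
  using has_complex_derivative_locally_invertible[OF Ph zb open_ball] by blast
 have "P z = 0" by (simp add: P_def)
 then have "0 \<in> P ` ball z s" using s(1) by (metis centre_in_ball imageI)
 then obtain et where et: "et > 0" "ball 0 et <= P ` ball z s" using s(3) openE by blast
 obtain kp where kp: "kp holomorphic_on P ` ball z s" "\<And>w. w \<in> ball z s ==> kp (P w) = w"
  using holomorphic_has_inverse[OF holomorphic_on_subset[OF Ph s(2)] open_ball s(4)] by metis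
 have inv: "kp w \<in> ball z s" "P (kp w) = w" if w: "w \<in> ball 0 et" for w
 proof -
  obtain v where "v \<in> ball z s" "w = P v" using et(2) w by blast
  then show "kp w \<in> ball z s" "P (kp w) = w" using kp(2) by auto
 qed
 show ?thesis
 proof (rule that)
  show "et > 0" by (rule et)
  show "continuous_on (ball 0 et) kp"
   using kp(1) et(2) holomorphic_on_imp_continuous_on holomorphic_on_subset by blast
  show "inj_on kp (ball 0 et)" by (rule inj_on_inverseI[where g = P]) (rule inv)
  show "kp ` ball 0 et <= ball z e" using inv(1) s(2) r'(3) by blast
  fix w :: complex assume w: "w \<in> ball 0 et"
  have "kp w \<in> ball z r" "kp w \<in> ball z r'" using inv(1)[OF w] s(2) r'(2) by blast+
  then have "F (kp w) = (kp w - z) ^ m * k (kp w) ^ m" using F km by simp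
  also have "\<dots> = P (kp w) ^ m" by (simp add: P_def power_mult_distrib)
  finally show "F (kp w) = w ^ m" using inv(2)[OF w] by simp
  assume "w ~= 0"
  then show "kp w ~= z" using inv(2)[OF w] \<open>P z = 0\<close> by auto
 qed
qed

text \<open>A radius below 1 makes the right half of the circle cross the real line between the
  branch points 0 and 1.\<close>

lemma cis_in_sector:
 assumes "0 < y" "y < 1"
 shows "pi / 2 <= tth ==> tth <= 3 * pi / 2 ==> of_real y * cis tth \<in> sector 0"
  "3 * pi / 2 <= tth ==> tth <= 5 * pi / 2 ==> of_real y * cis tth \<in> sector 1"
proof -
 show "of_real y * cis tth \<in> sector 0" if tth: "pi / 2 <= tth" "tth <= 3 * pi / 2"
 proof (cases "sin tth = 0")
  case True
  have "cos (tth - pi) >= 0" using tth by (intro cos_ge_zero) auto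
  then have "cos tth <= 0" by (simp add: cos_diff)
  moreover have "cos tth ~= 0" using True sin_cos_squared_add[of tth] by auto
  ultimately have "cos tth < 0" by simp
  then show ?thesis using assms by (simp add: cut_plane_def side_def mult_pos_neg)
 qed (use assms in \<open>simp add: cut_plane_def\<close>)
 show "of_real y * cis tth \<in> sector 1" if tth: "3 * pi / 2 <= tth" "tth <= 5 * pi / 2"
 proof (cases "sin tth = 0")
  case True
  have "cos (tth - 2 * pi) >= 0" using tth by (intro cos_ge_zero) auto
  then have "cos tth >= 0" by (simp add: cos_diff)
  moreover have "cos tth ~= 0" using True sin_cos_squared_add[of tth] by auto
  ultimately have "cos tth > 0" by simp
  moreover have "y * cos tth < 1"
   using assms cos_le_one[of tth] mult_left_le[of "cos tth" y] by linarith
  ultimately show ?thesis using assms by (simp add: cut_plane_def side_def)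
 qed (use assms in \<open>simp add: cut_plane_def\<close>)
qed

definition constant_over :: "complex set => (complex => complex) => complex set => (complex => nat) => bool" where
 "constant_over S pps U L \<longleftrightarrow>
  (\<forall>T t t'. connected T & T <= S & pps ` T <= U & t \<in> T & t' \<in> T --> L t = L t')"

lemma constant_overD:
 "constant_over S pps U L ==> connected T ==> T <= S ==> pps ` T <= U ==> t \<in> T ==> t' \<in> T ==> L t = L t'"
 unfolding constant_over_def by blast

text \<open>\<open>LX\<close> and \<open>LY\<close> label the sheets over the plane minus the positive and over the plane minus the
 rest of the real line. Going once around the branch point of order \<open>m\<close> crosses \<open>2 m\<close> half planes,
 alternately through the negative and the positive half line.\<close>

lemma ramification_cycle:
 fixes pps kp :: "complex => complex" and LX LY :: "complex => nat" and s :: "nat => nat"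
 assumes m: "m >= 1" and et: "et > 0" and y: "0 < y" "y < 1" "y < et ^ m"
  and kp: "continuous_on (ball 0 et - {0}) kp" "inj_on kp (ball 0 et - {0})" "kp ` (ball 0 et - {0}) <= S"
   "\<forall>w\<in>ball 0 et - {0}. pps (kp w) = w ^ m"
  and LX: "constant_over S pps (sector 0) LX"
  and LY: "constant_over S pps (sector 1) LY"
  and up: "\<forall>t\<in>S. Im (pps t) > 0 --> LY t = LX t"
  and down: "\<forall>t\<in>S. Im (pps t) < 0 --> LY t = s (LX t)"
  and inj: "inj_on LX {t \<in> S. pps t = \<i> * y}"
 shows "\<exists>e. (\<forall>j. s (LX (e j)) = LX (e (Suc j))) & inj_on (%j. LX (e j)) {..<m} \<and>
  e m = e 0 & (\<forall>j. e j \<in> {t \<in> S. pps t = \<i> * of_real y}) & (\<forall>j. e j \<in> kp ` (ball 0 et - {0}))"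
proof -
 \<comment> \<open>\<open>\<rho>\<close> is the radius upstairs for which \<open>w ^ m\<close> runs
   on the circle of radius \<open>y\<close>; turning by \<open>tth / m\<close> upstairs covers a
   turn by \<open>tth\<close> below.\<close>
 define \<rho> where "\<rho> = root m y"
 have \<rho>: "\<rho> > 0" "\<rho> ^ m = y" using m y by (simp_all add: \<rho>_def)
 have \<rho>et: "\<rho> < et" using y(3) \<rho> et by (metis less_imp_le power_less_imp_less_base)
 define p where "p tth = of_real \<rho> * cis (tth / of_nat m)" for tth
 have p: "p tth \<in> ball 0 et - {0}" for tth using \<rho> \<rho>et by (simp add: p_def norm_mult)
 have ppsp: "pps (kp (p tth)) = of_real y * cis tth" for tth
 proof -
  have "cis (tth / of_nat m) ^ m = cis tth" using Complex.DeMoivre[of "tth / of_nat m" m] m by (simp del: Complex.DeMoivre)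
  then have "p tth ^ m = of_real (\<rho> ^ m) * cis tth"
   by (simp add: p_def power_mult_distrib)
  then show ?thesis using bspec[OF kp(4) p] m \<rho>(2) by simp
 qed
 have kpS: "kp (p tth) \<in> S" for tth using kp(3) imageI[OF p, of kp] by (rule subsetD)
 have cont: "continuous_on A (%tth. kp (p tth))" for A
 proof (rule continuous_on_compose2[OF kp(1)])
  show "continuous_on A p" unfolding p_def using m by (intro continuous_intros) auto
  show "p ` A <= ball 0 et - {0}" by (rule image_subsetI) (rule p)
 qed
 have sec: "of_real y * cis tth \<in> sector k"
  if "2 * pi * real j + a <= tth" "tth <= 2 * pi * real j + b"
   "\<And>tth. a <= tth ==> tth <= b ==> of_real y * cis tth \<in> sector k" for tth j a b k
 proof -
  have "cis (tth - 2 * pi * real j) = cis tth"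
   by (simp add: cis_divide[symmetric] cis_multiple_2pi)
  moreover have "of_real y * cis (tth - 2 * pi * real j) \<in> sector k" using that(1,2) by (intro that(3)) auto
  ultimately show ?thesis by simp
 qed
 \<comment> \<open>After \<open>j\<close> full turns below, \<open>e j\<close> and
   \<open>e' j\<close> lie over the top and the bottom of the circle.\<close>
 define e where "e j = kp (p (2 * pi * real j + pi / 2))" for j
 define e' where "e' j = kp (p (2 * pi * real j + 3 * pi / 2))" for j
 have c2: "cis (2 * pi * real j + tth) = cis tth" for j tth
  by (simp add: cis_mult[symmetric] cis_multiple_2pi)
 have ppse: "pps (e j) = \<i> * y" for j unfolding e_def ppsp c2 by (simp add: mult.commute)
 have ppse': "pps (e' j) = - \<i> * y" for j
 proof -
  have "cis (3 * pi / 2) = - \<i>"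
  proof -
   have "3 * pi / 2 = pi + pi / 2" by simp
   then show ?thesis by (simp only: cis_mult[symmetric]) simp
  qed
  then show ?thesis unfolding e'_def ppsp c2 by (simp add: mult.commute)
 qed
 \<comment> \<open>From top to bottom the circle crosses the negative half line, where
   \<open>LX\<close> is constant; from the bottom to the next top it crosses the positive side,
   where \<open>LY\<close> is constant.\<close>
 have 1: "LX (e' j) = LX (e j)" for j
 proof (rule constant_overD[OF LX])
  let ?A = "{2 * pi * real j + pi / 2 .. 2 * pi * real j + 3 * pi / 2}"
  show "connected ((%tth. kp (p tth)) ` ?A)" by (rule connected_continuous_image[OF cont]) simp
  show "(%tth. kp (p tth)) ` ?A <= S" by (rule image_subsetI) (rule kpS)
  show "pps ` (%tth. kp (p tth)) ` ?A <= sector 0"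
  proof clarify
   fix tth assume "tth \<in> ?A"
   then have *: "2 * pi * real j + pi / 2 <= tth" "tth <= 2 * pi * real j + 3 * pi / 2" by simp_all
   show "pps (kp (p tth)) \<in> sector 0"
    unfolding ppsp by (rule sec[OF * cis_in_sector(1)[OF y(1,2)]])
  qed
  show "e' j \<in> (%tth. kp (p tth)) ` ?A" unfolding e'_def by (rule imageI) simp
  show "e j \<in> (%tth. kp (p tth)) ` ?A" unfolding e_def by (rule imageI) simp
 qed
 have 2: "LY (e' j) = LY (e (Suc j))" for j
 proof (rule constant_overD[OF LY])
  let ?A = "{2 * pi * real j + 3 * pi / 2 .. 2 * pi * real j + 5 * pi / 2}"
  show "connected ((%tth. kp (p tth)) ` ?A)" by (rule connected_continuous_image[OF cont]) simp
  show "(%tth. kp (p tth)) ` ?A <= S" by (rule image_subsetI) (rule kpS)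
  show "pps ` (%tth. kp (p tth)) ` ?A <= sector 1"
  proof clarify
   fix tth assume "tth \<in> ?A"
   then have *: "2 * pi * real j + 3 * pi / 2 <= tth" "tth <= 2 * pi * real j + 5 * pi / 2" by simp_all
   show "pps (kp (p tth)) \<in> sector 1"
    unfolding ppsp by (rule sec[OF * cis_in_sector(2)[OF y(1,2)]])
  qed
  show "e' j \<in> (%tth. kp (p tth)) ` ?A" unfolding e'_def by (rule imageI) simp
  show "e (Suc j) \<in> (%tth. kp (p tth)) ` ?A" unfolding e_def by (rule imageI) (simp add: algebra_simps)
 qed
 have eS: "e j \<in> S" "e' j \<in> S" for j using kpS by (simp_all add: e_def e'_def)
 have step: "s (LX (e j)) = LX (e (Suc j))" for j
 proof -
  have "s (LX (e j)) = LY (e' j)" using bspec[OF down eS(2), of j] ppse'[of j] y 1[of j] by simp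
  also have "\<dots> = LX (e (Suc j))" using 2[of j] bspec[OF up eS(1), of "Suc j"] ppse[of "Suc j"] y by simp
  finally show ?thesis .
 qed
 show ?thesis
 proof (intro exI[of _ e] conjI allI)
  show "s (LX (e j)) = LX (e (Suc j))" for j by (rule step)
  show "inj_on (%j. LX (e j)) {..<m}"
  proof (rule inj_onI)
   fix i j assume ij: "i \<in> {..<m}" "j \<in> {..<m}" "LX (e i) = LX (e j)"
   have "e i = e j" using inj_onD[OF inj ij(3)] eS ppse by simp
   then have "p (2 * pi * real i + pi / 2) = p (2 * pi * real j + pi / 2)"
    using inj_onD[OF kp(2) _ p p] unfolding e_def by blast
   then have eq: "cis ((2 * pi * real i + pi / 2) / m) = cis ((2 * pi * real j + pi / 2) / m)"
    using \<rho>(1) unfolding p_def by (simp only: mult_cancel_left of_real_eq_0_iff) simp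
   have "cis (((2 * pi * real i + pi / 2) - (2 * pi * real j + pi / 2)) / m) = 1"
    unfolding diff_divide_distrib[of "2 * pi * real i + pi / 2"] cis_divide[symmetric] eq
    by (rule divide_self) (rule cis_neq_zero)
   then obtain k :: int where "((2 * pi * real i + pi / 2) - (2 * pi * real j + pi / 2)) / m = of_int k * (2 * pi)"
    by (auto simp: cis_conv_exp exp_eq_1)
   then have "(real i - real j) * (2 * pi) = (of_int k * real m) * (2 * pi)" using m by (simp add: field_simps)
   then have "real i - real j = of_int k * real m" by simp
   then have e: "int i - int j = k * int m" by (metis of_int_diff of_int_eq_iff of_int_mult of_int_of_nat_eq)
   have "k = 0"
   proof (rule ccontr)
    assume "k ~= 0"
    then have "1 <= \<bar>k\<bar>" by linarith
    then have "\<bar>k * int m\<bar> >= int m" using mult_right_mono[of 1 "\<bar>k\<bar>" "int m"] by (simp add: abs_mult)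
    then show False using e ij(1,2) by auto
   qed
   then show "i = j" using e by simp
  qed
  show "e m = e 0"
  proof -
   have "p (2 * pi * real m + pi / 2) = p (pi / 2)"
   proof -
    have "(2 * pi * real m + pi / 2) / real m = 2 * pi + (pi / 2) / real m" using m by (simp add: field_simps)
    then show ?thesis using c2[of 1 "(pi / 2) / real m"] by (simp add: p_def)
   qed
   then show ?thesis by (simp add: e_def)
  qed
  show "e j \<in> {t \<in> S. pps t = \<i> * of_real y}" for j using eS ppse by simp
  show "e j \<in> kp ` (ball 0 et - {0})" for j unfolding e_def by (rule imageI) (rule p)
 qed
qed

text \<open>If the charts account for all sheets, then the monodromy is a single cycle.\<close>

lemma ramification_is_cycle:
 fixes pps :: "complex => complex" and LX LY :: "complex => nat" and s :: "nat => nat"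
 assumes m: "m >= 1" and s: "s permutes {1..n}"
  and LX: "constant_over S pps (sector 0) LX"
  and LY: "constant_over S pps (sector 1) LY"
  and up: "\<forall>t\<in>S. Im (pps t) > 0 --> LY t = LX t"
  and down: "\<forall>t\<in>S. Im (pps t) < 0 --> LY t = s (LX t)"
  and bij: "\<And>y. y > 0 ==> bij_betw LX {t \<in> S. pps t = \<i> * of_real y} {1..n}"
  and et: "et > 0" and kp: "continuous_on (ball 0 et - {0}) kp" "inj_on kp (ball 0 et - {0})"
   "kp ` (ball 0 et - {0}) <= S" "\<forall>w\<in>ball 0 et - {0}. pps (kp w) = w ^ m"
  and Q: "finite Q" "card Q + m = n"
  and \<xi>: "\<And>q. q \<in> Q ==> continuous_on (ball 0 et - {0}) (\<xi> q)" "\<And>q. q \<in> Q ==> inj_on (\<xi> q) (ball 0 et - {0})"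
   "\<And>q. q \<in> Q ==> \<xi> q ` (ball 0 et - {0}) <= S" "\<And>q w. q \<in> Q ==> w \<in> ball 0 et - {0} ==> pps (\<xi> q w) = w"
  and disj: "\<And>q. q \<in> Q ==> \<xi> q ` (ball 0 et - {0}) \<inter> kp ` (ball 0 et - {0}) = {}"
   "\<And>q q'. q \<in> Q ==> q' \<in> Q ==> q ~= q' ==> \<xi> q ` (ball 0 et - {0}) \<inter> \<xi> q' ` (ball 0 et - {0}) = {}"
 shows "\<exists>A\<subseteq>{1..n}. card A = m & is_cycle_on s A"
proof -
 obtain y where y: "0 < y" "y < 1" "y < et ^ m" "y < et"
 proof -
  have "0 < min (min 1 et) (et ^ m)" using et by simp
  then obtain y where "0 < y" "y < min (min 1 et) (et ^ m)" using dense by blast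
  then show ?thesis using that by simp
 qed
 let ?F = "{t \<in> S. pps t = \<i> * of_real y}"
 have inj: "inj_on LX ?F" using bij[OF y(1)] bij_betw_imp_inj_on by blast
 from ramification_cycle[OF m et y(1-3) kp LX LY up down inj]
 obtain e where e0: "\<forall>j. s (LX (e j)) = LX (e (Suc j))" "inj_on (%j. LX (e j)) {..<m}"
  "e m = e 0" "\<forall>j. e j \<in> ?F" "\<forall>j. e j \<in> kp ` (ball 0 et - {0})"
  by (elim exE conjE)
 note e = spec[OF e0(1)] e0(2,3) spec[OF e0(4)] spec[OF e0(5)]
 \<comment> \<open>A simple point is the case of multiplicity 1: its cycle of labels has length 1,
   so it gives a fixed point of \<open>s\<close>.\<close>
 have "\<exists>t. s (LX t) = LX t & t \<in> ?F & t \<in> \<xi> q ` (ball 0 et - {0})" if q: "q \<in> Q" for q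
 proof -
  have 4: "\<forall>w\<in>ball 0 et - {0}. pps (\<xi> q w) = w ^ 1" using \<xi>(4)[OF q] by simp
  have y1: "y < et ^ 1" using y(4) by simp
  from ramification_cycle[OF order_refl et y(1,2) y1 \<xi>(1-3)[OF q] 4 LX LY up down inj]
  obtain e where e: "\<forall>j. s (LX (e j)) = LX (e (Suc j))" "inj_on (%j. LX (e j)) {..<1}"
   "e 1 = e 0" "\<forall>j. e j \<in> ?F" "\<forall>j. e j \<in> \<xi> q ` (ball 0 et - {0})"
   by (elim exE conjE)
  have "s (LX (e 0)) = LX (e 0)" using spec[OF e(1), of 0] e(3) by simp
  then show ?thesis using spec[OF e(4), of 0] spec[OF e(5), of 0] by blast
 qed
 then obtain t where t: "\<And>q. q \<in> Q ==> s (LX (t q)) = LX (t q) & t q \<in> ?F & t q \<in> \<xi> q ` (ball 0 et - {0})"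
  by metis
 define A where "A = (%j. LX (e j)) ` {..<m}"
 define B where "B = (%q. LX (t q)) ` Q"
 have LXF: "LX u \<in> {1..n}" if "u \<in> ?F" for u using bij_betwE[OF bij[OF y(1)]] that by blast
 have A: "A <= {1..n}" "card A = m"
  using LXF e(4) card_image[OF e(2)] by (auto simp: A_def)
 have "inj_on (%q. LX (t q)) Q"
 proof (rule inj_onI)
  fix q q' assume q: "q \<in> Q" "q' \<in> Q" "LX (t q) = LX (t q')"
  then have "t q = t q'" using inj_onD[OF inj q(3)] t by blast
  then show "q = q'" using disj(2)[OF q(1,2)] t[OF q(1)] t[OF q(2)] by auto
 qed
 then have B: "B <= {1..n}" "card B = card Q"
  using LXF t card_image by (auto simp: B_def)
 have AB: "A \<inter> B = {}"
 proof (rule equals0I)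
  fix x assume "x \<in> A \<inter> B"
  then have "x \<in> A" "x \<in> B" by blast+
  then obtain j q where jq: "x = LX (e j)" "q \<in> Q" "x = LX (t q)"
   unfolding A_def B_def by (elim imageE) simp
  then have "LX (e j) = LX (t q)" by simp
  then have "e j = t q" using inj_onD[OF inj] e(4)[of j] t[OF jq(2)] by blast
  then show False using disj(1)[OF jq(2)] e(5)[of j] t[OF jq(2)] by auto
 qed
 \<comment> \<open>The \<open>m\<close> labels on the cycle and the \<open>n - m\<close> fixed
   labels are distinct and hence are all labels.\<close>
 have "A \<union> B = {1..n}"
 proof (rule card_subset_eq)
  have "finite A" "finite B" using A B finite_subset by blast+
  then show "card (A \<union> B) = card {1..n}" using AB A B Q by (simp add: card_Un_disjoint)
 qed (use A B in auto)
 have pow: "(s ^^ k) (LX (e j)) = LX (e (j + k))" for j k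
  by (induct k) (simp_all add: e(1))
 have per: "LX (e (j + m)) = LX (e j)" for j
 proof -
  have "LX (e (m + j)) = (s ^^ j) (LX (e m))" by (rule pow[symmetric])
  also have "\<dots> = (s ^^ j) (LX (e 0))" by (simp only: e(3))
  also have "\<dots> = LX (e (0 + j))" by (rule pow)
  finally show ?thesis by (simp only: add.commute[of j m] add_0)
 qed
 have "is_cycle_on s A"
  unfolding is_cycle_on_def
 proof (intro conjI allI impI ballI)
  fix x assume "x \<notin> A"
  show "s x = x"
  proof (cases "x \<in> {1..n}")
   case True
   then have "x \<in> B" using \<open>A \<union> B = {1..n}\<close> \<open>x \<notin> A\<close> by blast
   then obtain q where "q \<in> Q" "x = LX (t q)" unfolding B_def by (elim imageE)
   then show ?thesis using t by simp
  qed (rule permutes_not_in[OF s])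
 next
  fix x x' assume "x \<in> A" "x' \<in> A"
  then obtain i j where ij: "i < m" "j < m" "x = LX (e i)" "x' = LX (e j)" by (auto simp: A_def)
  have "(s ^^ (m - i + j)) x = LX (e (i + (m - i + j)))" unfolding ij(3) by (rule pow)
  also have "i + (m - i + j) = j + m" using ij(1) by simp
  finally have "(s ^^ (m - i + j)) x = x'" using per[of j] ij(4) by simp
  then show "\<exists>k. (s ^^ k) x = x'" by (rule exI)
 qed
 then show ?thesis using A by blast
qed

section \<open>Ramification of a rational function over 0\<close>

lemma card_simple_roots:
 fixes p :: "complex poly"
 assumes "p ~= 0" "\<And>t. poly p t = 0 ==> poly (pderiv p) t ~= 0"
 shows "card {t. poly p t = 0} = degree p"
proof -
 have "rsquarefree p" using assms by (auto simp: rsquarefree_roots)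
 then have one: "Polynomial.order t p = 0 \<or> Polynomial.order t p = 1" for t by (auto simp: rsquarefree_def)
 have "proots p = mset_set {t. poly p t = 0}"
 proof (rule multiset_eqI)
  fix t
  have "Polynomial.order t p = (if poly p t = 0 then 1 else 0)"
   using one[of t] assms(1) order_root[of p t] by auto
  then show "count (proots p) t = count (mset_set {t. poly p t = 0}) t"
   using assms(1) poly_roots_finite[OF assms(1)] by simp
 qed
 then have "degree p = size (mset_set {t. poly p t = 0})" using size_proots_complex[of p] by simp
 then show ?thesis by simp
qed

text \<open>Charts at the simple zeros in \<open>Q\<close> are built here from \<open>P\<close> and
  \<open>R\<close>. The chart at the multiple point is handed in, on a punctured disc, because that
  point may be infinity; \<open>dl\<close> keeps it away from the simple zeros.\<close>

lemma poly_ramification: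
 fixes P R :: "complex poly" and LX LY :: "complex => nat"
 assumes m: "m >= 1" and s: "s permutes {1..n}" and S: "finite (- S)"
  and pps: "pps = (%t. - poly P t / poly R t)" and R: "\<forall>t\<in>S. poly R t ~= 0"
  and LX: "constant_over S pps (sector 0) LX" and LY: "constant_over S pps (sector 1) LY"
  and up: "\<forall>t\<in>S. Im (pps t) > 0 --> LY t = LX t" and down: "\<forall>t\<in>S. Im (pps t) < 0 --> LY t = s (LX t)"
  and bij': "\<forall>y>0. bij_betw LX {t \<in> S. pps t = \<i> * of_real y} {1..n}"
  and et0: "et0 > 0" and kp: "continuous_on (ball 0 et0 - {0}) kp" "inj_on kp (ball 0 et0 - {0})"
   "kp ` (ball 0 et0 - {0}) <= S" "\<forall>w\<in>ball 0 et0 - {0}. pps (kp w) = w ^ m"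
  and Q: "finite Q" "card Q + m = n" "\<forall>q\<in>Q. poly P q = 0 & poly (pderiv P) q ~= 0 & poly R q ~= 0"
  and dl: "dl > 0" "\<forall>q\<in>Q. \<forall>w\<in>ball 0 et0 - {0}. dl <= dist q (kp w)"
 shows "\<exists>A\<subseteq>{1..n}. card A = m & is_cycle_on s A"
proof -
 have bij: "bij_betw LX {t \<in> S. pps t = \<i> * of_real y} {1..n}" if "y > 0" for y using bij' that by blast
 have "\<exists>d>0. \<forall>x\<in>Q \<union> - S. x ~= q --> d <= dist q x" for q using finite_set_avoid[of "Q \<union> - S"] Q(1) S by blast
 then obtain d where d: "\<And>q. d q > 0" "\<And>q x. x \<in> Q \<union> - S ==> x ~= q ==> d q <= dist q x" by metis
 define e where "e q = min dl (d q / 2)" for q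
 have e: "e q > 0" for q using dl(1) d(1)[of q] by (simp add: e_def)
 have eS: "ball q (e q) - {q} <= S" for q
 proof
  fix x assume x: "x \<in> ball q (e q) - {q}"
  show "x \<in> S"
  proof (rule ccontr)
   assume "x \<notin> S"
   then have "d q <= dist q x" using d(2)[of x q] x by auto
   then show False using x d(1)[of q] by (simp add: e_def)
  qed
 qed
 have chart: "\<exists>et \<xi>. et > 0 & continuous_on (ball 0 et) \<xi> & inj_on \<xi> (ball 0 et) & \<xi> ` ball 0 et <= ball q (e q) \<and>
   (\<forall>w\<in>ball 0 et. pps (\<xi> w) = w ^ 1) & (\<forall>w\<in>ball 0 et. w ~= 0 --> \<xi> w ~= q)" if q: "q \<in> Q" for q
 proof -
  have P: "poly P q = 0" "poly (pderiv P) q ~= 0" "poly R q ~= 0" using Q(3) q by auto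
  obtain P' where P': "P = [:- q, 1:] * P'" using P(1) by (auto simp: poly_eq_0_iff_dvd elim: dvdE)
  have "pderiv P = [:- q, 1:] * pderiv P' + P' * pderiv [:- q, 1:]" unfolding P' by (rule pderiv_mult)
  then have "poly (pderiv P) q = poly P' q" by (simp add: pderiv_pCons)
  then have nz: "- poly P' q / poly R q ~= 0" using P by simp
  have Rnz: "poly R w ~= 0" if "w \<in> ball q (e q)" for w
   using that eS[of q] R P(3) by (cases "w = q") auto
  have h: "(%w. - poly P' w / poly R w) holomorphic_on ball q (e q)"
   using Rnz by (intro holomorphic_intros) auto
  have F: "pps w = (w - q) ^ 1 * (- poly P' w / poly R w)" for w
   unfolding pps P' by (simp add: divide_inverse algebra_simps)
  obtain et \<xi> where "et > 0" "continuous_on (ball 0 et) \<xi>" "inj_on \<xi> (ball 0 et)" "\<xi> ` ball 0 et <= ball q (e q)"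
   "\<forall>w\<in>ball 0 et. pps (\<xi> w) = w ^ 1" "\<forall>w\<in>ball 0 et. w ~= 0 --> \<xi> w ~= q"
   by (rule local_root_chart[OF h e nz order_refl F e[of q]]) auto
  then show ?thesis by blast
 qed
 then obtain et1 \<xi> where c: "\<And>q. q \<in> Q ==> et1 q > 0 & continuous_on (ball 0 (et1 q)) (\<xi> q) & inj_on (\<xi> q) (ball 0 (et1 q)) \<and>
   \<xi> q ` ball 0 (et1 q) <= ball q (e q) & (\<forall>w\<in>ball 0 (et1 q). pps (\<xi> q w) = w ^ 1) \<and>
   (\<forall>w\<in>ball 0 (et1 q). w ~= 0 --> \<xi> q w ~= q)" by metis
 define et where "et = Min (insert et0 (et1 ` Q))"
 have et: "et > 0" "et <= et0" "\<And>q. q \<in> Q ==> et <= et1 q"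
 proof -
  show "et > 0" unfolding et_def using et0 c Q(1) by (subst Min_gr_iff) auto
  show "et <= et0" unfolding et_def using Q(1) by (intro Min_le) auto
  show "\<And>q. q \<in> Q ==> et <= et1 q" unfolding et_def using Q(1) by (intro Min_le) auto
 qed
 let ?D = "ball (0::complex) et - {0}"
 have D0: "?D <= ball 0 et0 - {0}" using et(2) by auto
 have Dq: "?D <= ball 0 (et1 q)" if "q \<in> Q" for q using et(3)[OF that] by auto
 have \<xi>b: "\<xi> q ` ?D <= ball q (e q) - {q}" if "q \<in> Q" for q
 proof
  fix x assume "x \<in> \<xi> q ` ?D"
  then obtain w where w: "w \<in> ?D" "x = \<xi> q w" by (elim imageE)
  have w': "w \<in> ball 0 (et1 q)" "w ~= 0" using w(1) Dq[OF that] by auto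
  have 1: "\<xi> q ` ball 0 (et1 q) <= ball q (e q)" "\<forall>w\<in>ball 0 (et1 q). w ~= 0 --> \<xi> q w ~= q"
   subgoal using c[OF that] by (elim conjE)
   subgoal using c[OF that] by (elim conjE)
   done
  have "\<xi> q w \<in> ball q (e q)" by (rule subsetD[OF 1(1) imageI[OF w'(1)]])
  moreover have "\<xi> q w ~= q" using 1(2)[rule_format, OF w'] .
  ultimately show "x \<in> ball q (e q) - {q}" by (simp add: w(2))
 qed
 show ?thesis
 proof (rule ramification_is_cycle[OF m s LX LY up down bij et(1)])
  show "continuous_on ?D kp" by (rule continuous_on_subset[OF kp(1) D0])
  show "inj_on kp ?D" by (rule inj_on_subset[OF kp(2) D0])
  show "kp ` ?D <= S" by (rule order_trans[OF image_mono[OF D0] kp(3)])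
  show "\<forall>w\<in>?D. pps (kp w) = w ^ m" using kp(4) D0 by blast
  show "finite Q" "card Q + m = n" by (rule Q)+
  show "continuous_on ?D (\<xi> q)" "inj_on (\<xi> q) ?D" if q: "q \<in> Q" for q
  proof -
   have 1: "continuous_on (ball 0 (et1 q)) (\<xi> q)" "inj_on (\<xi> q) (ball 0 (et1 q))" 
    subgoal using c[OF q] by (elim conjE)
    subgoal using c[OF q] by (elim conjE)
    done
   show "continuous_on ?D (\<xi> q)" by (rule continuous_on_subset[OF 1(1) Dq[OF q]])
   show "inj_on (\<xi> q) ?D" by (rule inj_on_subset[OF 1(2) Dq[OF q]])
  qed
  show "\<xi> q ` ?D <= S" if q: "q \<in> Q" for q by (rule order_trans[OF \<xi>b[OF q] eS])
  show "pps (\<xi> q w) = w" if q: "q \<in> Q" and w: "w \<in> ?D" for q w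
  proof -
   have "\<forall>w\<in>ball 0 (et1 q). pps (\<xi> q w) = w ^ 1" using c[OF q] by (elim conjE)
   then have "pps (\<xi> q w) = w ^ 1" using subsetD[OF Dq[OF q] w] by (rule bspec)
   then show ?thesis by simp
  qed
  show "\<xi> q ` ?D \<inter> kp ` ?D = {}" if q: "q \<in> Q" for q
  proof (rule equals0I)
   fix x assume "x \<in> \<xi> q ` ?D \<inter> kp ` ?D"
   then have x: "x \<in> \<xi> q ` ?D" "x \<in> kp ` ?D" by (simp_all only: Int_iff)
   from x(2) obtain w' where w': "x = kp w'" "w' \<in> ?D" by (rule imageE)
   have w: "x \<in> ball q (e q)" using subsetD[OF \<xi>b[OF q] x(1)] by simp
   have "dl <= dist q x" unfolding w'(1) using dl(2)[rule_format, OF q subsetD[OF D0 w'(2)]] .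
   then show False using w by (simp add: e_def)
  qed
  show "\<xi> q ` ?D \<inter> \<xi> q' ` ?D = {}" if q: "q \<in> Q" "q' \<in> Q" "q ~= q'" for q q'
  proof (rule equals0I)
   fix x assume "x \<in> \<xi> q ` ?D \<inter> \<xi> q' ` ?D"
   then have x: "x \<in> \<xi> q ` ?D" "x \<in> \<xi> q' ` ?D" by (simp_all only: Int_iff)
   have "x \<in> ball q (e q)" "x \<in> ball q' (e q')"
    using subsetD[OF \<xi>b[OF q(1)] x(1)] subsetD[OF \<xi>b[OF q(2)] x(2)] by simp_all
   then have "dist q x < d q / 2" "dist q' x < d q' / 2" unfolding e_def mem_ball by linarith+
   moreover have "q' \<in> Q \<union> - S" "q \<in> Q \<union> - S" using q by simp_all
   then have "d q <= dist q q'" "d q' <= dist q' q"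
    using d(2)[of q' q] d(2)[of q q'] q(3) by (simp_all only: not_sym simp_thms)
   ultimately show False using dist_triangle2[of q q' x] dist_commute[of q q'] by linarith
  qed
 qed
qed

text \<open>The maps \<open>1 - 1 / z\<close> and \<open>1 / (1 - z)\<close> preserve the half
  planes and permute 0, 1, infinity cyclically. They carry the branch points 1 and infinity to 0, so
  that one ramification argument serves all three; the sectors rotate accordingly.\<close>

lemma one_minus_inverse_sector:
 fixes z :: complex assumes z: "z ~= 0" and w: "w = 1 - 1 / z"
 shows "Im w > 0 \<longleftrightarrow> Im z > 0" "Im w < 0 \<longleftrightarrow> Im z < 0"
  "w \<in> sector 0 ==> z \<in> sector 1" "w \<in> sector 1 ==> z \<in> sector 2"
proof -
 have n: "(Re z)\<^sup>2 + (Im z)\<^sup>2 > 0" using z by (simp add: complex_neq_0)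
 have im: "Im w = Im z / ((Re z)\<^sup>2 + (Im z)\<^sup>2)" by (simp add: w Im_divide)
 show 1: "Im w > 0 \<longleftrightarrow> Im z > 0" "Im w < 0 \<longleftrightarrow> Im z < 0"
  unfolding im using n by (simp_all add: zero_less_divide_iff divide_less_0_iff)
 have re: "Re w = 1 - 1 / Re z" if "Im z = 0" using that by (simp add: w Re_divide power2_eq_square)
 have rz: "Re z ~= 0" if "Im z = 0" using that z by (auto simp: complex_eq_iff)
 show "w \<in> sector 0 ==> z \<in> sector 1"
 proof (cases "Im z = 0")
  case True
  assume "w \<in> sector 0"
  then have "1 - 1 / Re z < 0" using True 1 re by (auto simp: cut_plane_def side_def)
  then have 2: "1 < 1 / Re z" by simp
  then have "0 < Re z" by (metis less_trans zero_less_divide_1_iff zero_less_one)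
  then have "Re z < 1" using 2 by (simp add: less_divide_eq)
  then have "0 < Re z" "Re z < 1" using \<open>0 < Re z\<close> by auto
  then show ?thesis by (simp add: cut_plane_def side_def)
 qed (simp add: cut_plane_def)
 show "w \<in> sector 1 ==> z \<in> sector 2"
 proof (cases "Im z = 0")
  case True
  assume "w \<in> sector 1"
  then have "0 < 1 - 1 / Re z" "1 - 1 / Re z < 1" using True 1 re by (auto simp: cut_plane_def side_def)
  then have "1 / Re z < 1" "1 / Re z > 0" by auto
  then have "1 < Re z" by (simp add: zero_less_divide_iff divide_less_eq_1)
  then show ?thesis by (simp add: cut_plane_def side_def)
 qed (simp add: cut_plane_def)
qed

lemma inverse_one_minus_sector:
 fixes z :: complex assumes z: "z ~= 1" and w: "w = 1 / (1 - z)"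
 shows "Im w > 0 \<longleftrightarrow> Im z > 0" "Im w < 0 \<longleftrightarrow> Im z < 0"
  "w \<in> sector 0 ==> z \<in> sector 2" "w \<in> sector 1 ==> z \<in> sector 0"
proof -
 have n: "(Re (1 - z))\<^sup>2 + (Im (1 - z))\<^sup>2 > 0" using complex_neq_0[of "1 - z"] z by simp
 have im: "Im w = Im z / ((Re (1 - z))\<^sup>2 + (Im (1 - z))\<^sup>2)" by (simp add: w Im_divide)
 show 1: "Im w > 0 \<longleftrightarrow> Im z > 0" "Im w < 0 \<longleftrightarrow> Im z < 0"
  unfolding im using n by (simp_all only: zero_less_divide_iff divide_less_0_iff) auto
 have re: "Re w = 1 / (1 - Re z)" if "Im z = 0" using that by (simp add: w Re_divide power2_eq_square)
 show "w \<in> sector 0 ==> z \<in> sector 2"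
 proof (cases "Im z = 0")
  case True
  assume "w \<in> sector 0"
  then have "1 / (1 - Re z) < 0" using True 1 re by (auto simp: cut_plane_def side_def)
  then have "1 < Re z" by (simp add: divide_less_0_iff)
  then show ?thesis by (simp add: cut_plane_def side_def)
 qed (simp add: cut_plane_def)
 show "w \<in> sector 1 ==> z \<in> sector 0"
 proof (cases "Im z = 0")
  case True
  assume "w \<in> sector 1"
  then have "1 / (1 - Re z) < 1" "1 / (1 - Re z) > 0" using True 1 re by (auto simp: cut_plane_def side_def)
  then have "Re z < 0" by (simp add: zero_less_divide_iff divide_less_eq_1)
  then show ?thesis by (simp add: cut_plane_def side_def)
 qed (simp add: cut_plane_def)
qed

section \<open>The residue ratio as a branched cover\<close>

context residue_data
begin

definition residue_ratio :: "complex => complex" where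
 "residue_ratio t = - poly p1 t / poly p3 t"

definition generic_zeros :: "complex set" where
 "generic_zeros = {t. poly p1 t ~= 0 & poly p2 t ~= 0 & poly p3 t ~= 0}"

lemma p2_nonzero: "p2 ~= 0" "degree p2 = a"
proof -
 have "p2 = p1 + p2 + p3 - (p1 + p3)" by simp
 then have p2: "p2 = - (p1 + p3)" unfolding sum_zero by simp
 have "degree (p1 + p3) = a" using degree_p1 degree_p3 b_le_a by (subst degree_add_eq_left) auto
 then show "degree p2 = a" unfolding p2 degree_minus .
 then show "p2 ~= 0" using a_pos by auto
qed

lemma finite_complement: "finite (- generic_zeros)"
proof -
 have "- generic_zeros = {t. poly p1 t = 0} \<union> {t. poly p2 t = 0} \<union> {t. poly p3 t = 0}"
  by (auto simp: generic_zeros_def)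
 then show ?thesis using poly_roots_finite[OF degree_p1(2)] poly_roots_finite[OF p2_nonzero(1)] poly_roots_finite[OF degree_p3(2)] by simp
qed

lemma generic_zeros_01: "t \<in> generic_zeros ==> t ~= 0 & t ~= 1"
 using special_values by (auto simp: generic_zeros_def)

text \<open>At a zero of one of the three polynomials the Wronskian is, up to sign, its derivative
  times one of the other two polynomials.\<close>

lemma pderiv_nonzero:
 assumes "t ~= 0" "t ~= 1"
 shows "poly p1 t = 0 ==> poly (pderiv p1) t ~= 0 & poly p3 t ~= 0"
  "poly p2 t = 0 ==> poly (pderiv p2) t ~= 0 & poly p1 t ~= 0"
  "poly p3 t = 0 ==> poly (pderiv p3) t ~= 0 & poly p2 t ~= 0"
proof -
 have W: "poly p1 t * poly (pderiv p3) t - poly (pderiv p1) t * poly p3 t ~= 0"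
  using wronskian_nonzero[OF assms] by (simp add: wronskian_def)
 have W': "poly (pderiv p2) t * poly p3 t - poly p2 t * poly (pderiv p3) t ~= 0"
  using wronskian_nonzero[OF assms] by (simp add: wronskian_eq)
 have p1: "poly p1 t = - poly p2 t - poly p3 t" using sum_zero_poly[of t] by (simp add: eq_neg_iff_add_eq_0 algebra_simps)
 show "poly p1 t = 0 ==> poly (pderiv p1) t ~= 0 & poly p3 t ~= 0" using W by auto
 show "poly p2 t = 0 ==> poly (pderiv p2) t ~= 0 & poly p1 t ~= 0" using W' p1 by auto
 show "poly p3 t = 0 ==> poly (pderiv p3) t ~= 0 & poly p2 t ~= 0" using W p1 by auto
qed

lemma special_values2: "poly p1 1 ~= 0" "poly p2 0 ~= 0"
 using special_values sum_zero_poly[of 1] sum_zero_poly[of 0] by auto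

sublocale punctured_cover generic_zeros residue_ratio a
proof
 show "open generic_zeros" using finite_complement finite_imp_closed by (metis closed_def double_complement)
 show "path_connected generic_zeros"
  using path_connected_complement_countable[of "- generic_zeros"] finite_complement
  by (simp add: uncountable_infinite countable_finite)
 show "residue_ratio holomorphic_on generic_zeros"
  unfolding residue_ratio_def by (intro holomorphic_intros) (auto simp: generic_zeros_def)
 show "a >= 1" by (rule a_pos)
 show "deriv residue_ratio t ~= 0" if t: "t \<in> generic_zeros" for t
 proof -
  have p3: "poly p3 t ~= 0" using t by (simp add: generic_zeros_def)
  have "(residue_ratio has_field_derivative
    (- poly (pderiv p1) t * poly p3 t - - poly p1 t * poly (pderiv p3) t) / (poly p3 t * poly p3 t)) (at t)"
   unfolding residue_ratio_def[abs_def] by (intro DERIV_divide DERIV_minus poly_DERIV p3)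
  then have "deriv residue_ratio t = (poly wronskian t) / (poly p3 t * poly p3 t)"
   by (simp add: DERIV_imp_deriv wronskian_def)
  then show ?thesis using wronskian_nonzero generic_zeros_01[OF t] p3 by simp
 qed
 show "residue_ratio ` generic_zeros <= - {0, 1}"
 proof clarify
  fix t assume t: "t \<in> generic_zeros" and e: "residue_ratio t \<in> {0, 1}"
  have "residue_ratio t ~= 0" using t by (simp add: residue_ratio_def generic_zeros_def)
  moreover have "residue_ratio t ~= 1"
  proof
   assume "residue_ratio t = 1"
   then have "- poly p1 t = poly p3 t" using t by (simp add: residue_ratio_def generic_zeros_def field_simps)
   moreover have "poly p2 t = (poly p1 t + poly p2 t + poly p3 t) - poly p1 t - poly p3 t" by simp
   ultimately have "poly p2 t = 0" unfolding sum_zero_poly by (metis add.inverse_inverse diff_0 diff_self minus_diff_eq)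
   then show False using t by (simp add: generic_zeros_def)
  qed
  ultimately show False using e by simp
 qed
 \<comment> \<open>The fiber over \<open>y\<close> is the zero set of \<open>p1 + y p3\<close>, of
   degree \<open>a\<close> because \<open>b3 - 1 < a\<close>; a double root would be a zero of the
   Wronskian.\<close>
 show "card {t \<in> generic_zeros. residue_ratio t = y} = a" if y: "y \<notin> {0, 1}" for y
 proof -
  let ?P = "p1 + smult y p3"
  have deg: "degree ?P = a"
   using degree_p1 degree_p3 b_le_a by (subst degree_add_eq_left) auto
  have root: "t \<in> generic_zeros & residue_ratio t = y & poly (pderiv ?P) t ~= 0" if r: "poly ?P t = 0" for t
  proof -
   have e: "poly p1 t = - y * poly p3 t" using r by (simp add: eq_neg_iff_add_eq_0)
   have t0: "t ~= 0" using e special_values y by auto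
   have t1: "t ~= 1"
   proof
    assume "t = 1"
    then have "poly p1 1 = - poly p3 1" using sum_zero_poly[of 1] special_values by (simp add: eq_neg_iff_add_eq_0)
    then show False using e y special_values \<open>t = 1\<close> by simp
   qed
   have p3: "poly p3 t ~= 0"
   proof
    assume "poly p3 t = 0"
    then show False using e pderiv_nonzero(1)[OF t0 t1] by simp
   qed
   have p1: "poly p1 t ~= 0" using e p3 y by simp
   have "poly p2 t = (y - 1) * poly p3 t" using sum_zero_poly[of t] e by (simp add: algebra_simps)
   then have p2: "poly p2 t ~= 0" using p3 y by simp
   have "poly wronskian t = - (poly (pderiv ?P) t) * poly p3 t"
    using e by (simp add: wronskian_def pderiv_add pderiv_smult algebra_simps)
   then have "poly (pderiv ?P) t ~= 0" using wronskian_nonzero[OF t0 t1] by auto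
   moreover have "residue_ratio t = y" using e p3 by (simp add: residue_ratio_def)
   ultimately show ?thesis using p1 p2 p3 by (simp add: generic_zeros_def)
  qed
  have "{t \<in> generic_zeros. residue_ratio t = y} = {t. poly ?P t = 0}"
   using root by (auto simp: residue_ratio_def generic_zeros_def field_simps)
  moreover have "card {t. poly ?P t = 0} = degree ?P"
   by (rule card_simple_roots) (use root deg a_pos in auto)
  ultimately show ?thesis using deg by simp
 qed
qed

end

locale residue_cover = residue_data a b1 b2 b3 + labelled_cover "generic_zeros" "residue_ratio" a lab c
 for a b1 b2 b3 lab c
begin


text \<open>\<open>pps\<close> is the ratio after a Moebius map that puts the branch point in
  question at 0, and sectors \<open>j\<close> and \<open>k\<close> are the ones that become sectors
  0 and 1. \<open>ssg\<close> is a coordinate around the multiple point: the identity,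
  \<open>1 - w\<close> or \<open>inverse\<close>.\<close>

lemma cycle_at:
 fixes P R :: "complex poly" and ssg h :: "complex => complex"
 defines "pps \<equiv> %t. - poly P t / poly R t"
 assumes m: "m >= 1" and s: "s permutes {1..a}" and R: "\<forall>t\<in>generic_zeros. poly R t ~= 0"
  and sec: "\<forall>t\<in>generic_zeros. pps t \<in> sector 0 --> residue_ratio t \<in> sector j"
   "\<forall>t\<in>generic_zeros. pps t \<in> sector 1 --> residue_ratio t \<in> sector k"
  and sgn: "\<forall>t\<in>generic_zeros. (Im (pps t) > 0 \<longleftrightarrow> Im (residue_ratio t) > 0) & (Im (pps t) < 0 \<longleftrightarrow> Im (residue_ratio t) < 0)"
  and val: "\<forall>y>0. \<exists>v\<in>sector j. \<forall>t\<in>generic_zeros. pps t = \<i> * of_real y \<longleftrightarrow> residue_ratio t = v"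
  and down: "\<forall>t\<in>generic_zeros. Im (residue_ratio t) < 0 --> lab k t = s (lab j t)"
  and h: "h holomorphic_on ball 0 r" "r > 0" "h 0 ~= 0"
  and ssg: "continuous_on (- {0}) ssg" "inj_on ssg (- {0})"
   "\<forall>w\<in>ball 0 r - {0}. ssg w \<in> generic_zeros & pps (ssg w) = w ^ m * h w"
  and Q: "finite Q" "card Q + m = a" "\<forall>q\<in>Q. poly P q = 0 & poly (pderiv P) q ~= 0 & poly R q ~= 0"
  and dl: "dl > 0" "\<forall>q\<in>Q. \<forall>w\<in>ball 0 r - {0}. dl <= dist q (ssg w)"
 shows "\<exists>A\<subseteq>{1..a}. card A = m & is_cycle_on s A"
proof -
 have F: "w ^ m * h w = (w - 0) ^ m * h w" for w by simp
 obtain et kp where k: "et > 0" "continuous_on (ball 0 et) kp" "inj_on kp (ball 0 et)" "kp ` ball 0 et <= ball 0 r"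
  "\<forall>w\<in>ball 0 et. kp w ^ m * h (kp w) = w ^ m" "\<forall>w\<in>ball 0 et. w ~= 0 --> kp w ~= 0"
 proof (rule local_root_chart[OF h m F h(2)])
  fix et kp assume "et > 0" "continuous_on (ball 0 et) kp" "inj_on kp (ball 0 et)" "kp ` ball 0 et <= ball 0 r"
   "\<And>w. w \<in> ball 0 et ==> kp w ^ m * h (kp w) = w ^ m" "\<And>w. w \<in> ball 0 et ==> w ~= 0 ==> kp w ~= 0"
  then show thesis by (intro that[of et kp] ballI impI) 
 qed
 let ?D = "ball 0 et - {0::complex}"
 have kb: "kp w \<in> ball 0 r - {0}" if "w \<in> ?D" for w
 proof -
  have w: "w \<in> ball 0 et" "w ~= 0" using that by simp_all
  have "kp w \<in> ball 0 r" using k(4) w(1) by (rule subsetD[OF _ imageI])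
  then show ?thesis using k(6) w by simp
 qed
 have k0: "kp ` ?D <= - {0}"
 proof (rule image_subsetI)
  fix w assume "w \<in> ?D"
  then show "kp w \<in> - {0}" using kb[of w] by simp
 qed
 have 1: "continuous_on ?D (%w. ssg (kp w))"
  by (rule continuous_on_compose2[OF ssg(1) continuous_on_subset[OF k(2)] k0]) auto
 have 2: "inj_on (%w. ssg (kp w)) ?D"
 proof -
  have "inj_on (ssg \<circ> kp) ?D"
   by (rule comp_inj_on[OF inj_on_subset[OF k(3)] inj_on_subset[OF ssg(2) k0]]) auto
  then show ?thesis by (simp add: o_def)
 qed
 have 3: "(%w. ssg (kp w)) ` ?D <= generic_zeros"
 proof (rule image_subsetI)
  fix w assume "w \<in> ?D"
  then show "ssg (kp w) \<in> generic_zeros" using ssg(3)[rule_format, OF kb[of w]] by simp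
 qed
 have 4: "\<forall>w\<in>?D. pps (ssg (kp w)) = w ^ m"
 proof
  fix w assume w: "w \<in> ?D"
  have "pps (ssg (kp w)) = kp w ^ m * h (kp w)" using ssg(3)[rule_format, OF kb[OF w]] by simp
  then show "pps (ssg (kp w)) = w ^ m" using k(5) w by simp
 qed
 have 5: "\<forall>q\<in>Q. \<forall>w\<in>?D. dl <= dist q (ssg (kp w))"
 proof (intro ballI)
  fix q w assume "q \<in> Q" "w \<in> ?D"
  then show "dl <= dist q (ssg (kp w))" by (intro dl(2)[rule_format] kb)
 qed
 have con: "constant_over generic_zeros pps (sector i) (lab l)"
  if "\<forall>t\<in>generic_zeros. pps t \<in> sector i --> residue_ratio t \<in> sector l" for i l
  unfolding constant_over_def
 proof (intro allI impI, elim conjE)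
  fix T t t' assume T: "connected T" "T <= generic_zeros" "pps ` T <= sector i" "t \<in> T" "t' \<in> T"
  have "residue_ratio ` T <= sector l"
  proof (rule image_subsetI)
   fix x assume x: "x \<in> T"
   have "pps x \<in> sector i" using T(3) x by (rule subsetD[OF _ imageI])
   then show "residue_ratio x \<in> sector l" using that T(2) x by blast
  qed
  then show "lab l t = lab l t'" by (rule label_const[OF T(1,2) _ T(4,5)])
 qed
 have up: "\<forall>t\<in>generic_zeros. Im (pps t) > 0 --> lab k t = lab j t" using label_up sgn by blast
 have dn: "\<forall>t\<in>generic_zeros. Im (pps t) < 0 --> lab k t = s (lab j t)" using down sgn by blast
 have bij: "\<forall>y>0. bij_betw (lab j) {t \<in> generic_zeros. pps t = \<i> * of_real y} {1..a}"
 proof (intro allI impI)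
  fix y :: real assume "y > 0"
  then obtain v where v: "v \<in> sector j" "\<forall>t\<in>generic_zeros. pps t = \<i> * of_real y \<longleftrightarrow> residue_ratio t = v" using val by blast
  have "{t \<in> generic_zeros. pps t = \<i> * of_real y} = {t \<in> generic_zeros. residue_ratio t = v}" using v(2) by blast
  then show "bij_betw (lab j) {t \<in> generic_zeros. pps t = \<i> * of_real y} {1..a}" using label_bij[OF v(1)] by simp
 qed
 have ps: "pps = (%t. - poly P t / poly R t)" by (simp add: pps_def)
 show ?thesis
  by (rule poly_ramification[OF m s finite_complement ps R con[OF sec(1)] con[OF sec(2)] up dn bij k(1) 1 2 3 4 Q dl(1) 5])
qed

lemma separation:
 assumes "finite B"
 obtains d where "d > 0" "\<forall>x\<in>B \<union> - generic_zeros. x ~= p --> d <= dist p x"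
 using finite_set_avoid[of "B \<union> - generic_zeros" p] finite_complement assms by auto

lemma cycle1: "\<exists>A\<subseteq>{1..a}. card A = m1 & is_cycle_on (c 0) A"
proof -
 let ?Q = "{t. poly q1 t = 0}"
 have Q: "poly p1 q = 0 & poly (pderiv p1) q ~= 0 & poly p3 q ~= 0 & q ~= 0" if "q \<in> ?Q" for q
 proof -
  have "poly p1 q = 0" "q ~= 0" using that q1_props(2) by (auto simp: p1_factor)
  then show ?thesis using pderiv_nonzero(1)[of q] special_values2(1) by auto
 qed
 have finQ: "finite ?Q" by (rule poly_roots_finite[OF q1_props(3)])
 have "card ?Q = degree q1"
 proof (rule card_simple_roots[OF q1_props(3)])
  fix t assume t: "poly q1 t = 0"
  have "poly (pderiv p1) t = t ^ m1 * poly (pderiv q1) t"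
   using t by (simp add: p1_def pderiv_mult)
  then show "poly (pderiv q1) t ~= 0" using Q[of t] t by auto
 qed
 then have cardQ: "card ?Q + m1 = a" using q1_props(1) m_eq b_pos by simp
 obtain d where d: "d > 0" "\<forall>x\<in>?Q \<union> - generic_zeros. x ~= 0 --> d <= dist 0 x" using separation[OF finQ] .
 have S: "x \<in> generic_zeros" if "x \<in> ball 0 (d / 2)" "x ~= 0" for x
 proof (rule ccontr)
  assume "x \<notin> generic_zeros"
  then have "d <= dist 0 x" using d(2) that(2) by blast
  then show False using that d(1) by simp
 qed
 have nz3: "poly p3 x ~= 0" if "x \<in> ball 0 (d / 2)" for x
  using S[OF that] special_values(3) by (cases "x = 0") (auto simp: generic_zeros_def)
 show ?thesis
 proof (rule cycle_at[where P = p1 and R = p3 and ssg = "%w. w" and j = 0 and k = 1 and Q = ?Q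
    and h = "%t. - poly q1 t / poly p3 t" and r = "d / 2" and dl = "d / 2"])
  show "(%t. - poly q1 t / poly p3 t) holomorphic_on ball 0 (d / 2)"
   using nz3 by (intro holomorphic_intros) auto
  show "\<forall>t\<in>generic_zeros. - poly p1 t / poly p3 t \<in> sector 0 --> residue_ratio t \<in> sector 0"
   "\<forall>t\<in>generic_zeros. - poly p1 t / poly p3 t \<in> sector 1 --> residue_ratio t \<in> sector 1"
   "\<forall>t\<in>generic_zeros. (Im (- poly p1 t / poly p3 t) > 0 \<longleftrightarrow> Im (residue_ratio t) > 0) \<and>
    (Im (- poly p1 t / poly p3 t) < 0 \<longleftrightarrow> Im (residue_ratio t) < 0)"
   by (simp_all add: residue_ratio_def)
  show "\<forall>y>0. \<exists>v\<in>sector 0. \<forall>t\<in>generic_zeros. - poly p1 t / poly p3 t = \<i> * of_real y \<longleftrightarrow> residue_ratio t = v"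
  proof (intro allI impI)
   fix y :: real assume "y > 0"
   then have "\<i> * of_real y \<in> sector 0" by (simp add: cut_plane_def)
   then show "\<exists>v\<in>sector 0. \<forall>t\<in>generic_zeros. - poly p1 t / poly p3 t = \<i> * of_real y \<longleftrightarrow> residue_ratio t = v"
    by (intro bexI[of _ "\<i> * of_real y"]) (simp_all add: residue_ratio_def)
  qed
  show "\<forall>t\<in>generic_zeros. Im (residue_ratio t) < 0 --> lab 1 t = c 0 (lab 0 t)" using label_down(1) by blast
  show "\<forall>w\<in>ball 0 (d / 2) - {0}. w \<in> generic_zeros & - poly p1 w / poly p3 w = w ^ m1 * (- poly q1 w / poly p3 w)"
   using S by (simp add: p1_factor)
  show "\<forall>q\<in>?Q. poly p1 q = 0 & poly (pderiv p1) q ~= 0 & poly p3 q ~= 0" using Q by blast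
  show "\<forall>q\<in>?Q. \<forall>w\<in>ball 0 (d / 2) - {0}. d / 2 <= dist q (w :: complex)"
  proof (intro ballI)
   fix q w :: complex assume q: "q \<in> ?Q" and w: "w \<in> ball 0 (d / 2) - {0}"
   have "d <= dist 0 q" using d(2) Q[OF q] q by blast
   then show "d / 2 <= dist q w" using w dist_triangle[of 0 q w] by (simp add: dist_commute)
  qed
 qed (use m_eq(4) c_permutes d(1) finQ cardQ q1_props(2) special_values(3) in \<open>auto simp: generic_zeros_def\<close>)
qed

lemma residue_ratio_transforms:
 assumes t: "t \<in> generic_zeros"
 shows "- poly p2 t / poly p1 t = 1 - 1 / residue_ratio t" "- poly p3 t / poly p2 t = 1 / (1 - residue_ratio t)"
  "residue_ratio t ~= 0" "residue_ratio t ~= 1"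
proof -
 have nz: "poly p1 t ~= 0" "poly p2 t ~= 0" "poly p3 t ~= 0" using t by (auto simp: generic_zeros_def)
 have p2: "poly p2 t = - poly p1 t - poly p3 t" using sum_zero_poly[of t] by (simp add: eq_neg_iff_add_eq_0 algebra_simps)
 show "- poly p2 t / poly p1 t = 1 - 1 / residue_ratio t"
  using nz by (simp add: p2 residue_ratio_def field_simps)
 have "1 - residue_ratio t = - poly p2 t / poly p3 t" using nz by (simp add: p2 residue_ratio_def field_simps)
 then show "- poly p3 t / poly p2 t = 1 / (1 - residue_ratio t)" "residue_ratio t ~= 1" using nz by auto
 show "residue_ratio t ~= 0" using nz by (simp add: residue_ratio_def)
qed

lemma cycle2: "\<exists>A\<subseteq>{1..a}. card A = m2 & is_cycle_on (c 1) A"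
proof -
 let ?q = "pcompose q2 [:1, -1:]"
 have "pcompose ([:0, 1:] ^ i) [:1, -1:] = [:1, -1::complex:] ^ i" for i
  by (induct i) (simp_all add: pcompose_mult pcompose_pCons pcompose_1)
 then have p2: "p2 = [:1, -1:] ^ m2 * ?q" by (simp add: p2_def pcompose_mult)
 let ?Q = "{t. poly ?q t = 0}"
 have q0: "?q ~= 0" using p2 p2_nonzero(1) by (metis mult_zero_right)
 have Q: "poly p2 q = 0 & poly (pderiv p2) q ~= 0 & poly p1 q ~= 0 & q ~= 1" if "q \<in> ?Q" for q
 proof -
  have "poly p2 q = 0" "q ~= 1" using that q2_props(2) by (auto simp: p2_factor poly_pcompose)
  then show ?thesis using pderiv_nonzero(2)[of q] special_values2(2) by auto
 qed
 have finQ: "finite ?Q" by (rule poly_roots_finite[OF q0])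
 have "card ?Q = degree ?q"
 proof (rule card_simple_roots[OF q0])
  fix t assume t: "poly ?q t = 0"
  have "poly (pderiv p2) t = (1 - t) ^ m2 * poly (pderiv ?q) t"
   using t by (simp add: p2 pderiv_mult)
  then show "poly (pderiv ?q) t ~= 0" using Q[of t] t by auto
 qed
 moreover have "degree ?q = degree q2" by (simp add: degree_pcompose)
 ultimately have cardQ: "card ?Q + m2 = a" using q2_props(1) m_eq b_pos by simp
 obtain d where d: "d > 0" "\<forall>x\<in>?Q \<union> - generic_zeros. x ~= 1 --> d <= dist 1 x" using separation[OF finQ] .
 have S: "1 - x \<in> generic_zeros" if "x \<in> ball 0 (d / 2)" "x ~= 0" for x
 proof (rule ccontr)
  assume "1 - x \<notin> generic_zeros"
  then have "1 - x \<in> ?Q \<union> - generic_zeros" "1 - x ~= 1" using that(2) by simp_all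
  then have "d <= dist 1 (1 - x)" using d(2) by blast
  then show False using that d(1) by (simp add: dist_norm)
 qed
 have nz1: "poly p1 (1 - x) ~= 0" if "x \<in> ball 0 (d / 2)" for x
  using S[OF that] special_values2(1) by (cases "x = 0") (auto simp: generic_zeros_def)
 show ?thesis
 proof (rule cycle_at[where P = p2 and R = p1 and ssg = "%w. 1 - w" and j = 1 and k = 2 and Q = ?Q
    and h = "%t. - poly q2 t / poly p1 (1 - t)" and r = "d / 2" and dl = "d / 2"])
  show "(%t. - poly q2 t / poly p1 (1 - t)) holomorphic_on ball 0 (d / 2)"
   using nz1 by (intro holomorphic_intros) auto
  show "\<forall>t\<in>generic_zeros. - poly p2 t / poly p1 t \<in> sector 0 --> residue_ratio t \<in> sector 1"
   "\<forall>t\<in>generic_zeros. - poly p2 t / poly p1 t \<in> sector 1 --> residue_ratio t \<in> sector 2"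
   "\<forall>t\<in>generic_zeros. (Im (- poly p2 t / poly p1 t) > 0 \<longleftrightarrow> Im (residue_ratio t) > 0) \<and>
    (Im (- poly p2 t / poly p1 t) < 0 \<longleftrightarrow> Im (residue_ratio t) < 0)"
   using one_minus_inverse_sector[OF residue_ratio_transforms(3) residue_ratio_transforms(1)] by blast+
  show "\<forall>y>0. \<exists>v\<in>sector 1. \<forall>t\<in>generic_zeros. - poly p2 t / poly p1 t = \<i> * of_real y \<longleftrightarrow> residue_ratio t = v"
  proof (intro allI impI)
   fix y :: real assume y: "y > 0"
   let ?v = "1 / (1 - \<i> * of_real y)"
   have nz: "1 - \<i> * of_real y ~= 0" by (simp add: complex_eq_iff)
   have "Im ?v = y / (1 + y\<^sup>2)" by (simp add: Im_divide)
   moreover have "1 + y\<^sup>2 > 0" by (simp add: add_pos_nonneg)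
   ultimately have "?v \<in> sector 1" using y by (simp add: cut_plane_def)
   moreover have "- poly p2 t / poly p1 t = \<i> * of_real y \<longleftrightarrow> residue_ratio t = ?v" if t: "t \<in> generic_zeros" for t
   proof -
    have "1 - 1 / residue_ratio t = \<i> * of_real y \<longleftrightarrow> 1 / residue_ratio t = 1 - \<i> * of_real y"
     by (auto simp: algebra_simps)
    also have "\<dots> \<longleftrightarrow> residue_ratio t = ?v" using residue_ratio_transforms(3)[OF t] nz by (auto simp: field_simps)
    finally show ?thesis by (simp only: residue_ratio_transforms(1)[OF t])
   qed
   ultimately show "\<exists>v\<in>sector 1. \<forall>t\<in>generic_zeros. - poly p2 t / poly p1 t = \<i> * of_real y \<longleftrightarrow> residue_ratio t = v"
    by blast
  qed
  show "\<forall>t\<in>generic_zeros. Im (residue_ratio t) < 0 --> lab 2 t = c 1 (lab 1 t)" using label_down(2) by blast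
  show "\<forall>w\<in>ball 0 (d / 2) - {0}. 1 - w \<in> generic_zeros \<and>
    - poly p2 (1 - w) / poly p1 (1 - w) = w ^ m2 * (- poly q2 w / poly p1 (1 - w))"
   using S by (simp add: p2_factor)
  show "\<forall>q\<in>?Q. poly p2 q = 0 & poly (pderiv p2) q ~= 0 & poly p1 q ~= 0" using Q by blast
  show "\<forall>q\<in>?Q. \<forall>w\<in>ball 0 (d / 2) - {0}. d / 2 <= dist q (1 - w)"
  proof (intro ballI)
   fix q w :: complex assume q: "q \<in> ?Q" and w: "w \<in> ball 0 (d / 2) - {0}"
   have "d <= dist 1 q" using d(2) Q[OF q] q by blast
   moreover have "dist 1 (1 - w) < d / 2" using w by (simp add: dist_norm)
   ultimately show "d / 2 <= dist q (1 - w)" using dist_triangle[of 1 q "1 - w"] by (simp add: dist_commute)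
  qed
  show "continuous_on (- {0}) (%w::complex. 1 - w)" by (intro continuous_intros)
  show "- poly q2 0 / poly p1 (1 - 0) ~= 0" using q2_props(2) special_values2(1) by simp
 qed (use m_eq(5) c_permutes d(1) finQ cardQ in \<open>auto simp: generic_zeros_def inj_on_def\<close>)
qed

lemma cycle3: "\<exists>A\<subseteq>{1..a}. card A = m3 & is_cycle_on (c 2) A"
proof -
 let ?Q = "{t. poly p3 t = 0}"
 have Q: "poly p3 q = 0 & poly (pderiv p3) q ~= 0 & poly p2 q ~= 0" if "q \<in> ?Q" for q
 proof -
  have "q ~= 0" "q ~= 1" using that special_values by auto
  then show ?thesis using pderiv_nonzero(3)[of q] that by auto
 qed
 have finQ: "finite ?Q" by (rule poly_roots_finite[OF degree_p3(2)])
 have "card ?Q = degree p3" by (rule card_simple_roots[OF degree_p3(2)]) (use Q in blast)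
 then have cardQ: "card ?Q + m3 = a" using degree_p3(1) m_eq b_pos by simp
 have "finite (?Q \<union> - generic_zeros)" using finQ finite_complement by simp
 then obtain M where M: "M > 0" "\<forall>x\<in>?Q \<union> - generic_zeros. norm x <= M"
  using finite_imp_bounded bounded_pos by blast
 \<comment> \<open>\<open>inverse\<close> maps the punctured ball of radius \<open>r\<close> beyond
   norm \<open>M + 1\<close>, so its image keeps distance at least 1 from \<open>?Q\<close>; this is
   the \<open>dl = 1\<close> used below.\<close>
 define r where "r = 1 / (M + 1)"
 have r: "r > 0" using M(1) by (simp add: r_def)
 have big: "M + 1 < norm (inverse x)" if "x \<in> ball 0 r" "x ~= 0" for x :: complex
 proof -
  have "inverse r < inverse (norm x)" using that by (intro less_imp_inverse_less) auto
  then show ?thesis by (simp add: r_def norm_inverse)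
 qed
 have S: "inverse x \<in> generic_zeros" if "x \<in> ball 0 r" "x ~= 0" for x
 proof (rule ccontr)
  assume "inverse x \<notin> generic_zeros"
  then have "norm (inverse x) <= M" using M(2) by blast
  then show False using big[OF that] by simp
 qed
 have refl: "poly (reflect_poly p) x = x ^ degree p * poly p (inverse x)" if "x ~= 0" for x :: complex and p
  using that by (rule poly_reflect_poly_nz)
 have nz2: "poly (reflect_poly p2) x ~= 0" if "x \<in> ball 0 r" for x
 proof (cases "x = 0")
  case True then show ?thesis using p2_nonzero(1) by (simp add: poly_0_coeff_0)
 next
  case False then show ?thesis using S[OF that] by (simp add: refl generic_zeros_def)
 qed
 \<comment> \<open>\<open>p2\<close> has degree \<open>a\<close> and \<open>p3\<close> has degree
   \<open>b3 - 1\<close>; the difference is the multiplicity \<open>m3\<close> at infinity.\<close>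
 have F: "- poly p3 (inverse w) / poly p2 (inverse w) = w ^ m3 * (- poly (reflect_poly p3) w / poly (reflect_poly p2) w)"
  if w: "w ~= 0" for w
 proof -
  have "a = m3 + (b3 - 1)" using m_eq b_pos by simp
  then have "w ^ a = w ^ m3 * w ^ (b3 - 1)" by (simp add: power_add)
  then show ?thesis using w by (simp add: refl p2_nonzero(2) degree_p3(1) field_simps)
 qed
 show ?thesis
 proof (rule cycle_at[where P = p3 and R = p2 and ssg = inverse and j = 2 and k = 0 and Q = ?Q
    and h = "%w. - poly (reflect_poly p3) w / poly (reflect_poly p2) w" and r = r and dl = 1])
  show "(%w. - poly (reflect_poly p3) w / poly (reflect_poly p2) w) holomorphic_on ball 0 r"
   using nz2 by (intro holomorphic_intros) auto
  show "\<forall>t\<in>generic_zeros. - poly p3 t / poly p2 t \<in> sector 0 --> residue_ratio t \<in> sector 2"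
   "\<forall>t\<in>generic_zeros. - poly p3 t / poly p2 t \<in> sector 1 --> residue_ratio t \<in> sector 0"
   "\<forall>t\<in>generic_zeros. (Im (- poly p3 t / poly p2 t) > 0 \<longleftrightarrow> Im (residue_ratio t) > 0) \<and>
    (Im (- poly p3 t / poly p2 t) < 0 \<longleftrightarrow> Im (residue_ratio t) < 0)"
   using inverse_one_minus_sector[OF residue_ratio_transforms(4) residue_ratio_transforms(2)] by blast+
  show "\<forall>y>0. \<exists>v\<in>sector 2. \<forall>t\<in>generic_zeros. - poly p3 t / poly p2 t = \<i> * of_real y \<longleftrightarrow> residue_ratio t = v"
  proof (intro allI impI)
   fix y :: real assume y: "y > 0"
   let ?v = "1 - 1 / (\<i> * of_real y)"
   have nz: "\<i> * of_real y ~= 0" using y by simp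
   have "Im ?v = 1 / y" using y by (simp add: Im_divide power2_eq_square)
   then have "?v \<in> sector 2" using y by (simp add: cut_plane_def)
   moreover have "- poly p3 t / poly p2 t = \<i> * of_real y \<longleftrightarrow> residue_ratio t = ?v" if t: "t \<in> generic_zeros" for t
   proof -
    have n1: "1 - residue_ratio t ~= 0" using residue_ratio_transforms(4)[OF t] by simp
    have "1 / (1 - residue_ratio t) = \<i> * of_real y \<longleftrightarrow> 1 - residue_ratio t = 1 / (\<i> * of_real y)"
    proof
     assume "1 / (1 - residue_ratio t) = \<i> * of_real y"
     then show "1 - residue_ratio t = 1 / (\<i> * of_real y)" using n1 by (metis div_by_1 divide_divide_eq_right mult_1)
    next
     assume e: "1 - residue_ratio t = 1 / (\<i> * of_real y)"
     show "1 / (1 - residue_ratio t) = \<i> * of_real y" unfolding e using nz by simp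
    qed
    also have "\<dots> \<longleftrightarrow> residue_ratio t = ?v" by (auto simp: algebra_simps)
    finally show ?thesis by (simp only: residue_ratio_transforms(2)[OF t])
   qed
   ultimately show "\<exists>v\<in>sector 2. \<forall>t\<in>generic_zeros. - poly p3 t / poly p2 t = \<i> * of_real y \<longleftrightarrow> residue_ratio t = v"
    by blast
  qed
  show "\<forall>t\<in>generic_zeros. Im (residue_ratio t) < 0 --> lab 0 t = c 2 (lab 2 t)" using label_down(3) by blast
  show "\<forall>w\<in>ball 0 r - {0 :: complex}. inverse w \<in> generic_zeros & - poly p3 (inverse w) / poly p2 (inverse w) =
    w ^ m3 * (- poly (reflect_poly p3) w / poly (reflect_poly p2) w)"
  proof
   fix w :: complex assume "w \<in> ball 0 r - {0}"
   then have "w \<in> ball 0 r" "w ~= 0" by auto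
   then show "inverse w \<in> generic_zeros & - poly p3 (inverse w) / poly p2 (inverse w) =
    w ^ m3 * (- poly (reflect_poly p3) w / poly (reflect_poly p2) w)" using S F by simp
  qed
  show "\<forall>q\<in>?Q. poly p3 q = 0 & poly (pderiv p3) q ~= 0 & poly p2 q ~= 0" using Q by blast
  show "\<forall>q\<in>?Q. \<forall>w\<in>ball 0 r - {0 :: complex}. 1 <= dist q (inverse w :: complex)"
  proof (intro ballI)
   fix q w :: complex assume q: "q \<in> ?Q" and w: "w \<in> ball 0 r - {0 :: complex}"
   have "norm q <= M" using M(2) q by blast
   moreover have "M + 1 < norm (inverse w)" using big w by blast
   ultimately show "1 <= dist q (inverse w)" using norm_triangle_sub[of "inverse w" q] by (simp add: dist_norm norm_minus_commute)
  qed
  show "continuous_on (- {0}) (inverse :: complex => complex)" by (intro continuous_intros) auto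
  show "- poly (reflect_poly p3) 0 / poly (reflect_poly p2) 0 ~= 0"
   using p2_nonzero(1) degree_p3(2) by (simp add: poly_0_coeff_0)
 qed (use m_eq(6) c_permutes r finQ cardQ in \<open>auto simp: generic_zeros_def inj_on_def\<close>)
qed

lemma residue_cycle_triple:
 assumes "m1 >= 2" "m2 >= 2" "m3 >= 2" shows "cycle_triple a (c 0) (c 1) (c 2) m1 m2 m3"
proof
 show "m1 + m2 + m3 = 2 * a + 1" using m_eq a_eq by simp
 show "\<And>x y. x \<in> {1..a} ==> y \<in> {1..a} ==> \<exists>g\<in>generate (sym_group a) {c 0, c 1, c 2}. g x = y"
  using G_transitive by blast
 show "c 2 (c 1 (c 0 x)) = x" for x using c_prod by (simp add: fun_eq_iff)
qed (use assms c_permutes cycle1 cycle2 cycle3 in blast)+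

end

section \<open>The sphere and its Moebius transformations\<close>

lemma inj_infinity_chart: "inj infinity_chart"
 by (rule injI) (auto simp: infinity_chart_def split: if_splits)

lemma range_infinity_chart: "range infinity_chart = - {Some 0}"
proof
 show "range infinity_chart <= - {Some 0}" by (auto simp: infinity_chart_def)
 show "- {Some 0} <= range infinity_chart"
 proof
  fix p :: sphere assume p: "p \<in> - {Some 0}"
  show "p \<in> range infinity_chart"
  proof (cases p)
   case None then have "p = infinity_chart 0" by (simp add: infinity_chart_def)
   then show ?thesis by simp
  next
   case (Some z)
   then have "p = infinity_chart (inverse z)" using p by (auto simp: infinity_chart_def)
   then show ?thesis by simp
  qed
 qed
qed

lemma inv_charts:
 "inv_into UNIV Some (Some z) = z" "inv_into UNIV infinity_chart (infinity_chart w) = w"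
proof -
 show "inv_into UNIV Some (Some z) = z" by (rule inv_into_f_f) auto
 show "inv_into UNIV infinity_chart (infinity_chart w) = w" by (rule inv_into_f_f[OF inj_infinity_chart UNIV_I])
qed

text \<open>A neighbourhood of infinity, the complement of a compact set, becomes a neighbourhood of
  0 in the chart at infinity; so the compactification carries the topology glued from the two
  charts.\<close>

lemma openin_sphere: "openin sphere_topology U \<longleftrightarrow> open (Some -` U) & open (infinity_chart -` U)"
proof
 have inv_open: "open {w. w ~= 0 & inverse w \<in> V}" if "open V" for V :: "complex set"
 proof -
  have "open ((- {0}) \<inter> inverse -` V)"
   by (rule continuous_open_preimage) (use that in \<open>auto intro!: continuous_intros\<close>)
  moreover have "(- {0}) \<inter> inverse -` V = {w. w ~= 0 & inverse w \<in> V}" by auto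
  ultimately show ?thesis by simp
 qed
 assume "openin sphere_topology U"
 then consider V where "open V" "U = Some ` V" | C where "compact C" "U = insert None (Some ` (UNIV - C))"
  unfolding sphere_topology_def openin_Alexandroff_compactification by auto
 then show "open (Some -` U) & open (infinity_chart -` U)"
 proof cases
  case 1
  have "Some -` U = V" using 1 by auto
  moreover have "infinity_chart -` U = {w. w ~= 0 & inverse w \<in> V}" using 1 by (auto simp: infinity_chart_def split: if_splits)
  ultimately show ?thesis using 1 inv_open by simp
 next
  case 2
  obtain R where R: "R > 0" "\<And>z. z \<in> C ==> norm z <= R" using compact_imp_bounded[OF 2(1)] bounded_pos by metis
  have "Some -` U = - C" using 2 by auto
  moreover have "infinity_chart -` U = ball 0 (inverse R) \<union> {w. w ~= 0 & inverse w \<in> - C}"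
  proof
   show "infinity_chart -` U <= ball 0 (inverse R) \<union> {w. w ~= 0 & inverse w \<in> - C}"
    using 2 R(1) by (auto simp: infinity_chart_def split: if_splits)
   show "ball 0 (inverse R) \<union> {w. w ~= 0 & inverse w \<in> - C} <= infinity_chart -` U"
   proof
    fix w assume w: "w \<in> ball 0 (inverse R) \<union> {w. w ~= 0 & inverse w \<in> - C}"
    show "w \<in> infinity_chart -` U"
    proof (cases "w = 0")
     case True then show ?thesis using 2 by (simp add: infinity_chart_def)
    next
     case False
     have "inverse w \<notin> C"
     proof
      assume "inverse w \<in> C"
      then have "norm (inverse w) <= R" "norm w < inverse R" using R(2) w by auto
      then have "inverse (norm w) <= R" "norm w < inverse R" by (simp_all add: norm_inverse)
      then show False using False R(1)
       by (metis inverse_inverse_eq inverse_less_imp_less leD norm_eq_zero zero_less_norm_iff inverse_positive_iff_positive less_imp_inverse_less)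
     qed
     then show ?thesis using False 2 by (auto simp: infinity_chart_def)
    qed
   qed
  qed
  moreover have "open (- C)" using 2(1) compact_imp_closed by blast
  ultimately show ?thesis using inv_open[of "- C"] by (simp only: open_Un open_ball simp_thms)
 qed
next
 assume U: "open (Some -` U) & open (infinity_chart -` U)"
 show "openin sphere_topology U"
 proof (cases "None \<in> U")
  case False
  have "p \<in> U \<longleftrightarrow> p \<in> Some ` (Some -` U)" for p by (cases p) (use False in auto)
  then have "U = Some ` (Some -` U)" by blast
  then show ?thesis unfolding sphere_topology_def openin_Alexandroff_compactification using U by auto
 next
  case True
  let ?C = "- (Some -` U)"
  have "0 \<in> infinity_chart -` U" using True by (simp add: infinity_chart_def)
  then obtain e where e: "e > 0" "ball 0 e <= infinity_chart -` U" using U openE by blast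
  have "?C <= cball 0 (inverse e)"
  proof
   fix z assume z: "z \<in> ?C"
   show "z \<in> cball 0 (inverse e)"
   proof (rule ccontr)
    assume "z \<notin> cball 0 (inverse e)"
    then have n: "norm z > inverse e" by simp
    then have z0: "norm z > 0" using e(1) by (meson less_trans positive_imp_inverse_positive)
    then have "norm (inverse z) < e" using less_imp_inverse_less[OF n positive_imp_inverse_positive[OF e(1)]] by (simp add: norm_inverse)
    then have "inverse z \<in> infinity_chart -` U" using e(2) by auto
    then show False using z z0 by (auto simp: infinity_chart_def)
   qed
  qed
  then have "compact ?C" using U by (meson bounded_cball bounded_subset closed_Compl compact_eq_bounded_closed)
  moreover have "U = insert None (Some ` (UNIV - ?C))"
  proof -
   have "p \<in> U \<longleftrightarrow> p \<in> insert None (Some ` (UNIV - ?C))" for p by (cases p) (use True in auto)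
   then show ?thesis by blast
  qed
  ultimately show ?thesis unfolding sphere_topology_def openin_Alexandroff_compactification
   using U by (intro disjI2 exI[of _ ?C]) auto
 qed
qed

lemma topspace_sphere: "topspace sphere_topology = UNIV"
 by (auto simp: sphere_topology_def UNIV_option_conv)

lemma charts_cover: "\<exists>aal\<in>sphere_charts. p \<in> range aal"
proof (cases p)
 case None
 have "p \<in> range infinity_chart" using None by (simp add: range_infinity_chart)
 then show ?thesis by (auto simp: sphere_charts_def)
qed (auto simp: sphere_charts_def)

lemma openin_chart_image:
 assumes "aal \<in> sphere_charts" "open V" shows "openin sphere_topology (aal ` V)"
proof -
 have inv_open: "open {w. w ~= 0 & inverse w \<in> V}"
 proof -
  have "open ((- {0}) \<inter> inverse -` V)"
   by (rule continuous_open_preimage) (use assms(2) in \<open>auto intro!: continuous_intros\<close>)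
  moreover have "(- {0}) \<inter> inverse -` V = {w. w ~= 0 & inverse w \<in> V}" by auto
  ultimately show ?thesis by simp
 qed
 consider "aal = Some" | "aal = infinity_chart" using assms(1) by (auto simp: sphere_charts_def)
 then show ?thesis
 proof cases
  case 1
  have "Some -` aal ` V = V" "infinity_chart -` aal ` V = {w. w ~= 0 & inverse w \<in> V}"
   using 1 by (auto simp: infinity_chart_def split: if_splits)
  then show ?thesis using assms(2) inv_open by (simp add: openin_sphere)
 next
  case 2
  have "Some -` aal ` V = {w. w ~= 0 & inverse w \<in> V}"
  proof
   show "Some -` aal ` V <= {w. w ~= 0 & inverse w \<in> V}" using 2 by (auto simp: infinity_chart_def split: if_splits)
   show "{w. w ~= 0 & inverse w \<in> V} <= Some -` aal ` V"
   proof
    fix w assume w: "w \<in> {w. w ~= 0 & inverse w \<in> V}"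
    then have "Some w = infinity_chart (inverse w)" by (simp add: infinity_chart_def)
    then show "w \<in> Some -` aal ` V" using w 2 by auto
   qed
  qed
  moreover have "infinity_chart -` aal ` V = V" using 2 inj_infinity_chart by (simp add: inj_vimage_image_eq)
  ultimately show ?thesis using assms(2) inv_open by (simp add: openin_sphere)
 qed
qed

lemma sphere_continuousI:
 assumes "\<And>aal \<beta>. aal \<in> sphere_charts ==> \<beta> \<in> sphere_charts ==> open {u. \<phi> (\<beta> u) \<in> range aal} \<and>
  continuous_on {u. \<phi> (\<beta> u) \<in> range aal} (%u. inv_into UNIV aal (\<phi> (\<beta> u)))"
 shows "continuous_map sphere_topology sphere_topology \<phi>"
 unfolding continuous_map_def
proof (intro conjI allI impI)
 show "\<phi> \<in> topspace sphere_topology \<rightarrow> topspace sphere_topology" by (simp add: topspace_sphere)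
 fix U assume U: "openin sphere_topology U"
 have *: "open {u. \<phi> (\<beta> u) \<in> U}" if \<beta>: "\<beta> \<in> sphere_charts" for \<beta>
 proof -
  let ?D = "%aal. {u. \<phi> (\<beta> u) \<in> range aal}"
  have "{u. \<phi> (\<beta> u) \<in> U} = (\<Union>aal\<in>sphere_charts. ?D aal \<inter> (%u. inv_into UNIV aal (\<phi> (\<beta> u))) -` (aal -` U))"
  proof
   show "{u. \<phi> (\<beta> u) \<in> U} <= (\<Union>aal\<in>sphere_charts. ?D aal \<inter> (%u. inv_into UNIV aal (\<phi> (\<beta> u))) -` (aal -` U))"
   proof
    fix u assume u: "u \<in> {u. \<phi> (\<beta> u) \<in> U}"
    obtain aal where aal: "aal \<in> sphere_charts" "\<phi> (\<beta> u) \<in> range aal" using charts_cover by blast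
    then show "u \<in> (\<Union>aal\<in>sphere_charts. ?D aal \<inter> (%u. inv_into UNIV aal (\<phi> (\<beta> u))) -` (aal -` U))"
     using u by (intro UN_I[OF aal(1)]) (simp add: f_inv_into_f)
   qed
   show "(\<Union>aal\<in>sphere_charts. ?D aal \<inter> (%u. inv_into UNIV aal (\<phi> (\<beta> u))) -` (aal -` U)) <= {u. \<phi> (\<beta> u) \<in> U}"
    by (auto simp: f_inv_into_f)
  qed
  moreover have "open (?D aal \<inter> (%u. inv_into UNIV aal (\<phi> (\<beta> u))) -` (aal -` U))" if aal: "aal \<in> sphere_charts" for aal
  proof (rule continuous_open_preimage)
   show "open (?D aal)" "continuous_on (?D aal) (%u. inv_into UNIV aal (\<phi> (\<beta> u)))" using assms[OF aal \<beta>] by auto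
   show "open (aal -` U)" using U aal unfolding openin_sphere sphere_charts_def by auto
  qed
  ultimately show ?thesis by auto
 qed
 have "open (Some -` {x. \<phi> x \<in> U})" "open (infinity_chart -` {x. \<phi> x \<in> U})"
  using *[of Some] *[of infinity_chart] by (simp_all add: sphere_charts_def vimage_def)
 then show "openin sphere_topology {x \<in> topspace sphere_topology. \<phi> x \<in> U}"
  by (simp add: openin_sphere topspace_sphere)
qed

lemma sphere_holomorphic_comp:
 assumes \<phi>: "sphere_holomorphic \<phi>" and pps: "sphere_holomorphic pps" shows "sphere_holomorphic (pps \<circ> \<phi>)"
 unfolding sphere_holomorphic_def
proof (intro conjI ballI)
 have c\<phi>: "continuous_map sphere_topology sphere_topology \<phi>" and cpps: "continuous_map sphere_topology sphere_topology pps"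
  using assms by (auto simp: sphere_holomorphic_def)
 then show "continuous_map sphere_topology sphere_topology (pps \<circ> \<phi>)" by (rule continuous_map_compose)
 have op: "open {u. g (\<beta> u) \<in> range aal}"
  if "continuous_map sphere_topology sphere_topology g" "aal \<in> sphere_charts" "\<beta> \<in> sphere_charts" for g aal \<beta>
 proof -
  have "openin sphere_topology (range aal)" using openin_chart_image[OF that(2) open_UNIV] .
  then have "openin sphere_topology {x \<in> topspace sphere_topology. g x \<in> range aal}"
   using that(1) by (auto simp: continuous_map_def)
  then have "open (Some -` {x. g x \<in> range aal})" "open (infinity_chart -` {x. g x \<in> range aal})"
   by (simp_all add: topspace_sphere openin_sphere)
  then show ?thesis using that(3) by (auto simp: sphere_charts_def vimage_def)
 qed
 fix aal \<beta> assume ab: "aal \<in> sphere_charts" "\<beta> \<in> sphere_charts"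
 let ?D = "{u. (pps \<circ> \<phi>) (\<beta> u) \<in> range aal}"
 have oD: "open ?D" using op[OF continuous_map_compose[OF c\<phi> cpps] ab] .
 show "(%u. inv_into UNIV aal ((pps \<circ> \<phi>) (\<beta> u))) holomorphic_on ?D"
  unfolding holomorphic_on_def
 proof
  fix u assume u: "u \<in> ?D"
  obtain gm where gm: "gm \<in> sphere_charts" "\<phi> (\<beta> u) \<in> range gm" using charts_cover by blast
  let ?E = "{u. \<phi> (\<beta> u) \<in> range gm}" and ?F = "{v. pps (gm v) \<in> range aal}"
  let ?g = "%u. inv_into UNIV gm (\<phi> (\<beta> u))" and ?h = "%v. inv_into UNIV aal (pps (gm v))"
  have oE: "open ?E" by (rule op[OF c\<phi> gm(1) ab(2)])
  have g: "?g holomorphic_on ?E" and h: "?h holomorphic_on ?F"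
   using \<phi> pps ab gm(1) by (auto simp: sphere_holomorphic_def)
  have gi: "gm (?g v) = \<phi> (\<beta> v)" if "v \<in> ?E" for v using that by (simp add: f_inv_into_f)
  have "?g ` (?E \<inter> ?D) <= ?F"
  proof (rule image_subsetI)
   fix v assume v: "v \<in> ?E \<inter> ?D"
   then have "pps (gm (?g v)) = pps (\<phi> (\<beta> v))" using gi by simp
   then show "?g v \<in> ?F" using v by simp
  qed
  then have "(?h \<circ> ?g) holomorphic_on (?E \<inter> ?D)"
   by (intro holomorphic_on_compose_gen[OF holomorphic_on_subset[OF g] h]) auto
  then have "(%u. inv_into UNIV aal ((pps \<circ> \<phi>) (\<beta> u))) holomorphic_on (?E \<inter> ?D)"
   by (rule holomorphic_transform) (simp add: f_inv_into_f)
  moreover have "open (?E \<inter> ?D)" "u \<in> ?E \<inter> ?D" using oE oD u gm(2) by auto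
  ultimately have "(%u. inv_into UNIV aal ((pps \<circ> \<phi>) (\<beta> u))) field_differentiable at u"
   by (meson holomorphic_on_imp_differentiable_at)
  then show "(%u. inv_into UNIV aal ((pps \<circ> \<phi>) (\<beta> u))) field_differentiable at u within ?D"
   by (rule field_differentiable_at_within)
 qed
qed

section \<open>Homogeneous coordinates and Moebius maps\<close>

fun hx :: "sphere => complex" where "hx None = 1" | "hx (Some z) = z"
fun hy :: "sphere => complex" where "hy None = 0" | "hy (Some z) = 1"

text \<open>The determinant of the homogeneous coordinates of two points: it replaces the difference
  \<open>x - y\<close> and still makes sense at infinity.\<close>

definition bracket :: "sphere => sphere => complex" where
 "bracket p q = hx p * hy q - hx q * hy p"

definition hom_point :: "complex => complex => sphere" where
 "hom_point N D = (if D = 0 then None else Some (N / D))"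

lemma h_nonzero: "hx p ~= 0 \<or> hy p ~= 0" by (cases p) auto

lemma hom_point_h [simp]: "hom_point (hx p) (hy p) = p" by (cases p) (auto simp: hom_point_def)

lemma hom_point_scale: "c ~= 0 ==> hom_point (c * N) (c * D) = hom_point N D"
 by (auto simp: hom_point_def)

lemma hom_point_scaling:
 assumes "N ~= 0 \<or> D ~= 0"
 obtains k where "k ~= 0" "N = k * hx (hom_point N D)" "D = k * hy (hom_point N D)"
 using assms by (cases "D = 0") (auto simp: hom_point_def)

lemma bracket_eq_0_iff: "bracket p q = 0 \<longleftrightarrow> p = q"
 by (cases p; cases q) (auto simp: bracket_def)

lemma bracket_Some [simp]: "bracket (Some x) (Some y) = x - y" "bracket (Some x) None = - 1"
 by (simp_all add: bracket_def)

text \<open>A matrix, not its class up to scalars; invertibility is imposed where needed by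
  \<open>mdet A ~= 0\<close>.\<close>

datatype moebius = Moebius (ma: complex) (mb: complex) (mc: complex) (md: complex)

definition mdet :: "moebius => complex" where "mdet A = ma A * md A - mb A * mc A"

definition mob :: "moebius => sphere => sphere" where
 "mob A p = hom_point (ma A * hx p + mb A * hy p) (mc A * hx p + md A * hy p)"

definition mult_moebius :: "moebius => moebius => moebius" where
 "mult_moebius A B = Moebius (ma A * ma B + mb A * mc B) (ma A * mb B + mb A * md B)
  (mc A * ma B + md A * mc B) (mc A * mb B + md A * md B)"

definition inv_moebius :: "moebius => moebius" where
 "inv_moebius A = Moebius (md A) (- mb A) (- mc A) (ma A)"

lemma mdet_mult: "mdet (mult_moebius A B) = mdet A * mdet B"
 by (simp add: mdet_def mult_moebius_def algebra_simps)

lemma mdet_inv: "mdet (inv_moebius A) = mdet A" by (simp add: mdet_def inv_moebius_def)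

lemma moebius_nonzero:
 assumes "mdet A ~= 0" "x ~= 0 \<or> y ~= 0" shows "ma A * x + mb A * y ~= 0 \<or> mc A * x + md A * y ~= 0"
proof (rule ccontr)
 assume "\<not> ?thesis"
 then have e: "ma A * x + mb A * y = 0" "mc A * x + md A * y = 0" by auto
 have "mdet A * x = md A * (ma A * x + mb A * y) - mb A * (mc A * x + md A * y)"
  "mdet A * y = ma A * (mc A * x + md A * y) - mc A * (ma A * x + mb A * y)"
  by (simp_all add: mdet_def algebra_simps)
 then show False using e assms by simp
qed

lemma mob_hom_point:
 assumes "mdet A ~= 0" "N ~= 0 \<or> D ~= 0"
 shows "mob A (hom_point N D) = hom_point (ma A * N + mb A * D) (mc A * N + md A * D)"
proof -
 obtain k where k: "k ~= 0" "N = k * hx (hom_point N D)" "D = k * hy (hom_point N D)"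
  using hom_point_scaling[OF assms(2)] .
 let ?x = "hx (hom_point N D)" and ?y = "hy (hom_point N D)"
 have e: "ma A * N + mb A * D = k * (ma A * ?x + mb A * ?y)" "mc A * N + md A * D = k * (mc A * ?x + md A * ?y)"
  by (subst (1) k(2), subst (1) k(3), simp add: algebra_simps)+
 show ?thesis unfolding e hom_point_scale[OF k(1)] by (simp add: mob_def)
qed

lemma mob_mult: "mdet A ~= 0 ==> mdet B ~= 0 ==> mob A (mob B p) = mob (mult_moebius A B) p"
proof -
 assume d: "mdet A ~= 0" "mdet B ~= 0"
 have "mob A (mob B p) = mob A (hom_point (ma B * hx p + mb B * hy p) (mc B * hx p + md B * hy p))"
  by (simp add: mob_def[of B])
 also have "\<dots> = mob (mult_moebius A B) p"
  unfolding mob_hom_point[OF d(1) moebius_nonzero[OF d(2) h_nonzero]]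
  by (simp add: mob_def mult_moebius_def algebra_simps)
 finally show ?thesis .
qed

lemma mob_inv: "mdet A ~= 0 ==> mob (inv_moebius A) (mob A p) = p" "mdet A ~= 0 ==> mob A (mob (inv_moebius A) p) = p"
proof -
 assume d: "mdet A ~= 0"
 have s: "mob (Moebius k 0 0 k) p = p" if "k ~= 0" for k
  using hom_point_scale[OF that, of "hx p" "hy p"] by (simp add: mob_def)
 have "mult_moebius (inv_moebius A) A = Moebius (mdet A) 0 0 (mdet A)"
  "mult_moebius A (inv_moebius A) = Moebius (mdet A) 0 0 (mdet A)"
  by (simp_all add: mult_moebius_def inv_moebius_def mdet_def algebra_simps)
 then show "mob (inv_moebius A) (mob A p) = p" "mob A (mob (inv_moebius A) p) = p"
  using d s[OF d] by (simp_all add: mob_mult mdet_inv)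
qed

lemma bij_mob: "mdet A ~= 0 ==> bij (mob A)" "mdet A ~= 0 ==> inv_into UNIV (mob A) = mob (inv_moebius A)"
proof -
 assume d: "mdet A ~= 0"
 show "bij (mob A)" by (rule bij_betw_byWitness[where f' = "mob (inv_moebius A)"]) (use mob_inv[OF d] in auto)
 show "inv_into UNIV (mob A) = mob (inv_moebius A)"
  by (rule inv_unique_comp) (use mob_inv[OF d] in \<open>simp_all add: fun_eq_iff\<close>)
qed

lemma hom_point_charts:
 assumes "N ~= 0 \<or> D ~= 0"
 shows "hom_point N D \<in> range Some \<longleftrightarrow> D ~= 0" "hom_point N D \<in> range infinity_chart \<longleftrightarrow> N ~= 0"
  "D ~= 0 ==> inv_into UNIV Some (hom_point N D) = N / D"
  "N ~= 0 ==> inv_into UNIV infinity_chart (hom_point N D) = D / N"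
proof -
 show "hom_point N D \<in> range Some \<longleftrightarrow> D ~= 0" by (auto simp: hom_point_def)
 show "hom_point N D \<in> range infinity_chart \<longleftrightarrow> N ~= 0"
  using assms by (auto simp: range_infinity_chart hom_point_def)
 show "D ~= 0 ==> inv_into UNIV Some (hom_point N D) = N / D" by (simp add: hom_point_def inv_charts)
 show "inv_into UNIV infinity_chart (hom_point N D) = D / N" if "N ~= 0"
 proof -
  have "hom_point N D = infinity_chart (D / N)" using that by (auto simp: hom_point_def infinity_chart_def)
  then show ?thesis by (simp add: inv_charts)
 qed
qed

lemma mob_chart:
 "mob A (Some u) = hom_point (ma A * u + mb A) (mc A * u + md A)"
 "mob A (infinity_chart u) = hom_point (ma A + mb A * u) (mc A + md A * u)"
proof -
 show "mob A (Some u) = hom_point (ma A * u + mb A) (mc A * u + md A)" by (simp add: mob_def)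
 show "mob A (infinity_chart u) = hom_point (ma A + mb A * u) (mc A + md A * u)"
 proof (cases "u = 0")
  case False
  have "hom_point (ma A + mb A * u) (mc A + md A * u) =
    hom_point (inverse u * (ma A + mb A * u)) (inverse u * (mc A + md A * u))"
   using hom_point_scale[of "inverse u"] False by simp
  also have "\<dots> = hom_point (ma A * inverse u + mb A) (mc A * inverse u + md A)"
  proof -
   have "inverse u * (x + y * u) = x * inverse u + y" for x y using False by (simp add: field_simps)
   then show ?thesis by simp
  qed
  finally show ?thesis using False by (simp add: mob_def infinity_chart_def)
 qed (simp add: mob_def infinity_chart_def)
qed

lemma sphere_holomorphic_mob:
 assumes d: "mdet A ~= 0" shows "sphere_holomorphic (mob A)"
proof -
 have *: "open {u. mob A (\<beta> u) \<in> range aal} \<and>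
   (%u. inv_into UNIV aal (mob A (\<beta> u))) holomorphic_on {u. mob A (\<beta> u) \<in> range aal}"
  if ab: "aal \<in> sphere_charts" "\<beta> \<in> sphere_charts" for aal \<beta>
 proof -
  obtain N D where ND: "\<And>u. mob A (\<beta> u) = hom_point (N u) (D u)" "\<And>u. N u ~= 0 \<or> D u ~= 0"
   "N holomorphic_on UNIV" "D holomorphic_on UNIV"
  proof -
   consider "\<beta> = Some" | "\<beta> = infinity_chart" using ab(2) by (auto simp: sphere_charts_def)
   then show ?thesis
   proof cases
    case 1
    show ?thesis
    proof (rule that[of "%u. ma A * u + mb A" "%u. mc A * u + md A"])
     show "ma A * u + mb A ~= 0 \<or> mc A * u + md A ~= 0" for u
      using moebius_nonzero[OF d, of u 1] by simp
    qed (use 1 mob_chart in \<open>auto intro!: holomorphic_intros\<close>)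
   next
    case 2
    show ?thesis
    proof (rule that[of "%u. ma A + mb A * u" "%u. mc A + md A * u"])
     show "ma A + mb A * u ~= 0 \<or> mc A + md A * u ~= 0" for u
      using moebius_nonzero[OF d, of 1 u] by simp
    qed (use 2 mob_chart in \<open>auto intro!: holomorphic_intros\<close>)
   qed
  qed
  have cont: "continuous_on UNIV N" "continuous_on UNIV D" using ND(3,4) holomorphic_on_imp_continuous_on by blast+
  have op: "open {u. g u ~= 0}" if "continuous_on UNIV g" for g :: "complex => complex"
   using that by (rule open_Collect_neq) (rule continuous_on_const)
  consider "aal = Some" | "aal = infinity_chart" using ab(1) by (auto simp: sphere_charts_def)
  then show ?thesis
  proof cases
   case 1
   have "{u. mob A (\<beta> u) \<in> range aal} = {u. D u ~= 0}" using hom_point_charts(1)[OF ND(2)] 1 ND(1) by auto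
   moreover have "(%u. inv_into UNIV aal (mob A (\<beta> u))) holomorphic_on {u. D u ~= 0}"
   proof (rule holomorphic_transform)
    show "(%u. N u / D u) holomorphic_on {u. D u ~= 0}"
     by (intro holomorphic_intros holomorphic_on_subset[OF ND(3)] holomorphic_on_subset[OF ND(4)]) auto
   qed (use 1 ND(1) hom_point_charts(3)[OF ND(2)] in auto)
   ultimately show ?thesis using op cont by simp
  next
   case 2
   have "{u. mob A (\<beta> u) \<in> range aal} = {u. N u ~= 0}" using hom_point_charts(2)[OF ND(2)] 2 ND(1) by auto
   moreover have "(%u. inv_into UNIV aal (mob A (\<beta> u))) holomorphic_on {u. N u ~= 0}"
   proof (rule holomorphic_transform)
    show "(%u. D u / N u) holomorphic_on {u. N u ~= 0}"
     by (intro holomorphic_intros holomorphic_on_subset[OF ND(3)] holomorphic_on_subset[OF ND(4)]) auto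
   qed (use 2 ND(1) hom_point_charts(4)[OF ND(2)] in auto)
   ultimately show ?thesis using op cont by simp
  qed
 qed
 show ?thesis unfolding sphere_holomorphic_def
  using * sphere_continuousI[of "mob A"] holomorphic_on_imp_continuous_on by blast
qed

lemma sphere_biholomorphism_mob: "mdet A ~= 0 ==> sphere_biholomorphism (mob A)"
 unfolding sphere_biholomorphism_def using bij_mob sphere_holomorphic_mob by (simp add: mdet_inv)

text \<open>In the chart at infinity the map has a simple zero at 0. So the affine map
  \<open>g\<close> grows at most linearly, is affine by Liouville, and is the identity because it
  fixes 0 and 1.\<close>

lemma biholomorphism_fixing_three_points:
 assumes tth: "sphere_holomorphic tth" "inj tth" and fixed: "tth None = None" "tth (Some 0) = Some 0" "tth (Some 1) = Some 1"
 shows "tth p = p"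
proof -
 define g where "g u = inv_into UNIV Some (tth (Some u))" for u
 define k where "k w = inv_into UNIV infinity_chart (tth (infinity_chart w))" for w
 have fin: "tth (Some u) \<in> range Some" for u
 proof -
  have "tth (Some u) ~= tth None" using tth(2) by (metis injD option.distinct(1))
  then show ?thesis using fixed(1) by (cases "tth (Some u)") auto
 qed
 have g: "tth (Some u) = Some (g u)" for u using f_inv_into_f[OF fin[of u]] by (simp add: g_def)
 have gh: "g holomorphic_on UNIV"
  using tth(1) fin unfolding sphere_holomorphic_def g_def sphere_charts_def by auto
 have inf: "tth (infinity_chart w) \<in> range infinity_chart" for w
 proof -
  have "infinity_chart w ~= Some 0" using range_infinity_chart by (metis ComplD insertI1 rangeI)
  then have "tth (infinity_chart w) ~= Some 0" using tth(2) fixed(2) by (metis injD)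
  then show ?thesis by (simp add: range_infinity_chart)
 qed
 have k: "tth (infinity_chart w) = infinity_chart (k w)" for w using f_inv_into_f[OF inf[of w]] by (simp add: k_def)
 have kh: "k holomorphic_on UNIV"
  using tth(1) inf unfolding sphere_holomorphic_def k_def sphere_charts_def by auto
 have kinj: "inj k"
 proof (rule injI)
  fix x y assume "k x = k y"
  then have "tth (infinity_chart x) = tth (infinity_chart y)" by (simp add: k)
  then show "x = y" using tth(2) inj_infinity_chart by (metis injD)
 qed
 have k0: "k 0 = 0"
 proof -
  have "infinity_chart (k 0) = infinity_chart 0" using k[of 0] fixed(1) by (simp add: infinity_chart_def)
  then show ?thesis using inj_infinity_chart by (metis injD)
 qed
 have kd: "deriv k 0 ~= 0" using holomorphic_injective_imp_regular[OF kh open_UNIV kinj] by simp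
 have gk: "g z * k (inverse z) = 1" if z: "z ~= 0" for z
 proof -
  have "infinity_chart (inverse z) = Some z" using z by (simp add: infinity_chart_def)
  then have "infinity_chart (k (inverse z)) = Some (g z)" using k[of "inverse z"] g[of z] by simp
  then have "k (inverse z) ~= 0" "inverse (k (inverse z)) = g z" by (auto simp: infinity_chart_def split: if_splits)
  then show ?thesis using left_inverse by metis
 qed
 have "(k has_field_derivative deriv k 0) (at 0)" using kh by (simp add: holomorphic_derivI)
 then have lim: "((%w. k w / w) \<longlongrightarrow> deriv k 0) (at 0)" using k0 by (simp add: has_field_derivative_iff)
 \<comment> \<open>Near 0 the quotient \<open>k w / w\<close> exceeds half of its limit in norm;
   through \<open>g z * k (inverse z) = 1\<close> this becomes the bound \<open>B * norm z\<close>
   for \<open>g z\<close> at large \<open>z\<close>.\<close>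
 have "\<forall>\<^sub>F w in at 0. norm (deriv k 0) / 2 < norm (k w / w)"
  by (rule order_tendstoD(1)[OF tendsto_norm[OF lim]]) (use kd in simp)
 then obtain e where e: "e > 0" "\<And>w. w ~= 0 ==> norm w < e ==> norm (deriv k 0) / 2 < norm (k w / w)"
  by (auto simp: eventually_at)
 define B where "B = 2 / norm (deriv k 0)"
 have bound: "norm (g z) <= B * norm z ^ 1" if z: "2 / e <= norm z" for z
 proof -
  have "2 / e > 0" using e(1) by simp
  then have z0: "z ~= 0" "norm z > 0" using z by auto
  have "1 / e < 2 / e" using e(1) by (simp add: divide_strict_right_mono)
  then have "1 / e < norm z" using z by simp
  then have "norm (inverse z) < e" using z0 e(1) by (simp add: norm_inverse norm_divide field_simps)
  then have "norm (deriv k 0) / 2 < norm (k (inverse z) / inverse z)" using e(2)[of "inverse z"] z0 by simp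
  moreover have "k (inverse z) / inverse z = k (inverse z) * z" by (simp only: divide_inverse inverse_inverse_eq)
  ultimately have 1: "norm (deriv k 0) / 2 < norm (k (inverse z)) * norm z" by (simp only: norm_mult)
  have 2: "norm (g z) * norm (k (inverse z)) = 1" using gk[OF z0(1)] by (metis norm_mult norm_one)
  then have gp: "norm (g z) > 0" by (metis mult_zero_left norm_eq_zero zero_less_norm_iff zero_neq_one)
  have "norm (g z) * (norm (deriv k 0) / 2) <= norm (g z) * (norm (k (inverse z)) * norm z)"
   using 1 gp by (intro mult_left_mono) simp_all
  also have "\<dots> = norm z" using 2 by (simp add: mult.assoc[symmetric])
  finally show ?thesis using kd by (simp add: B_def field_simps)
 qed
 have lin: "g \<xi> = g 0 + deriv g 0 * \<xi>" for \<xi>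
 proof -
  have "g \<xi> = (\<Sum>k\<le>1. (deriv ^^ k) g 0 / fact k * \<xi> ^ k)"
   by (rule Liouville_polynomial[OF gh, where A = "2 / e" and B = B and n = 1]) (rule bound)
  also have "\<dots> = g 0 + deriv g 0 * \<xi>" by simp
  finally show ?thesis .
 qed
 have "Some (g 0) = Some 0" "Some (g 1) = Some 1" using g[of 0] g[of 1] fixed by simp_all
 then have g01: "g 0 = 0" "g 1 = 1" by simp_all
 have "deriv g 0 = 1" using lin[of 1] by (simp add: g01)
 then have "g \<xi> = \<xi>" for \<xi> by (subst lin) (simp add: g01)
 then have "tth (Some u) = Some u" for u by (subst g) simp
 then show ?thesis using fixed(1) by (cases p) simp_all
qed

text \<open>The factor between the matrix image of the coordinates of \<open>p\<close> and the
  normalized coordinates of \<open>mob A p\<close>.\<close>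

definition mscale :: "moebius => sphere => complex" where
 "mscale A p = (if mc A * hx p + md A * hy p = 0 then ma A * hx p + mb A * hy p else mc A * hx p + md A * hy p)"

lemma mscale:
 assumes "mdet A ~= 0"
 shows "mscale A p ~= 0" "mscale A p * hx (mob A p) = ma A * hx p + mb A * hy p"
  "mscale A p * hy (mob A p) = mc A * hx p + md A * hy p"
 using moebius_nonzero[OF assms h_nonzero[of p]] by (auto simp: mscale_def mob_def hom_point_def)

lemma bracket_mob:
 assumes "mdet A ~= 0"
 shows "bracket (mob A p) (mob A q) = mdet A * bracket p q / (mscale A p * mscale A q)"
proof -
 have "mscale A p * mscale A q * bracket (mob A p) (mob A q) =
   (mscale A p * hx (mob A p)) * (mscale A q * hy (mob A q)) - (mscale A q * hx (mob A q)) * (mscale A p * hy (mob A p))"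
  by (simp add: bracket_def algebra_simps)
 also have "\<dots> = mdet A * bracket p q"
  unfolding mscale[OF assms] by (simp add: bracket_def mdet_def algebra_simps)
 finally show ?thesis using mscale(1)[OF assms] by (simp add: field_simps)
qed

lemma deriv_mob:
 assumes "mob A (Some x) ~= None"
 shows "((%u. the (mob A (Some u))) has_field_derivative (mdet A / (mc A * x + md A)\<^sup>2)) (at x)"
proof -
 have D: "mc A * x + md A ~= 0" using assms by (simp add: mob_def hom_point_def split: if_splits)
 have "((%u. (ma A * u + mb A) / (mc A * u + md A)) has_field_derivative
   (ma A * (mc A * x + md A) - (ma A * x + mb A) * mc A) / ((mc A * x + md A) * (mc A * x + md A))) (at x)"
  by (intro derivative_eq_intros refl | simp add: D)+
 moreover have "(ma A * (mc A * x + md A) - (ma A * x + mb A) * mc A) / ((mc A * x + md A) * (mc A * x + md A)) =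
   mdet A / (mc A * x + md A)\<^sup>2"
  by (simp add: mdet_def power2_eq_square algebra_simps)
 ultimately have 1: "((%u. (ma A * u + mb A) / (mc A * u + md A)) has_field_derivative mdet A / (mc A * x + md A)\<^sup>2) (at x)"
  by simp
 have 2: "open {u. mc A * u + md A ~= 0}" by (intro open_Collect_neq continuous_intros)
 show ?thesis
  by (rule has_field_derivative_transform_within_open[OF 1 2]) (use D in \<open>auto simp: mob_def hom_point_def\<close>)
qed

section \<open>Forms with one zero and their residues\<close>

text \<open>The image of a small circle winds once around the image point, because the logarithmic
  derivative of \<open>zt u - zt y\<close> has residue 1 at \<open>y\<close>. The residue theorem
  along this image curve then compares the two residues.\<close>

lemma residue_change_variable:
 assumes S: "open S" "y \<in> S" "zt holomorphic_on S" "inj_on zt S"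
  and G: "d > 0" "G holomorphic_on ball (zt y) d - {zt y}"
  and F: "\<forall>\<^sub>F u in at y. F u = G (zt u) * deriv zt u"
 shows "residue F y = residue G (zt y)"
proof -
 define D where "D = ball (zt y) d"
 define S' where "S' = S \<inter> zt -` D"
 have S': "open S'" "y \<in> S'" "S' <= S"
  unfolding S'_def D_def using S G(1)
  by (auto intro!: continuous_open_preimage holomorphic_on_imp_continuous_on)
 have hol: "zt holomorphic_on S'" by (rule holomorphic_on_subset[OF S(3) S'(3)])
 have hd: "deriv zt holomorphic_on S'" by (rule holomorphic_deriv[OF hol S'(1)])
 have ne: "zt u ~= zt y" if "u \<in> S' - {y}" for u using S(4) that S' by (auto dest: inj_onD)
 obtain r where r: "r > 0" "cball y r <= S'" using S' open_contains_cball by blast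
 let ?c = "circlepath y r" and ?g = "zt \<circ> circlepath y r"
 have pc: "path_image ?c <= S' - {y}" using r sphere_cball[of y r] by auto
 then have pc': "path_image ?c <= S'" by auto
 have vg: "valid_path ?g" by (rule valid_path_compose_holomorphic[OF _ hol S'(1) pc']) simp
 have pg: "path_image ?g <= D - {zt y}"
 proof -
  have "zt ` (S' - {y}) <= D - {zt y}" using ne by (auto simp: S'_def)
  then show ?thesis using pc unfolding path_image_compose by (meson image_mono order_trans)
 qed
 have int: "contour_integral ?g H = 2 * pi * \<i> * residue (%w. deriv zt w * H (zt w)) y"
  if H: "H holomorphic_on D - {zt y}" for H
 proof -
  have "zt analytic_on S'" using hol S'(1) by (simp add: analytic_on_open)
  then have "contour_integral ?g H = contour_integral ?c (%w. deriv zt w * H (zt w))"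
   by (rule contour_integral_comp_analyticW) (use pc' in auto)
  also have "\<dots> = 2 * pi * \<i> * residue (%w. deriv zt w * H (zt w)) y"
  proof (rule contour_integral_unique, rule base_residue[OF S'(1,2) r(1) _ r(2)])
   have "(H \<circ> zt) holomorphic_on S' - {y}"
    by (rule holomorphic_on_compose_gen[OF holomorphic_on_subset[OF hol] H]) (use ne in \<open>auto simp: S'_def\<close>)
   then show "(%w. deriv zt w * H (zt w)) holomorphic_on S' - {y}"
    by (intro holomorphic_on_mult holomorphic_on_subset[OF hd]) (auto simp: o_def)
  qed
  finally show ?thesis .
 qed
 have wn: "winding_number ?g (zt y) = 1"
 proof -
  have "residue (%w. deriv zt w * (1 / (zt w - zt y))) y = 1"
  proof (rule residue_simple'[OF S'(1,2)])
   show "(%w. deriv zt w * (1 / (zt w - zt y))) holomorphic_on S' - {y}"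
    using ne by (intro holomorphic_intros holomorphic_on_subset[OF hd] holomorphic_on_subset[OF hol]) auto
   have d0: "deriv zt y ~= 0" by (rule holomorphic_injective_imp_regular[OF S(3,1,4,2)])
   have "(zt has_field_derivative deriv zt y) (at y)" by (rule holomorphic_derivI[OF hol S'(1,2)])
   then have 1: "((%w. (zt w - zt y) / (w - y)) \<longlongrightarrow> deriv zt y) (at y)" by (simp add: has_field_derivative_iff)
   have "isCont (deriv zt) y"
    using holomorphic_on_imp_continuous_on[OF hd] S'(1,2) continuous_on_eq_continuous_at by blast
   then have "(deriv zt \<longlongrightarrow> deriv zt y) (at y)" by (simp add: isCont_def)
   then have "((%w. deriv zt w / ((zt w - zt y) / (w - y))) \<longlongrightarrow> deriv zt y / deriv zt y) (at y)"
    by (rule tendsto_divide[OF _ 1 d0])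
   then show "((%w. deriv zt w * (1 / (zt w - zt y)) * (w - y)) \<longlongrightarrow> 1) (at y)" using d0 by simp
  qed
  moreover have "(%w. 1 / (w - zt y)) holomorphic_on D - {zt y}" by (intro holomorphic_intros) auto
  ultimately have "contour_integral ?g (%w. 1 / (w - zt y)) = 2 * pi * \<i>" by (subst int) simp_all
  moreover have "zt y \<notin> path_image ?g" using pg by blast
  ultimately show ?thesis by (subst winding_number_valid_path[OF vg]) simp_all
 qed
 have "contour_integral ?g G = 2 * pi * \<i> * (\<Sum>p\<in>{zt y}. winding_number ?g p * residue G p)"
 proof (rule Residue_theorem[of D])
  show "G holomorphic_on D - {zt y}" using G(2) by (simp add: D_def)
  show "\<forall>z. z \<notin> D --> winding_number ?g z = 0"
   using pg vg unfolding D_def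
   by (intro allI impI winding_number_zero_outside[of _ "ball (zt y) d"])
    (auto simp: valid_path_imp_path pathfinish_compose pathstart_compose)
 qed (use pg vg in \<open>auto simp: D_def pathfinish_compose pathstart_compose\<close>)
 then have "contour_integral ?g G = 2 * pi * \<i> * residue G (zt y)" using wn by simp
 moreover have "contour_integral ?g G = 2 * pi * \<i> * residue (%w. deriv zt w * G (zt w)) y"
  by (rule int) (use G(2) in \<open>simp add: D_def\<close>)
 ultimately have "residue (%w. deriv zt w * G (zt w)) y = residue G (zt y)" by simp
 moreover have "residue F y = residue (%w. deriv zt w * G (zt w)) y"
  by (rule residue_cong[OF _ refl]) (use F in \<open>simp add: mult.commute\<close>)
 ultimately show ?thesis by simp
qed

text \<open>Pullback up to finitely many affine points, which is stable under changes of charts.\<close>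

definition pulls :: "moebius => (complex => complex) => (complex => complex) => bool" where
 "pulls A F G \<longleftrightarrow> finite {u. F u ~= G (the (mob A (Some u))) * (mdet A / (mc A * u + md A)\<^sup>2)}"

text \<open>The change between the two charts; its determinant - 1 accounts for the sign in
  \<open>coeff_at_infinity\<close>.\<close>

definition swap :: moebius where "swap = Moebius 0 1 1 0"

lemma mdet_swap: "mdet swap = - 1" by (simp add: mdet_def swap_def)

lemma mob_swap: "mob swap None = Some 0" "mob swap (Some 0) = None" "w ~= 0 ==> mob swap (Some w) = Some (inverse w)"
 by (simp_all add: swap_def mob_def hom_point_def divide_inverse)

lemma mob_Some: "mob A (Some u) = (if mc A * u + md A = 0 then None else Some ((ma A * u + mb A) / (mc A * u + md A)))"
 by (simp add: mob_def hom_point_def)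

lemma finite_pole:
 assumes "mdet A ~= 0" shows "finite {u. mc A * u + md A = 0}"
proof (cases "mc A = 0")
 case True
 then show ?thesis using assms by (simp add: mdet_def)
next
 case False
 then have "{u. mc A * u + md A = 0} <= {- md A / mc A}" by (auto simp: field_simps eq_neg_iff_add_eq_0)
 then show ?thesis using finite_subset by blast
qed

lemma is_pullback_mob:
 "is_pullback (mob A) g f \<longleftrightarrow>
  (\<forall>u. mc A * u + md A ~= 0 --> f u = g ((ma A * u + mb A) / (mc A * u + md A)) * (mdet A / (mc A * u + md A)\<^sup>2))"
proof -
 have "deriv (%u. the (mob A (Some u))) u = mdet A / (mc A * u + md A)\<^sup>2" if "mc A * u + md A ~= 0" for u
  by (rule DERIV_imp_deriv[OF deriv_mob]) (use that in \<open>simp add: mob_Some\<close>)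
 then show ?thesis unfolding is_pullback_def by (auto simp: mob_Some)
qed

lemma pulls_pullback:
 assumes "mdet A ~= 0" "is_pullback (mob A) g f" shows "pulls A f g"
proof -
 have "{u. f u ~= g (the (mob A (Some u))) * (mdet A / (mc A * u + md A)\<^sup>2)} <= {u. mc A * u + md A = 0}"
  using assms(2) by (auto simp: is_pullback_mob mob_Some)
 then show ?thesis unfolding pulls_def using finite_pole[OF assms(1)] finite_subset by blast
qed

lemma pulls_swap: "pulls swap (coeff_at_infinity f) f" "pulls swap f (coeff_at_infinity f)"
proof -
 have "{u. coeff_at_infinity f u ~= f (the (mob swap (Some u))) * (mdet swap / (mc swap * u + md swap)\<^sup>2)} <= {0}"
 proof
  fix u assume u: "u \<in> {u. coeff_at_infinity f u ~= f (the (mob swap (Some u))) * (mdet swap / (mc swap * u + md swap)\<^sup>2)}"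
  show "u \<in> {0}"
  proof (rule ccontr)
   assume "u \<notin> {0}"
   then have u0: "u ~= 0" by simp
   have "coeff_at_infinity f u = f (the (mob swap (Some u))) * (mdet swap / (mc swap * u + md swap)\<^sup>2)"
    unfolding mob_swap(3)[OF u0] mdet_swap by (simp add: coeff_at_infinity_def swap_def)
   then show False using u by simp
  qed
 qed
 then show "pulls swap (coeff_at_infinity f) f" unfolding pulls_def using finite_subset by blast
 have "{u. f u ~= coeff_at_infinity f (the (mob swap (Some u))) * (mdet swap / (mc swap * u + md swap)\<^sup>2)} <= {0}"
 proof
  fix u assume u: "u \<in> {u. f u ~= coeff_at_infinity f (the (mob swap (Some u))) * (mdet swap / (mc swap * u + md swap)\<^sup>2)}"
  show "u \<in> {0}"
  proof (rule ccontr)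
   assume "u \<notin> {0}"
   then have u0: "u ~= 0" by simp
   have "f u = coeff_at_infinity f (the (mob swap (Some u))) * (mdet swap / (mc swap * u + md swap)\<^sup>2)"
    unfolding mob_swap(3)[OF u0] mdet_swap using u0
    by (simp add: coeff_at_infinity_def swap_def power_divide power_inverse divide_inverse)
   then show False using u by simp
  qed
 qed
 then show "pulls swap f (coeff_at_infinity f)" unfolding pulls_def using finite_subset by blast
qed

lemma pulls_trans:
 assumes A: "mdet A ~= 0" and B: "mdet B ~= 0" and FG: "pulls A F G" and GH: "pulls B G H"
 shows "pulls (mult_moebius B A) F H"
proof -
 define E1 where "E1 = {u. F u ~= G (the (mob A (Some u))) * (mdet A / (mc A * u + md A)\<^sup>2)}"
 define E2 where "E2 = {u. G u ~= H (the (mob B (Some u))) * (mdet B / (mc B * u + md B)\<^sup>2)}"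
 define E0 where "E0 = {u. mc A * u + md A = 0}"
 define E3 where "E3 = (%v. the (mob (inv_moebius A) (Some v))) ` E2"
 have fin: "finite (E1 \<union> E0 \<union> E3)"
  using FG GH finite_pole[OF A] by (simp add: E0_def E1_def E2_def E3_def pulls_def)
 have "{u. F u ~= H (the (mob (mult_moebius B A) (Some u))) *
   (mdet (mult_moebius B A) / (mc (mult_moebius B A) * u + md (mult_moebius B A))\<^sup>2)} <= E1 \<union> E0 \<union> E3"
 proof (rule subsetI, rule ccontr)
  fix u assume u: "u \<in> {u. F u ~= H (the (mob (mult_moebius B A) (Some u))) *
    (mdet (mult_moebius B A) / (mc (mult_moebius B A) * u + md (mult_moebius B A))\<^sup>2)}"
   and "u \<notin> E1 \<union> E0 \<union> E3"
  then have n: "u \<notin> E1" "mc A * u + md A ~= 0" "u \<notin> E3" by (auto simp: E0_def)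
  define v where "v = (ma A * u + mb A) / (mc A * u + md A)"
  have v: "mob A (Some u) = Some v" using n(2) by (simp add: mob_Some v_def)
  have "v \<notin> E2"
  proof
   assume "v \<in> E2"
   then have "the (mob (inv_moebius A) (Some v)) \<in> E3" unfolding E3_def by (rule imageI)
   then show False using n(3) mob_inv(1)[OF A, of "Some u"] by (simp add: v)
  qed
  then have 1: "G v = H (the (mob B (Some v))) * (mdet B / (mc B * v + md B)\<^sup>2)" by (simp add: E2_def)
  have 2: "F u = G v * (mdet A / (mc A * u + md A)\<^sup>2)" using n(1) by (simp add: E1_def v)
  have 3: "mob (mult_moebius B A) (Some u) = mob B (Some v)" using mob_mult[OF B A, of "Some u"] by (simp add: v)
  have "v * (mc A * u + md A) = ma A * u + mb A" using n(2) by (simp add: v_def)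
  then have "mc B * (ma A * u + mb A) + md B * (mc A * u + md A) = (mc B * v + md B) * (mc A * u + md A)"
   by (metis (no_types, lifting) distrib_right mult.assoc)
  moreover have "mc (mult_moebius B A) * u + md (mult_moebius B A) = mc B * (ma A * u + mb A) + md B * (mc A * u + md A)"
   by (simp add: mult_moebius_def algebra_simps)
  ultimately have 4: "mc (mult_moebius B A) * u + md (mult_moebius B A) = (mc B * v + md B) * (mc A * u + md A)" by simp
  have "F u = H (the (mob (mult_moebius B A) (Some u))) *
    (mdet (mult_moebius B A) / (mc (mult_moebius B A) * u + md (mult_moebius B A))\<^sup>2)"
   unfolding 2 1 3 4 mdet_mult by (simp add: power_mult_distrib)
  then show False using u by simp
 qed
 then show ?thesis unfolding pulls_def using fin finite_subset by blast
qed

lemma eventually_not_in_finite: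
 assumes "finite E" shows "\<forall>\<^sub>F u in at (y::complex). u \<notin> E"
proof -
 have "open (- (E - {y}))" using assms finite_imp_closed[of "E - {y}"] by (simp only: open_Compl finite_Diff)
 then have "\<forall>\<^sub>F u in at y. u \<in> - (E - {y}) - {y}" by (rule eventually_at_in_open) simp
 then show ?thesis by (rule eventually_mono) blast
qed

lemma residue_pulls:
 assumes A: "mdet A ~= 0" and FG: "pulls A F G" and y: "mob A (Some y) = Some y'"
  and G: "isolated_singularity_at G y'"
 shows "residue F y = residue G y'"
proof -
 define zt where "zt u = the (mob A (Some u))" for u
 define S where "S = {u. mc A * u + md A ~= 0}"
 have "open S" unfolding S_def by (intro open_Collect_neq continuous_intros)
 have yS: "y \<in> S" using y by (auto simp: S_def mob_Some split: if_splits)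
 have der: "(zt has_field_derivative mdet A / (mc A * u + md A)\<^sup>2) (at u)" if "u \<in> S" for u
  unfolding zt_def by (rule deriv_mob) (use that in \<open>simp add: S_def mob_Some\<close>)
 have hol: "zt holomorphic_on S"
  unfolding holomorphic_on_def field_differentiable_def using der has_field_derivative_at_within by blast
 have inj: "inj_on zt S"
 proof (rule inj_onI)
  fix u v assume uv: "u \<in> S" "v \<in> S" "zt u = zt v"
  then have "mob A (Some u) = mob A (Some v)" by (simp add: zt_def mob_Some S_def)
  then have "Some u = Some v" using bij_mob(1)[OF A] by (meson bij_is_inj injD)
  then show "u = v" by simp
 qed
 have y': "zt y = y'" by (simp add: zt_def y)
 obtain d where d: "d > 0" "G analytic_on ball y' d - {y'}" using G by (auto simp: isolated_singularity_at_def)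
 have Gh: "G holomorphic_on ball (zt y) d - {zt y}" unfolding y' by (rule analytic_imp_holomorphic[OF d(2)])
 have "\<forall>\<^sub>F u in at y. u \<in> S" using eventually_at_in_open'[OF \<open>open S\<close> yS] .
 moreover have "\<forall>\<^sub>F u in at y. u \<notin> {u. F u ~= G (the (mob A (Some u))) * (mdet A / (mc A * u + md A)\<^sup>2)}"
  by (rule eventually_not_in_finite) (use FG in \<open>simp add: pulls_def\<close>)
 ultimately have "\<forall>\<^sub>F u in at y. F u = G (zt u) * deriv zt u"
 proof eventually_elim
  case (elim u)
  then show ?case using DERIV_imp_deriv[OF der[of u]] by (simp add: zt_def)
 qed
 then show ?thesis using residue_change_variable[OF \<open>open S\<close> yS hol inj d(1) Gh] by (simp add: y')
qed

text \<open>Composing with \<open>swap\<close> on either side brings infinity to 0, so the four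
  cases, according to whether \<open>p\<close> and its image are at infinity, all come from the
  affine statement \<open>residue_pulls\<close>.\<close>

lemma residue_pullback:
 assumes A: "mdet A ~= 0" and g: "meromorphic_form g" and pb: "is_pullback (mob A) g f"
 shows "form_residue f p = form_residue g (mob A p)"
proof -
 have iso: "isolated_singularity_at g x" "isolated_singularity_at (coeff_at_infinity g) 0" for x
 proof -
  have "g meromorphic_on {x}" using g by (auto simp: meromorphic_form_def nicely_meromorphic_on_def intro: meromorphic_on_subset)
  then show "isolated_singularity_at g x" by (simp add: meromorphic_at_iff)
  show "isolated_singularity_at (coeff_at_infinity g) 0" using g by (simp add: meromorphic_form_def meromorphic_at_iff)
 qed
 have J: "mdet swap ~= 0" by (simp add: mdet_swap)
 note pA = pulls_pullback[OF A pb]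
 have JA: "mdet (mult_moebius swap A) ~= 0" and AJ: "mdet (mult_moebius A swap) ~= 0" using A J by (simp_all add: mdet_mult)
 have p0: "mob swap (Some 0) = None" "mob swap None = Some 0" by (simp_all add: mob_swap)
 show ?thesis
 proof (cases p)
  case (Some y)
  show ?thesis
  proof (cases "mob A (Some y)")
   case S': (Some y')
   then show ?thesis using residue_pulls[OF A pA S' iso(1)] Some by simp
  next
   case None
   have "mob (mult_moebius swap A) (Some y) = Some 0" using mob_mult[OF J A, of "Some y"] None p0 by simp
   then show ?thesis using residue_pulls[OF JA pulls_trans[OF A J pA pulls_swap(2)] _ iso(2)] Some None by simp
  qed
 next
  case None
  have e: "mob (mult_moebius A swap) (Some 0) = mob A None" using mob_mult[OF A J, of "Some 0"] p0 by simp
  note pAJ = pulls_trans[OF J A pulls_swap(1) pA]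
  show ?thesis
  proof (cases "mob A None")
   case S': (Some y')
   then show ?thesis using residue_pulls[OF AJ pAJ _ iso(1)] e None by simp
  next
   case N: None
   have JAJ: "mdet (mult_moebius swap (mult_moebius A swap)) ~= 0" using J AJ by (simp add: mdet_mult)
   have "mob (mult_moebius swap (mult_moebius A swap)) (Some 0) = Some 0"
    using mob_mult[OF J AJ, of "Some 0"] e N p0 by simp
   then show ?thesis using residue_pulls[OF JAJ pulls_trans[OF AJ J pAJ pulls_swap(2)] _ iso(2)] N None by simp
  qed
 qed
qed

section \<open>Forms determined by their divisor up to a scalar\<close>

lemma ratio_limit:
 assumes "F meromorphic_on {x}" "G meromorphic_on {x}" "\<exists>\<^sub>F u in at x. F u ~= 0" "\<exists>\<^sub>F u in at x. G u ~= 0"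
  and "zorder F x = zorder G x"
 shows "\<exists>l. l ~= 0 & (%u. F u / G u) \<midarrow>x\<rightarrow> l"
proof -
 have ex: "\<exists>g r. r > 0 & g x ~= 0 & g holomorphic_on cball x r & (\<forall>w\<in>cball x r - {x}. H w = g w * (w - x) powi zorder H x)"
  if "H meromorphic_on {x}" "\<exists>\<^sub>F u in at x. H u ~= 0" for H
  using zorder_exist[of H x] that by (auto simp: meromorphic_at_iff)
 obtain g r where g: "r > 0" "g x ~= 0" "g holomorphic_on cball x r" "\<forall>w\<in>cball x r - {x}. F w = g w * (w - x) powi zorder F x"
  using ex[OF assms(1,3)] by blast
 obtain h s where h: "s > 0" "h x ~= 0" "h holomorphic_on cball x s" "\<forall>w\<in>cball x s - {x}. G w = h w * (w - x) powi zorder G x"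
  using ex[OF assms(2,4)] by blast
 have cont: "(k \<longlongrightarrow> k x) (at x)" if "t > 0" "k holomorphic_on cball x t" for k and t :: real
 proof -
  have "continuous_on (ball x t) k" using that(2) holomorphic_on_imp_continuous_on continuous_on_subset ball_subset_cball by blast
  then have "isCont k x" using that(1) continuous_on_eq_continuous_at open_ball centre_in_ball by blast
  then show ?thesis by (simp add: isCont_def)
 qed
 have "((%u. g u / h u) \<longlongrightarrow> g x / h x) (at x)" by (rule tendsto_divide[OF cont[OF g(1,3)] cont[OF h(1,3)] h(2)])
 moreover have "\<forall>\<^sub>F u in at x. g u / h u = F u / G u"
 proof -
  have "\<forall>\<^sub>F u in at x. u \<in> ball x (min r s) - {x}" by (rule eventually_at_in_open) (use g h in auto)
  then show ?thesis
  proof eventually_elim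
   case (elim u)
   then have u: "u ~= x" "u \<in> cball x r - {x}" "u \<in> cball x s - {x}" by auto
   then have "(u - x) powi zorder G x ~= 0" by simp
   moreover have "F u = g u * (u - x) powi zorder G x" "G u = h u * (u - x) powi zorder G x"
    using g(4) h(4) u assms(5) by auto
   ultimately show ?case by simp
  qed
 qed
 ultimately have "((%u. F u / G u) \<longlongrightarrow> g x / h x) (at x)" by (rule Lim_transform_eventually)
 then show ?thesis using g(2) h(2) by (intro exI[of _ "g x / h x"]) simp
qed

lemma prod_power_int:
 fixes x :: complex
 assumes "x ~= 0" "finite S" shows "(\<Prod>j\<in>S. x powi f j) = x powi (\<Sum>j\<in>S. f j)"
 using assms(2) by (induction S rule: finite_induct) (simp_all add: power_int_add assms(1))

locale form_data =
 fixes a :: nat and b :: "'p::finite => nat"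
 assumes a_pos: "a >= 1" and b_pos: "\<And>j. b j >= 1" and a_eq: "a + 2 = (\<Sum>j\<in>UNIV. b j)"
begin

text \<open>The bracket of an affine point with infinity is the constant - 1, so a zero or a pole at
  infinity contributes only a sign and no separate formula is needed.\<close>

definition form_of :: "complex => sphere => ('p => sphere) => complex => complex" where
 "form_of C q z x = C * bracket (Some x) q ^ a / (\<Prod>j\<in>UNIV. bracket (Some x) (z j) ^ b j)"

lemma form_of_scale: "form_of (k * C) q z = (%x. k * form_of C q z x)"
 by (simp add: form_of_def fun_eq_iff)

text \<open>Each bracket leaves a factor \<open>c u + d\<close> in the denominator. Since
  \<open>a\<close> minus the sum of the pole orders is - 2, these factors cancel against the
  derivative \<open>mdet A / (c u + d)^2\<close> up to this constant.\<close>

definition pull_factor :: "moebius => sphere => ('p => sphere) => complex" where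
 "pull_factor A q z = (mdet A / mscale A q) ^ a / (\<Prod>j\<in>UNIV. (mdet A / mscale A (z j)) ^ b j) * mdet A"

lemma pull_factor_nonzero: "mdet A ~= 0 ==> pull_factor A q z ~= 0"
 using mscale(1) by (simp add: pull_factor_def)

lemma form_of_pullback:
 assumes A: "mdet A ~= 0"
 shows "is_pullback (mob A) (form_of C (mob A q) (mob A \<circ> z)) (form_of (C * pull_factor A q z) q z)"
 unfolding is_pullback_mob
proof (intro allI impI)
 fix u assume s: "mc A * u + md A ~= 0"
 let ?s = "mc A * u + md A" and ?v = "(ma A * u + mb A) / (mc A * u + md A)"
 have v: "Some ?v = mob A (Some u)" using s by (simp add: mob_Some)
 have ms: "mscale A (Some u) = ?s" using s by (simp add: mscale_def)
 have br: "bracket (Some ?v) (mob A p) = bracket (Some u) p * (mdet A / mscale A p) / ?s" for p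
  unfolding v bracket_mob[OF A] ms by (simp add: mult_ac)
 have prod: "(\<Prod>j\<in>UNIV. bracket (Some ?v) ((mob A \<circ> z) j) ^ b j) =
   (\<Prod>j\<in>UNIV. bracket (Some u) (z j) ^ b j) * (\<Prod>j\<in>UNIV. (mdet A / mscale A (z j)) ^ b j) / ?s ^ (a + 2)"
  unfolding o_def br a_eq by (simp add: power_mult_distrib power_divide prod.distrib prod_dividef power_sum)
 have sa: "?s ^ (a + 2) = ?s ^ a * ?s\<^sup>2" by (rule power_add)
 have nz: "?s ^ a ~= 0" "?s\<^sup>2 ~= 0" using s by simp_all
 have alg: "C * (P * K) * D = C * (X * Y / t) / (Q * M / (t * r)) * (D / r)"
  if "t ~= 0" "r ~= 0" "P = X / Q" "K = Y / M" for C P K D X Y Q M t r :: complex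
  using that by (cases "Q = 0 \<or> M = 0") (auto simp: field_simps)
 show "form_of (C * pull_factor A q z) q z u = form_of C (mob A q) (mob A \<circ> z) ?v * (mdet A / ?s\<^sup>2)"
  unfolding form_of_def prod br pull_factor_def sa
  using alg[OF nz refl refl, where C = C and D = "mdet A" and X = "bracket (Some u) q ^ a" and
    Q = "\<Prod>j\<in>UNIV. bracket (Some u) (z j) ^ b j" and Y = "(mdet A / mscale A q) ^ a" and
    M = "\<Prod>j\<in>UNIV. (mdet A / mscale A (z j)) ^ b j"]
  by (simp add: power_mult_distrib power_divide mult_ac)
qed

lemma bracket_affine: "bracket (Some x) p = x * hy p - hx p" by (simp add: bracket_def)

lemma form_of_meromorphic: "form_of C q z meromorphic_on {x}"
 unfolding form_of_def[abs_def] bracket_affine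
 by (intro meromorphic_intros analytic_on_imp_meromorphic_on analytic_intros)

lemma form_of_analytic:
 assumes "Some x \<notin> range z" shows "form_of C q z analytic_on {x}"
proof -
 have "(\<Prod>j\<in>UNIV. bracket (Some x) (z j) ^ b j) ~= 0" using assms by (auto simp: bracket_eq_0_iff)
 then show ?thesis unfolding form_of_def[abs_def] bracket_affine by (intro analytic_intros) auto
qed

lemma form_of_eq_0_iff:
 assumes "C ~= 0" "Some x \<notin> range z" shows "form_of C q z x = 0 \<longleftrightarrow> q = Some x"
proof -
 have "(\<Prod>j\<in>UNIV. bracket (Some x) (z j) ^ b j) ~= 0" using assms by (auto simp: bracket_eq_0_iff)
 then show ?thesis using assms(1) a_pos by (auto simp: form_of_def bracket_eq_0_iff)
qed

lemma form_of_pole: "Some x \<in> range z ==> form_of C q z x = 0"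
proof -
 assume "Some x \<in> range z"
 then obtain j where "z j = Some x" by auto
 then have "bracket (Some x) (z j) ^ b j = 0" using b_pos[of j] by (simp add: bracket_eq_0_iff)
 then have "(\<Prod>j\<in>UNIV. bracket (Some x) (z j) ^ b j) = 0" by (intro prod_zero) auto
 then show ?thesis by (simp add: form_of_def)
qed

definition special_points :: "sphere => ('p => sphere) => complex set" where
 "special_points q z = {x. Some x \<in> insert q (range z)}"

lemma finite_special_points: "finite (special_points q z)"
 unfolding special_points_def using finite_vimageI[of "insert q (range z)" Some] by (simp add: vimage_def)

lemma form_of_frequently_nonzero:
 assumes "C ~= 0" shows "\<exists>\<^sub>F u in at x. form_of C q z u ~= 0"
proof (rule eventually_frequently)
 show "at x ~= bot" by simp
 have "\<forall>\<^sub>F u in at x. u \<notin> special_points q z" by (rule eventually_not_in_finite[OF finite_special_points])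
 then show "\<forall>\<^sub>F u in at x. form_of C q z u ~= 0"
  by (rule eventually_mono) (use assms form_of_eq_0_iff in \<open>auto simp: special_points_def\<close>)
qed

text \<open>The divisor of \<open>form_of\<close>. Contributions are summed, so the formula stays
  correct when labels collide or \<open>q\<close> is one of the poles.\<close>

definition order_at :: "sphere => ('p => sphere) => sphere => int" where
 "order_at q z p = (if p = q then int a else 0) - (\<Sum>j\<in>UNIV. if z j = p then int (b j) else 0)"

lemma zorder_form_of:
 assumes C: "C ~= 0" shows "zorder (form_of C q z) x = order_at q z (Some x)"
proof (rule zorder_eqI)
 define S where "S = - (special_points q z - {x})"
 \<comment> \<open>\<open>k p\<close> is the bracket with \<open>p\<close> after its zero at
   \<open>x\<close>, if there is one, has been divided out.\<close>
 define k where "k = (%p w. if p = Some x then 1 else bracket (Some w) p)"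
 define g where "g w = C * k q w ^ a / (\<Prod>j\<in>UNIV. k (z j) w ^ b j)" for w
 have "closed (special_points q z - {x})" by (rule finite_imp_closed) (simp add: finite_special_points)
 then show "open S" unfolding S_def by (rule open_Compl)
 show "x \<in> S" by (simp add: S_def)
 have knz: "k p w ~= 0" if "w \<in> S" "p \<in> insert q (range z)" for p w
 proof (cases "p = Some x")
  case False
  have "p ~= Some w" using that False by (auto simp: S_def special_points_def)
  then show ?thesis using False by (auto simp: k_def bracket_eq_0_iff)
 qed (simp add: k_def)
 have kh: "k p holomorphic_on S" for p
  unfolding k_def bracket_affine by (cases "p = Some x") (auto intro!: holomorphic_intros)
 show "g holomorphic_on S"
  unfolding g_def[abs_def] by (intro holomorphic_intros kh) (use knz in auto)
 show "g x ~= 0" using C knz[OF \<open>x \<in> S\<close>] by (simp add: g_def)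
 fix w assume w: "w \<in> S" "w ~= x"
 have br: "bracket (Some w) p ^ n = k p w ^ n * (w - x) powi (if p = Some x then int n else 0)" for p n
  by (simp add: k_def power_int_of_nat)
 have "(\<Prod>j\<in>UNIV. bracket (Some w) (z j) ^ b j) =
   (\<Prod>j\<in>UNIV. k (z j) w ^ b j) * (w - x) powi (\<Sum>j\<in>UNIV. if z j = Some x then int (b j) else 0)"
  unfolding br prod.distrib using w(2) by (subst prod_power_int) auto
 moreover have "bracket (Some w) q ^ a = k q w ^ a * (w - x) powi (if Some x = q then int a else 0)"
  unfolding br by (cases "q = Some x") auto
 ultimately show "form_of C q z w = g w * (w - x) powi order_at q z (Some x)"
  using w(2) by (simp add: form_of_def g_def order_at_def power_int_diff)
qed

lemma coeff_form_of:
 "\<exists>K. K ~= 0 & (\<forall>w. w ~= 0 --> coeff_at_infinity (form_of C q z) w = form_of (K * C) (mob swap q) (mob swap \<circ> z) w)"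
proof -
 have J: "mdet swap ~= 0" by (simp add: mdet_swap)
 have inv: "mob swap (mob swap p) = p" for p
  using mob_inv(1)[OF J, of p] hom_point_scale[of "- 1"]
  by (cases p; cases "the p = 0") (simp_all add: mob_swap)
 let ?K = "pull_factor swap (mob swap q) (mob swap \<circ> z)"
 have "is_pullback (mob swap) (form_of C q z) (form_of (C * ?K) (mob swap q) (mob swap \<circ> z))"
  using form_of_pullback[OF J, of C "mob swap q" "mob swap \<circ> z"] by (simp add: inv o_def)
 then have "form_of (C * ?K) (mob swap q) (mob swap \<circ> z) w = coeff_at_infinity (form_of C q z) w" if "w ~= 0" for w
  using that unfolding is_pullback_mob mdet_swap
  by (auto simp: coeff_at_infinity_def swap_def divide_inverse)
 then show ?thesis using pull_factor_nonzero[OF J] by (intro exI[of _ ?K]) (simp add: mult.commute)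
qed

lemma order_at_mob: "mdet A ~= 0 ==> order_at (mob A q) (mob A \<circ> z) (mob A p) = order_at q z p"
proof -
 assume "mdet A ~= 0"
 then have "mob A x = mob A y \<longleftrightarrow> x = y" for x y using bij_mob(1) by (metis bij_is_inj injD)
 then show ?thesis by (simp add: order_at_def)
qed

lemma form_order_form_of:
 assumes C: "C ~= 0"
 shows "form_order (form_of C q z) p = order_at q z p" "coeff_at_infinity (form_of C q z) meromorphic_on {0}"
  "\<exists>\<^sub>F w in at 0. coeff_at_infinity (form_of C q z) w ~= 0"
proof -
 obtain K where K: "K ~= 0" "\<forall>w. w ~= 0 --> coeff_at_infinity (form_of C q z) w = form_of (K * C) (mob swap q) (mob swap \<circ> z) w"
  using coeff_form_of by blast
 have ev: "\<forall>\<^sub>F w in at 0. coeff_at_infinity (form_of C q z) w = form_of (K * C) (mob swap q) (mob swap \<circ> z) w"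
  unfolding eventually_at_filter using K(2) by (simp add: eventually_mono)
 show "coeff_at_infinity (form_of C q z) meromorphic_on {0}"
  using form_of_meromorphic[of "K * C" "mob swap q" "mob swap \<circ> z" 0] meromorphic_on_cong'[OF _ refl] ev
  by (subst meromorphic_at_iff, subst isolated_singularity_at_cong[OF ev refl], subst not_essential_cong[OF ev refl])
   (simp add: meromorphic_at_iff)
 have KC: "K * C ~= 0" using K(1) C by simp
 show "\<exists>\<^sub>F w in at 0. coeff_at_infinity (form_of C q z) w ~= 0"
  by (rule frequently_rev_mp[OF form_of_frequently_nonzero[OF KC, of "mob swap q" "mob swap \<circ> z" 0]])
   (use ev in \<open>auto elim!: eventually_mono\<close>)
 show "form_order (form_of C q z) p = order_at q z p"
 proof (cases p)
  case None
  have "zorder (coeff_at_infinity (form_of C q z)) 0 = zorder (form_of (K * C) (mob swap q) (mob swap \<circ> z)) 0"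
   by (rule zorder_cong[OF ev refl])
  also have "\<dots> = order_at (mob swap q) (mob swap \<circ> z) (mob swap None)" using zorder_form_of[OF KC] by (simp add: mob_swap)
  also have "\<dots> = order_at q z None" by (rule order_at_mob) (simp add: mdet_swap)
  finally show ?thesis using None by simp
 qed (use zorder_form_of[OF C] in simp)
qed

lemma order_at_values:
 assumes "inj z" "q \<notin> range z"
 shows "order_at q z (z j) = - int (b j)" "order_at q z q = int a" "p ~= q ==> p \<notin> range z ==> order_at q z p = 0"
proof -
 have "(\<Sum>i\<in>UNIV. if z i = z j then int (b i) else 0) = (\<Sum>i\<in>UNIV. if i = j then int (b i) else 0)"
  by (rule sum.cong) (use assms(1) in \<open>auto dest: injD\<close>)
 then show "order_at q z (z j) = - int (b j)" using assms(2) by (auto simp: order_at_def)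
 have *: "(\<Sum>i\<in>UNIV. if z i = p then int (b i) else 0) = 0" if "p \<notin> range z" for p
  by (rule sum.neutral) (use that in auto)
 show "order_at q z q = int a" using *[OF assms(2)] by (simp add: order_at_def)
 show "p ~= q ==> p \<notin> range z ==> order_at q z p = 0" using *[of p] by (simp add: order_at_def)
qed

lemma positive_order_iff:
 assumes "inj z" "q \<notin> range z"
 shows "{p. order_at q z p > 0} = {q}" "{p. order_at q z p < 0} = range z"
proof -
 have c: "p = q \<or> (\<exists>j. p = z j) \<or> (p ~= q & p \<notin> range z)" for p by auto
 have n: "- int (b j) < 0" for j using b_pos[of j] by simp
 note v = order_at_values[OF assms]
 show "{p. order_at q z p > 0} = {q}"
 proof (rule Set.set_eqI)
  fix p show "p \<in> {p. order_at q z p > 0} \<longleftrightarrow> p \<in> {q}"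
   using c[of p] v n a_pos assms(2) by (elim disjE exE) (auto simp: v)
 qed
 show "{p. order_at q z p < 0} = range z"
 proof (rule Set.set_eqI)
  fix p show "p \<in> {p. order_at q z p < 0} \<longleftrightarrow> p \<in> range z"
   using c[of p] v n a_pos assms(2) by (elim disjE exE) (auto simp: v)
 qed
qed

lemma form_of_marked:
 assumes C: "C ~= 0" and z: "inj z" "q \<notin> range z"
 shows "(form_of C q z, z) \<in> marked_forms a b" "{p. form_order (form_of C q z) p > 0} = {q}"
proof -
 note fo = form_order_form_of[OF C]
 show q: "{p. form_order (form_of C q z) p > 0} = {q}" unfolding fo(1) using positive_order_iff(1)[OF z] .
 have neg: "{p. form_order (form_of C q z) p < 0} = range z" unfolding fo(1) using positive_order_iff(2)[OF z] .
 have nice: "form_of C q z nicely_meromorphic_on UNIV"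
  unfolding nicely_meromorphic_on_def
 proof (intro conjI ballI)
  show "form_of C q z meromorphic_on UNIV" using form_of_meromorphic meromorphic_on_meromorphic_at by blast
  fix x
  show "is_pole (form_of C q z) x & form_of C q z x = 0 \<or> form_of C q z \<midarrow>x\<rightarrow> form_of C q z x"
  proof (cases "Some x \<in> range z")
   case True
   then have "form_order (form_of C q z) (Some x) < 0" using neg by blast
   then have "zorder (form_of C q z) x < 0" by simp
   then have "is_pole (form_of C q z) x"
    using form_of_meromorphic[of C q z x] form_of_frequently_nonzero[OF C, where x = x]
    by (intro neg_zorder_imp_is_pole) (auto simp: meromorphic_at_iff)
   then show ?thesis using form_of_pole[OF True] by simp
  next
   case False
   then show ?thesis using analytic_at_imp_isCont[OF form_of_analytic] by (simp add: isCont_def)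
  qed
 qed
 have ex: "\<exists>x. form_of C q z x ~= 0" using form_of_frequently_nonzero[OF C] frequently_ex by blast
 have v: "form_order (form_of C q z) q = int a" "form_order (form_of C q z) (z j) = - int (b j)" for j
  using order_at_values[OF z] by (simp_all only: fo(1))
 have "bij_betw z UNIV {p. form_order (form_of C q z) p < 0}" unfolding neg bij_betw_def using z(1) by blast
 moreover have "\<exists>q'. {p. form_order (form_of C q z) p > 0} = {q'} & form_order (form_of C q z) q' = int a"
  using q v(1) by (intro exI[of _ q] conjI)
 ultimately show "(form_of C q z, z) \<in> marked_forms a b"
  unfolding marked_forms_def meromorphic_form_def mem_Collect_eq prod.case
  using nice fo(2) ex v(2) by (intro conjI allI)
qed

text \<open>The quotient by the explicit form with the same divisor has no zeros or poles, not even
  at infinity; once its singularities are removed it is constant by Liouville.\<close>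

lemma marked_formsE:
 assumes m: "(f, z) \<in> marked_forms a b"
 obtains C q where "C ~= 0" "inj z" "q \<notin> range z" "f = form_of C q z" "{p. form_order f p > 0} = {q}"
proof -
 obtain q where q: "{p. form_order f p > 0} = {q}" "form_order f q = int a" using m by (auto simp: marked_forms_def)
 have z: "inj z" "range z = {p. form_order f p < 0}" "\<And>j. form_order f (z j) = - int (b j)"
  using m by (auto simp: marked_forms_def bij_betw_def)
 have nice: "f nicely_meromorphic_on UNIV" and inf: "coeff_at_infinity f meromorphic_on {0}" and ex: "\<exists>x. f x ~= 0"
  using m by (auto simp: marked_forms_def meromorphic_form_def)
 have qz: "q \<notin> range z" using q(2) by (simp add: z(2))
 define G where "G = form_of 1 q z"
 have ord: "form_order f p = form_order G p" for p
 proof -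
  note v = order_at_values[OF z(1) qz]
  consider "p = q" | j where "p = z j" | "p ~= q" "p \<notin> range z" by blast
  then have "form_order f p = order_at q z p"
  proof cases
   case 1 then show ?thesis using q(2) v by simp
  next
   case 2 then show ?thesis using z(3) v by simp
  next
   case 3
   then have "\<not> form_order f p > 0" "\<not> form_order f p < 0" using q(1) z(2) by blast+
   then show ?thesis using v(3)[OF 3] by simp
  qed
  then show ?thesis by (simp add: G_def form_order_form_of(1))
 qed
 have mf: "f meromorphic_on {x}" for x
  using nice by (auto simp: nicely_meromorphic_on_def intro: meromorphic_on_subset)
 have mG: "G meromorphic_on {x}" for x unfolding G_def by (rule form_of_meromorphic)
 have ff: "\<exists>\<^sub>F u in at x. f u ~= 0" for x
 proof (rule ccontr)
  assume "\<not> ?thesis"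
  then have "\<forall>\<^sub>F u in at x. f u = 0" by (simp add: frequently_def)
  then have "\<exists>\<^sub>F u in at x. f u = 0" by (intro eventually_frequently) simp_all
  then have "f w = 0" for w
   by (rule frequently_eq_meromorphic_imp_constant[OF _ nice]) (simp_all add: convex_connected)
  then show False using ex by simp
 qed
 have fG: "\<exists>\<^sub>F u in at x. G u ~= 0" for x unfolding G_def by (rule form_of_frequently_nonzero) simp
 \<comment> \<open>If the coefficient at infinity vanished near 0, then \<open>f\<close> would
   vanish around the point 2 / \<open>e\<close>, against \<open>ff\<close>.\<close>
 have fi: "\<exists>\<^sub>F w in at 0. coeff_at_infinity f w ~= 0"
 proof (rule ccontr)
  assume "\<not> ?thesis"
  then have "\<forall>\<^sub>F w in at 0. coeff_at_infinity f w = 0" by (simp add: frequently_def)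
  then obtain e where e: "e > 0" "\<And>w. w ~= 0 ==> norm w < e ==> coeff_at_infinity f w = 0"
   by (auto simp: eventually_at)
  define x where "x = complex_of_real (2 / e)"
  have "open {u. norm u > 1 / e}" by (intro open_Collect_less continuous_intros)
  moreover have "norm x = 2 / e" unfolding x_def norm_of_real using e(1) by simp
  then have "x \<in> {u. norm u > 1 / e}" using e(1) divide_strict_right_mono[of 1 2 e] by simp
  ultimately have "\<forall>\<^sub>F u in at x. u \<in> {u. norm u > 1 / e}" by (rule eventually_at_in_open')
  then have "\<forall>\<^sub>F u in at x. f u = 0"
  proof eventually_elim
   case (elim u)
   then have u: "norm u > 1 / e" by simp
   then have "norm u > 0" using e(1) by (meson divide_pos_pos less_trans zero_less_one)
   then have u0: "u ~= 0" by simp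
   have "norm (inverse u) < e" using u e(1) \<open>norm u > 0\<close> by (simp add: norm_inverse norm_divide field_simps)
   then have "coeff_at_infinity f (inverse u) = 0" using e(2) u0 by simp
   then show ?case using u0 by (simp add: coeff_at_infinity_def)
  qed
  then show False using ff[of x] by (simp add: frequently_def)
 qed
 have lim: "\<exists>l. l ~= 0 & (%u. f u / G u) \<midarrow>x\<rightarrow> l" for x
  by (rule ratio_limit[OF mf mG ff fG]) (use ord[of "Some x"] in simp)
 have "\<exists>l. l ~= 0 & (%u. coeff_at_infinity f u / coeff_at_infinity G u) \<midarrow>0\<rightarrow> l"
  by (rule ratio_limit[OF inf _ fi]) (use form_order_form_of[of 1 q z] ord[of None] in \<open>simp_all add: G_def\<close>)
 then obtain l where l: "l ~= 0" "(%u. coeff_at_infinity f u / coeff_at_infinity G u) \<midarrow>0\<rightarrow> l" by blast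
 have "((%u. f (inverse u) / G (inverse u)) \<longlongrightarrow> l) (at 0)"
  by (rule Lim_transform_eventually[OF l(2)])
   (auto simp: eventually_at_filter coeff_at_infinity_def intro!: always_eventually)
 then have li: "((%u. f u / G u) \<longlongrightarrow> l) at_infinity" by (simp add: lim_at_infinity_0 o_def)
 define R where "R = remove_sings (%u. f u / G u)"
 have an: "R analytic_on {x}" for x
 proof -
  obtain l where "(%u. f u / G u) \<midarrow>x\<rightarrow> l" using lim by blast
  moreover have "isolated_singularity_at (%u. f u / G u) x"
  proof -
   have "(%u. f u / G u) meromorphic_on {x}" by (intro meromorphic_intros mf mG)
   then show ?thesis by (simp add: meromorphic_at_iff)
  qed
  ultimately show ?thesis unfolding R_def by (intro remove_sings_analytic_at)
 qed
 have "R analytic_on UNIV" using an by (subst analytic_on_analytic_at) simp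
 then have hol: "R holomorphic_on UNIV" by (rule analytic_imp_holomorphic)
 let ?E = "special_points q z"
 have anf: "f analytic_on {x}" if x: "Some x \<notin> range z" for x
 proof (rule nicely_meromorphic_on_imp_analytic_at[OF nice UNIV_I])
  show "\<not> is_pole f x"
  proof
   assume "is_pole f x"
   then have "zorder f x < 0" using mf[of x] by (intro isolated_pole_imp_neg_zorder) (auto simp: meromorphic_at_iff)
   then show False using x by (simp add: z(2))
  qed
 qed
 have RE: "R x = f x / G x" if x: "x \<notin> ?E" for x
 proof -
  have x': "Some x \<notin> range z" "q ~= Some x" using x by (auto simp: special_points_def)
  then have "G x ~= 0" unfolding G_def by (subst form_of_eq_0_iff) auto
  moreover have "G analytic_on {x}" unfolding G_def by (rule form_of_analytic[OF x'(1)])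
  ultimately have "(%u. f u / G u) analytic_on {x}" using anf[OF x'(1)] by (intro analytic_intros) auto
  then show ?thesis unfolding R_def by (rule remove_sings_at_analytic)
 qed
 have "\<forall>\<^sub>F u in at_infinity. u \<notin> ?E"
 proof -
  obtain B where "\<And>u. u \<in> ?E ==> norm u <= B" using finite_imp_bounded[OF finite_special_points] bounded_iff by metis
  then have "\<forall>u. B + 1 <= norm u --> u \<notin> ?E" by force
  then show ?thesis unfolding eventually_at_infinity by blast
 qed
 then have "\<forall>\<^sub>F u in at_infinity. f u / G u = R u" by (rule eventually_mono) (simp add: RE)
 then have "(R \<longlongrightarrow> l) at_infinity" by (rule Lim_transform_eventually[OF li])
 then have Rl: "R x = l" for x using Liouville_weak[OF hol] by simp
 have feq: "f x = l * G x" if x: "x \<notin> ?E" for x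
 proof -
  have "Some x \<notin> range z" "q ~= Some x" using x by (auto simp: special_points_def)
  then have "G x ~= 0" unfolding G_def by (subst form_of_eq_0_iff) auto
  then show ?thesis using RE[OF x] Rl[of x] by (simp add: field_simps)
 qed
 \<comment> \<open>At a pole both sides are 0 by the convention for nicely meromorphic functions;
   elsewhere both sides are continuous and agree nearby.\<close>
 have "f x = l * G x" for x
 proof (cases "Some x \<in> range z")
  case True
  then have "zorder f x < 0" by (simp add: z(2))
  then have "is_pole f x" using mf[of x] ff by (intro neg_zorder_imp_is_pole) (auto simp: meromorphic_at_iff)
  then have "f x = 0"
  proof -
   have "\<not> f \<midarrow>x\<rightarrow> f x"
    using \<open>is_pole f x\<close> not_tendsto_and_filterlim_at_infinity[of "at x" f "f x"] by (auto simp: is_pole_def)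
   moreover have "is_pole f x & f x = 0 \<or> f \<midarrow>x\<rightarrow> f x" using nice by (simp add: nicely_meromorphic_on_def)
   ultimately show ?thesis by blast
  qed
  then show ?thesis using form_of_pole[OF True] by (simp add: G_def)
 next
  case False
  have 1: "(f \<longlongrightarrow> f x) (at x)" using analytic_at_imp_isCont[OF anf[OF False]] by (simp add: isCont_def)
  have "(G \<longlongrightarrow> G x) (at x)" unfolding G_def
   using analytic_at_imp_isCont[OF form_of_analytic[OF False]] by (simp add: isCont_def)
  then have 2: "((%u. l * G u) \<longlongrightarrow> l * G x) (at x)" by (intro tendsto_intros)
  have "\<forall>\<^sub>F u in at x. l * G u = f u"
   using eventually_not_in_finite[OF finite_special_points, of q z x] by (rule eventually_mono) (simp add: feq)
  then have "(f \<longlongrightarrow> l * G x) (at x)" by (rule Lim_transform_eventually[OF 2])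
  then show ?thesis using tendsto_unique[OF _ 1] by simp
 qed
 then have "f = form_of l q z" using form_of_scale[of l 1] by (simp add: G_def fun_eq_iff)
 then show ?thesis using that[OF l(1) z(1) qz] q(1) by blast
qed

end

section \<open>The cross-ratio coordinate on the stratum\<close>

lemma residue_scale: "isolated_singularity_at f z ==> residue (%u. c * f u) z = c * residue f z"
proof -
 assume "isolated_singularity_at f z"
 then obtain d where d: "d > 0" "f analytic_on ball z d - {z}" by (auto simp: isolated_singularity_at_def)
 show ?thesis by (rule residue_lmul[OF open_ball]) (use d analytic_imp_holomorphic in auto)
qed

lemma form_residue_scale:
 assumes "meromorphic_form f" shows "form_residue (%x. c * f x) p = c * form_residue f p"
proof (cases p)
 case (Some x)
 have "f meromorphic_on {x}" using assms by (auto simp: meromorphic_form_def nicely_meromorphic_on_def intro: meromorphic_on_subset)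
 then show ?thesis using Some by (simp add: residue_scale meromorphic_at_iff)
next
 case None
 have "coeff_at_infinity (%x. c * f x) = (%w. c * coeff_at_infinity f w)" by (simp add: coeff_at_infinity_def fun_eq_iff)
 then show ?thesis using assms None by (simp add: residue_scale meromorphic_at_iff meromorphic_form_def)
qed

lemma is_pullback_unique:
 assumes "is_pullback (mob A) g f" "is_pullback (mob A) g f'"
 shows "{u. f u ~= f' u} <= {u. mc A * u + md A = 0}"
proof (rule subsetI, rule ccontr)
 fix u assume u: "u \<in> {u. f u ~= f' u}" "u \<notin> {u. mc A * u + md A = 0}"
 then have "mc A * u + md A ~= 0" by simp
 then have "f u = f' u" using assms[unfolded is_pullback_mob] by metis
 then show False using u(1) by simp
qed

lemma three_distinct: "(1::3) ~= 2" "(2::3) ~= 3" "(1::3) ~= 3"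
 by simp_all

lemma prod_3: "(\<Prod>j\<in>(UNIV::3 set). f j) = f 1 * f 2 * (f 3 :: 'a::comm_monoid_mult)"
 unfolding UNIV_3 by (simp add: mult_ac)

locale three_poles = form_data a b for a and b :: "3 => nat"
begin

sublocale rd: residue_data a "b 1" "b 2" "b 3"
 by unfold_locales (use a_pos b_pos a_eq in \<open>simp_all add: sum_3\<close>)

definition base_points :: "3 => sphere" where
 "base_points j = (if j = 1 then Some 0 else if j = 2 then Some 1 else None)"

lemma base_points [simp]: "base_points 1 = Some 0" "base_points 2 = Some 1" "base_points 3 = None"
 using three_distinct by (simp_all add: base_points_def)

lemma base_points_inj: "inj base_points" "Some t \<notin> range base_points \<longleftrightarrow> t ~= 0 & t ~= 1"
proof -
 show "inj base_points"
 proof (rule injI)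
  fix i j assume "base_points i = base_points j"
  then show "i = j" using exhaust_3[of i] exhaust_3[of j] by auto
 qed
 show "Some t \<notin> range base_points \<longleftrightarrow> t ~= 0 & t ~= 1" unfolding UNIV_3 by auto
qed

text \<open>The Moebius map that sends the three poles to 0, 1, infinity. In homogeneous coordinates
  it needs no case distinction for a pole at infinity.\<close>

definition normalizer :: "(3 => sphere) => moebius" where
 "normalizer z = (let k = bracket (z 2) (z 3); l = bracket (z 2) (z 1) in
  Moebius (hy (z 1) * k) (- hx (z 1) * k) (hy (z 3) * l) (- hx (z 3) * l))"

lemma mob_normalizer: "mob (normalizer z) p =
  hom_point (bracket p (z 1) * bracket (z 2) (z 3)) (bracket p (z 3) * bracket (z 2) (z 1))"
 by (simp add: mob_def normalizer_def Let_def bracket_def algebra_simps)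

lemma normalizer:
 assumes "inj z" shows "mdet (normalizer z) ~= 0" "mob (normalizer z) (z j) = base_points j"
  "mob (normalizer z) \<circ> z = base_points"
proof -
 have d: "z 1 ~= z 2" "z 2 ~= z 3" "z 1 ~= z 3" using assms three_distinct by (auto dest: injD)
 have "mdet (normalizer z) = bracket (z 1) (z 3) * bracket (z 2) (z 3) * bracket (z 2) (z 1)"
  by (simp add: mdet_def normalizer_def Let_def bracket_def algebra_simps)
 then show "mdet (normalizer z) ~= 0" using d by (auto simp: bracket_eq_0_iff)
 have nz: "bracket (z 2) (z 1) ~= 0" "bracket (z 2) (z 3) ~= 0" "bracket (z 1) (z 3) ~= 0" "bracket (z 3) (z 1) ~= 0"
  "bracket (z 3) (z 3) = 0" "bracket (z 1) (z 1) = 0"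
  using d by (auto simp: bracket_eq_0_iff)
 show *: "mob (normalizer z) (z j) = base_points j" for j
  using exhaust_3[of j] nz by (auto simp: mob_normalizer hom_point_def)
 show "mob (normalizer z) \<circ> z = base_points" by (rule ext) (simp add: *)
qed

definition zero_of :: "(complex => complex) => sphere" where
 "zero_of f = (THE q. form_order f q > 0)"

text \<open>For a marked form the zero differs from the third pole, so it is not sent to infinity
  and \<open>the\<close> returns a genuine value.\<close>

definition cross_ratio :: "3 marked_form => complex" where
 "cross_ratio m = the (mob (normalizer (snd m)) (zero_of (fst m)))"

lemma marked_form_data:
 assumes m: "m \<in> marked_forms a b"
 obtains C q where "C ~= 0" "inj (snd m)" "q \<notin> range (snd m)" "fst m = form_of C q (snd m)" "zero_of (fst m) = q"
  "mob (normalizer (snd m)) q = Some (cross_ratio m)" "cross_ratio m ~= 0" "cross_ratio m ~= 1"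
proof -
 obtain f z where fz: "m = (f, z)" by (cases m)
 obtain C q where C: "C ~= 0" "inj z" "q \<notin> range z" "f = form_of C q z" "{p. form_order f p > 0} = {q}"
  using marked_formsE m unfolding fz by blast
 have zq: "zero_of f = q" unfolding zero_of_def
  by (rule the_equality) (use C(5) in blast)+
 have inj: "inj (mob (normalizer z))" using bij_mob(1)[OF normalizer(1)[OF C(2)]] by (rule bij_is_inj)
 have ne: "mob (normalizer z) q ~= base_points j" for j
 proof
  assume "mob (normalizer z) q = base_points j"
  then have "mob (normalizer z) q = mob (normalizer z) (z j)" by (simp add: normalizer(2)[OF C(2)])
  then have "q = z j" using inj by (rule injD[rotated])
  then show False using C(3) by simp
 qed
 have "mob (normalizer z) q = Some (cross_ratio m)"
  using ne[of 3] unfolding cross_ratio_def fz by (simp add: zq)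
 then show ?thesis using that C zq ne[of 1] ne[of 2] unfolding fz by simp
qed

text \<open>The sign cancels the power of - 1 that the pole at infinity contributes to
  \<open>form_of\<close>.\<close>

definition normal_form :: "complex => complex => complex => complex" where
 "normal_form c t = form_of (c * (- 1) ^ b 3) (Some t) base_points"

lemma normal_form_eq: "normal_form c t = normal_coeff a (b 1) (b 2) c t"
proof
 fix x
 have "(- 1 :: complex) ^ b 3 * (- 1) ^ b 3 = 1" by (simp add: power_mult_distrib[symmetric])
 then have "inverse ((- 1 :: complex) ^ b 3) = (- 1) ^ b 3" by (metis inverse_unique)
 then show "normal_form c t x = normal_coeff a (b 1) (b 2) c t x"
  by (simp add: normal_form_def form_of_def normal_coeff_def prod_3 divide_inverse power_mult_distrib[symmetric] mult_ac)
qed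

lemma normal_form_marked:
 assumes "c ~= 0" "t ~= 0" "t ~= 1"
 shows "(normal_form c t, base_points) \<in> marked_forms a b" "cross_ratio (normal_form c t, base_points) = t"
  "meromorphic_form (normal_form c t)"
proof -
 have C: "c * (- 1) ^ b 3 ~= 0" using assms by simp
 have q: "Some t \<notin> range base_points" using base_points_inj(2) assms by simp
 show 1: "(normal_form c t, base_points) \<in> marked_forms a b"
  unfolding normal_form_def by (rule form_of_marked[OF C base_points_inj(1) q])
 show "meromorphic_form (normal_form c t)" using 1 by (simp add: marked_forms_def)
 have "zero_of (normal_form c t) = Some t" unfolding zero_of_def normal_form_def
  by (rule the_equality) (use form_of_marked(2)[OF C base_points_inj(1) q] in blast)+
 then show "cross_ratio (normal_form c t, base_points) = t"
  by (simp add: cross_ratio_def mob_normalizer bracket_def hom_point_def)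
qed

lemma normal_form_residues:
 assumes "c ~= 0" "t ~= 0" "t ~= 1"
 shows "form_residue (normal_form c t) (base_points 1) = 2 * of_real pi * \<i> * c * poly rd.p1 t"
  "form_residue (normal_form c t) (base_points 2) = 2 * of_real pi * \<i> * c * poly rd.p2 t"
  "form_residue (normal_form c t) (base_points 3) = 2 * of_real pi * \<i> * c * poly rd.p3 t"
proof -
 have e: "normal_form c t = (%x. c * normal_form 1 t x)" using form_of_scale[of c] by (simp add: normal_form_def)
 have s: "form_residue (normal_form c t) p = c * form_residue (normal_form 1 t) p" for p
  unfolding e by (rule form_residue_scale) (use normal_form_marked(3) assms in simp)
 show "form_residue (normal_form c t) (base_points 1) = 2 * of_real pi * \<i> * c * poly rd.p1 t"
  "form_residue (normal_form c t) (base_points 2) = 2 * of_real pi * \<i> * c * poly rd.p2 t"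
  "form_residue (normal_form c t) (base_points 3) = 2 * of_real pi * \<i> * c * poly rd.p3 t"
  unfolding s by (simp_all add: normal_form_eq rd.poly_p1 rd.poly_p2 rd.poly_p3)
qed

lemma cross_ratio_residues:
 assumes m: "m \<in> marked_forms a b"
 obtains c where "c ~= 0" "marked_residues m $ 1 = c * poly rd.p1 (cross_ratio m)"
  "marked_residues m $ 2 = c * poly rd.p2 (cross_ratio m)" "marked_residues m $ 3 = c * poly rd.p3 (cross_ratio m)"
proof -
 obtain C q where C: "C ~= 0" "inj (snd m)" "q \<notin> range (snd m)" "fst m = form_of C q (snd m)"
  "mob (normalizer (snd m)) q = Some (cross_ratio m)" "cross_ratio m ~= 0" "cross_ratio m ~= 1"
  using marked_form_data[OF m] by metis
 let ?z = "snd m" and ?t = "cross_ratio m"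
 let ?A = "normalizer ?z"
 note A = normalizer[OF C(2)]
 let ?K = "pull_factor ?A q ?z"
 have K: "?K ~= 0" by (rule pull_factor_nonzero[OF A(1)])
 define c where "c = C / ?K * (- 1) ^ b 3"
 have c: "c ~= 0" using C(1) K by (simp add: c_def)
 have "c * (- 1) ^ b 3 = C / ?K" by (simp add: c_def power_mult_distrib[symmetric])
 then have nf: "normal_form c ?t = form_of (C / ?K) (mob ?A q) (mob ?A \<circ> ?z)" by (simp add: normal_form_def A(3) C(5))
 have "is_pullback (mob ?A) (normal_form c ?t) (fst m)"
  using form_of_pullback[OF A(1), of "C / ?K" q ?z] K unfolding nf C(4)[symmetric] by (simp add: C(4)[symmetric])
 then have "form_residue (fst m) (?z j) = form_residue (normal_form c ?t) (base_points j)" for j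
  using residue_pullback[OF A(1) normal_form_marked(3)[OF c C(6,7)]] A(2) by simp
 then have r: "marked_residues m $ j = form_residue (normal_form c ?t) (base_points j)" for j by (simp add: marked_residues_def)
 show ?thesis
  by (rule that[of "2 * of_real pi * \<i> * c"]) (use c normal_form_residues[OF c C(6,7)] in \<open>simp_all only: r, auto\<close>)
qed

text \<open>Agreement off a finite set extends by continuity to all affine points that are not
  poles, and among these the zero is the only point with value 0. An affine zero of one form is thus
  a zero of the other.\<close>

lemma form_of_zero_unique:
 assumes C: "C ~= 0" "C1 ~= 0" and q: "q \<notin> range z" "q1 \<notin> range z"
  and fin: "finite {u. form_of C q z u ~= form_of C1 q1 z u}"
 shows "q = q1"
proof -
 have eq: "form_of C q z x = form_of C1 q1 z x" if x: "Some x \<notin> range z" for x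
 proof -
  have lim: "(form_of D p z \<longlongrightarrow> form_of D p z x) (at x)" for D p
   using analytic_at_imp_isCont[OF form_of_analytic[OF x]] by (simp add: isCont_def)
  have "\<forall>\<^sub>F u in at x. form_of C q z u = form_of C1 q1 z u"
   using eventually_not_in_finite[OF fin] by (rule eventually_mono) simp
  then have "(form_of C1 q1 z \<longlongrightarrow> form_of C q z x) (at x)" by (rule Lim_transform_eventually[OF lim])
  then show ?thesis using tendsto_unique[OF _ _ lim] by simp
 qed
 show ?thesis
 proof (cases q)
  case (Some x)
  then have x: "Some x \<notin> range z" using q by simp
  have "form_of C q z x = 0" using form_of_eq_0_iff[OF C(1) x, of q] Some by blast
  then have "form_of C1 q1 z x = 0" unfolding eq[OF x] .
  then show ?thesis using form_of_eq_0_iff[OF C(2) x, of q1] Some by blast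
 next
  case None
  show ?thesis
  proof (cases q1)
   case (Some x)
   then have x: "Some x \<notin> range z" using q by simp
   have "form_of C1 q1 z x = 0" using form_of_eq_0_iff[OF C(2) x, of q1] Some by blast
   then have "form_of C q z x = 0" unfolding eq[OF x] .
   then show ?thesis using form_of_eq_0_iff[OF C(1) x, of q] Some by blast
  qed (simp add: None)
 qed
qed

lemma transition_moebius:
 assumes "inj z" "inj w"
 shows "mdet (mult_moebius (inv_moebius (normalizer w)) (normalizer z)) ~= 0"
  "mob (mult_moebius (inv_moebius (normalizer w)) (normalizer z)) p = mob (inv_moebius (normalizer w)) (mob (normalizer z) p)"
  "mob (mult_moebius (inv_moebius (normalizer w)) (normalizer z)) (z j) = w j"
proof -
 note Z = normalizer[OF assms(1)] and W = normalizer[OF assms(2)]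
 have W': "mdet (inv_moebius (normalizer w)) ~= 0" using W(1) by (simp add: mdet_inv)
 show "mdet (mult_moebius (inv_moebius (normalizer w)) (normalizer z)) ~= 0" using W' Z(1) by (simp add: mdet_mult)
 show *: "mob (mult_moebius (inv_moebius (normalizer w)) (normalizer z)) p = mob (inv_moebius (normalizer w)) (mob (normalizer z) p)" for p
  by (rule mob_mult[OF W' Z(1), symmetric])
 have "mob (inv_moebius (normalizer w)) (mob (normalizer w) (w j)) = w j" by (rule mob_inv(1)[OF W(1)])
 then show "mob (mult_moebius (inv_moebius (normalizer w)) (normalizer z)) (z j) = w j"
  unfolding * Z(2) W(2) .
qed

text \<open>An isomorphism is an arbitrary biholomorphism of the sphere. Conjugated by the
  normalizers it fixes 0, 1, infinity, hence it is the Moebius map \<open>?M\<close>, and the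
  formulas for pullbacks of explicit forms become available.\<close>

lemma iso_invariants:
 assumes "(m, m') \<in> form_iso a b"
 shows "cross_ratio m = cross_ratio m'" "marked_residues m = marked_residues m'" "m \<in> marked_forms a b" "m' \<in> marked_forms a b"
proof -
 obtain \<phi> where mm: "m \<in> marked_forms a b" "m' \<in> marked_forms a b" and
  \<phi>: "sphere_biholomorphism \<phi>" "is_pullback \<phi> (fst m') (fst m)" "snd m' = \<phi> \<circ> snd m"
  using assms by (cases m; cases m') (auto simp: form_iso_def)
 show "m \<in> marked_forms a b" "m' \<in> marked_forms a b" by (rule mm)+
 let ?z = "snd m" and ?w = "snd m'"
 obtain C q where C: "C ~= 0" "inj ?z" "q \<notin> range ?z" "fst m = form_of C q ?z" "zero_of (fst m) = q"
  using marked_form_data[OF mm(1)] by metis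
 obtain C' q' where C': "C' ~= 0" "inj ?w" "q' \<notin> range ?w" "fst m' = form_of C' q' ?w" "zero_of (fst m') = q'"
  using marked_form_data[OF mm(2)] by metis
 let ?A = "normalizer ?z" and ?B = "normalizer ?w"
 note A = normalizer[OF C(2)] and B = normalizer[OF C'(2)]
 define tth where "tth = mob ?B \<circ> (\<phi> \<circ> mob (inv_moebius ?A))"
 have A': "mdet (inv_moebius ?A) ~= 0" using A(1) by (simp add: mdet_inv)
 have htth: "sphere_holomorphic tth" unfolding tth_def
  by (intro sphere_holomorphic_comp sphere_holomorphic_mob A' B(1)) (use \<phi>(1) in \<open>simp add: sphere_biholomorphism_def\<close>)
 have itth: "inj tth" unfolding tth_def
  by (intro inj_compose bij_is_inj bij_mob(1) A' B(1)) (use \<phi>(1) in \<open>simp_all add: sphere_biholomorphism_def\<close>)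
 have fx: "tth (base_points j) = base_points j" for j
 proof -
  have "mob (inv_moebius ?A) (base_points j) = ?z j" using mob_inv(1)[OF A(1), of "?z j"] by (simp add: A(2))
  moreover have "\<phi> (?z j) = ?w j" by (simp add: \<phi>(3))
  ultimately show ?thesis using B(2) by (simp add: tth_def del: base_points)
 qed
 have tth: "tth p = p" for p
  by (rule biholomorphism_fixing_three_points[OF htth itth]) (use fx[of 1] fx[of 2] fx[of 3] in simp_all)
 let ?M = "mult_moebius (inv_moebius ?B) ?A"
 note M = transition_moebius[OF C(2) C'(2)]
 have MB: "mob ?B (mob ?M p) = mob ?A p" for p unfolding M(2) by (rule mob_inv(2)[OF B(1)])
 have "\<phi> p = mob ?M p" for p
 proof -
  have "mob ?B (\<phi> p) = mob ?A p" using tth[of "mob ?A p"] mob_inv(1)[OF A(1), of p] by (simp add: tth_def)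
  then have "mob ?B (\<phi> p) = mob ?B (mob ?M p)" by (simp add: MB)
  then show ?thesis using bij_is_inj[OF bij_mob(1)[OF B(1)]] by (rule injD[rotated])
 qed
 then have \<phi>M: "\<phi> = mob ?M" by (rule ext)
 have pb: "is_pullback (mob ?M) (fst m') (fst m)" using \<phi>(2) by (simp add: \<phi>M)
 have "meromorphic_form (fst m')" using mm(2) by (auto simp: marked_forms_def)
 then show "marked_residues m = marked_residues m'"
  using residue_pullback[OF M(1) _ pb] M(3) by (simp add: marked_residues_def vec_eq_iff)
 define q1 where "q1 = mob (inv_moebius ?M) q'"
 have q1: "mob ?M q1 = q'" unfolding q1_def by (rule mob_inv(2)[OF M(1)])
 have wz: "mob ?M \<circ> ?z = ?w" by (rule ext) (simp add: M(3))
 let ?K = "pull_factor ?M q1 ?z"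
 have pb1: "is_pullback (mob ?M) (fst m') (form_of (C' * ?K) q1 ?z)"
  using form_of_pullback[OF M(1), of C' q1 ?z] by (simp add: q1 wz C'(4))
 have "q = q1"
 proof (rule form_of_zero_unique[OF C(1) _ C(3)])
  show "C' * ?K ~= 0" using C'(1) pull_factor_nonzero[OF M(1)] by simp
  show "q1 \<notin> range ?z"
  proof
   assume "q1 \<in> range ?z"
   then obtain j where "q1 = ?z j" by blast
   then have "q' = ?w j" using q1 M(3) by simp
   then show False using C'(3) by simp
  qed
  have "{u. form_of C q ?z u ~= form_of (C' * ?K) q1 ?z u} <= {u. mc ?M * u + md ?M = 0}"
   using is_pullback_unique[OF pb pb1] unfolding C(4)[symmetric] .
  then show "finite {u. form_of C q ?z u ~= form_of (C' * ?K) q1 ?z u}" using finite_pole[OF M(1)] finite_subset by blast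
 qed
 then have "mob ?B q' = mob ?A q" using MB q1 by metis
 then show "cross_ratio m = cross_ratio m'" by (simp add: cross_ratio_def C(5) C'(5))
qed

text \<open>Equal cross-ratios make the two forms proportional after a Moebius map, and one nonzero
  residue forces the factor to be 1.\<close>

lemma iso_from_invariants:
 assumes mm: "m \<in> marked_forms a b" "m' \<in> marked_forms a b" and T: "cross_ratio m = cross_ratio m'"
  and R: "marked_residues m = marked_residues m'" and nz: "marked_residues m $ i ~= 0"
 shows "(m, m') \<in> form_iso a b"
proof -
 let ?z = "snd m" and ?w = "snd m'"
 obtain C q where C: "C ~= 0" "inj ?z" "q \<notin> range ?z" "fst m = form_of C q ?z"
  "mob (normalizer ?z) q = Some (cross_ratio m)"
  using marked_form_data[OF mm(1)] by metis
 obtain C' q' where C': "C' ~= 0" "inj ?w" "q' \<notin> range ?w" "fst m' = form_of C' q' ?w"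
  "mob (normalizer ?w) q' = Some (cross_ratio m')"
  using marked_form_data[OF mm(2)] by metis
 let ?A = "normalizer ?z" and ?B = "normalizer ?w"
 let ?M = "mult_moebius (inv_moebius ?B) ?A"
 note M = transition_moebius[OF C(2) C'(2)]
 have wz: "mob ?M \<circ> ?z = ?w" by (rule ext) (simp add: M(3))
 have "mob ?M q = mob (inv_moebius ?B) (mob ?B q')" unfolding M(2) C(5) C'(5) T ..
 then have qq: "mob ?M q = q'" using mob_inv(1)[OF normalizer(1)[OF C'(2)]] by simp
 define D where "D = C' * pull_factor ?M q ?z"
 have D: "D ~= 0" using C'(1) pull_factor_nonzero[OF M(1)] by (simp add: D_def)
 have pb: "is_pullback (mob ?M) (fst m') (form_of D q ?z)"
  using form_of_pullback[OF M(1), of C' q ?z] by (simp add: qq wz C'(4) D_def)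
 have mer: "meromorphic_form (fst m')" "meromorphic_form (form_of D q ?z)"
  using mm(2) form_of_marked(1)[OF D C(2,3)] by (auto simp: marked_forms_def)
 have f: "fst m = (%x. C / D * form_of D q ?z x)" using form_of_scale[of "C / D" D q ?z] D by (simp add: C(4))
 have "marked_residues m $ i = form_residue (fst m) (?z i)" by (simp add: marked_residues_def)
 also have "\<dots> = C / D * form_residue (form_of D q ?z) (?z i)"
  unfolding f by (rule form_residue_scale[OF mer(2)])
 also have "\<dots> = C / D * marked_residues m $ i"
  using residue_pullback[OF M(1) mer(1) pb, of "?z i"] unfolding R by (simp add: M(3) marked_residues_def)
 finally have "C / D = 1" using nz mult_cancel_right1[of "marked_residues m $ i" "C / D"] by blast
 then have "fst m = form_of D q ?z" using f by simp
 then have "is_pullback (mob ?M) (fst m') (fst m)" using pb by simp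
 then show ?thesis unfolding form_iso_def
  using mm sphere_biholomorphism_mob[OF M(1)] wz by (cases m; cases m') auto
qed

lemma iso_refl: "m \<in> marked_forms a b ==> (m, m) \<in> form_iso a b"
proof -
 assume m: "m \<in> marked_forms a b"
 let ?I = "Moebius 1 0 0 1"
 have I: "mob ?I = id" by (simp add: mob_def fun_eq_iff)
 have "sphere_biholomorphism (mob ?I)" by (rule sphere_biholomorphism_mob) (simp add: mdet_def)
 moreover have "is_pullback (mob ?I) f f" for f by (simp add: is_pullback_mob mdet_def)
 ultimately show ?thesis using m unfolding form_iso_def I by (cases m) (auto intro!: exI[of _ id])
qed

abbreviation iso_class :: "3 marked_form => 3 marked_form set" where
 "iso_class m \<equiv> form_iso a b `` {m}"

definition class_ratio :: "3 marked_form set => complex" where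
 "class_ratio X = the_elem (cross_ratio ` X)"

lemma class_invariants:
 assumes m: "m \<in> marked_forms a b"
 shows "iso_class m \<in> stratum a b" "residual_map (iso_class m) = marked_residues m" "class_ratio (iso_class m) = cross_ratio m"
proof -
 show "iso_class m \<in> stratum a b" unfolding stratum_def by (rule quotientI[OF m])
 have mem: "m \<in> iso_class m" using iso_refl[OF m] by (simp only: Image_singleton_iff)
 have inv: "marked_residues x = marked_residues m" "cross_ratio x = cross_ratio m" if "x \<in> iso_class m" for x
 proof -
  have "(m, x) \<in> form_iso a b" using that by (simp only: Image_singleton_iff)
  note i = iso_invariants(1,2)[OF this]
  show "marked_residues x = marked_residues m" by (rule i(2)[symmetric])
  show "cross_ratio x = cross_ratio m" by (rule i(1)[symmetric])
 qed
 have "marked_residues ` iso_class m = {marked_residues m}"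
 proof (rule equalityI)
  show "marked_residues ` iso_class m <= {marked_residues m}" by (rule image_subsetI) (simp only: inv(1) singleton_iff)
  show "{marked_residues m} <= marked_residues ` iso_class m" using imageI[OF mem] by (simp only: insert_subset empty_subsetI simp_thms)
 qed
 then show "residual_map (iso_class m) = marked_residues m" by (simp only: residual_map_def the_elem_eq)
 have "cross_ratio ` iso_class m = {cross_ratio m}"
 proof (rule equalityI)
  show "cross_ratio ` iso_class m <= {cross_ratio m}" by (rule image_subsetI) (simp only: inv(2) singleton_iff)
  show "{cross_ratio m} <= cross_ratio ` iso_class m" using imageI[OF mem] by (simp only: insert_subset empty_subsetI simp_thms)
 qed
 then show "class_ratio (iso_class m) = cross_ratio m" by (simp only: class_ratio_def the_elem_eq)
qed

lemma iso_class_eq: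
 assumes "m \<in> marked_forms a b" "m' \<in> marked_forms a b" "cross_ratio m = cross_ratio m'"
  "marked_residues m = marked_residues m'" "marked_residues m $ i ~= 0"
 shows "iso_class m = iso_class m'"
proof -
 have "(m, x) \<in> form_iso a b \<longleftrightarrow> (m', x) \<in> form_iso a b" for x
 proof
  assume x: "(m, x) \<in> form_iso a b"
  note I = iso_invariants[OF x]
  have nz: "marked_residues m' $ i ~= 0" using assms(5) unfolding assms(4) .
  show "(m', x) \<in> form_iso a b"
   by (rule iso_from_invariants[OF assms(2) I(4) trans[OF assms(3)[symmetric] I(1)] trans[OF assms(4)[symmetric] I(2)] nz])
 next
  assume x: "(m', x) \<in> form_iso a b"
  note I = iso_invariants[OF x]
  show "(m, x) \<in> form_iso a b"
   by (rule iso_from_invariants[OF assms(1) I(4) trans[OF assms(3) I(1)] trans[OF assms(4) I(2)] assms(5)])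
 qed
 then show ?thesis by (intro Set.set_eqI) (simp only: Image_singleton_iff)
qed

end

text \<open>The normalized coordinates \<open>hx\<close> and \<open>hy\<close> jump at infinity. In
  each chart they can be rescaled to continuous functions, which is good enough for quotients of
  brackets.\<close>

lemma chart_vector:
 assumes "aal \<in> sphere_charts"
 obtains vx vy :: "complex => complex" where "continuous_on UNIV vx" "continuous_on UNIV vy"
  "\<forall>u. \<exists>k. k ~= 0 & vx u = k * hx (aal u) & vy u = k * hy (aal u)"
proof -
 consider "aal = Some" | "aal = infinity_chart" using assms by (auto simp: sphere_charts_def)
 then show ?thesis
 proof cases
  case 1
  show ?thesis
  proof (rule that[of "%u. u" "%u. 1"])
   show "\<forall>u. \<exists>k. k ~= 0 & u = k * hx (aal u) & 1 = k * hy (aal u)" using 1 by (intro allI exI[of _ 1]) simp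
  qed (intro continuous_intros)+
 next
  case 2
  show ?thesis
  proof (rule that[of "%u. 1" "%u. u"])
   show "\<forall>u. \<exists>k. k ~= 0 & 1 = k * hx (aal u) & u = k * hy (aal u)"
   proof
    fix u show "\<exists>k. k ~= 0 & 1 = k * hx (aal u) & u = k * hy (aal u)"
     using 2 by (cases "u = 0") (auto simp: infinity_chart_def intro: exI[of _ 1] exI[of _ u])
   qed
  qed (intro continuous_intros)+
 qed
qed

lemma UN_Collect_mem: "(\<Union>U\<in>K. {m \<in> S. k m \<in> U}) = {m \<in> S. k m \<in> \<Union>K}"
 by blast

section \<open>Continuity of the cross-ratio and of families of normal forms\<close>

context three_poles
begin

lemma openin_stratum:
 "openin (stratum_topology a b) U \<longleftrightarrow>
  U <= stratum a b & openin (marked_forms_topology a b) {m \<in> marked_forms a b. iso_class m \<in> U}"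
proof -
 let ?P = "%U. U <= stratum a b & openin (marked_forms_topology a b) {m \<in> marked_forms a b. iso_class m \<in> U}"
 have "istopology ?P" unfolding istopology_def
 proof (intro conjI allI impI)
  fix U V assume "?P U" "?P V"
  then have "openin (marked_forms_topology a b) ({m \<in> marked_forms a b. iso_class m \<in> U} \<inter> {m \<in> marked_forms a b. iso_class m \<in> V})"
   by (intro openin_Int) simp_all
  moreover have "{m \<in> marked_forms a b. iso_class m \<in> U} \<inter> {m \<in> marked_forms a b. iso_class m \<in> V} =
    {m \<in> marked_forms a b. iso_class m \<in> U \<inter> V}" by (rule Set.set_eqI) (simp, blast)
  ultimately show "openin (marked_forms_topology a b) {m \<in> marked_forms a b. iso_class m \<in> U \<inter> V}" by simp
  show "U \<inter> V <= stratum a b" using \<open>?P U\<close> by (simp add: le_infI1)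
 next
  fix K assume K: "\<forall>U\<in>K. ?P U"
  have "openin (marked_forms_topology a b) (\<Union>U\<in>K. {m \<in> marked_forms a b. iso_class m \<in> U})"
   by (rule openin_Union) (use K in auto)
  moreover have "(\<Union>U\<in>K. {m \<in> marked_forms a b. iso_class m \<in> U}) = {m \<in> marked_forms a b. iso_class m \<in> \<Union>K}"
   by (rule UN_Collect_mem)
  ultimately show "openin (marked_forms_topology a b) {m \<in> marked_forms a b. iso_class m \<in> \<Union>K}" by simp
  show "\<Union>K <= stratum a b" using K by (intro Union_least) simp
 qed
 then show ?thesis unfolding stratum_topology_def by (simp add: topology_inverse')
qed

abbreviation vb :: "complex => complex => complex => complex => complex" where
 "vb x y x' y' \<equiv> x * y' - x' * y"

text \<open>The cross-ratio is a quotient of brackets formed from the zero and the poles, and these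
  points vary continuously by the first two families of generating sets of the topology.\<close>

lemma cross_ratio_open:
 assumes V: "open V" shows "openin (marked_forms_topology a b) {m \<in> marked_forms a b. cross_ratio m \<in> V}"
proof (subst openin_subopen, intro ballI)
 fix m assume m: "m \<in> {m \<in> marked_forms a b. cross_ratio m \<in> V}"
 then have mm: "m \<in> marked_forms a b" and mV: "cross_ratio m \<in> V" by simp_all
 define q where "q = zero_of (fst m)"
 let ?z = "snd m"
 have zq: "form_order (fst m') (zero_of (fst m')) > 0"
  and zu: "form_order (fst m') p > 0 ==> p = zero_of (fst m')"
  and cr: "bracket (zero_of (fst m')) (snd m' 3) * bracket (snd m' 2) (snd m' 1) ~= 0"
   "cross_ratio m' = bracket (zero_of (fst m')) (snd m' 1) * bracket (snd m' 2) (snd m' 3) /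
    (bracket (zero_of (fst m')) (snd m' 3) * bracket (snd m' 2) (snd m' 1))"
  if m': "m' \<in> marked_forms a b" for m' p
 proof -
  obtain q' where q': "{p. form_order (fst m') p > 0} = {q'}" using m' by (auto simp: marked_forms_def)
  have "zero_of (fst m') = q'" unfolding zero_of_def by (rule the_equality) (use q' in blast)+
  then show "form_order (fst m') (zero_of (fst m')) > 0" "form_order (fst m') p > 0 ==> p = zero_of (fst m')" using q' by blast+
  have "mob (normalizer (snd m')) (zero_of (fst m')) = Some (cross_ratio m')"
   by (rule marked_form_data[OF m']) simp
  then show "bracket (zero_of (fst m')) (snd m' 3) * bracket (snd m' 2) (snd m' 1) ~= 0"
   "cross_ratio m' = bracket (zero_of (fst m')) (snd m' 1) * bracket (snd m' 2) (snd m' 3) /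
    (bracket (zero_of (fst m')) (snd m' 3) * bracket (snd m' 2) (snd m' 1))"
   by (simp_all add: mob_normalizer hom_point_def split: if_splits)
 qed
 obtain aal0 u0 where aal0: "aal0 \<in> sphere_charts" "q = aal0 u0" using charts_cover[of q] by blast
 obtain aal1 u1 where aal1: "aal1 \<in> sphere_charts" "?z 1 = aal1 u1" using charts_cover[of "?z 1"] by blast
 obtain aal2 u2 where aal2: "aal2 \<in> sphere_charts" "?z 2 = aal2 u2" using charts_cover[of "?z 2"] by blast
 obtain aal3 u3 where aal3: "aal3 \<in> sphere_charts" "?z 3 = aal3 u3" using charts_cover[of "?z 3"] by blast
 obtain x0 y0 where c0: "continuous_on UNIV x0" "continuous_on UNIV y0" "\<forall>u. \<exists>k. k ~= 0 & x0 u = k * hx (aal0 u) & y0 u = k * hy (aal0 u)"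
  using chart_vector[OF aal0(1)] by metis
 obtain x1 y1 where c1: "continuous_on UNIV x1" "continuous_on UNIV y1" "\<forall>u. \<exists>k. k ~= 0 & x1 u = k * hx (aal1 u) & y1 u = k * hy (aal1 u)"
  using chart_vector[OF aal1(1)] by metis
 obtain x2 y2 where c2: "continuous_on UNIV x2" "continuous_on UNIV y2" "\<forall>u. \<exists>k. k ~= 0 & x2 u = k * hx (aal2 u) & y2 u = k * hy (aal2 u)"
  using chart_vector[OF aal2(1)] by metis
 obtain x3 y3 where c3: "continuous_on UNIV x3" "continuous_on UNIV y3" "\<forall>u. \<exists>k. k ~= 0 & x3 u = k * hx (aal3 u) & y3 u = k * hy (aal3 u)"
  using chart_vector[OF aal3(1)] by metis
 \<comment> \<open>\<open>N / D\<close> is the cross-ratio in chart coordinates. The scaling factors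
   of the coordinate vectors cancel, since each of the four points enters \<open>N\<close> and
   \<open>D\<close> exactly once.\<close>
 define N where "N w = vb (x0 (fst w)) (y0 (fst w)) (x1 (fst (snd w))) (y1 (fst (snd w))) *
   vb (x2 (fst (snd (snd w)))) (y2 (fst (snd (snd w)))) (x3 (snd (snd (snd w)))) (y3 (snd (snd (snd w))))"
  for w :: "complex \<times> complex \<times> complex \<times> complex"
 define D where "D w = vb (x0 (fst w)) (y0 (fst w)) (x3 (snd (snd (snd w)))) (y3 (snd (snd (snd w)))) *
   vb (x2 (fst (snd (snd w)))) (y2 (fst (snd (snd w)))) (x1 (fst (snd w))) (y1 (fst (snd w)))"
  for w :: "complex \<times> complex \<times> complex \<times> complex"
 have ND: "D (v0, v1, v2, v3) = 0 \<longleftrightarrow> bracket (aal0 v0) (aal3 v3) * bracket (aal2 v2) (aal1 v1) = 0"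
   "N (v0, v1, v2, v3) / D (v0, v1, v2, v3) = bracket (aal0 v0) (aal1 v1) * bracket (aal2 v2) (aal3 v3) /
    (bracket (aal0 v0) (aal3 v3) * bracket (aal2 v2) (aal1 v1))" for v0 v1 v2 v3
 proof -
  obtain k0 where k0: "k0 ~= 0" "x0 v0 = k0 * hx (aal0 v0)" "y0 v0 = k0 * hy (aal0 v0)" using c0(3) by blast
  obtain k1 where k1: "k1 ~= 0" "x1 v1 = k1 * hx (aal1 v1)" "y1 v1 = k1 * hy (aal1 v1)" using c1(3) by blast
  obtain k2 where k2: "k2 ~= 0" "x2 v2 = k2 * hx (aal2 v2)" "y2 v2 = k2 * hy (aal2 v2)" using c2(3) by blast
  obtain k3 where k3: "k3 ~= 0" "x3 v3 = k3 * hx (aal3 v3)" "y3 v3 = k3 * hy (aal3 v3)" using c3(3) by blast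
  have vb: "vb (k * hx p) (k * hy p) (k' * hx p') (k' * hy p') = k * k' * bracket p p'" for k k' p p'
   by (simp add: bracket_def algebra_simps)
  have Dd: "D (v0, v1, v2, v3) = (k0 * k1 * k2 * k3) * (bracket (aal0 v0) (aal3 v3) * bracket (aal2 v2) (aal1 v1))"
   unfolding D_def fst_conv snd_conv k0(2,3) k1(2,3) k2(2,3) k3(2,3) vb by (simp add: mult_ac)
  have Nn: "N (v0, v1, v2, v3) = (k0 * k1 * k2 * k3) * (bracket (aal0 v0) (aal1 v1) * bracket (aal2 v2) (aal3 v3))"
   unfolding N_def fst_conv snd_conv k0(2,3) k1(2,3) k2(2,3) k3(2,3) vb by (simp add: mult_ac)
  have k: "k0 * k1 * k2 * k3 ~= 0" using k0(1) k1(1) k2(1) k3(1) by simp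
  show "D (v0, v1, v2, v3) = 0 \<longleftrightarrow> bracket (aal0 v0) (aal3 v3) * bracket (aal2 v2) (aal1 v1) = 0"
   unfolding Dd using k by simp
  show "N (v0, v1, v2, v3) / D (v0, v1, v2, v3) = bracket (aal0 v0) (aal1 v1) * bracket (aal2 v2) (aal3 v3) /
    (bracket (aal0 v0) (aal3 v3) * bracket (aal2 v2) (aal1 v1))"
   unfolding Dd Nn by (rule mult_divide_mult_cancel_left[OF k])
 qed
 have contND: "continuous_on UNIV N" "continuous_on UNIV D"
  unfolding N_def D_def
  by (intro continuous_intros continuous_on_compose2[OF c0(1)] continuous_on_compose2[OF c0(2)]
    continuous_on_compose2[OF c1(1)] continuous_on_compose2[OF c1(2)] continuous_on_compose2[OF c2(1)]
    continuous_on_compose2[OF c2(2)] continuous_on_compose2[OF c3(1)] continuous_on_compose2[OF c3(2)] subset_UNIV)+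
 define W where "W = {w. D w ~= 0} \<inter> (%w. N w / D w) -` V"
 have "open W" unfolding W_def
 proof (rule continuous_open_preimage[OF _ _ V])
  show "open {w. D w ~= 0}" by (rule open_Collect_neq[OF contND(2) continuous_on_const])
  show "continuous_on {w. D w ~= 0} (%w. N w / D w)"
   by (intro continuous_on_divide continuous_on_subset[OF contND(1)] continuous_on_subset[OF contND(2)]) auto
 qed
 moreover have "(u0, u1, u2, u3) \<in> W"
  using cr[OF mm] mV unfolding W_def aal1(2) aal2(2) aal3(2) q_def[symmetric] aal0(2) by (simp add: ND)
 ultimately obtain B0 W1 where B0: "open B0" "open W1" "u0 \<in> B0" "(u1, u2, u3) \<in> W1" "B0 \<times> W1 <= W"
  by (rule open_prod_elim) auto
 obtain B1 W2 where B1: "open B1" "open W2" "u1 \<in> B1" "(u2, u3) \<in> W2" "B1 \<times> W2 <= W1"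
  using open_prod_elim[OF B0(2,4)] by (metis mem_Sigma_iff)
 obtain B2 B3 where B2: "open B2" "open B3" "u2 \<in> B2" "u3 \<in> B3" "B2 \<times> B3 <= W2"
  using open_prod_elim[OF B1(2,4)] by (metis mem_Sigma_iff)
 let ?gen = "{{(f, z). z j \<in> U} | j U. openin sphere_topology U} \<union>
    {{(f, z). \<exists>q\<in>U. form_order f q > 0} | U. openin sphere_topology U} \<union>
    {{(f, z). Some ` K \<inter> range z = {} & f ` K <= V} | K V. compact K & open V}
    :: 3 marked_form set set"
 have g1: "openin (topology_generated_by ?gen) {(f, z). z j \<in> U}" if "openin sphere_topology U" for j U
  by (rule topology_generated_by_Basis, rule UnI1, rule UnI1, rule CollectI, rule exI[of _ j], rule exI[of _ U],
    rule conjI[OF refl that])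
 have g2: "openin (topology_generated_by ?gen) {(f, z). \<exists>q\<in>U. form_order f q > 0}" if "openin sphere_topology U" for U
  by (rule topology_generated_by_Basis, rule UnI1, rule UnI2, rule CollectI, rule exI[of _ U], rule conjI[OF refl that])
 let ?O = "{(f, z). z 1 \<in> aal1 ` B1} \<inter> ({(f, z). z 2 \<in> aal2 ` B2} \<inter> ({(f, z). z 3 \<in> aal3 ` B3} \<inter>
   {(f, z). \<exists>q\<in>aal0 ` B0. form_order f q > 0})) :: 3 marked_form set"
 have "openin (topology_generated_by ?gen) ?O"
  by (intro openin_Int g1 g2 openin_chart_image aal0(1) aal1(1) aal2(1) aal3(1) B0(1) B1(1) B2(1,2))
 then have op: "openin (marked_forms_topology a b) (marked_forms a b \<inter> ?O)"
  unfolding marked_forms_topology_def by (rule openin_subtopology_Int2)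
 have "q \<in> aal0 ` B0" "form_order (fst m) q > 0" using aal0(2) B0(3) zq[OF mm] by (simp_all add: q_def[symmetric])
 then have mO: "m \<in> marked_forms a b \<inter> ?O"
  using mm aal1(2) aal2(2) aal3(2) B1(3) B2(3,4) by (cases m) auto
 have "marked_forms a b \<inter> ?O <= {m \<in> marked_forms a b. cross_ratio m \<in> V}"
 proof
  fix m' assume m': "m' \<in> marked_forms a b \<inter> ?O"
  then have mm': "m' \<in> marked_forms a b" by simp
  obtain f' z' where fz: "m' = (f', z')" by (rule prod.exhaust)
  have i: "snd m' 1 \<in> aal1 ` B1" "snd m' 2 \<in> aal2 ` B2" "snd m' 3 \<in> aal3 ` B3" "\<exists>q\<in>aal0 ` B0. form_order (fst m') q > 0"
   using m' unfolding fz fst_conv snd_conv Int_iff mem_Collect_eq prod.case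
   by (simp_all only: simp_thms)
  from i(1) obtain v1 where v1: "snd m' 1 = aal1 v1" "v1 \<in> B1" by (rule imageE)
  from i(2) obtain v2 where v2: "snd m' 2 = aal2 v2" "v2 \<in> B2" by (rule imageE)
  from i(3) obtain v3 where v3: "snd m' 3 = aal3 v3" "v3 \<in> B3" by (rule imageE)
  from i(4) obtain p where p: "p \<in> aal0 ` B0" "form_order (fst m') p > 0" by (rule bexE)
  from p(1) obtain v0 where v0: "p = aal0 v0" "v0 \<in> B0" by (rule imageE)
  have z0: "zero_of (fst m') = aal0 v0" using zu[OF mm' p(2)] v0(1) by (rule trans[OF sym])
  note v = v0(2) v1(2) v2(2) v3(2) v1(1) v2(1) v3(1) z0
  have "(v0, v1, v2, v3) \<in> W" 
   by (rule subsetD[OF B0(5) SigmaI[OF v(1) subsetD[OF B1(5) SigmaI[OF v(2) subsetD[OF B2(5) SigmaI[OF v(3,4)]]]]]])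
  then have "N (v0, v1, v2, v3) / D (v0, v1, v2, v3) \<in> V" by (simp add: W_def)
  then have "cross_ratio m' \<in> V" unfolding cr(2)[OF mm'] v(5-8) ND(2) .
  then show "m' \<in> {m \<in> marked_forms a b. cross_ratio m \<in> V}" using mm' by simp
 qed
 then show "\<exists>T. openin (marked_forms_topology a b) T & m \<in> T & T <= {m \<in> marked_forms a b. cross_ratio m \<in> V}"
  using op mO by (intro exI[of _ "marked_forms a b \<inter> ?O"] conjI)
qed

text \<open>Together with \<open>class_data\<close> this turns a lift to the stratum into a lift
  under the residue ratio.\<close>

lemma class_ratio_path:
 assumes dl: "pathin (stratum_topology a b) dl"
 shows "continuous_on {0..1} (%s. class_ratio (dl s))" "s \<in> {0..1} ==> dl s \<in> stratum a b"
proof -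
 have c: "continuous_map (top_of_set {0..1}) (stratum_topology a b) dl" using dl by (simp add: pathin_def)
 have top: "topspace (stratum_topology a b) <= stratum a b"
  unfolding topspace_def by (rule Union_least) (simp add: openin_stratum)
 show mem: "dl s \<in> stratum a b" if "s \<in> {0..1}" for s
  using continuous_map_funspace[OF c] that top by auto
 show "continuous_on {0..1} (%s. class_ratio (dl s))"
  unfolding continuous_openin_preimage_eq
 proof (intro allI impI)
  fix V :: "complex set" assume V: "open V"
  let ?U = "{X \<in> stratum a b. class_ratio X \<in> V}"
  have "{m \<in> marked_forms a b. iso_class m \<in> ?U} = {m \<in> marked_forms a b. cross_ratio m \<in> V}"
   by (rule Set.set_eqI) (auto simp: class_invariants)
  then have "openin (stratum_topology a b) ?U" using cross_ratio_open[OF V] by (simp add: openin_stratum)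
  then have "openin (top_of_set {0..1}) {s \<in> topspace (top_of_set {0..1}). dl s \<in> ?U}"
   by (rule openin_continuous_map_preimage[OF c])
  moreover have "{s \<in> topspace (top_of_set {0..1}). dl s \<in> ?U} = {0..1} \<inter> (%s. class_ratio (dl s)) -` V"
   using mem by auto
  ultimately show "openin (top_of_set {0..1}) ({0..1} \<inter> (%s. class_ratio (dl s)) -` V)" by simp
 qed
qed

text \<open>The poles are constant and the zero is \<open>t s\<close>, so the compact-open sets are
  the delicate ones: the parameters for which some point of \<open>K\<close> is sent outside
  \<open>V\<close> form the projection of a compact set, which is closed.\<close>

lemma normal_path:
 assumes c: "continuous_on {0..1} c" and t: "continuous_on {0..1} t"
  and nz: "\<And>s. s \<in> {0..1} ==> c s ~= 0 & t s ~= 0 & t s ~= 1"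
 shows "pathin (stratum_topology a b) (%s. iso_class (normal_form (c s) (t s), base_points))"
proof -
 let ?I = "top_of_set {0..1::real}" and ?F = "%s. (normal_form (c s) (t s), base_points)"
 let ?gen = "{{(f, z). z j \<in> U} | j U. openin sphere_topology U} \<union>
    {{(f, z). \<exists>q\<in>U. form_order f q > 0} | U. openin sphere_topology U} \<union>
    {{(f, z). Some ` K \<inter> range z = {} & f ` K <= V} | K V. compact K & open V}
    :: 3 marked_form set set"
 have mk: "?F s \<in> marked_forms a b" if "s \<in> {0..1}" for s
  using normal_form_marked(1) nz[OF that] by blast
 have ford: "form_order (normal_form (c s) (t s)) p > 0 \<longleftrightarrow> p = Some (t s)" if s: "s \<in> {0..1}" for s p
 proof -
  have "c s * (- 1) ^ b 3 ~= 0" "Some (t s) \<notin> range base_points" using nz[OF s] base_points_inj(2) by simp_all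
  then have "{p. form_order (normal_form (c s) (t s)) p > 0} = {Some (t s)}"
   unfolding normal_form_def by (rule form_of_marked(2)[OF _ base_points_inj(1)])
  then show ?thesis by blast
 qed
 have "continuous_map ?I (topology_generated_by ?gen) ?F"
 proof (rule continuous_on_generated_topo)
  have pole: "openin ?I (?F -` {(f, z). z j \<in> U'} \<inter> topspace ?I)" for j :: 3 and U' :: "sphere set"
  proof -
   have "?F -` {(f, z). z j \<in> U'} = UNIV \<or> ?F -` {(f, z). z j \<in> U'} = {}" by auto
   then show ?thesis by (elim disjE) (simp_all only: Int_UNIV_left Int_empty_left openin_topspace openin_empty)
  qed
  have zero: "openin ?I (?F -` {(f, z). \<exists>q\<in>U'. form_order f q > 0} \<inter> topspace ?I)" if U': "openin sphere_topology U'" for U'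
  proof -
   have e: "?F -` {(f, z). \<exists>q\<in>U'. form_order f q > 0} \<inter> topspace ?I = {0..1} \<inter> t -` (Some -` U')"
    using ford by auto
   have "open (Some -` U')" using U' by (simp add: openin_sphere)
   then have "openin ?I ({0..1} \<inter> t -` (Some -` U'))"
    using t unfolding continuous_openin_preimage_eq by blast
   then show ?thesis unfolding e .
  qed
  have coeff: "openin ?I (?F -` {(f, z). Some ` K \<inter> range z = {} & f ` K <= V} \<inter> topspace ?I)"
   if Kc: "compact K" and V: "open V" for K V
  proof (cases "Some ` K \<inter> range base_points = {}")
    case False
    then have e: "?F -` {(f, z). Some ` K \<inter> range z = {} & f ` K <= V} = {}" by auto
    show ?thesis unfolding e by simp
   next
    case True
    have K01: "u ~= 0" "u ~= 1" if "u \<in> K" for u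
    proof -
     have "Some u \<notin> range base_points" using True that by blast
     then show "u ~= 0" "u ~= 1" by (simp_all add: base_points_inj(2))
    qed
    define h where "h w = c (fst w) * (snd w - t (fst w)) ^ a / (snd w ^ b 1 * (snd w - 1) ^ b 2)" for w :: "real \<times> complex"
    have hc: "continuous_on ({0..1} \<times> K) h" unfolding h_def
     by (intro continuous_intros continuous_on_compose2[OF c] continuous_on_compose2[OF t]) (use K01 in auto)
    have hF: "h (s, u) = normal_form (c s) (t s) u" for s u by (simp add: h_def normal_form_eq normal_coeff_def)
    have cp: "compact ({0..1::real} \<times> K)" by (intro compact_Times compact_Icc Kc)
    have "closed (({0..1} \<times> K) \<inter> h -` (- V))"
     by (rule continuous_closed_preimage[OF hc]) (use cp compact_imp_closed V in auto)
    then have "compact (({0..1} \<times> K) \<inter> (({0..1} \<times> K) \<inter> h -` (- V)))" by (rule compact_Int_closed[OF cp])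
    then have "compact (({0..1} \<times> K) \<inter> h -` (- V))" by (simp add: Int_assoc[symmetric])
    then have "compact (fst ` (({0..1} \<times> K) \<inter> h -` (- V)))"
     by (rule compact_continuous_image[rotated]) (intro continuous_intros)
    then have op: "open (- fst ` (({0..1} \<times> K) \<inter> h -` (- V)))" by (simp add: compact_imp_closed open_Compl)
    have "?F -` {(f, z). Some ` K \<inter> range z = {} & f ` K <= V} \<inter> topspace ?I = {0..1} \<inter> - fst ` (({0..1} \<times> K) \<inter> h -` (- V))"
    proof (rule Set.set_eqI)
     fix s
     have "s \<in> ?F -` {(f, z). Some ` K \<inter> range z = {} & f ` K <= V} \<inter> topspace ?I \<longleftrightarrow> s \<in> {0..1} & (\<forall>u\<in>K. h (s, u) \<in> V)"
      unfolding hF using True by auto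
     also have "\<dots> \<longleftrightarrow> s \<in> {0..1} \<inter> - fst ` (({0..1} \<times> K) \<inter> h -` (- V))" by force
     finally show "s \<in> ?F -` {(f, z). Some ` K \<inter> range z = {} & f ` K <= V} \<inter> topspace ?I \<longleftrightarrow> s \<in> {0..1} \<inter> - fst ` (({0..1} \<times> K) \<inter> h -` (- V))" .
    qed
    then show ?thesis using openin_open_Int[OF op, of "{0..1}"] by (rule ssubst)
   qed
  fix U assume "U \<in> ?gen"
  then show "openin ?I (?F -` U \<inter> topspace ?I)"
  proof (elim UnE CollectE exE conjE)
   fix j :: 3 and U' assume "U = {(f, z). z j \<in> U'}"
   then show "openin ?I (?F -` U \<inter> topspace ?I)" using pole[where j = j and U' = U'] by (simp only:)
  next
   fix U' assume "U = {(f, z). \<exists>q\<in>U'. form_order f q > 0}" "openin sphere_topology U'"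
   then show "openin ?I (?F -` U \<inter> topspace ?I)" using zero[of U'] by (simp only:)
  next
   fix K V assume "U = {(f, z). Some ` K \<inter> range z = {} & f ` K <= V}" "compact K" "open V"
   then show "openin ?I (?F -` U \<inter> topspace ?I)" using coeff[of K V] by (simp only:)
  qed
 next
  have o: "openin sphere_topology UNIV" using openin_topspace[of sphere_topology] by (simp only: topspace_sphere)
  have "{(f, z). z 1 \<in> (UNIV :: sphere set)} \<in> ?gen"
   by (rule UnI1, rule UnI1, rule CollectI, rule exI[of _ 1], rule exI[of _ UNIV], rule conjI[OF refl o])
  moreover have "{(f, z). z 1 \<in> (UNIV :: sphere set)} = (UNIV :: 3 marked_form set)" by auto
  ultimately have "UNIV \<in> ?gen" by (simp only:)
  then show "?F ` topspace ?I <= \<Union> ?gen" by (rule order_trans[OF subset_UNIV Union_upper])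
 qed
 then have F: "continuous_map ?I (marked_forms_topology a b) ?F"
  unfolding marked_forms_topology_def continuous_map_in_subtopology using mk by auto
 show ?thesis unfolding pathin_def continuous_map_def
 proof (intro conjI allI impI)
  have st: "openin (stratum_topology a b) (stratum a b)"
  proof -
   have "{m \<in> marked_forms a b. iso_class m \<in> stratum a b} = {m \<in> marked_forms a b. cross_ratio m \<in> UNIV}"
    by (rule Set.set_eqI) (auto simp: class_invariants)
   then show ?thesis using cross_ratio_open[OF open_UNIV] by (simp add: openin_stratum)
  qed
  show "(%s. iso_class (?F s)) \<in> topspace ?I \<rightarrow> topspace (stratum_topology a b)"
   using mk class_invariants(1) openin_subset[OF st] by auto
  fix U assume "openin (stratum_topology a b) U"
  then have "openin (marked_forms_topology a b) {m \<in> marked_forms a b. iso_class m \<in> U}" by (simp add: openin_stratum)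
  then have "openin ?I {s \<in> topspace ?I. ?F s \<in> {m \<in> marked_forms a b. iso_class m \<in> U}}"
   by (rule openin_continuous_map_preimage[OF F])
  moreover have "{s \<in> topspace ?I. ?F s \<in> {m \<in> marked_forms a b. iso_class m \<in> U}} = {s \<in> topspace ?I. iso_class (?F s) \<in> U}"
   using mk by auto
  ultimately show "openin ?I {s \<in> topspace ?I. iso_class (?F s) \<in> U}" by simp
 qed
qed

end

section \<open>The monodromy group\<close>

text \<open>A two-element index set imposes the same condition as its one-element complement,
  because the residues sum to 0.\<close>

lemma generic_residues_iff:
 fixes x :: "complex ^ 3"
 shows "x \<in> residual_space - resonance_arrangement \<longleftrightarrow> x $ 1 + x $ 2 + x $ 3 = 0 & x $ 1 ~= 0 & x $ 2 ~= 0 & x $ 3 ~= 0"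
proof -
 have sI: "(\<Sum>j\<in>I. x $ j) = (if 1 \<in> I then x $ 1 else 0) + (if 2 \<in> I then x $ 2 else 0) + (if 3 \<in> I then x $ 3 else 0)" for I :: "3 set"
 proof -
  have "(\<Sum>j\<in>I. x $ j) = (\<Sum>j\<in>UNIV. if j \<in> I then x $ j else 0)" by (simp add: sum.If_cases)
  then show ?thesis by (simp only: sum_3)
 qed
 have rs: "x \<in> residual_space \<longleftrightarrow> x $ 1 + x $ 2 + x $ 3 = 0" by (simp only: residual_space_def mem_Collect_eq sum_3)
 have arr: "x \<in> resonance_arrangement \<longleftrightarrow> (\<exists>I. I ~= {} & I ~= UNIV & x \<in> residual_space & (\<Sum>j\<in>I. x $ j) = 0)"
  unfolding resonance_arrangement_def by blast
 have ne: "{j} ~= (UNIV :: 3 set)" for j :: 3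
 proof
  assume "{j} = (UNIV :: 3 set)"
  then have "1 \<in> {j}" "2 \<in> {j}" by simp_all
  then show False using three_distinct(1) by simp
 qed
 show ?thesis
 proof
  assume x: "x \<in> residual_space - resonance_arrangement"
  have "x $ j ~= 0" for j
  proof
   assume "x $ j = 0"
   then have "(\<Sum>i\<in>{j}. x $ i) = 0" by simp
   then have "x \<in> resonance_arrangement" unfolding arr using ne[of j] x by blast
   then show False using x by simp
  qed
  then show "x $ 1 + x $ 2 + x $ 3 = 0 & x $ 1 ~= 0 & x $ 2 ~= 0 & x $ 3 ~= 0" using x rs by simp
 next
  assume x: "x $ 1 + x $ 2 + x $ 3 = 0 & x $ 1 ~= 0 & x $ 2 ~= 0 & x $ 3 ~= 0"
  have "x \<notin> resonance_arrangement"
  proof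
   assume "x \<in> resonance_arrangement"
   then obtain I where I: "I ~= {}" "I ~= UNIV" "(\<Sum>j\<in>I. x $ j) = 0" unfolding arr by blast
   have "1 \<in> I \<or> 2 \<in> I \<or> 3 \<in> I" using I(1) exhaust_3 by (metis all_not_in_conv)
   moreover have "1 \<notin> I \<or> 2 \<notin> I \<or> 3 \<notin> I" using I(2) exhaust_3 by (metis UNIV_eq_I)
   ultimately show False using I(3) x unfolding sI by (auto simp: add_eq_0_iff split: if_splits)
  qed
  then show "x \<in> residual_space - resonance_arrangement" using x rs by simp
 qed
qed

lemma permutation_transport_iso:
 assumes h: "bij_betw h F {1..n}" and sub: "subgroup G (sym_group n)"
  and M: "M = {\<pi> \<in> Bij F. \<exists>g\<in>G. \<forall>X\<in>F. h (\<pi> X) = g (h X)}"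
 shows "(BijGroup F)\<lparr>carrier := M\<rparr> \<cong> (sym_group n)\<lparr>carrier := G\<rparr>"
  "\<And>g. g \<in> G ==> (\<lambda>X\<in>F. inv_into F h (g (h X))) \<in> M"
  "\<And>\<pi>. \<pi> \<in> M ==> \<exists>g\<in>G. \<pi> = (\<lambda>X\<in>F. inv_into F h (g (h X)))"
proof -
 have G: "g permutes {1..n}" if "g \<in> G" for g
  using subgroup.mem_carrier[OF sub that] by (simp add: sym_group_def)
 \<comment> \<open>Elements of \<open>Bij F\<close> are undefined outside \<open>F\<close>, hence
   the restriction in the transported permutation.\<close>
 define e where "e g = (\<lambda>X\<in>F. inv_into F h (g (h X)))" for g
 have hF: "h X \<in> {1..n}" if "X \<in> F" for X using h that by (rule bij_betwE[THEN bspec])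
 have gF: "g y \<in> {1..n}" if "g \<in> G" "y \<in> {1..n}" for g y using permutes_in_image[OF G[OF that(1)]] that(2) by blast
 have iF: "inv_into F h y \<in> F" "h (inv_into F h y) = y" if "y \<in> {1..n}" for y
  using that h by (auto simp: bij_betw_def f_inv_into_f inv_into_into)
 have ih: "inv_into F h (h X) = X" if "X \<in> F" for X using h that by (simp add: bij_betw_def)
 have he: "h (e g X) = g (h X)" "e g X \<in> F" if "g \<in> G" "X \<in> F" for g X
  using iF[OF gF[OF that(1) hF[OF that(2)]]] that(2) by (simp_all add: e_def)
 have bij: "bij_betw (e g) F F" if g: "g \<in> G" for g
 proof -
  have "bij_betw (inv_into F h \<circ> (g \<circ> h)) F F"
   by (intro bij_betw_trans[OF bij_betw_trans[OF h permutes_imp_bij[OF G[OF g]]] bij_betw_inv_into[OF h]])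
  then show ?thesis by (rule bij_betw_cong[THEN iffD1, rotated]) (simp add: e_def)
 qed
 have eB: "e g \<in> Bij F" if g: "g \<in> G" for g using bij[OF g] by (simp add: Bij_def e_def)
 have eM: "e g \<in> M" if g: "g \<in> G" for g unfolding M using eB[OF g] he(1)[OF g] g by blast
 have Me: "\<exists>g\<in>G. \<pi> = e g" if \<pi>: "\<pi> \<in> M" for \<pi>
 proof -
  obtain g where g: "g \<in> G" "\<forall>X\<in>F. h (\<pi> X) = g (h X)" and B: "\<pi> \<in> Bij F" using \<pi> unfolding M by blast
  have "\<pi> = e g"
  proof (rule extensionalityI[of _ F])
   show "\<pi> \<in> extensional F" "e g \<in> extensional F" using B by (simp_all add: Bij_def e_def)
   fix X assume X: "X \<in> F"
   then have "\<pi> X \<in> F" using B by (auto simp: Bij_def bij_betw_def)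
   then have "\<pi> X = inv_into F h (h (\<pi> X))" by (rule ih[symmetric])
   also have "\<dots> = e g X" using g(2) X by (simp add: e_def)
   finally show "\<pi> X = e g X" .
  qed
  then show ?thesis using g(1) by blast
 qed
 have inj: "inj_on e G"
 proof (rule inj_onI)
  fix g g' assume g: "g \<in> G" "g' \<in> G" "e g = e g'"
  show "g = g'"
  proof
   fix y
   show "g y = g' y"
   proof (cases "y \<in> {1..n}")
    case True
    have "g (h (inv_into F h y)) = g' (h (inv_into F h y))" using he(1)[OF g(1) iF(1)[OF True]] he(1)[OF g(2) iF(1)[OF True]] g(3) by simp
    then show ?thesis by (simp only: iF(2)[OF True])
   next
    case False
    then show ?thesis using permutes_not_in[OF G[OF g(1)]] permutes_not_in[OF G[OF g(2)]] by simp
   qed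
  qed
 qed
 have "e \<in> iso ((sym_group n)\<lparr>carrier := G\<rparr>) ((BijGroup F)\<lparr>carrier := M\<rparr>)"
 proof (rule isoI)
  show "e \<in> hom ((sym_group n)\<lparr>carrier := G\<rparr>) ((BijGroup F)\<lparr>carrier := M\<rparr>)"
  proof (rule homI)
   fix g g' assume gg: "g \<in> carrier ((sym_group n)\<lparr>carrier := G\<rparr>)" "g' \<in> carrier ((sym_group n)\<lparr>carrier := G\<rparr>)"
   then have g: "g \<in> G" "g' \<in> G" by simp_all
   show "e g \<in> carrier ((BijGroup F)\<lparr>carrier := M\<rparr>)" using eM[OF g(1)] by simp
   have "e (g \<circ> g') = compose F (e g) (e g')"
   proof (rule extensionalityI[of _ F])
    fix X assume X: "X \<in> F"
    have "h (e g' X) = g' (h X)" by (rule he(1)[OF g(2) X])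
    then show "e (g \<circ> g') X = compose F (e g) (e g') X" using X he(2)[OF g(2) X] by (simp add: compose_def e_def[of g] e_def[of "g \<circ> g'"])
   qed (simp_all add: e_def)
   then show "e (g \<otimes>\<^bsub>(sym_group n)\<lparr>carrier := G\<rparr>\<^esub> g') = e g \<otimes>\<^bsub>(BijGroup F)\<lparr>carrier := M\<rparr>\<^esub> e g'"
    using eB[OF g(1)] eB[OF g(2)] by (simp add: BijGroup_def sym_group_def)
  qed
  have "e ` G = M"
  proof (rule equalityI)
   show "e ` G <= M" by (rule image_subsetI) (rule eM)
   show "M <= e ` G" using Me by (blast intro: imageI)
  qed
  then show "bij_betw e (carrier ((sym_group n)\<lparr>carrier := G\<rparr>)) (carrier ((BijGroup F)\<lparr>carrier := M\<rparr>))"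
   using inj by (simp add: bij_betw_def)
 qed
 moreover have "group ((sym_group n)\<lparr>carrier := G\<rparr>)"
  using subgroup.subgroup_is_group[OF sub sym_group_is_group] .
 ultimately show "(BijGroup F)\<lparr>carrier := M\<rparr> \<cong> (sym_group n)\<lparr>carrier := G\<rparr>"
  using group.iso_sym is_isoI by blast
 show "\<And>g. g \<in> G ==> (\<lambda>X\<in>F. inv_into F h (g (h X))) \<in> M" using eM by (simp add: e_def)
 show "\<And>\<pi>. \<pi> \<in> M ==> \<exists>g\<in>G. \<pi> = (\<lambda>X\<in>F. inv_into F h (g (h X)))" using Me by (simp add: e_def)
qed

lemma cyclic_permutations_iso:
 assumes ssg: "ssg permutes {1..n}" "is_cycle_on ssg {1..n}" "n >= 1"
 shows "(sym_group n)\<lparr>carrier := range (%k. ssg ^^ k)\<rparr> \<cong> integer_mod_group n" "ssg ^^ n = id"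
proof -
 have x0: "(1::nat) \<in> {1..n}" using ssg(3) by simp
 have perm: "(ssg ^^ k) permutes {1..n}" for k using ssg(1) by (induction k) (simp_all add: permutes_compose permutes_id)
 have inj: "inj (ssg ^^ k)" for k using permutes_inj[OF perm] .
 have orbit: "(%k. (ssg ^^ k) 1) ` UNIV = {1..n}"
 proof (rule equalityI)
  show "range (%k. (ssg ^^ k) 1) <= {1..n}" using permutes_in_image[OF perm] x0 by blast
  show "{1..n} <= range (%k. (ssg ^^ k) 1)"
  proof
   fix y assume "y \<in> {1..n}"
   then obtain k where "(ssg ^^ k) 1 = y" using ssg(2) x0 unfolding is_cycle_on_def by blast
   then show "y \<in> range (%k. (ssg ^^ k) 1)" by blast
  qed
 qed
 have "\<exists>d>0. (ssg ^^ d) 1 = 1"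
 proof -
  have "\<not> inj (%k. (ssg ^^ k) 1)"
  proof
   assume "inj (%k. (ssg ^^ k) 1)"
   then have "infinite (range (%k. (ssg ^^ k) 1))" using finite_imageD infinite_UNIV_nat by blast
   then show False unfolding orbit by simp
  qed
  then obtain i j where "i < j" "(ssg ^^ i) 1 = (ssg ^^ j) 1" unfolding inj_def by (metis nat_neq_iff)
  then have "(ssg ^^ i) ((ssg ^^ (j - i)) 1) = (ssg ^^ i) 1" by (metis add_diff_inverse_nat comp_apply funpow_add less_imp_not_less)
  then have "(ssg ^^ (j - i)) 1 = 1" using inj by (meson injD)
  then show ?thesis using \<open>i < j\<close> by (intro exI[of _ "j - i"]) simp
 qed
 define d where "d = (LEAST d. d > 0 & (ssg ^^ d) 1 = 1)"
 have d: "d > 0" "(ssg ^^ d) 1 = 1" using LeastI_ex[OF \<open>\<exists>d>0. (ssg ^^ d) 1 = 1\<close>] by (simp_all add: d_def)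
 have least: "\<not> (k > 0 & (ssg ^^ k) 1 = 1)" if "k < d" for k
  using not_less_Least[of k "%d. d > 0 & (ssg ^^ d) 1 = 1"] that unfolding d_def by blast
 have per: "(ssg ^^ k) 1 = (ssg ^^ (k mod d)) 1" for k
 proof -
  have "(ssg ^^ (i * d)) 1 = 1" for i
  proof (induction i)
   case (Suc i)
   have "(ssg ^^ (Suc i * d)) 1 = (ssg ^^ d) ((ssg ^^ (i * d)) 1)" by (simp only: mult_Suc funpow_add comp_apply)
   then show ?case by (simp only: Suc.IH d(2))
  qed simp
  then have "(ssg ^^ (k mod d + k div d * d)) 1 = (ssg ^^ (k mod d)) 1" by (simp only: funpow_add comp_apply)
  then show ?thesis by (simp only: mod_div_mult_eq)
 qed
 have dist: "i = j" if "i < d" "j < d" "(ssg ^^ i) 1 = (ssg ^^ j) 1" for i j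
  using that
 proof (induction i j rule: linorder_wlog)
  case (le i j)
  then have "(ssg ^^ i) ((ssg ^^ (j - i)) 1) = (ssg ^^ i) 1" by (metis comp_apply funpow_add le_add_diff_inverse)
  then have "(ssg ^^ (j - i)) 1 = 1" using inj by (meson injD)
  then have "\<not> j - i > 0" using least[of "j - i"] le by auto
  then show ?case using le by simp
 qed auto
 have "(%k. (ssg ^^ k) 1) ` {..<d} = {1..n}"
 proof -
  have "range (%k. (ssg ^^ k) 1) <= (%k. (ssg ^^ k) 1) ` {..<d}"
  proof
   fix y assume "y \<in> range (%k. (ssg ^^ k) 1)"
   then obtain k where "y = (ssg ^^ k) 1" by blast
   then have "y = (ssg ^^ (k mod d)) 1" using per by simp
   then show "y \<in> (%k. (ssg ^^ k) 1) ` {..<d}" using d(1) by (intro image_eqI[of _ _ "k mod d"]) simp_all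
  qed
  then show ?thesis unfolding orbit[symmetric] by blast
 qed
 moreover have "inj_on (%k. (ssg ^^ k) 1) {..<d}" by (rule inj_onI) (use dist in simp)
 ultimately have dn: "d = n" using card_image[of "%k. (ssg ^^ k) 1" "{..<d}"] by simp
 \<comment> \<open>Powers of one permutation commute and the orbit of 1 is everything, so a power is
   determined by its value at 1.\<close>
 have eqI: "ssg ^^ i = ssg ^^ j" if e: "(ssg ^^ i) 1 = (ssg ^^ j) 1" for i j
 proof
  fix y
  show "(ssg ^^ i) y = (ssg ^^ j) y"
  proof (cases "y \<in> {1..n}")
   case True
   then obtain k where k: "y = (ssg ^^ k) 1" using orbit by blast
   have "(ssg ^^ i) ((ssg ^^ k) 1) = (ssg ^^ k) ((ssg ^^ i) 1)" "(ssg ^^ j) ((ssg ^^ k) 1) = (ssg ^^ k) ((ssg ^^ j) 1)"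
    by (metis add.commute comp_apply funpow_add)+
   then show ?thesis unfolding k e by simp
  next
   case False
   then show ?thesis using permutes_not_in[OF perm] by simp
  qed
 qed
 have modn: "ssg ^^ k = ssg ^^ (k mod n)" for k by (rule eqI) (use per dn in simp)
 define r where "r k = ssg ^^ nat k" for k :: int
 have "r \<in> iso (integer_mod_group n) ((sym_group n)\<lparr>carrier := range (%k. ssg ^^ k)\<rparr>)"
 proof (rule isoI)
  have car: "carrier (integer_mod_group n) = {0..<int n}" using ssg(3) by (simp add: carrier_integer_mod_group)
  show "r \<in> hom (integer_mod_group n) ((sym_group n)\<lparr>carrier := range (%k. ssg ^^ k)\<rparr>)"
  proof (rule homI)
   fix x y assume xy: "x \<in> carrier (integer_mod_group n)" "y \<in> carrier (integer_mod_group n)"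
   show "r x \<in> carrier ((sym_group n)\<lparr>carrier := range (%k. ssg ^^ k)\<rparr>)" by (simp add: r_def)
   have "nat ((x + y) mod int n) = (nat x + nat y) mod n" using xy by (simp add: car nat_mod_distrib nat_add_distrib)
   then have "r ((x + y) mod int n) = ssg ^^ (nat x + nat y)" using modn[of "nat x + nat y"] by (simp add: r_def)
   then show "r (x \<otimes>\<^bsub>integer_mod_group n\<^esub> y) = r x \<otimes>\<^bsub>(sym_group n)\<lparr>carrier := range (%k. ssg ^^ k)\<rparr>\<^esub> r y"
    by (simp add: r_def sym_group_def funpow_add)
  qed
  have "inj_on r {0..<int n}"
  proof (rule inj_onI)
   fix x y assume xy: "x \<in> {0..<int n}" "y \<in> {0..<int n}" "r x = r y"
   have "nat x = nat y" by (rule dist) (use xy dn in \<open>auto simp: r_def\<close>)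
   then show "x = y" using xy eq_nat_nat_iff[of x y] by simp
  qed
  moreover have "r ` {0..<int n} = range (%k. ssg ^^ k)"
  proof (rule equalityI)
   show "range (%k. ssg ^^ k) <= r ` {0..<int n}"
   proof
    fix g assume "g \<in> range (%k. ssg ^^ k)"
    then obtain k where "g = ssg ^^ k" by blast
    then have "g = r (int (k mod n))" using modn by (simp add: r_def)
    then show "g \<in> r ` {0..<int n}" using ssg(3) by (intro image_eqI[of _ _ "int (k mod n)"]) simp_all
   qed
  qed (auto simp: r_def)
  ultimately show "bij_betw r (carrier (integer_mod_group n)) (carrier ((sym_group n)\<lparr>carrier := range (%k. ssg ^^ k)\<rparr>))"
   by (simp add: bij_betw_def car)
 qed
 then show "(sym_group n)\<lparr>carrier := range (%k. ssg ^^ k)\<rparr> \<cong> integer_mod_group n"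
  by (intro group.iso_sym[OF group_integer_mod_group] is_isoI)
 show "ssg ^^ n = id" using modn[of n] by (simp add: id_def)
qed

context three_poles
begin

text \<open>The scale is read off from the third residue, which for a normal form is
  \<open>2 pi i\<close> times the scale times the value of \<open>p3\<close>.\<close>

definition class_at :: "complex ^ 3 => complex => 3 marked_form set" where
 "class_at x t = iso_class (normal_form (x $ 3 / (2 * of_real pi * \<i> * poly rd.p3 t)) t, base_points)"

lemma class_at:
 fixes x :: "complex ^ 3"
 assumes x: "x \<in> residual_space - resonance_arrangement" and t: "t \<in> rd.generic_zeros"
  and r: "rd.residue_ratio t = - (x $ 1) / x $ 3"
 shows "class_at x t \<in> stratum a b" "residual_map (class_at x t) = x" "class_ratio (class_at x t) = t"
proof -
 have x': "x $ 1 + x $ 2 + x $ 3 = 0" "x $ 1 ~= 0" "x $ 2 ~= 0" "x $ 3 ~= 0" using x generic_residues_iff by blast+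
 have p: "poly rd.p1 t ~= 0" "poly rd.p2 t ~= 0" "poly rd.p3 t ~= 0" using t by (auto simp: rd.generic_zeros_def)
 define c where "c = x $ 3 / (2 * of_real pi * \<i> * poly rd.p3 t)"
 have c: "c ~= 0" using x'(4) p(3) by (simp add: c_def)
 have t01: "t ~= 0" "t ~= 1" using rd.generic_zeros_01[OF t] by auto
 note nf = normal_form_marked[OF c t01] and res = normal_form_residues[OF c t01]
 let ?m = "(normal_form c t, base_points)"
 have X: "class_at x t = iso_class ?m" by (simp add: class_at_def c_def)
 show "class_at x t \<in> stratum a b" unfolding X by (rule class_invariants(1)[OF nf(1)])
 show "class_ratio (class_at x t) = t" unfolding X class_invariants(3)[OF nf(1)] by (rule nf(2))
 have c3: "2 * of_real pi * \<i> * c = x $ 3 / poly rd.p3 t" by (simp add: c_def)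
 have p1: "poly rd.p1 t * x $ 3 = x $ 1 * poly rd.p3 t"
  using r p(3) x'(4) by (simp add: rd.residue_ratio_def field_simps)
 have r3: "marked_residues ?m $ 3 = x $ 3" unfolding marked_residues_def using res(3) p(3) c3 by simp
 have "marked_residues ?m $ 1 = x $ 3 / poly rd.p3 t * poly rd.p1 t" unfolding marked_residues_def using res(1) c3 by simp
 then have r1: "marked_residues ?m $ 1 = x $ 1" using p1 p(3) by (simp add: field_simps)
 have "marked_residues ?m $ 1 + marked_residues ?m $ 2 + marked_residues ?m $ 3 =
   2 * of_real pi * \<i> * c * (poly rd.p1 t + poly rd.p2 t + poly rd.p3 t)"
  unfolding marked_residues_def using res by (simp add: algebra_simps)
 also have "\<dots> = x $ 1 + x $ 2 + x $ 3" by (simp only: rd.sum_zero_poly x'(1) mult_zero_right)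
 finally have r2: "marked_residues ?m $ 2 = x $ 2" using r1 r3 by simp
 have "marked_residues ?m = x" unfolding vec_eq_iff forall_3 using r1 r2 r3 by blast
 then show "residual_map (class_at x t) = x" unfolding X class_invariants(2)[OF nf(1)] .
qed

text \<open>Off the arrangement all residues are nonzero, so the cross-ratio is a generic zero, and
  residues and cross-ratio together determine the class.\<close>

lemma class_data:
 assumes X: "X \<in> stratum a b" and x: "residual_map X \<in> residual_space - resonance_arrangement"
 shows "class_ratio X \<in> rd.generic_zeros" "rd.residue_ratio (class_ratio X) = - (residual_map X $ 1) / residual_map X $ 3"
  "X = class_at (residual_map X) (class_ratio X)"
proof -
 obtain m where m: "m \<in> marked_forms a b" "X = iso_class m" using X unfolding stratum_def by (rule quotientE)
 let ?x = "residual_map X" and ?t = "class_ratio X"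
 have mx: "marked_residues m = ?x" "cross_ratio m = ?t" using class_invariants[OF m(1)] unfolding m(2) by simp_all
 obtain c where c: "c ~= 0" "?x $ 1 = c * poly rd.p1 ?t" "?x $ 2 = c * poly rd.p2 ?t" "?x $ 3 = c * poly rd.p3 ?t"
  using cross_ratio_residues[OF m(1)] unfolding mx by metis
 have x': "?x $ 1 ~= 0" "?x $ 2 ~= 0" "?x $ 3 ~= 0" using x generic_residues_iff by blast+
 show g: "?t \<in> rd.generic_zeros" using c x' by (auto simp: rd.generic_zeros_def)
 show r: "rd.residue_ratio ?t = - (?x $ 1) / ?x $ 3" using c by (simp add: rd.residue_ratio_def)
 note ca = class_at[OF x g r]
 define k where "k = ?x $ 3 / (2 * of_real pi * \<i> * poly rd.p3 ?t)"
 have k: "k ~= 0" using x'(3) c by (auto simp: k_def)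
 have t01: "?t ~= 0" "?t ~= 1" using rd.generic_zeros_01[OF g] by auto
 note nf = normal_form_marked[OF k t01]
 have Y: "class_at ?x ?t = iso_class (normal_form k ?t, base_points)" by (simp add: class_at_def k_def)
 have mr: "marked_residues (normal_form k ?t, base_points) = ?x" using ca(2) unfolding Y class_invariants(2)[OF nf(1)] .
 have "iso_class m = iso_class (normal_form k ?t, base_points)"
  by (rule iso_class_eq[OF m(1) nf(1) trans[OF mx(2) nf(2)[symmetric]] trans[OF mx(1) mr[symmetric]], of 3])
   (use x'(3) mx(1) in simp)
 then show "X = class_at ?x ?t" using m(2) Y by simp
qed

text \<open>A class over generic residues is the same as its residues and its cross-ratio, so
  lifting a loop of residues amounts to lifting the loop of their ratios under
  \<open>residue_ratio\<close>.\<close>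

theorem monodromy_description:
 fixes lam :: "complex ^ 3"
 assumes lam: "lam \<in> residual_space - resonance_arrangement" and rc: "residue_cover a (b 1) (b 2) (b 3) lab c"
 obtains h where "bij_betw h (residual_fiber a b lam) {1..a}"
  "monodromy_perms a b lam = {\<pi> \<in> Bij (residual_fiber a b lam).
   \<exists>g\<in>generate (sym_group a) {c 0, c 1, c 2}. \<forall>X\<in>residual_fiber a b lam. h (\<pi> X) = g (h X)}"
proof -
 interpret rc: residue_cover a "b 1" "b 2" "b 3" lab c by (rule rc)
 let ?F = "residual_fiber a b lam"
 \<comment> \<open>The ratio of residues is unchanged by scaling and maps the complement of the
   arrangement to the plane without 0 and 1.\<close>
 define \<mu> where "\<mu> x = - (x $ 1) / x $ 3" for x :: "complex ^ 3"
 have \<mu>01: "\<mu> x \<notin> {0, 1}" "x $ 3 ~= 0" if "x \<in> residual_space - resonance_arrangement" for x :: "complex ^ 3"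
 proof -
  have x': "x $ 1 + x $ 2 + x $ 3 = 0" "x $ 1 ~= 0" "x $ 2 ~= 0" "x $ 3 ~= 0" using that generic_residues_iff by blast+
  have "\<mu> x ~= 1"
  proof
   assume "\<mu> x = 1"
   then have "- (x $ 1) / x $ 3 = 1" unfolding \<mu>_def .
   then have "- (x $ 1) = 1 * x $ 3" unfolding nonzero_divide_eq_eq[OF x'(4)] .
   then have e: "x $ 3 = - (x $ 1)" by (simp only: mult_1_left)
   have "x $ 2 = 0" using x'(1) unfolding e by simp
   then show False using x'(3) by simp
  qed
  moreover have "\<mu> x ~= 0" using x' by (simp add: \<mu>_def)
  ultimately show "\<mu> x \<notin> {0, 1}" by simp
  show "x $ 3 ~= 0" by (rule x'(4))
 qed
 obtain k where k: "k \<in> {0, 1, 2}" "\<mu> lam \<in> sector k" using sector_cover[OF \<mu>01(1)[OF lam]] by (rule bexE)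
 define h where "h X = lab k (class_ratio X)" for X
 have FD: "class_ratio X \<in> rd.fiber (\<mu> lam)" "X = class_at lam (class_ratio X)" "X \<in> stratum a b" "residual_map X = lam"
  if X: "X \<in> ?F" for X
 proof -
  show X': "X \<in> stratum a b" "residual_map X = lam" using X by (simp_all add: residual_fiber_def)
  note d = class_data[OF X'(1), unfolded X'(2), OF lam]
  show "class_ratio X \<in> rd.fiber (\<mu> lam)" using d(1,2) by (simp add: \<mu>_def)
  show "X = class_at lam (class_ratio X)" by (rule d(3))
 qed
 have inF: "class_at lam t \<in> ?F" "class_ratio (class_at lam t) = t" if "t \<in> rd.fiber (\<mu> lam)" for t
 proof -
  have t: "t \<in> rd.generic_zeros" "rd.residue_ratio t = - (lam $ 1) / lam $ 3" using that by (simp_all add: \<mu>_def)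
  show "class_at lam t \<in> ?F" "class_ratio (class_at lam t) = t"
   using class_at[OF lam t] by (simp_all add: residual_fiber_def)
 qed
 have bT: "bij_betw class_ratio ?F (rd.fiber (\<mu> lam))"
 proof (rule bij_betw_byWitness[where f' = "class_at lam"])
  show "\<forall>X\<in>?F. class_at lam (class_ratio X) = X" using FD(2) by (intro ballI) (rule sym)
  show "\<forall>t\<in>rd.fiber (\<mu> lam). class_ratio (class_at lam t) = t" using inF(2) by (rule ballI)
  show "class_ratio ` ?F <= rd.fiber (\<mu> lam)" by (rule image_subsetI) (rule FD(1))
  show "class_at lam ` rd.fiber (\<mu> lam) <= ?F" by (rule image_subsetI) (rule inF(1))
 qed
 have bh: "bij_betw h ?F {1..a}"
  using bij_betw_trans[OF bT rc.label_bij[OF k(2)]] by (simp only: h_def[abs_def] comp_def)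
 have "\<pi> \<in> monodromy_perms a b lam \<longleftrightarrow> \<pi> \<in> Bij ?F & (\<exists>g\<in>rc.G. \<forall>X\<in>?F. h (\<pi> X) = g (h X))" for \<pi>
 proof
  assume "\<pi> \<in> monodromy_perms a b lam"
  then obtain gm where B: "\<pi> \<in> Bij ?F" and gm: "path gm" "path_image gm <= residual_space - resonance_arrangement"
   "pathstart gm = lam" "pathfinish gm = lam"
   and lift: "\<forall>X\<in>?F. \<exists>dl. lifts_loop a b gm dl & dl 0 = X & dl 1 = \<pi> X"
   unfolding monodromy_perms_def by blast
  have gs: "gm s \<in> residual_space - resonance_arrangement" if "s \<in> {0..1}" for s
   using gm(2) that unfolding path_image_def by blast
  have "path (\<mu> \<circ> gm)" unfolding path_def o_def \<mu>_def
   using gm(1) gs \<mu>01(2) unfolding path_def by (intro continuous_intros) auto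
  moreover have "path_image (\<mu> \<circ> gm) <= - {0, 1}"
   unfolding path_image_def by (rule image_subsetI) (use gs \<mu>01(1) in simp)
  moreover have e: "(\<mu> \<circ> gm) 0 = \<mu> lam" "(\<mu> \<circ> gm) 1 = \<mu> lam" using gm(3,4) by (simp_all add: pathstart_def pathfinish_def)
  ultimately have "\<exists>g\<in>rc.G. \<forall>dl. rc.lift_of (\<mu> \<circ> gm) dl --> lab k (dl 1) = g (lab k (dl 0))"
   using k by (intro rc.monodromy_in_group) simp_all
  then obtain g where g: "g \<in> rc.G" "\<forall>dl. rc.lift_of (\<mu> \<circ> gm) dl --> lab k (dl 1) = g (lab k (dl 0))" by blast
  have "h (\<pi> X) = g (h X)" if X: "X \<in> ?F" for X
  proof -
   obtain dl where dl: "lifts_loop a b gm dl" "dl 0 = X" "dl 1 = \<pi> X" using lift X by blast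
   then have p: "pathin (stratum_topology a b) dl" "\<forall>s\<in>{0..1}. residual_map (dl s) = gm s" by (simp_all add: lifts_loop_def)
   have "rc.lift_of (\<mu> \<circ> gm) (%s. class_ratio (dl s))"
    unfolding rc.lift_of_def
   proof (intro conjI ballI)
    show "continuous_on {0..1} (%s. class_ratio (dl s))" by (rule class_ratio_path(1)[OF p(1)])
    fix s :: real assume s: "s \<in> {0..1}"
    have rs: "residual_map (dl s) = gm s" using p(2) s by blast
    note d = class_data[OF class_ratio_path(2)[OF p(1) s], unfolded rs, OF gs[OF s]]
    show "class_ratio (dl s) \<in> rd.generic_zeros" by (rule d(1))
    show "rd.residue_ratio (class_ratio (dl s)) = (\<mu> \<circ> gm) s" using d(2) by (simp add: \<mu>_def)
   qed
   then have "lab k (class_ratio (dl 1)) = g (lab k (class_ratio (dl 0)))" using g(2) by blast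
   then show ?thesis by (simp add: h_def dl)
  qed
  then show "\<pi> \<in> Bij ?F & (\<exists>g\<in>rc.G. \<forall>X\<in>?F. h (\<pi> X) = g (h X))" using B g(1) by blast
 next
  assume "\<pi> \<in> Bij ?F & (\<exists>g\<in>rc.G. \<forall>X\<in>?F. h (\<pi> X) = g (h X))"
  then obtain g where B: "\<pi> \<in> Bij ?F" and g: "g \<in> rc.G" "\<forall>X\<in>?F. h (\<pi> X) = g (h X)" by blast
  obtain gm where gm: "path gm" "path_image gm <= - {0, 1}" "gm 0 = \<mu> lam" "gm 1 = \<mu> lam"
   "\<forall>dl. rc.lift_of gm dl --> lab k (dl 1) = g (lab k (dl 0))"
   using rc.group_realized[OF g(1) k(2)] unfolding rc.realized_def by blast
  \<comment> \<open>A loop of ratios is turned into a loop of residues by keeping the third residue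
    at \<open>lam $ 3\<close>; the ratio gives the first one and the vanishing sum the
    second.\<close>
  define \<Gamma> :: "real => complex ^ 3" where
   "\<Gamma> s = (\<chi> j. (if j = 1 then - (lam $ 3) else if j = 2 then lam $ 3 else 0) * gm s +
    (if j = 2 then - (lam $ 3) else if j = 3 then lam $ 3 else 0))" for s
  have \<Gamma>j: "\<Gamma> s $ 1 = - (lam $ 3) * gm s" "\<Gamma> s $ 2 = lam $ 3 * gm s - lam $ 3" "\<Gamma> s $ 3 = lam $ 3" for s
   using three_distinct by (simp_all add: \<Gamma>_def)
  have l: "lam $ 1 + lam $ 2 + lam $ 3 = 0" "lam $ 3 ~= 0" using lam generic_residues_iff by blast+
  have gen: "\<Gamma> s \<in> residual_space - resonance_arrangement" if s: "s \<in> {0..1}" for s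
  proof -
   have "gm s \<notin> {0, 1}" using gm(2) s unfolding path_image_def by blast
   then have "lam $ 3 * (gm s - 1) ~= 0" "gm s ~= 0" using l(2) by simp_all
   then show ?thesis unfolding generic_residues_iff \<Gamma>j using l(2) by (simp add: algebra_simps)
  qed
  have \<mu>\<Gamma>: "- (\<Gamma> s $ 1) / \<Gamma> s $ 3 = gm s" for s using l(2) by (simp add: \<Gamma>j)
  have ends: "\<Gamma> s = lam" if "gm s = \<mu> lam" for s
  proof -
   have 1: "\<Gamma> s $ 1 = lam $ 1" using l(2) by (simp add: \<Gamma>j that \<mu>_def)
   have "lam $ 2 = (lam $ 1 + lam $ 2 + lam $ 3) - lam $ 1 - lam $ 3" by simp
   then have l2: "lam $ 2 = - (lam $ 1) - lam $ 3" by (simp only: l(1) diff_0)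
   have "\<Gamma> s $ 2 = - (\<Gamma> s $ 1) - lam $ 3" by (simp add: \<Gamma>j)
   also have "\<dots> = lam $ 2" by (simp only: 1 l2)
   finally show ?thesis unfolding vec_eq_iff forall_3 using 1 \<Gamma>j(3) by blast
  qed
  have pG: "path \<Gamma>" unfolding path_def \<Gamma>_def using gm(1) unfolding path_def by (intro continuous_intros)
  have "\<exists>dl. lifts_loop a b \<Gamma> dl & dl 0 = X & dl 1 = \<pi> X" if X: "X \<in> ?F" for X
  proof -
   have t0: "class_ratio X \<in> rd.generic_zeros" "rd.residue_ratio (class_ratio X) = gm 0" using FD(1)[OF X] gm(3) by simp_all
   obtain \<tau> where \<tau>: "rc.lift_of gm \<tau>" "\<tau> 0 = class_ratio X" using rc.exists_lift[OF gm(1,2) t0] .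
   have \<tau>s: "\<tau> s \<in> rd.generic_zeros" "rd.residue_ratio (\<tau> s) = gm s" if "s \<in> {0..1}" for s
    using \<tau>(1) that unfolding rc.lift_of_def by blast+
   have \<tau>c: "continuous_on {0..1} \<tau>" using \<tau>(1) unfolding rc.lift_of_def by blast
   have nz3: "poly rd.p3 (\<tau> s) ~= 0" if "s \<in> {0..1}" for s using \<tau>s(1)[OF that] by (simp add: rd.generic_zeros_def)
   define dl where "dl s = class_at (\<Gamma> s) (\<tau> s)" for s
   have "pathin (stratum_topology a b) (%s. iso_class (normal_form (lam $ 3 / (2 * of_real pi * \<i> * poly rd.p3 (\<tau> s))) (\<tau> s), base_points))"
   proof (rule normal_path[OF _ \<tau>c])
    show "continuous_on {0..1} (%s. lam $ 3 / (2 * of_real pi * \<i> * poly rd.p3 (\<tau> s)))"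
     using nz3 by (intro continuous_intros \<tau>c) simp
    show "lam $ 3 / (2 * of_real pi * \<i> * poly rd.p3 (\<tau> s)) ~= 0 & \<tau> s ~= 0 & \<tau> s ~= 1" if "s \<in> {0..1}" for s
     using l(2) nz3[OF that] rd.generic_zeros_01[OF \<tau>s(1)[OF that]] by simp
   qed
   then have "pathin (stratum_topology a b) dl" by (simp only: dl_def[abs_def] class_at_def \<Gamma>j)
   moreover have res: "residual_map (dl s) = \<Gamma> s" "dl s \<in> stratum a b" "class_ratio (dl s) = \<tau> s" if s: "s \<in> {0..1}" for s
    unfolding dl_def using class_at[OF gen[OF s] \<tau>s(1)[OF s]] \<tau>s(2)[OF s] \<mu>\<Gamma>[of s] by simp_all
   ultimately have "lifts_loop a b \<Gamma> dl" by (simp add: lifts_loop_def)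
   moreover have "dl 0 = X" unfolding dl_def ends[OF gm(3)] \<tau>(2) by (rule FD(2)[OF X, symmetric])
   moreover have "dl 1 = \<pi> X"
   proof -
    have F1: "dl 1 \<in> ?F" using res(1,2)[of 1] ends[OF gm(4)] by (simp add: residual_fiber_def)
    have \<pi>X: "\<pi> X \<in> ?F" using B X by (auto simp: Bij_def bij_betw_def)
    have "h (dl 1) = lab k (\<tau> 1)" using res(3)[of 1] by (simp add: h_def)
    also have "\<dots> = g (lab k (\<tau> 0))" using gm(5) \<tau>(1) by blast
    also have "\<dots> = h (\<pi> X)" using g(2) X by (simp add: \<tau>(2) h_def)
    finally have "h (dl 1) = h (\<pi> X)" .
    then show ?thesis by (rule inj_onD[OF bij_betw_imp_inj_on[OF bh] _ F1 \<pi>X])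
   qed
   ultimately show ?thesis by blast
  qed
  moreover have "path_image \<Gamma> <= residual_space - resonance_arrangement"
   unfolding path_image_def by (rule image_subsetI) (rule gen)
  moreover have "pathstart \<Gamma> = lam" "pathfinish \<Gamma> = lam"
   using ends[OF gm(3)] ends[OF gm(4)] by (simp_all add: pathstart_def pathfinish_def)
  ultimately show "\<pi> \<in> monodromy_perms a b lam" unfolding monodromy_perms_def using B pG by blast
 qed
 then have "monodromy_perms a b lam = {\<pi> \<in> Bij ?F. \<exists>g\<in>rc.G. \<forall>X\<in>?F. h (\<pi> X) = g (h X)}" by blast
 then show ?thesis using that bh by blast
qed

end

text \<open>In the cyclic case the generators are a full cycle, the identity and, by the product
  relation, the inverse of the cycle.\<close>

lemma generate_cyclic:
 assumes ssg: "ssg permutes {1..n}" "is_cycle_on ssg {1..n}" "n >= 1"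
  and S: "ssg \<in> S" "\<forall>s\<in>S. s = ssg \<or> s = id \<or> (\<forall>x. s (ssg x) = x)"
 shows "generate (sym_group n) S = range (%k. ssg ^^ k)"
proof -
 interpret group "sym_group n" by (rule sym_group_is_group)
 have n: "ssg ^^ n = id" by (rule cyclic_permutations_iso(2)[OF ssg])
 have perm: "ssg ^^ k \<in> carrier (sym_group n)" for k
  using ssg(1) by (induction k) (simp_all add: sym_group_def permutes_compose permutes_id)
 have inv: "inv\<^bsub>sym_group n\<^esub> (ssg ^^ k) \<in> range (%k. ssg ^^ k)" for k
 proof -
  have "ssg ^^ (k * n) = id" using n by (induction k) (simp_all add: funpow_add)
  moreover have "k * (n - 1) + k = k * n" using ssg(3) by (cases n) simp_all
  ultimately have "ssg ^^ (k * (n - 1)) \<circ> ssg ^^ k = id" by (simp add: funpow_add[symmetric])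
  then have "ssg ^^ (k * (n - 1)) \<otimes>\<^bsub>sym_group n\<^esub> (ssg ^^ k) = \<one>\<^bsub>sym_group n\<^esub>" by (simp add: sym_group_def)
  then have "inv\<^bsub>sym_group n\<^esub> (ssg ^^ k) = ssg ^^ (k * (n - 1))" by (rule inv_equality[OF _ perm perm])
  then show ?thesis by (rule ssubst) (rule rangeI)
 qed
 have "(ssg ^^ 0) \<in> range (%k. ssg ^^ k)" "(ssg ^^ 1) \<in> range (%k. ssg ^^ k)" by (rule rangeI)+
 then have r01: "id \<in> range (%k. ssg ^^ k)" "ssg \<in> range (%k. ssg ^^ k)" by simp_all
 have mem: "s \<in> range (%k. ssg ^^ k)" if s: "s \<in> S" for s
 proof -
  consider "s = ssg" | "s = id" | "\<forall>x. s (ssg x) = x" using S(2) s by blast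
  then show ?thesis
  proof cases
   case 3
   have "s = ssg ^^ (n - 1)"
   proof
    fix y
    have "ssg ((ssg ^^ (n - 1)) y) = (ssg ^^ Suc (n - 1)) y" by simp
    also have "\<dots> = y" using n ssg(3) by (simp del: funpow.simps)
    finally show "s y = (ssg ^^ (n - 1)) y" using 3 by metis
   qed
   then show ?thesis by (rule ssubst) (rule rangeI)
  qed (use r01 in simp_all)
 qed
 have sub: "subgroup (range (%k. ssg ^^ k)) (sym_group n)"
 proof (rule subgroupI)
  show "range (%k. ssg ^^ k) <= carrier (sym_group n)" using perm by (intro image_subsetI)
  show "range (%k. ssg ^^ k) ~= {}" using r01(1) by blast
  show "inv\<^bsub>sym_group n\<^esub> g \<in> range (%k. ssg ^^ k)" if "g \<in> range (%k. ssg ^^ k)" for g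
   using that by (elim imageE) (simp only: inv)
  show "g \<otimes>\<^bsub>sym_group n\<^esub> g' \<in> range (%k. ssg ^^ k)" if g: "g \<in> range (%k. ssg ^^ k)" and g': "g' \<in> range (%k. ssg ^^ k)" for g g'
  proof -
   obtain k where k: "g = ssg ^^ k" using g by (rule imageE)
   obtain k' where k': "g' = ssg ^^ k'" using g' by (rule imageE)
   from k k' have "g \<otimes>\<^bsub>sym_group n\<^esub> g' = ssg ^^ (k + k')" by (simp add: sym_group_def funpow_add)
   then show ?thesis by (rule ssubst) (rule rangeI)
  qed
 qed
 have SR: "S <= range (%k. ssg ^^ k)" by (rule subsetI) (rule mem)
 have "S <= carrier (sym_group n)" by (rule order_trans[OF SR subgroup.subset[OF sub]])
 then have sg: "subgroup (generate (sym_group n) S) (sym_group n)" by (rule generate_is_subgroup)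
 show ?thesis
 proof (rule equalityI)
  show "generate (sym_group n) S <= range (%k. ssg ^^ k)" by (rule generate_subgroup_incl[OF SR sub])
  show "range (%k. ssg ^^ k) <= generate (sym_group n) S"
  proof (rule image_subsetI)
   fix k
   show "ssg ^^ k \<in> generate (sym_group n) S"
   proof (induction k)
    case 0
    show ?case using subgroup.one_closed[OF sg] by (simp add: sym_group_def id_def)
   next
    case (Suc k)
    have "ssg \<otimes>\<^bsub>sym_group n\<^esub> (ssg ^^ k) \<in> generate (sym_group n) S"
     by (rule subgroup.m_closed[OF sg generate.incl[OF S(1)] Suc])
    moreover have "ssg ^^ Suc k = ssg \<otimes>\<^bsub>sym_group n\<^esub> (ssg ^^ k)" by (simp add: sym_group_def)
    ultimately show ?case by (simp only:)
   qed
  qed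
 qed
qed

lemma cycle_on_singleton_id:
 assumes "s permutes {1..n}" "card A = 1" "is_cycle_on s A" shows "s = id"
proof
 fix x
 obtain y where A: "A = {y}" using assms(2) card_1_singletonE by blast
 have f: "s x = x" if "x ~= y" for x using assms(3) that unfolding is_cycle_on_def A by simp
 have "s y = y"
 proof (rule ccontr)
  assume ne: "s y ~= y"
  then have "s (s y) = s y" by (rule f)
  then show False using ne permutes_inj[OF assms(1)] by (meson injD)
 qed
 then show "s x = id x" using f by (cases "x = y") simp_all
qed

text \<open>When \<open>b_i = b_j = 1\<close>, the cycle belonging to the third pole has length
  \<open>b_i + b_j - 1 = 1\<close>, so it is the identity, while those belonging to the simple poles
  have the full length \<open>a\<close>.\<close>

lemma (in residue_cover) two_simple_poles_cyclic:
 assumes "(b1 = 1 & b2 = 1) \<or> (b2 = 1 & b3 = 1) \<or> (b1 = 1 & b3 = 1)"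
 obtains ssg where "ssg permutes {1..a}" "is_cycle_on ssg {1..a}" "G = range (%k. ssg ^^ k)"
proof -
 have full: "is_cycle_on s {1..a}" if s: "\<exists>A\<subseteq>{1..a}. card A = a & is_cycle_on s A" for s
 proof -
  obtain A where A: "A <= {1..a}" "card A = a" "is_cycle_on s A" using s by (elim exE conjE)
  have "A = {1..a}" by (rule card_subset_eq) (use A(1,2) in simp_all)
  then show ?thesis using A(3) by (simp only:)
 qed
 have one: "c k = id" if ck: "\<exists>A\<subseteq>{1..a}. card A = 1 & is_cycle_on (c k) A" for k
 proof -
  obtain A where A: "A <= {1..a}" "card A = 1" "is_cycle_on (c k) A" using ck by (elim exE conjE)
  show ?thesis by (rule cycle_on_singleton_id[OF c_permutes A(2,3)])
 qed
 note p = c_prod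
 consider (12) "b1 = 1" "b2 = 1" | (23) "b2 = 1" "b3 = 1" | (13) "b1 = 1" "b3 = 1" using assms by blast
 then show ?thesis
 proof cases
  case 12
  then have m: "m1 = a" "m3 = 1" using m_eq a_eq by simp_all
  have c2: "c 2 = id" by (rule one) (use cycle3 m in simp)
  have cy: "is_cycle_on (c 0) {1..a}" by (rule full) (use cycle1 m in simp)
  have "generate (sym_group a) {c 0, c 1, c 2} = range (%k. c 0 ^^ k)"
   by (rule generate_cyclic[OF c_permutes cy a_pos]) (use p c2 in auto)
  then show ?thesis using that[OF c_permutes cy] by simp
 next
  case 23
  then have m: "m2 = a" "m1 = 1" using m_eq a_eq by simp_all
  have c0: "c 0 = id" by (rule one) (use cycle1 m in simp)
  have cy: "is_cycle_on (c 1) {1..a}" by (rule full) (use cycle2 m in simp)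
  have p': "c 2 (c 1 x) = x" for x using p[of x] unfolding c0 by simp
  have "generate (sym_group a) {c 0, c 1, c 2} = range (%k. c 1 ^^ k)"
   by (rule generate_cyclic[OF c_permutes cy a_pos]) (use p' c0 in auto)
  then show ?thesis using that[OF c_permutes cy] by simp
 next
  case 13
  then have m: "m1 = a" "m2 = 1" using m_eq a_eq by simp_all
  have c1: "c 1 = id" by (rule one) (use cycle2 m in simp)
  have cy: "is_cycle_on (c 0) {1..a}" by (rule full) (use cycle1 m in simp)
  have p': "c 2 (c 0 x) = x" for x using p[of x] unfolding c1 by simp
  have "generate (sym_group a) {c 0, c 1, c 2} = range (%k. c 0 ^^ k)"
   by (rule generate_cyclic[OF c_permutes cy a_pos]) (use p' c1 in auto)
  then show ?thesis using that[OF c_permutes cy] by simp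
 qed
qed

section \<open>Relabelling the poles and assembling the four cases\<close>

lemma exists_relabelling:
 fixes i j :: 3 assumes "i ~= j" shows "\<exists>ssg :: 3 => 3. bij ssg & ssg 2 = i & ssg 3 = j"
proof -
 let ?s = "transposition (2 :: 3) i"
 let ?t = "transposition (?s 3) j"
 have s2: "?s 2 = i" by simp
 have bs: "bij ?s" by (rule bij_transpose)
 have "?s 3 ~= i" using inj_eq[OF bij_is_inj[OF bs], of 3 2] three_distinct(2) unfolding s2 by simp
 then have t: "?t (?s 2) = i" "?t (?s 3) = j" using assms unfolding s2 by (simp_all add: transpose_apply_other)
 have "bij (?t \<circ> ?s)" by (rule bij_comp[OF bs bij_transpose])
 then show ?thesis using t by (intro exI[of _ "?t \<circ> ?s"] conjI) (simp_all only: comp_apply)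
qed

lemma bij_3_distinct:
 fixes ssg :: "3 => 3" assumes "bij ssg" shows "ssg 1 ~= ssg 2" "ssg 2 ~= ssg 3" "ssg 1 ~= ssg 3"
 using three_distinct by (simp_all only: inj_eq[OF bij_is_inj[OF assms]] simp_thms)

text \<open>The labels of the fiber are composed with the numbering of the Sylow subgroups; on 1 to
  6 both actions consist of the same permutations, namely those of \<open>G\<close>.\<close>

lemma exotic_transport:
 assumes h: "bij_betw h F {1..6}" and kp: "bij_betw kp {1..6} (sylow_subgroups 5 (sym_group 5))"
  and k1: "\<forall>p\<in>G. \<exists>g\<in>carrier (sym_group 5). \<forall>i\<in>{1..6}. sylow_conjugation 5 (sym_group 5) g (kp i) = kp (p i)"
  and k2: "\<forall>g\<in>carrier (sym_group 5). \<exists>p\<in>G. \<forall>i\<in>{1..6}. sylow_conjugation 5 (sym_group 5) g (kp i) = kp (p i)"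
  and M: "M = {\<pi> \<in> Bij F. \<exists>g\<in>G. \<forall>X\<in>F. h (\<pi> X) = g (h X)}"
  and e: "\<And>g. g \<in> G ==> \<exists>\<pi>\<in>M. \<forall>X\<in>F. h (\<pi> X) = g (h X)"
 shows "perm_group_isomorphic F M (sylow_subgroups 5 (sym_group 5)) exotic_S5"
proof -
 let ?B = "sylow_subgroups 5 (sym_group 5)"
 define H where "H = kp \<circ> h"
 have bH: "bij_betw H F ?B" unfolding H_def by (rule bij_betw_trans[OF h kp])
 define T where "T \<pi> = (\<lambda>y\<in>?B. H (\<pi> (inv_into F H y)))" for \<pi>
 have TC: "T \<pi> = sylow_conjugation 5 (sym_group 5) g"
  if p: "\<forall>X\<in>F. h (\<pi> X) = p (h X)" and g: "\<forall>i\<in>{1..6}. sylow_conjugation 5 (sym_group 5) g (kp i) = kp (p i)" for \<pi> p g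
 proof (rule extensionalityI[of _ ?B])
  show "T \<pi> \<in> extensional ?B" by (simp add: T_def)
  show "sylow_conjugation 5 (sym_group 5) g \<in> extensional ?B" by (simp add: sylow_conjugation_def)
  fix y assume y: "y \<in> ?B"
  let ?X = "inv_into F H y"
  have X: "?X \<in> F" "H ?X = y" using bH y by (auto simp: bij_betw_def inv_into_into f_inv_into_f)
  have hX: "h ?X \<in> {1..6}" using h X(1) by (rule bij_betwE[THEN bspec])
  have "T \<pi> y = kp (h (\<pi> ?X))" using y by (simp add: T_def H_def)
  also have "\<dots> = kp (p (h ?X))" using p X(1) by simp
  also have "\<dots> = sylow_conjugation 5 (sym_group 5) g (kp (h ?X))" using g hX by simp
  also have "kp (h ?X) = y" using X(2) by (simp add: H_def)
  finally show "T \<pi> y = sylow_conjugation 5 (sym_group 5) g y" .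
 qed
 have "exotic_S5 = T ` M"
 proof (rule equalityI)
  show "exotic_S5 <= T ` M" unfolding exotic_S5_def
  proof (rule image_subsetI)
   fix g assume "g \<in> carrier (sym_group 5)"
   then obtain p where p: "p \<in> G" "\<forall>i\<in>{1..6}. sylow_conjugation 5 (sym_group 5) g (kp i) = kp (p i)" using k2 by blast
   obtain \<pi> where \<pi>: "\<pi> \<in> M" "\<forall>X\<in>F. h (\<pi> X) = p (h X)" using e[OF p(1)] by blast
   show "sylow_conjugation 5 (sym_group 5) g \<in> T ` M" unfolding TC[OF \<pi>(2) p(2), symmetric] by (rule imageI[OF \<pi>(1)])
  qed
  show "T ` M <= exotic_S5" unfolding exotic_S5_def
  proof (rule image_subsetI)
   fix \<pi> assume "\<pi> \<in> M"
   then obtain p where p: "p \<in> G" "\<forall>X\<in>F. h (\<pi> X) = p (h X)" unfolding M by blast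
   obtain g where g: "g \<in> carrier (sym_group 5)" "\<forall>i\<in>{1..6}. sylow_conjugation 5 (sym_group 5) g (kp i) = kp (p i)"
    using k1 p(1) by blast
   show "T \<pi> \<in> sylow_conjugation 5 (sym_group 5) ` carrier (sym_group 5)" unfolding TC[OF p(2) g(2)] by (rule imageI[OF g(1)])
  qed
 qed
 then show ?thesis unfolding perm_group_isomorphic_def using bH by (intro exI[of _ H]) (simp add: T_def[abs_def])
qed

theorem theorem1p4:
  fixes a :: nat and b :: "3 \<Rightarrow> nat" and lam :: "complex ^ 3"
  assumes "a \<ge> 1" and "\<forall>j. b j \<ge> 1"
    and "int a - int (b 1) - int (b 2) - int (b 3) = - 2"
    and "lam \<in> residual_space - resonance_arrangement"
  shows "let
      case_i = (\<exists>\<sigma> :: 3 \<Rightarrow> 3. bij \<sigma> \<and> b (\<sigma> 2) = 1 \<and> b (\<sigma> 3) = 1);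
      case_ii = (\<exists>\<sigma> :: 3 \<Rightarrow> 3. bij \<sigma> \<and> b (\<sigma> 1) = 2 \<and> b (\<sigma> 2) = 3 \<and> b (\<sigma> 3) = 3);
      case_iii = (\<exists>\<sigma> :: 3 \<Rightarrow> 3. bij \<sigma> \<and> b (\<sigma> 1) \<ge> 2 \<and> b (\<sigma> 2) \<ge> 2 \<and>
        even (b (\<sigma> 1)) = even (b (\<sigma> 2)) \<and> even (b (\<sigma> 2)) = even (b (\<sigma> 3)))
    in
      (case_i \<longrightarrow> monodromy_group a b lam \<cong> integer_mod_group a) \<and>
      (case_ii \<longrightarrow>
         perm_group_isomorphic (residual_fiber a b lam) (carrier (monodromy_group a b lam))
           (sylow_subgroups 5 (sym_group 5)) exotic_S5) \<and>
      (case_iii \<longrightarrow> monodromy_group a b lam \<cong> alt_group a) \<and>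
      (\<not> case_i \<and> \<not> case_ii \<and> \<not> case_iii \<longrightarrow> monodromy_group a b lam \<cong> sym_group a)"
proof -
 have sum: "a + 2 = b 1 + b 2 + b 3" using assms(3) by linarith
 interpret three_poles a b
  by (intro three_poles.intro form_data.intro) (use assms(1,2) sum in \<open>simp_all add: sum_3\<close>)
 obtain lab c where "labelled_cover rd.generic_zeros rd.residue_ratio a lab c" using rd.exists_labelled_cover by (elim exE)
 then have rc: "residue_cover a (b 1) (b 2) (b 3) lab c" by (intro residue_cover.intro rd.residue_data_axioms)
 interpret rc: residue_cover a "b 1" "b 2" "b 3" lab c by (rule rc)
 let ?F = "residual_fiber a b lam" and ?M = "monodromy_perms a b lam"
 obtain h where h: "bij_betw h ?F {1..a}"
  "?M = {\<pi> \<in> Bij ?F. \<exists>g\<in>rc.G. \<forall>X\<in>?F. h (\<pi> X) = g (h X)}"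
  using monodromy_description[OF assms(4) rc] .
 note tr = permutation_transport_iso[OF h(1) rc.subgr h(2)]
 have iso: "monodromy_group a b lam \<cong> (sym_group a)\<lparr>carrier := rc.G\<rparr>" unfolding monodromy_group_def by (rule tr(1))
 define two_ones where "two_ones \<longleftrightarrow> (b 1 = 1 & b 2 = 1) \<or> (b 2 = 1 & b 3 = 1) \<or> (b 1 = 1 & b 3 = 1)"
 have two: "two_ones" if "i ~= j" "b i = 1" "b j = 1" for i j
  using that exhaust_3[of i] exhaust_3[of j] unfolding two_ones_def by (elim disjE) simp_all
 \<comment> \<open>Each cycle length is the sum of two pole orders minus 1, so length 1 requires two
   simple poles.\<close>
 have m_ge: "rd.m1 >= 2" "rd.m2 >= 2" "rd.m3 >= 2" if "\<not> two_ones"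
  using that b_pos[of 1] b_pos[of 2] b_pos[of 3] unfolding two_ones_def rd.m1_def rd.m2_def rd.m3_def by auto
 note triple = rc.residue_cycle_triple[OF m_ge]
 have ct: "cycle_triple a (c 0) (c 1) (c 2) rd.m1 rd.m2 rd.m3" if "\<not> two_ones" by (rule triple) (rule that)+
 have main: "rc.G = (if even (b 1) = even (b 2) & even (b 2) = even (b 3) then carrier (alt_group a) else carrier (sym_group a))"
  if "\<not> two_ones" "{#b 1, b 2, b 3#} ~= {#2, 3, 3#}"
  by (rule cycle_triple.generate_alt_or_sym[OF ct[OF that(1)] _ _ _ b_pos b_pos b_pos that(2)]) (use rd.m_eq in simp_all)
 have I: "monodromy_group a b lam \<cong> integer_mod_group a"
  if ex: "\<exists>ssg :: 3 => 3. bij ssg & b (ssg 2) = 1 & b (ssg 3) = 1"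
 proof -
  obtain ssg :: "3 => 3" where ssg: "bij ssg" "b (ssg 2) = 1" "b (ssg 3) = 1" using ex by (elim exE conjE)
  have t: "two_ones" by (rule two[OF bij_3_distinct(2)[OF ssg(1)] ssg(2,3)])
  obtain s where s: "s permutes {1..a}" "is_cycle_on s {1..a}" "rc.G = range (%k. s ^^ k)"
   by (rule rc.two_simple_poles_cyclic[OF t[unfolded two_ones_def]])
  show ?thesis by (rule iso_trans[OF iso[unfolded s(3)] cyclic_permutations_iso(1)[OF s(1,2) assms(1)]])
 qed
 have II: "perm_group_isomorphic ?F (carrier (monodromy_group a b lam)) (sylow_subgroups 5 (sym_group 5)) exotic_S5"
  if ex: "\<exists>ssg :: 3 => 3. bij ssg & b (ssg 1) = 2 & b (ssg 2) = 3 & b (ssg 3) = 3"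
 proof -
  obtain ssg :: "3 => 3" where ssg: "bij ssg" "b (ssg 1) = 2" "b (ssg 2) = 3" "b (ssg 3) = 3" using ex by (elim exE conjE)
  have vals: "(b 1 = 2 & b 2 = 3 & b 3 = 3) \<or> (b 1 = 3 & b 2 = 2 & b 3 = 3) \<or> (b 1 = 3 & b 2 = 3 & b 3 = 2)"
   using exhaust_3[of "ssg 1"] exhaust_3[of "ssg 2"] exhaust_3[of "ssg 3"] ssg(2-4) bij_3_distinct[OF ssg(1)]
   by (elim disjE) (simp_all)
  have nt: "\<not> two_ones" using vals by (auto simp: two_ones_def)
  have a6: "a = 6" using vals sum by auto
  \<comment> \<open>\<open>exotic_action\<close> expects the two 4-cycles in the first two places; a
    rotation moves the pole of order 2 to the third place without changing the group.\<close>
  have key: "\<exists>kp. bij_betw kp {1..6} (sylow_subgroups 5 (sym_group 5)) \<and>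
    (\<forall>p\<in>rc.G. \<exists>g\<in>carrier (sym_group 5). \<forall>i\<in>{1..6}. sylow_conjugation 5 (sym_group 5) g (kp i) = kp (p i)) \<and>
    (\<forall>g\<in>carrier (sym_group 5). \<exists>p\<in>rc.G. \<forall>i\<in>{1..6}. sylow_conjugation 5 (sym_group 5) g (kp i) = kp (p i))"
   if t: "cycle_triple a s1 s2 s3 n1 n2 n3" and S: "{s1, s2, s3} = {c 0, c 1, c 2}" and n: "n1 = 4" "n2 = 4" for s1 s2 s3 n1 n2 n3
   by (rule cycle_triple.exotic_action[OF t a6 n, unfolded S]) (intro exI conjI)
  note t0 = ct[OF nt]
  note t1 = cycle_triple.rotate[OF t0]
  note t2 = cycle_triple.rotate[OF t1]
  have perm: "{c 1, c 2, c 0} = {c 0, c 1, c 2}" "{c 2, c 0, c 1} = {c 0, c 1, c 2}" by (simp_all only: insert_commute)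
  have m4: "b 1 = 3 ==> rd.m1 = 4" "b 2 = 3 ==> rd.m2 = 4" "b 3 = 3 ==> rd.m3 = 4" using rd.m_eq a6 by simp_all
  have "\<exists>kp. bij_betw kp {1..6} (sylow_subgroups 5 (sym_group 5)) \<and>
    (\<forall>p\<in>rc.G. \<exists>g\<in>carrier (sym_group 5). \<forall>i\<in>{1..6}. sylow_conjugation 5 (sym_group 5) g (kp i) = kp (p i)) \<and>
    (\<forall>g\<in>carrier (sym_group 5). \<exists>p\<in>rc.G. \<forall>i\<in>{1..6}. sylow_conjugation 5 (sym_group 5) g (kp i) = kp (p i))"
   using vals
  proof (elim disjE conjE)
   assume v: "b 1 = 2" "b 2 = 3" "b 3 = 3"
   show "\<exists>kp. bij_betw kp {1..6} (sylow_subgroups 5 (sym_group 5)) \<and>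
    (\<forall>p\<in>rc.G. \<exists>g\<in>carrier (sym_group 5). \<forall>i\<in>{1..6}. sylow_conjugation 5 (sym_group 5) g (kp i) = kp (p i)) \<and>
    (\<forall>g\<in>carrier (sym_group 5). \<exists>p\<in>rc.G. \<forall>i\<in>{1..6}. sylow_conjugation 5 (sym_group 5) g (kp i) = kp (p i))"
    by (rule key[OF t1 perm(1) m4(2)[OF v(2)] m4(3)[OF v(3)]])
  next
   assume v: "b 1 = 3" "b 2 = 2" "b 3 = 3"
   show "\<exists>kp. bij_betw kp {1..6} (sylow_subgroups 5 (sym_group 5)) \<and>
    (\<forall>p\<in>rc.G. \<exists>g\<in>carrier (sym_group 5). \<forall>i\<in>{1..6}. sylow_conjugation 5 (sym_group 5) g (kp i) = kp (p i)) \<and>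
    (\<forall>g\<in>carrier (sym_group 5). \<exists>p\<in>rc.G. \<forall>i\<in>{1..6}. sylow_conjugation 5 (sym_group 5) g (kp i) = kp (p i))"
    by (rule key[OF t2 perm(2) m4(3)[OF v(3)] m4(1)[OF v(1)]])
  next
   assume v: "b 1 = 3" "b 2 = 3" "b 3 = 2"
   show "\<exists>kp. bij_betw kp {1..6} (sylow_subgroups 5 (sym_group 5)) \<and>
    (\<forall>p\<in>rc.G. \<exists>g\<in>carrier (sym_group 5). \<forall>i\<in>{1..6}. sylow_conjugation 5 (sym_group 5) g (kp i) = kp (p i)) \<and>
    (\<forall>g\<in>carrier (sym_group 5). \<exists>p\<in>rc.G. \<forall>i\<in>{1..6}. sylow_conjugation 5 (sym_group 5) g (kp i) = kp (p i))"
    by (rule key[OF t0 refl m4(1)[OF v(1)] m4(2)[OF v(2)]])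
  qed
  then obtain kp where kp: "bij_betw kp {1..6} (sylow_subgroups 5 (sym_group 5))"
    "\<forall>p\<in>rc.G. \<exists>g\<in>carrier (sym_group 5). \<forall>i\<in>{1..6}. sylow_conjugation 5 (sym_group 5) g (kp i) = kp (p i)"
    "\<forall>g\<in>carrier (sym_group 5). \<exists>p\<in>rc.G. \<forall>i\<in>{1..6}. sylow_conjugation 5 (sym_group 5) g (kp i) = kp (p i)" by (elim exE conjE)
  have h6: "bij_betw h ?F {1..6}" using h(1) unfolding a6 .
  have "\<exists>\<pi>\<in>?M. \<forall>X\<in>?F. h (\<pi> X) = g (h X)" if g: "g \<in> rc.G" for g
  proof (rule bexI[OF _ tr(2)[OF g]], rule ballI)
   fix X assume X: "X \<in> ?F"
   have "h X \<in> {1..a}" using h(1) X by (rule bij_betwE[THEN bspec])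
   then have "g (h X) \<in> h ` ?F" using permutes_in_image[OF rc.perm[OF g]] h(1) by (simp add: bij_betw_def)
   then show "h ((\<lambda>X\<in>?F. inv_into ?F h (g (h X))) X) = g (h X)" using X by (simp add: f_inv_into_f)
  qed
  then have "perm_group_isomorphic ?F ?M (sylow_subgroups 5 (sym_group 5)) exotic_S5"
   by (rule exotic_transport[OF h6 kp h(2)])
  then show ?thesis by (simp add: monodromy_group_def)
 qed
 have III: "monodromy_group a b lam \<cong> alt_group a"
  if ex: "\<exists>ssg :: 3 => 3. bij ssg & b (ssg 1) >= 2 & b (ssg 2) >= 2 \<and>
    even (b (ssg 1)) = even (b (ssg 2)) & even (b (ssg 2)) = even (b (ssg 3))"
 proof -
  obtain ssg :: "3 => 3" where ssg: "bij ssg" "b (ssg 1) >= 2" "b (ssg 2) >= 2"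
   "even (b (ssg 1)) = even (b (ssg 2))" "even (b (ssg 2)) = even (b (ssg 3))" using ex by (elim exE conjE)
  have par: "even (b 1) = even (b 2) & even (b 2) = even (b 3)"
   using exhaust_3[of "ssg 1"] exhaust_3[of "ssg 2"] exhaust_3[of "ssg 3"] ssg(4,5) bij_3_distinct[OF ssg(1)]
   by (elim disjE) simp_all
  have nt: "\<not> two_ones" unfolding two_ones_def
   using exhaust_3[of "ssg 1"] exhaust_3[of "ssg 2"] ssg(2,3) bij_3_distinct(1)[OF ssg(1)]
   by (elim disjE) simp_all
  \<comment> \<open>The exotic triple contains an even and an odd order.\<close>
  have "{#b 1, b 2, b 3#} ~= {#2, 3, 3#}"
  proof
   assume e: "{#b 1, b 2, b 3#} = {#2, 3, 3#}"
   have "set_mset {#b 1, b 2, b 3#} = {2, 3}" unfolding e by simp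
   then have "2 \<in> {b 1, b 2, b 3}" "3 \<in> {b 1, b 2, b 3}" by auto
   then show False using par by auto
  qed
  then have "rc.G = carrier (alt_group a)" using main[OF nt] par by simp
  then have "(sym_group a)\<lparr>carrier := rc.G\<rparr> = alt_group a" by (simp add: alt_group_def)
  then show ?thesis using iso by simp
 qed
 have IV: "monodromy_group a b lam \<cong> sym_group a"
  if ni: "\<nexists>ssg :: 3 => 3. bij ssg & b (ssg 2) = 1 & b (ssg 3) = 1"
   and nii: "\<nexists>ssg :: 3 => 3. bij ssg & b (ssg 1) = 2 & b (ssg 2) = 3 & b (ssg 3) = 3"
   and niii: "\<nexists>ssg :: 3 => 3. bij ssg & b (ssg 1) >= 2 & b (ssg 2) >= 2 \<and>
    even (b (ssg 1)) = even (b (ssg 2)) & even (b (ssg 2)) = even (b (ssg 3))"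
 proof -
  have ne: "\<not> (b i = 1 & b j = 1)" if ij: "i ~= j" for i j
  proof
   assume v: "b i = 1 & b j = 1"
   obtain ssg :: "3 => 3" where "bij ssg" "ssg 2 = i" "ssg 3 = j" using exists_relabelling[OF ij] by (elim exE conjE)
   then have "bij ssg & b (ssg 2) = 1 & b (ssg 3) = 1" using v by (simp only: simp_thms)
   then have "\<exists>ssg :: 3 => 3. bij ssg & b (ssg 2) = 1 & b (ssg 3) = 1" by (intro exI[of _ ssg])
   then show False by (rule notE[OF ni])
  qed
  have nt: "\<not> two_ones" unfolding two_ones_def
   using ne[OF three_distinct(1)] ne[OF three_distinct(2)] ne[OF three_distinct(3)] by blast
  have rel: "\<exists>ssg :: 3 => 3. bij ssg & ssg 1 = k & ssg 2 = i & ssg 3 = j" if "i ~= j" "k ~= i" "k ~= j" for i j k :: 3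
  proof -
   obtain ssg :: "3 => 3" where s: "bij ssg" "ssg 2 = i" "ssg 3 = j" using exists_relabelling[OF \<open>i ~= j\<close>] by (elim exE conjE)
   have "ssg 1 ~= i" "ssg 1 ~= j" using bij_3_distinct[OF s(1)] s by auto
   then have "ssg 1 = k"
    using that exhaust_3[of i] exhaust_3[of j] exhaust_3[of k] exhaust_3[of "ssg 1"] by (elim disjE) simp_all
   then show ?thesis using s by (intro exI[of _ ssg] conjI)
  qed
  have nii': "\<not> (b k = 2 & b i = 3 & b j = 3)" if ijk: "i ~= j" "k ~= i" "k ~= j" for i j k
  proof
   assume v: "b k = 2 & b i = 3 & b j = 3"
   obtain ssg :: "3 => 3" where "bij ssg" "ssg 1 = k" "ssg 2 = i" "ssg 3 = j" using rel[OF ijk] by (elim exE conjE)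
   then have "bij ssg & b (ssg 1) = 2 & b (ssg 2) = 3 & b (ssg 3) = 3" using v by (simp only: simp_thms)
   then have "\<exists>ssg :: 3 => 3. bij ssg & b (ssg 1) = 2 & b (ssg 2) = 3 & b (ssg 3) = 3" by (intro exI[of _ ssg])
   then show False by (rule notE[OF nii])
  qed
  have nex: "{#b 1, b 2, b 3#} ~= {#2, 3, 3#}"
  proof
   assume e: "{#b 1, b 2, b 3#} = {#2, 3, 3#}"
   have c3: "count {#b 1, b 2, b 3#} 3 = 2" and c2: "count {#b 1, b 2, b 3#} 2 = 1" unfolding e by simp_all
   have "(b 1 = 2 & b 2 = 3 & b 3 = 3) \<or> (b 2 = 2 & b 1 = 3 & b 3 = 3) \<or> (b 3 = 2 & b 1 = 3 & b 2 = 3)"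
    using c3 c2 by (auto split: if_splits)
   then show False using nii'[of 2 3 1] nii'[of 1 3 2] nii'[of 1 2 3] three_distinct by auto
  qed
  \<comment> \<open>If all orders had the same parity, failure of case (iii) would leave at most one
    order above 1, hence two simple poles, which is case (i).\<close>
  have np: "\<not> (even (b 1) = even (b 2) & even (b 2) = even (b 3))"
  proof
   assume par: "even (b 1) = even (b 2) & even (b 2) = even (b 3)"
   have par': "even (b i) = even (b j)" for i j
    using par exhaust_3[of i] exhaust_3[of j] by (elim disjE) simp_all
   have nb: "\<not> (b k >= 2 & b i >= 2)" if ijk: "i ~= j" "k ~= i" "k ~= j" for i j k
   proof
    assume v: "b k >= 2 & b i >= 2"
    obtain ssg :: "3 => 3" where "bij ssg" "ssg 1 = k" "ssg 2 = i" "ssg 3 = j" using rel[OF ijk] by (elim exE conjE)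
    then have "bij ssg & b (ssg 1) >= 2 & b (ssg 2) >= 2 & even (b (ssg 1)) = even (b (ssg 2)) & even (b (ssg 2)) = even (b (ssg 3))"
     using v par'[of k i] par'[of i j] by (simp only: simp_thms)
    then have "\<exists>ssg :: 3 => 3. bij ssg & b (ssg 1) >= 2 & b (ssg 2) >= 2 \<and>
     even (b (ssg 1)) = even (b (ssg 2)) & even (b (ssg 2)) = even (b (ssg 3))" by (intro exI[of _ ssg])
    then show False by (rule notE[OF niii])
   qed
   have "\<not> (b 1 >= 2 & b 2 >= 2)" "\<not> (b 2 >= 2 & b 3 >= 2)" "\<not> (b 1 >= 2 & b 3 >= 2)"
    using nb[of 2 3 1] nb[of 3 1 2] nb[of 3 2 1] three_distinct by auto
   moreover have "b 1 = 1 \<or> b 1 >= 2" "b 2 = 1 \<or> b 2 >= 2" "b 3 = 1 \<or> b 3 >= 2"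
    using b_pos[of 1] b_pos[of 2] b_pos[of 3] by linarith+
   ultimately show False using nt unfolding two_ones_def by blast
  qed
  have g: "rc.G = carrier (sym_group a)" by (rule trans[OF main[OF nt nex] if_not_P[OF np]])
  have "(sym_group a)\<lparr>carrier := carrier (sym_group a)\<rparr> = sym_group a" by (simp add: sym_group_def)
  then show ?thesis using iso unfolding g by (simp only:)
 qed
 show ?thesis unfolding Let_def
  by ((intro conjI impI, rule I, assumption, rule II, assumption, rule III, assumption, elim conjE, rule IV, assumption+)
   | (use I II III IV in blast))
qed

end
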